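(* Let $\lambda,\gamma,\rho>0$, let $l:H^1_0(0,1)\to\mathbb{R}^+$ be continuous, let $a\in C(\mathbb{R})$ with $a(\mathbb{R})\subset[m,M]\subset(0,\infty)$, let $\phi\in C([-\rho,0],H^1_0(0,1))$, and let $f:\mathbb{R}\to\mathbb{R}$ be a continuous function for which there exist $C_0,C_1\in\mathbb{R}$ such that $$u f(u)\leq -\nu C_0u^2+C_1|u|\quad\text{for all }u\in\mathbb{R}\text{ and for both }\nu=\tfrac{m}{\lambda}\text{ and }\nu=\tfrac{M}{\lambda}.$$ Assume in addition that there are a continuous increasing function $\mu:[0,\infty)\to[0,\infty)$ with $\mu(0)=0$ and a number $\beta\in(0,\tfrac12)$ with $\int_0^1 s^{-1}\mu(s^\beta)\,ds<\infty$ such that $$|f(s)-f(s')|\leq\mu(|s-s'|)\ \text{ for all } s,s'\in\mathbb{R},$$ $$|a(l(u))-a(l(v))|\leq\mu(\|u-v\|_{H^1_0(0,1)})\ \text{ for all } u,v\in H^1_0(0,1),$$ $$\|\phi(t)-\phi(t')\|_{L^2(0,1)}\leq\mu(|t-t'|^\beta)\ \text{ for all } t,t'\in[-\rho,0].$$ Then the initial value problem $$\frac{\partial w}{\partial\tau}-a(l(w))\frac{\partial^2w}{\partial x^2}=\lambda f(w)+\gamma w(\tau-\rho),\quad\tau>0,\ x\in(0,1),$$ $$w(\tau,0)=w(\tau,1)=0,\qquad w(\tau)=\phi(\tau),\ \tau\in[-\rho,0],$$ has a strong solution $w\in C([0,\infty);H^2(0,1)\cap H^1_0(0,1))$.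
   Context: A strong solution is a continuous function $w:[-\rho,\infty)\to H^1_0(0,1)$ with $w=\phi$ on $[-\rho,0]$, which is continuously differentiable from $(0,\infty)$ into $L^2(0,1)$, satisfies $w(\tau)\in H^2(0,1)\cap H^1_0(0,1)$ for $\tau>0$, and satisfies the equation in $L^2(0,1)$ for every $\tau>0$. Here $f(w)$ denotes $x\mapsto f(w(\tau)(x))$.
   Formalization: Since w(0)=φ(0) need only lie in H^1_0, the claim w∈C([0,∞);H^2∩H^1_0) can fail; what is proved is a strong solution with w∈C((0,∞);H^2∩H^1_0), and w∈C([0,∞);H^2∩H^1_0) whenever φ(0)∈H^2(0,1). *)

theory Defs
  imports "HOL-Analysis.Analysis"
begin

text \<open>
  Elements of the spaces over the interval (0,1) are represented by functions on the reals; only the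
  values on (0,1), up to null sets, matter. The norms below are therefore seminorms on
  representatives, and equality in a space is almost-everywhere equality.
\<close>

abbreviation leb01 :: "real measure" where
  "leb01 \<equiv> lebesgue_on {0<..<1}"

definition L2 :: "(real \<Rightarrow> real) set" where
  "L2 = {u. u \<in> borel_measurable leb01 \<and> integrable leb01 (\<lambda>x. (u x)\<^sup>2)}"

definition L2_norm :: "(real \<Rightarrow> real) \<Rightarrow> real" where
  "L2_norm u = sqrt (LINT x|leb01. (u x)\<^sup>2)"

definition test_functions :: "(real \<Rightarrow> real) set" where
  "test_functions =
     {\<psi>. (\<forall>n x. ((deriv ^^ n) \<psi>) field_differentiable at x) \<and>
         compact (closure {x. \<psi> x \<noteq> 0}) \<and> closure {x. \<psi> x \<noteq> 0} \<subseteq> {0<..<1}}"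

definition is_weak_deriv :: "(real \<Rightarrow> real) \<Rightarrow> (real \<Rightarrow> real) \<Rightarrow> bool" where
  "is_weak_deriv u v \<longleftrightarrow>
     (\<forall>\<psi>\<in>test_functions. (LINT x|leb01. u x * deriv \<psi> x) = - (LINT x|leb01. v x * \<psi> x))"

definition H1 :: "(real \<Rightarrow> real) set" where
  "H1 = {u \<in> L2. \<exists>v\<in>L2. is_weak_deriv u v}"

text \<open>The chosen representative is immaterial: weak derivatives are unique almost everywhere.
  The value is unspecified outside \<^term>\<open>H1\<close>.\<close>
definition weak_deriv :: "(real \<Rightarrow> real) \<Rightarrow> (real \<Rightarrow> real)" where
  "weak_deriv u = (SOME v. v \<in> L2 \<and> is_weak_deriv u v)"

definition H1_norm :: "(real \<Rightarrow> real) \<Rightarrow> real" where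
  "H1_norm u = sqrt ((L2_norm u)\<^sup>2 + (L2_norm (weak_deriv u))\<^sup>2)"

definition H10 :: "(real \<Rightarrow> real) set" where
  "H10 = {u \<in> H1. \<exists>\<psi>. (\<forall>n::nat. \<psi> n \<in> test_functions) \<and>
                      (\<lambda>n. H1_norm (\<lambda>x. u x - \<psi> n x)) \<longlonglongrightarrow> 0}"

definition H10_norm :: "(real \<Rightarrow> real) \<Rightarrow> real" where
  "H10_norm u = L2_norm (weak_deriv u)"

definition H2 :: "(real \<Rightarrow> real) set" where
  "H2 = {u \<in> H1. weak_deriv u \<in> H1}"

definition H2_norm :: "(real \<Rightarrow> real) \<Rightarrow> real" where
  "H2_norm u = sqrt ((L2_norm u)\<^sup>2 + (L2_norm (weak_deriv u))\<^sup>2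
                      + (L2_norm (weak_deriv (weak_deriv u)))\<^sup>2)"

definition continuous_into ::
  "(real \<Rightarrow> real) set \<Rightarrow> ((real \<Rightarrow> real) \<Rightarrow> real) \<Rightarrow> real set \<Rightarrow> (real \<Rightarrow> real \<Rightarrow> real) \<Rightarrow> bool" where
  "continuous_into X N T w \<longleftrightarrow>
     (\<forall>t\<in>T. w t \<in> X) \<and>
     (\<forall>t\<in>T. ((\<lambda>s. N (\<lambda>x. w s x - w t x)) \<longlongrightarrow> 0) (at t within T))"

text \<open>Continuity with respect to the seminorm forces a functional to take the same value on
  functions that agree almost everywhere, so it is a functional on the space itself.\<close>
definition continuous_functional_H10 :: "((real \<Rightarrow> real) \<Rightarrow> real) \<Rightarrow> bool" where
  "continuous_functional_H10 l \<longleftrightarrow>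
     (\<forall>u\<in>H10. \<forall>e>0. \<exists>d>0. \<forall>v\<in>H10. H10_norm (\<lambda>x. v x - u x) < d \<longrightarrow> \<bar>l v - l u\<bar> < e)"

definition has_L2_derivative ::
  "(real \<Rightarrow> real \<Rightarrow> real) \<Rightarrow> (real \<Rightarrow> real) \<Rightarrow> real \<Rightarrow> bool" where
  "has_L2_derivative w v t \<longleftrightarrow>
     ((\<lambda>h. L2_norm (\<lambda>x. (w (t + h) x - w t x) / h - v x)) \<longlongrightarrow> 0) (at 0)"

text \<open>The Dirichlet boundary conditions are contained in the requirement that
  \<open>w t\<close> lies in \<^term>\<open>H10\<close>.\<close>
definition strong_solution ::
  "real \<Rightarrow> real \<Rightarrow> real \<Rightarrow> (real \<Rightarrow> real) \<Rightarrow> ((real \<Rightarrow> real) \<Rightarrow> real) \<Rightarrow> (real \<Rightarrow> real) \<Rightarrow>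
   (real \<Rightarrow> real \<Rightarrow> real) \<Rightarrow> (real \<Rightarrow> real \<Rightarrow> real) \<Rightarrow> bool" where
  "strong_solution lam \<gamma> \<rho> a l f \<phi> w \<longleftrightarrow>
     continuous_into H10 H10_norm {-\<rho>..} w \<and>
     (\<forall>t\<in>{-\<rho>..0}. AE x in leb01. w t x = \<phi> t x) \<and>
     (\<forall>t>0. w t \<in> H2 \<inter> H10) \<and>
     (\<exists>w'. continuous_into L2 L2_norm {0<..} w' \<and>
       (\<forall>t>0. has_L2_derivative w (w' t) t) \<and>
       (\<forall>t>0. AE x in leb01.
          w' t x - a (l (w t)) * weak_deriv (weak_deriv (w t)) x
            = lam * f (w t x) + \<gamma> * w (t - \<rho>) x))"

end

theory Submission
  imports Defs "HOL-Complex_Analysis.Great_Picard" "HOL-Real_Asymp.Real_Asymp"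
begin

text \<open>
  In the orthonormal sine basis of \<open>L\<^sup>2(0,1)\<close> the equation is a coupled system of scalar equations
  \<open>c\<^sub>k' = - \<kappa>\<^sub>k\<^sup>2 A(t) c\<^sub>k + h\<^sub>k(t)\<close> with \<open>\<kappa>\<^sub>k = (k + 1) \<pi>\<close>, \<open>k = 0, 1, 2, ...\<close>. All modes share the one positive coefficient
  \<open>A(t) = a(l(w(t)))\<close>, because the nonlocal term multiplies the Laplacian by a number, and the coupling sits only in
  \<open>A\<close> and in the source \<open>h = \<lambda> f(w) + \<gamma> w(\<cdot> - \<rho>)\<close>. The proof lives on sequences of coefficients; function spaces
  enter at the start and at the end, through a dictionary between Sobolev norms and weighted \<open>\<ell>\<^sup>2\<close> norms.

  A priori bounds. Every estimate is obtained by differentiating a finite weighted sum of squares in time and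
  comparing it with an explicit function, so that neither Bochner integrals nor Minkowski's inequality for integrals
  appear, and the constants do not depend on the number of modes. This gives tails that are small uniformly in time in the
  energy norm \<open>\<Sum> \<kappa>\<^sub>k\<^sup>2 c\<^sub>k\<^sup>2\<close> (\<open>weighted_tail_bound\<close>), and Hoelder continuity of exponent \<open>1/2\<close> in time, in the
  \<open>L\<^sup>2\<close> norm up to \<open>t = 0\<close> and in the energy norm away from it (\<open>l2_half_hoelder\<close>, \<open>weighted_half_hoelder\<close>).

  Existence. The nonlinearities are merely Dini continuous, so Picard iteration does not contract. Instead the
  argument of the nonlinearities is delayed by a small \<open>\<delta>\<close>; the delayed problem is solved step by step by the
  variation of constants formula (\<open>delayed_solution\<close>). As \<open>\<delta>\<close> tends to 0 a diagonal subsequence converges in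
  every mode, the uniform tails upgrade this to convergence in the energy norm, and dominated convergence passes to the
  limit in the integrated equation (\<open>nonlocal_solution_exists\<close>).

  Regularity. The equation must hold in \<open>L\<^sup>2\<close>, so \<open>\<Sum> \<kappa>\<^sub>k\<^sup>4 c\<^sub>k\<^sup>2\<close> must be finite and vary continuously. Freezing
  \<open>g = h / A\<close> at the final time, the difference between \<open>\<kappa>\<^sub>k\<^sup>2 c\<^sub>k\<close> and the solution of the frozen problem is controlled by
  \<open>\<integral> \<omega>(u)\<^sup>2 / u du\<close>, where \<open>\<omega>\<close> is the modulus of continuity of \<open>g\<close> in \<open>L\<^sup>2\<close> (\<open>dini_remainder\<close>). The Hoelder
  bounds and the moduli of \<open>f\<close>, \<open>a \<circ> l\<close> and \<open>\<phi>\<close> make \<open>\<omega>\<close> a multiple of \<open>\<mu>(C u\<^sup>\<beta>) + u\<^sup>\<beta>\<close>, and the integral converges by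
  the Dini condition; here \<open>\<beta> < 1/2\<close> is what the Hoelder exponent affords. If the initial value lies in \<open>H\<^sup>2\<close> the
  same estimates hold up to \<open>t = 0\<close>.

  Dictionary. Weak derivatives are unique because smooth cutoffs approximate indicators of intervals
  (\<open>fundamental_lemma\<close>). The sines are complete by Weierstrass approximation in the variable \<open>cos (\<pi> x)\<close>
  (\<open>sine_complete_test\<close>), and sine polynomials are limits of test functions in \<open>H\<^sup>1\<close> because they vanish linearly at
  the end points (\<open>smooth_vanishing_approx\<close>). Hence \<open>H\<^sup>1\<^sub>0\<close> consists of the sine series with square-summable
  \<open>\<kappa>\<^sub>k c\<^sub>k\<close>, and its intersection with \<open>H\<^sup>2\<close> of those with square-summable \<open>\<kappa>\<^sub>k\<^sup>2 c\<^sub>k\<close>.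
\<close>

section \<open>Square-summable sequences\<close>

definition ell2 :: "(nat \<Rightarrow> real) set" where
  "ell2 = {c. summable (\<lambda>k. (c k)\<^sup>2)}"

definition ell2_norm :: "(nat \<Rightarrow> real) \<Rightarrow> real" where
  "ell2_norm c = sqrt (\<Sum>k. (c k)\<^sup>2)"

lemma ell2_norm_sq: "c \<in> ell2 \<Longrightarrow> (ell2_norm c)\<^sup>2 = (\<Sum>k. (c k)\<^sup>2)"
  by (simp add: ell2_norm_def ell2_def suminf_nonneg)

lemma ell2_norm_nonneg: "c \<in> ell2 \<Longrightarrow> 0 \<le> ell2_norm c"
  by (simp add: ell2_norm_def ell2_def suminf_nonneg)

lemma sum_le_ell2_norm_sq:
  assumes "c \<in> ell2" "finite I"
  shows "(\<Sum>k\<in>I. (c k)\<^sup>2) \<le> (ell2_norm c)\<^sup>2"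
  using assms by (simp add: ell2_norm_sq ell2_def sum_le_suminf)

lemma abs_le_ell2_norm: "c \<in> ell2 \<Longrightarrow> \<bar>c k\<bar> \<le> ell2_norm c"
  using sum_le_ell2_norm_sq[of c "{k}"] ell2_norm_nonneg[of c] abs_le_square_iff[of "c k" "ell2_norm c"] by simp

text \<open>Membership and norm are both read off from partial sums, so that all later estimates may be
  proved for finitely many modes with bounds independent of their number.\<close>
lemma ell2_bounded_sums:
  assumes "\<And>N. (\<Sum>k<N. (c k)\<^sup>2) \<le> B"
  shows "c \<in> ell2" and "(ell2_norm c)\<^sup>2 \<le> B"
proof -
  show *: "c \<in> ell2"
    unfolding ell2_def using assms by (auto intro!: summableI_nonneg_bounded)
  then have "summable (\<lambda>k. (c k)\<^sup>2)" by (simp add: ell2_def)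
  with assms show "(ell2_norm c)\<^sup>2 \<le> B"
    unfolding ell2_norm_sq[OF *] by (intro suminf_le_const)
qed

lemma power2_diff_le: "(x - y)\<^sup>2 \<le> 2 * x\<^sup>2 + 2 * (y::real)\<^sup>2"
  using zero_le_power2[of "x + y"] by (simp add: power2_eq_square algebra_simps)

lemma power2_add_le: "(x + y)\<^sup>2 \<le> 2 * x\<^sup>2 + 2 * (y::real)\<^sup>2"
  using zero_le_power2[of "x - y"] by (simp add: power2_eq_square algebra_simps)

lemma ell2_norm_le: "c \<in> ell2 \<Longrightarrow> 0 \<le> B \<Longrightarrow> (\<And>N. (\<Sum>k<N. (c k)\<^sup>2) \<le> B\<^sup>2) \<Longrightarrow> ell2_norm c \<le> B"
  using ell2_bounded_sums(2)[of c "B\<^sup>2"] by (rule power2_le_imp_le) auto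

lemma ell2_L2_set_le: "c \<in> ell2 \<Longrightarrow> finite I \<Longrightarrow> L2_set c I \<le> ell2_norm c"
  using sum_le_ell2_norm_sq ell2_norm_nonneg by (auto simp: L2_set_def intro!: real_le_lsqrt sum_nonneg)

lemma ell2_add:
  assumes "c \<in> ell2" "d \<in> ell2"
  shows "(\<lambda>k. c k + d k) \<in> ell2" and "ell2_norm (\<lambda>k. c k + d k) \<le> ell2_norm c + ell2_norm d"
proof -
  have b: "(\<Sum>k<N. (c k + d k)\<^sup>2) \<le> (ell2_norm c + ell2_norm d)\<^sup>2" for N
  proof -
    have "L2_set (\<lambda>k. c k + d k) {..<N} \<le> ell2_norm c + ell2_norm d"
      using L2_set_triangle_ineq[of c d "{..<N}"] ell2_L2_set_le[OF assms(1), of "{..<N}"]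
        ell2_L2_set_le[OF assms(2), of "{..<N}"] by simp
    then show ?thesis unfolding L2_set_def by (rule sqrt_le_D)
  qed
  show *: "(\<lambda>k. c k + d k) \<in> ell2" by (rule ell2_bounded_sums[OF b])
  show "ell2_norm (\<lambda>k. c k + d k) \<le> ell2_norm c + ell2_norm d"
    using ell2_norm_le[OF * _ b] assms ell2_norm_nonneg by simp
qed

lemma ell2_scale:
  assumes "c \<in> ell2"
  shows "(\<lambda>k. r * c k) \<in> ell2" and "ell2_norm (\<lambda>k. r * c k) = \<bar>r\<bar> * ell2_norm c"
  using assms by (simp_all add: ell2_def ell2_norm_def power_mult_distrib suminf_mult real_sqrt_mult)

lemma ell2_diff:
  assumes "c \<in> ell2" "d \<in> ell2"
  shows "(\<lambda>k. c k - d k) \<in> ell2" and "ell2_norm (\<lambda>k. c k - d k) \<le> ell2_norm c + ell2_norm d"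
  using ell2_add[OF assms(1) ell2_scale(1)[OF assms(2), of "-1"]] ell2_scale(2)[OF assms(2), of "-1"]
  by simp_all

lemma ell2_norm_minus_commute: "ell2_norm (\<lambda>k. c k - d k) = ell2_norm (\<lambda>k. d k - c k)"
  by (simp add: ell2_norm_def power2_commute)

lemma ell2_mono:
  assumes "d \<in> ell2" "\<And>k. \<bar>c k\<bar> \<le> \<bar>d k\<bar>"
  shows "c \<in> ell2" and "ell2_norm c \<le> ell2_norm d"
proof -
  have b: "(\<Sum>k<N. (c k)\<^sup>2) \<le> (ell2_norm d)\<^sup>2" for N
  proof -
    have "(\<Sum>k<N. (c k)\<^sup>2) \<le> (\<Sum>k<N. (d k)\<^sup>2)"
      using assms(2) by (intro sum_mono) (simp add: abs_le_square_iff)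
    also have "\<dots> \<le> (ell2_norm d)\<^sup>2" by (rule sum_le_ell2_norm_sq) (use assms in auto)
    finally show ?thesis .
  qed
  show *: "c \<in> ell2" by (rule ell2_bounded_sums[OF b])
  show "ell2_norm c \<le> ell2_norm d"
    using ell2_norm_le[OF * _ b] assms ell2_norm_nonneg by simp
qed

lemma ell2_tail:
  assumes "d \<in> ell2" "e > 0"
  shows "\<exists>K. \<forall>N. (\<Sum>k=K..<N. (d k)\<^sup>2) \<le> e"
proof -
  from summable_partial_sum_bound[of "\<lambda>k. (d k)\<^sup>2" e] assms
  obtain K where K: "\<And>m n. m \<ge> K \<Longrightarrow> norm (\<Sum>k=m..n. (d k)\<^sup>2) < e" by (auto simp: ell2_def)
  have "(\<Sum>k=K..<N. (d k)\<^sup>2) \<le> e" for N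
  proof -
    have "(\<Sum>k=K..<N. (d k)\<^sup>2) \<le> (\<Sum>k=K..N. (d k)\<^sup>2)"
      by (rule sum_mono2) auto
    also have "\<dots> \<le> e" using K[of K N] by simp
    finally show ?thesis .
  qed
  then show ?thesis by blast
qed

lemma tendsto_ell2_norm_iff:
  assumes "eventually (\<lambda>i. c i \<in> ell2) F"
  shows "((\<lambda>i. ell2_norm (c i)) \<longlongrightarrow> 0) F \<longleftrightarrow> (\<forall>e>0. eventually (\<lambda>i. \<forall>N. (\<Sum>k<N. (c i k)\<^sup>2) \<le> e) F)"
    (is "?L \<longleftrightarrow> ?R")
proof
  assume L: ?L
  show ?R
  proof (intro allI impI)
    fix e :: real assume "e > 0"
    then have "eventually (\<lambda>i. dist (ell2_norm (c i)) 0 < sqrt e) F"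
      using L by (intro tendstoD) auto
    with assms show "eventually (\<lambda>i. \<forall>N. (\<Sum>k<N. (c i k)\<^sup>2) \<le> e) F"
    proof eventually_elim
      case (elim i)
      then have "(ell2_norm (c i))\<^sup>2 \<le> e"
        using power_mono[of "ell2_norm (c i)" "sqrt e" 2] ell2_norm_nonneg[OF elim(1)] \<open>e > 0\<close> by auto
      then show ?case using sum_le_ell2_norm_sq[OF elim(1) finite_lessThan] order_trans by blast
    qed
  qed
next
  assume R: ?R
  show ?L
  proof (rule tendstoI)
    fix e :: real assume "e > 0"
    then have "eventually (\<lambda>i. \<forall>N. (\<Sum>k<N. (c i k)\<^sup>2) \<le> (e/2)\<^sup>2) F" using R by simp
    with assms show "eventually (\<lambda>i. dist (ell2_norm (c i)) 0 < e) F"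
    proof eventually_elim
      case (elim i)
      then have "ell2_norm (c i) \<le> e/2" using \<open>e > 0\<close> by (intro ell2_norm_le) auto
      then show ?case using ell2_norm_nonneg[OF elim(1)] \<open>e > 0\<close> by simp
    qed
  qed
qed

lemma sum_split_at: "(\<Sum>k<N. f k) \<le> (\<Sum>k<K. f k) + (\<Sum>k=K..<N. f k)"
  if "\<And>k. 0 \<le> f k" for f :: "nat \<Rightarrow> real"
proof -
  have "(\<Sum>k<N. f k) \<le> sum f ({..<K} \<union> {K..<N})" by (rule sum_mono2) (auto simp: that)
  also have "\<dots> = (\<Sum>k<K. f k) + (\<Sum>k=K..<N. f k)" by (rule sum.union_disjoint) auto
  finally show ?thesis .
qed

text \<open>The compactness principle of the whole development: for a family whose tails are uniformly small,
  convergence of each coordinate is already convergence in norm. It serves for continuity in time and for limits of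
  approximate solutions alike.\<close>
lemma ell2_convergence:
  assumes F: "F \<noteq> bot" and lim: "\<And>k. ((\<lambda>i. c i k) \<longlongrightarrow> d k) F"
    and tails: "\<And>e. e > 0 \<Longrightarrow> \<exists>K. eventually (\<lambda>i. \<forall>N. (\<Sum>k=K..<N. (c i k)\<^sup>2) \<le> e) F"
  shows "d \<in> ell2" and "eventually (\<lambda>i. c i \<in> ell2) F"
    and "((\<lambda>i. ell2_norm (\<lambda>k. c i k - d k)) \<longlongrightarrow> 0) F"
proof -
  have dtail: "(\<Sum>k=K..<N. (d k)\<^sup>2) \<le> e"
    if "eventually (\<lambda>i. \<forall>N. (\<Sum>k=K..<N. (c i k)\<^sup>2) \<le> e) F" for K e N
    by (rule tendsto_upperbound[OF _ _ F, where f = "\<lambda>i. \<Sum>k=K..<N. (c i k)\<^sup>2"])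
      (auto intro!: tendsto_sum tendsto_power lim eventually_mono[OF that])
  have mem: "x \<in> ell2" if "\<And>N. (\<Sum>k=K..<N. (x k)\<^sup>2) \<le> e" for x :: "nat \<Rightarrow> real" and K e
  proof (rule ell2_bounded_sums)
    show "(\<Sum>k<N. (x k)\<^sup>2) \<le> (\<Sum>k<K. (x k)\<^sup>2) + e" for N
      using sum_split_at[where f = "\<lambda>k. (x k)\<^sup>2" and N = N and K = K] that[of N] by simp
  qed
  from tails[of 1] obtain K where K: "eventually (\<lambda>i. \<forall>N. (\<Sum>k=K..<N. (c i k)\<^sup>2) \<le> 1) F" by auto
  show d: "d \<in> ell2" by (rule mem[of d K 1]) (rule dtail[OF K])
  show c: "eventually (\<lambda>i. c i \<in> ell2) F"
    using K by (rule eventually_mono) (rule mem, erule spec)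
  have cd: "eventually (\<lambda>i. (\<lambda>k. c i k - d k) \<in> ell2) F"
    using c by (rule eventually_mono) (rule ell2_diff(1)[OF _ d])
  show "((\<lambda>i. ell2_norm (\<lambda>k. c i k - d k)) \<longlongrightarrow> 0) F"
  proof (subst tendsto_ell2_norm_iff[OF cd], intro allI impI)
    fix e :: real assume "e > 0"
    with tails[of "e/8"] obtain K where K: "eventually (\<lambda>i. \<forall>N. (\<Sum>k=K..<N. (c i k)\<^sup>2) \<le> e/8) F" by auto
    have "((\<lambda>i. \<Sum>k<K. (c i k - d k)\<^sup>2) \<longlongrightarrow> (\<Sum>k<K. (d k - d k)\<^sup>2)) F"
      by (intro tendsto_intros lim)
    then have "eventually (\<lambda>i. (\<Sum>k<K. (c i k - d k)\<^sup>2) < e/2) F"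
      using \<open>e > 0\<close> by (intro order_tendstoD(2)[where y="\<Sum>k<K. (d k - d k)\<^sup>2"]) auto
    with K show "eventually (\<lambda>i. \<forall>N. (\<Sum>k<N. (c i k - d k)\<^sup>2) \<le> e) F"
    proof eventually_elim
      case (elim i)
      show ?case
      proof
        fix N
        have "(\<Sum>k<N. (c i k - d k)\<^sup>2) \<le> (\<Sum>k<K. (c i k - d k)\<^sup>2) + (\<Sum>k=K..<N. (c i k - d k)\<^sup>2)"
          by (rule sum_split_at) simp
        also have "(\<Sum>k=K..<N. (c i k - d k)\<^sup>2) \<le> (\<Sum>k=K..<N. 2 * (c i k)\<^sup>2 + 2 * (d k)\<^sup>2)"
          by (intro sum_mono power2_diff_le)
        also have "\<dots> = 2 * (\<Sum>k=K..<N. (c i k)\<^sup>2) + 2 * (\<Sum>k=K..<N. (d k)\<^sup>2)"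
          by (simp add: sum.distrib sum_distrib_left)
        also have "\<dots> \<le> e/2" using elim(1)[rule_format, of N] dtail[OF K, of N] by linarith
        finally show "(\<Sum>k<N. (c i k - d k)\<^sup>2) \<le> e" using elim(2) by linarith
      qed
    qed
  qed
qed

text \<open>Conversely a convergent family has uniformly small tails; in this form continuity of the source
  is fed into the regularity estimate.\<close>
lemma ell2_convergence_tails:
  assumes d: "d \<in> ell2" and c: "eventually (\<lambda>i. c i \<in> ell2) F"
    and lim: "((\<lambda>i. ell2_norm (\<lambda>k. c i k - d k)) \<longlongrightarrow> 0) F" and "e > 0"
  shows "\<exists>K. eventually (\<lambda>i. \<forall>N. (\<Sum>k=K..<N. (c i k)\<^sup>2) \<le> e) F"
proof -
  obtain K where K: "\<And>N. (\<Sum>k=K..<N. (d k)\<^sup>2) \<le> e/4" using ell2_tail[OF d, of "e/4"] \<open>e > 0\<close> by auto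
  have cd: "eventually (\<lambda>i. (\<lambda>k. c i k - d k) \<in> ell2) F"
    using c by (rule eventually_mono) (rule ell2_diff(1)[OF _ d])
  have "eventually (\<lambda>i. \<forall>N. (\<Sum>k<N. (c i k - d k)\<^sup>2) \<le> e/4) F"
    using lim[unfolded tendsto_ell2_norm_iff[OF cd], rule_format, of "e/4"] \<open>e > 0\<close> by linarith
  then have "eventually (\<lambda>i. \<forall>N. (\<Sum>k=K..<N. (c i k)\<^sup>2) \<le> e) F"
  proof eventually_elim
    case (elim i)
    show ?case
    proof
      fix N
      have "(\<Sum>k=K..<N. (c i k)\<^sup>2) \<le> (\<Sum>k=K..<N. 2 * (c i k - d k)\<^sup>2 + 2 * (d k)\<^sup>2)"
        using power2_add_le[of "c i k - d k" "d k" for k] by (intro sum_mono) auto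
      also have "\<dots> = 2 * (\<Sum>k=K..<N. (c i k - d k)\<^sup>2) + 2 * (\<Sum>k=K..<N. (d k)\<^sup>2)"
        by (simp add: sum.distrib sum_distrib_left)
      also have "(\<Sum>k=K..<N. (c i k - d k)\<^sup>2) \<le> (\<Sum>k<N. (c i k - d k)\<^sup>2)"
        by (rule sum_mono2) auto
      finally show "(\<Sum>k=K..<N. (c i k)\<^sup>2) \<le> e" using elim[rule_format, of N] K[of N] by linarith
    qed
  qed
  then show ?thesis by blast
qed

lemma tendsto_ell2_coord:
  assumes d: "d \<in> ell2" and c: "eventually (\<lambda>i. c i \<in> ell2) F"
    and lim: "((\<lambda>i. ell2_norm (\<lambda>k. c i k - d k)) \<longlongrightarrow> 0) F"
  shows "((\<lambda>i. c i k) \<longlongrightarrow> d k) F"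
proof -
  have "eventually (\<lambda>i. norm (c i k - d k) \<le> ell2_norm (\<lambda>k. c i k - d k)) F"
    using c by (rule eventually_mono) (simp, rule abs_le_ell2_norm[OF ell2_diff(1)[OF _ d]])
  then show ?thesis by (subst Lim_null) (rule Lim_null_comparison[OF _ lim], simp)
qed

definition ell2_cont :: "real set \<Rightarrow> (real \<Rightarrow> nat \<Rightarrow> real) \<Rightarrow> bool" where
  "ell2_cont T c \<longleftrightarrow> (\<forall>t\<in>T. c t \<in> ell2 \<and>
     ((\<lambda>s. ell2_norm (\<lambda>k. c s k - c t k)) \<longlongrightarrow> 0) (at t within T))"

lemma eventually_in_within: "eventually (\<lambda>s. s \<in> T) (at t within T)"
  by (simp add: eventually_at_filter)

lemma ell2_cont_coord: "ell2_cont T c \<Longrightarrow> continuous_on T (\<lambda>t. c t k)"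
  unfolding continuous_on_def ell2_cont_def
  using tendsto_ell2_coord[OF _ eventually_mono[OF eventually_in_within[of T]]] by blast

lemma ell2_contI:
  assumes "\<And>t. t \<in> T \<Longrightarrow> c t \<in> ell2" and coord: "\<And>k. continuous_on T (\<lambda>t. c t k)"
    and tails: "\<And>t e. t \<in> T \<Longrightarrow> e > 0 \<Longrightarrow>
       \<exists>K. eventually (\<lambda>s. \<forall>N. (\<Sum>k=K..<N. (c s k)\<^sup>2) \<le> e) (at t within T)"
  shows "ell2_cont T c"
  unfolding ell2_cont_def
proof (intro ballI conjI assms)
  fix t assume t: "t \<in> T"
  show "((\<lambda>s. ell2_norm (\<lambda>k. c s k - c t k)) \<longlongrightarrow> 0) (at t within T)"
  proof (cases "at t within T = bot")
    case False
    then show ?thesis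
      by (rule ell2_convergence(3)) (use t coord tails in \<open>auto simp: continuous_on_def\<close>)
  qed simp
qed

lemma ell2_cont_tails:
  assumes "ell2_cont T c" "t \<in> T" "e > 0"
  shows "\<exists>K. eventually (\<lambda>s. \<forall>N. (\<Sum>k=K..<N. (c s k)\<^sup>2) \<le> e) (at t within T)"
  using assms unfolding ell2_cont_def
  by (intro ell2_convergence_tails[where d = "c t"] eventually_mono[OF eventually_in_within[of T t]]) auto

lemma ell2_cont_subset: "ell2_cont T c \<Longrightarrow> U \<subseteq> T \<Longrightarrow> ell2_cont U c"
  unfolding ell2_cont_def by (auto intro: tendsto_within_subset)

text \<open>Comparison principle behind all energy estimates. Only interior derivatives are required, since
  the coefficients need not be differentiable at the initial time and the comparison functions may be singular at the
  final one.\<close>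
lemma nonpos_deriv_difference:
  fixes Y G :: "real \<Rightarrow> real"
  assumes "a \<le> b" "continuous_on {a..b} Y" "continuous_on {a..b} G"
    and "\<And>s. a < s \<Longrightarrow> s < b \<Longrightarrow> \<exists>y g. (Y has_real_derivative y) (at s) \<and> (G has_real_derivative g) (at s) \<and> y \<le> g"
  shows "Y b - Y a \<le> G b - G a"
proof -
  have "(\<lambda>s. Y s - G s) a \<ge> (\<lambda>s. Y s - G s) b"
  proof (rule DERIV_nonpos_imp_decreasing_open[OF \<open>a \<le> b\<close>])
    fix s assume "a < s" "s < b"
    then obtain y g where "(Y has_real_derivative y) (at s)" "(G has_real_derivative g) (at s)" "y \<le> g"
      using assms(4) by blast
    then show "\<exists>z. ((\<lambda>s. Y s - G s) has_real_derivative z) (at s) \<and> z \<le> 0"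
      by (intro exI[of _ "y - g"]) (auto intro: DERIV_diff)
  qed (intro continuous_intros assms)
  then show ?thesis by simp
qed

text \<open>The integrating factor \<open>exp (\<beta> s)\<close> turns damping into monotonicity; the bound stays finite as
  time grows and improves with the damping rate.\<close>
lemma damped_growth:
  fixes Y :: "real \<Rightarrow> real"
  assumes "a \<le> b" "continuous_on {a..b} Y" "0 \<le> Y a" "0 < \<beta>" "0 \<le> B"
    and D: "\<And>s. a < s \<Longrightarrow> s < b \<Longrightarrow> \<exists>y. (Y has_real_derivative y) (at s) \<and> y \<le> - \<beta> * Y s + B"
  shows "Y b \<le> Y a + B / \<beta>"
proof -
  have "exp (\<beta> * b) * (Y b - B/\<beta>) - exp (\<beta> * a) * (Y a - B/\<beta>) \<le> (\<lambda>_. 0::real) b - (\<lambda>_. 0) a"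
  proof (rule nonpos_deriv_difference[OF \<open>a \<le> b\<close>])
    fix s assume "a < s" "s < b"
    then obtain y where y: "(Y has_real_derivative y) (at s)" "y \<le> - \<beta> * Y s + B" using D by blast
    have "((\<lambda>s. exp (\<beta> * s) * (Y s - B/\<beta>)) has_real_derivative
        exp (\<beta> * s) * \<beta> * (Y s - B/\<beta>) + exp (\<beta> * s) * y) (at s)"
      by (auto intro!: derivative_eq_intros y(1))
    moreover have "exp (\<beta> * s) * \<beta> * (Y s - B/\<beta>) + exp (\<beta> * s) * y = exp (\<beta> * s) * (\<beta> * Y s - B + y)"
      using \<open>0 < \<beta>\<close> by (simp add: field_simps)
    moreover have "exp (\<beta> * s) * (\<beta> * Y s - B + y) \<le> 0"
      using y(2) by (intro mult_nonneg_nonpos) auto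
    ultimately show "\<exists>y g. ((\<lambda>s. exp (\<beta> * s) * (Y s - B/\<beta>)) has_real_derivative y) (at s) \<and>
        ((\<lambda>_. 0::real) has_real_derivative g) (at s) \<and> y \<le> g"
      by (intro exI[of _ "exp (\<beta> * s) * (\<beta> * Y s - B + y)"] exI[of _ 0]) auto
  qed (intro continuous_intros assms)+
  then have "exp (\<beta> * b) * (Y b - B/\<beta>) \<le> exp (\<beta> * a) * (Y a - B/\<beta>)" by simp
  also have "\<dots> \<le> exp (\<beta> * a) * Y a" using assms by (simp add: field_simps)
  also have "\<dots> \<le> exp (\<beta> * b) * Y a" using assms by (intro mult_right_mono) auto
  finally have "Y b - B/\<beta> \<le> Y a" by simp
  then show ?thesis by simp
qed

section \<open>Energy estimates for diagonal linear flows\<close>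

text \<open>Exponential decay of a mode buys one power of its eigenvalue at the price of one power of the
  elapsed time.\<close>
lemma mult_exp_minus_le_one: "z * exp (- z) \<le> (1::real)"
proof -
  have "z \<le> exp z" using exp_ge_add_one_self[of z] by linarith
  then show ?thesis by (simp add: exp_minus field_simps)
qed

lemma young_ineq:
  fixes p u v :: real
  assumes "0 < p"
  shows "2 * u * v \<le> p * u\<^sup>2 + v\<^sup>2 / p"
proof -
  have "0 \<le> (p * u - v)\<^sup>2 / p" using assms by simp
  also have "(p * u - v)\<^sup>2 / p = p * u\<^sup>2 - 2 * u * v + v\<^sup>2 / p"
    using assms by (simp add: power2_eq_square field_simps)
  finally show ?thesis by simp
qed

lemma min_square_le: "0 \<le> x \<Longrightarrow> (min 1 x)\<^sup>2 \<le> (x::real)"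
proof -
  assume "0 \<le> x"
  then have "min 1 x * min 1 x \<le> 1 * x" by (intro mult_mono) auto
  then show ?thesis by (simp add: power2_eq_square)
qed

text \<open>The square roots \<open>\<kappa>\<close> of the eigenvalues are the primitive data, since the weight \<open>\<kappa>\<close> gives the
  energy norm and the weight \<open>\<kappa>\<^sup>2\<close> the norm of the second derivative.\<close>
locale diagonal_flow =
  fixes \<kappa> :: "nat \<Rightarrow> real" and m M :: real
  assumes \<kappa>_pos: "\<And>k. 0 < \<kappa> k" and \<kappa>_mono: "mono \<kappa>"
    and \<kappa>_top: "filterlim \<kappa> at_top sequentially"
    and m_pos: "0 < m" and m_le_M: "m \<le> M"
begin

lemma M_pos: "0 < M" using m_pos m_le_M by simp

definition lin_sol :: "real \<Rightarrow> (real \<Rightarrow> real) \<Rightarrow> (real \<Rightarrow> nat \<Rightarrow> real) \<Rightarrow> (real \<Rightarrow> nat \<Rightarrow> real) \<Rightarrow> bool" where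
  "lin_sol T A h c \<longleftrightarrow>
     continuous_on {0..T} A \<and> (\<forall>t\<in>{0..T}. m \<le> A t \<and> A t \<le> M) \<and>
     (\<forall>k. continuous_on {0..T} (\<lambda>t. h t k)) \<and>
     (\<forall>k. continuous_on {0..T} (\<lambda>t. c t k)) \<and>
     (\<forall>k t. 0 < t \<longrightarrow> t < T \<longrightarrow>
        ((\<lambda>t. c t k) has_real_derivative - (\<kappa> k)\<^sup>2 * A t * c t k + h t k) (at t))"

text \<open>With \<open>u = \<kappa>\<^sup>2 c\<close> and \<open>v = h\<close> the left side is the rate of change of \<open>(\<kappa> c)\<^sup>2\<close>: half of the
  dissipation absorbs the source.\<close>
lemma damped_product_bound:
  fixes A u v :: real
  assumes "m \<le> A"
  shows "- 2 * A * u\<^sup>2 + 2 * u * v \<le> - m * u\<^sup>2 + v\<^sup>2 / m"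
proof -
  have "2 * u * v \<le> m * u\<^sup>2 + v\<^sup>2 / m" by (rule young_ineq[OF m_pos])
  moreover have "m * u\<^sup>2 \<le> A * u\<^sup>2" using assms by (intro mult_right_mono) auto
  ultimately show ?thesis by linarith
qed

lemma damped_difference_bound:
  fixes A u v :: real
  assumes "m \<le> A"
  shows "m * u\<^sup>2 + 2 * u * (A * (v - u)) \<le> A * v\<^sup>2"
proof -
  have "m * u\<^sup>2 \<le> A * u\<^sup>2" using assms by (rule mult_right_mono) simp
  moreover have "0 \<le> A * (u - v)\<^sup>2" using assms m_pos by simp
  ultimately show ?thesis by (simp add: power2_eq_square algebra_simps)
qed

context
  fixes T A h c H
  assumes sol: "lin_sol T A h c"
    and h_bound: "\<And>t N. t \<in> {0..T} \<Longrightarrow> (\<Sum>k<N. (h t k)\<^sup>2) \<le> H"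
begin

lemma A_cont: "continuous_on {0..T} A"
  and A_lower: "t \<in> {0..T} \<Longrightarrow> m \<le> A t"
  and A_upper: "t \<in> {0..T} \<Longrightarrow> A t \<le> M"
  and c_cont: "continuous_on {0..T} (\<lambda>t. c t k)"
  and c_deriv: "0 < t \<Longrightarrow> t < T \<Longrightarrow>
        ((\<lambda>t. c t k) has_real_derivative - (\<kappa> k)\<^sup>2 * A t * c t k + h t k) (at t)"
  using sol unfolding lin_sol_def by auto

lemma H_nonneg: "0 \<le> T \<Longrightarrow> 0 \<le> H"
  using h_bound[of 0 0] by simp

lemma h_bound_tail: "t \<in> {0..T} \<Longrightarrow> (\<Sum>k=K..<N. (h t k)\<^sup>2) \<le> H"
  using h_bound[of t N] sum_mono2[of "{..<N}" "{K..<N}" "\<lambda>k. (h t k)\<^sup>2"] by force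

lemma c_cont_on: "0 \<le> a \<Longrightarrow> b \<le> T \<Longrightarrow> continuous_on {a..b} (\<lambda>t. c t k)"
  by (rule continuous_on_subset[OF c_cont]) auto

text \<open>Modes beyond \<open>K\<close> are damped at rate at least \<open>m \<kappa>\<^sub>K\<^sup>2\<close>, while the source feeds energy at the bounded rate
  \<open>H / m\<close>. What they can hold above their initial energy is the quotient, which vanishes as \<open>K\<close> grows.\<close>
lemma weighted_tail_bound:
  assumes t: "t \<in> {0..T}"
  shows "(\<Sum>k=K..<N. (\<kappa> k * c t k)\<^sup>2) \<le> (\<Sum>k=K..<N. (\<kappa> k * c 0 k)\<^sup>2) + H / (m * \<kappa> K)\<^sup>2"
proof -
  let ?Y = "\<lambda>t. \<Sum>k=K..<N. (\<kappa> k * c t k)\<^sup>2"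
  have "?Y t \<le> ?Y 0 + (H / m) / (m * (\<kappa> K)\<^sup>2)"
  proof (rule damped_growth[where a = 0 and Y = ?Y])
    show "continuous_on {0..t} ?Y" using t by (intro continuous_intros c_cont_on) auto
    show "0 \<le> H / m" using H_nonneg t m_pos by auto
    show "0 < m * (\<kappa> K)\<^sup>2" using m_pos \<kappa>_pos[of K] by simp
    fix s assume s: "0 < s" "s < t"
    let ?y = "\<lambda>k. 2 * (\<kappa> k)\<^sup>2 * c s k * (- (\<kappa> k)\<^sup>2 * A s * c s k + h s k)"
    have "(?Y has_real_derivative (\<Sum>k=K..<N. ?y k)) (at s)"
      using s t by (auto intro!: derivative_eq_intros c_deriv sum.cong simp: power2_eq_square algebra_simps)
    moreover have "(\<Sum>k=K..<N. ?y k) \<le> (\<Sum>k=K..<N. - (m * (\<kappa> K)\<^sup>2) * (\<kappa> k * c s k)\<^sup>2 + (h s k)\<^sup>2 / m)"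
    proof (rule sum_mono)
      fix k assume k: "k \<in> {K..<N}"
      have "?y k = - 2 * A s * ((\<kappa> k)\<^sup>2 * c s k)\<^sup>2 + 2 * ((\<kappa> k)\<^sup>2 * c s k) * h s k"
        by (simp add: power2_eq_square algebra_simps)
      also have "\<dots> \<le> - m * ((\<kappa> k)\<^sup>2 * c s k)\<^sup>2 + (h s k)\<^sup>2 / m"
        by (rule damped_product_bound) (use A_lower[of s] s t in auto)
      also have "((\<kappa> k)\<^sup>2 * c s k)\<^sup>2 = (\<kappa> k)\<^sup>2 * (\<kappa> k * c s k)\<^sup>2"
        by (simp add: power2_eq_square)
      also have "- m * ((\<kappa> k)\<^sup>2 * (\<kappa> k * c s k)\<^sup>2) \<le> - m * ((\<kappa> K)\<^sup>2 * (\<kappa> k * c s k)\<^sup>2)"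
      proof -
        have "(\<kappa> K)\<^sup>2 \<le> (\<kappa> k)\<^sup>2"
          using k \<kappa>_mono \<kappa>_pos[of K] by (auto intro!: power_mono dest: monoD)
        then show ?thesis using m_pos by (simp add: mult_right_mono)
      qed
      finally show "?y k \<le> - (m * (\<kappa> K)\<^sup>2) * (\<kappa> k * c s k)\<^sup>2 + (h s k)\<^sup>2 / m" by simp
    qed
    moreover have "\<dots> = - (m * (\<kappa> K)\<^sup>2) * ?Y s + (\<Sum>k=K..<N. (h s k)\<^sup>2) / m"
      by (simp only: sum.distrib sum_distrib_left sum_divide_distrib)
    moreover have "\<dots> \<le> - (m * (\<kappa> K)\<^sup>2) * ?Y s + H / m"
      using h_bound_tail[of s K N] s t m_pos by (simp add: divide_right_mono)
    ultimately show "\<exists>y. (?Y has_real_derivative y) (at s) \<and> y \<le> - (m * (\<kappa> K)\<^sup>2) * ?Y s + H / m"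
      by (intro exI[of _ "\<Sum>k=K..<N. ?y k"]) linarith
  qed (use t in \<open>auto intro: sum_nonneg\<close>)
  moreover have "(H / m) / (m * (\<kappa> K)\<^sup>2) = H / (m * \<kappa> K)\<^sup>2" by (simp add: power2_eq_square mult_ac)
  ultimately show ?thesis by metis
qed

lemma coord_lipschitz:
  assumes b: "\<And>t. t \<in> {0..T} \<Longrightarrow> \<bar>c t k\<bar> \<le> b" and b': "\<And>t. t \<in> {0..T} \<Longrightarrow> \<bar>h t k\<bar> \<le> b'"
    and st: "s \<in> {0..T}" "t \<in> {0..T}"
  shows "\<bar>c t k - c s k\<bar> \<le> ((\<kappa> k)\<^sup>2 * M * b + b') * \<bar>t - s\<bar>"
proof -
  have *: "\<bar>c t k - c s k\<bar> \<le> ((\<kappa> k)\<^sup>2 * M * b + b') * (t - s)"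
    if st: "s \<in> {0..T}" "t \<in> {0..T}" and "s < t" for s t
  proof -
    have "\<exists>l z. s < z \<and> z < t \<and> ((\<lambda>t. c t k) has_real_derivative l) (at z) \<and> c t k - c s k = (t - s) * l"
    proof (rule MVT[OF \<open>s < t\<close>])
      fix z assume "s < z" "z < t"
      then show "(\<lambda>t. c t k) differentiable (at z)"
        using st c_deriv[of z k] unfolding real_differentiable_def by auto
    qed (use st in \<open>auto intro!: c_cont_on\<close>)
    then obtain l z where z: "s < z" "z < t" and l: "((\<lambda>t. c t k) has_real_derivative l) (at z)"
      and eq': "c t k - c s k = (t - s) * l" by blast
    have "l = - (\<kappa> k)\<^sup>2 * A z * c z k + h z k"
      by (rule DERIV_unique[OF l c_deriv]) (use z st in auto)
    with eq' have eq: "c t k - c s k = (t - s) * (- (\<kappa> k)\<^sup>2 * A z * c z k + h z k)" by simp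
    have zT: "z \<in> {0..T}" using z st by auto
    have "\<bar>- (\<kappa> k)\<^sup>2 * A z * c z k + h z k\<bar> \<le> \<bar>(\<kappa> k)\<^sup>2 * A z * c z k\<bar> + \<bar>h z k\<bar>" by simp
    also have "\<bar>(\<kappa> k)\<^sup>2 * A z * c z k\<bar> \<le> (\<kappa> k)\<^sup>2 * M * b"
      unfolding abs_mult using A_lower[OF zT] A_upper[OF zT] m_pos b[OF zT] by (intro mult_mono) auto
    finally have "\<bar>- (\<kappa> k)\<^sup>2 * A z * c z k + h z k\<bar> \<le> (\<kappa> k)\<^sup>2 * M * b + b'" using b'[OF zT] by linarith
    then show ?thesis unfolding eq abs_mult using \<open>s < t\<close> by (simp add: mult.commute mult_left_mono)
  qed
  show ?thesis
    using *[of s t] *[of t s] st by (cases s t rule: linorder_cases) (auto simp: abs_minus_commute)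
qed

text \<open>The increment \<open>d\<close> from time \<open>r\<close> solves the same equation with additional source \<open>- \<kappa>\<^sup>2 A c(r)\<close>.
  Tested with \<open>d\<close> this source costs only the energy of \<open>c(r)\<close>, so that the square of the increment grows at most linearly.\<close>
lemma l2_half_hoelder:
  assumes rt: "0 \<le> r" "r \<le> t" "t \<le> T"
  shows "(\<Sum>k<N. (c t k - c r k)\<^sup>2) \<le> (M * (\<Sum>k<N. (\<kappa> k * c r k)\<^sup>2) + H / (m * (\<kappa> 0)\<^sup>2)) * (t - r)"
proof -
  let ?Y = "\<lambda>s. \<Sum>k<N. (c s k - c r k)\<^sup>2"
  let ?C = "M * (\<Sum>k<N. (\<kappa> k * c r k)\<^sup>2) + H / (m * (\<kappa> 0)\<^sup>2)"
  have "?Y t - ?Y r \<le> ?C * t - ?C * r"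
  proof (rule nonpos_deriv_difference[OF rt(2)])
    show "continuous_on {r..t} ?Y" using rt by (intro continuous_intros c_cont_on) auto
    fix s assume s: "r < s" "s < t"
    let ?y = "\<lambda>k. 2 * (c s k - c r k) * (- (\<kappa> k)\<^sup>2 * A s * c s k + h s k)"
    have sT: "s \<in> {0..T}" using s rt by auto
    have "(?Y has_real_derivative (\<Sum>k<N. ?y k)) (at s)"
      using s rt by (auto intro!: derivative_eq_intros c_deriv sum.cong simp: power2_eq_square algebra_simps)
    moreover have "(\<Sum>k<N. ?y k) \<le> (\<Sum>k<N. M * (\<kappa> k * c r k)\<^sup>2 + (h s k)\<^sup>2 / (m * (\<kappa> 0)\<^sup>2))"
    proof (rule sum_mono)
      fix k
      let ?d = "c s k - c r k" and ?P = "(\<kappa> k)\<^sup>2 * A s"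
      have P: "0 < ?P" "m * (\<kappa> 0)\<^sup>2 \<le> ?P"
        using \<kappa>_pos[of k] \<kappa>_pos[of 0] \<kappa>_mono A_lower[OF sT] m_pos
        by (auto simp: mult.commute[of _ "A s"] mono_def intro!: mult_mono power_mono)
      have 1: "- 2 * ?P * ?d * c r k \<le> ?P * ?d\<^sup>2 + ?P * (c r k)\<^sup>2"
      proof -
        have "0 \<le> ?P * (?d + c r k)\<^sup>2" using P by simp
        then show ?thesis by (simp add: power2_eq_square algebra_simps)
      qed
      have 2: "2 * ?d * h s k \<le> ?P * ?d\<^sup>2 + (h s k)\<^sup>2 / ?P"
        by (rule young_ineq) (use P in simp)
      have "?y k = - 2 * ?P * ?d\<^sup>2 + (- 2 * ?P * ?d * c r k) + 2 * ?d * h s k"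
        by (simp add: power2_eq_square algebra_simps)
      also have "\<dots> \<le> ?P * (c r k)\<^sup>2 + (h s k)\<^sup>2 / ?P" using 1 2 by linarith
      also have "?P * (c r k)\<^sup>2 \<le> M * (\<kappa> k * c r k)\<^sup>2"
        using mult_right_mono[OF A_upper[OF sT], of "(\<kappa> k * c r k)\<^sup>2"] by (simp add: power_mult_distrib mult_ac)
      also have "(h s k)\<^sup>2 / ?P \<le> (h s k)\<^sup>2 / (m * (\<kappa> 0)\<^sup>2)"
        using P m_pos \<kappa>_pos[of 0] by (intro divide_left_mono mult_pos_pos[of "?P"]) auto
      finally show "?y k \<le> M * (\<kappa> k * c r k)\<^sup>2 + (h s k)\<^sup>2 / (m * (\<kappa> 0)\<^sup>2)" by simp
    qed
    moreover have "\<dots> = M * (\<Sum>k<N. (\<kappa> k * c r k)\<^sup>2) + (\<Sum>k<N. (h s k)\<^sup>2) / (m * (\<kappa> 0)\<^sup>2)"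
      by (simp only: sum.distrib sum_distrib_left sum_divide_distrib)
    moreover have "\<dots> \<le> ?C"
      using h_bound[OF sT, of N] m_pos by (simp add: divide_right_mono)
    moreover have "((\<lambda>s. ?C * s) has_real_derivative ?C) (at s)"
      by (auto intro!: derivative_eq_intros)
    ultimately show "\<exists>y g. (?Y has_real_derivative y) (at s) \<and>
        ((\<lambda>s. ?C * s) has_real_derivative g) (at s) \<and> y \<le> g"
      by (intro exI[of _ "\<Sum>k<N. ?y k"] exI[of _ ?C]) linarith
  qed (intro continuous_intros)
  then show ?thesis unfolding right_diff_distrib by simp
qed

text \<open>In this intrinsic time the homogeneous flow is the heat semigroup with constant coefficient.\<close>
definition clock :: "real \<Rightarrow> real" where "clock t = integral {0..t} A"

lemma clock_deriv: "0 < t \<Longrightarrow> t < T \<Longrightarrow> (clock has_real_derivative A t) (at t)"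
  using integral_has_real_derivative[OF A_cont, of t] unfolding clock_def
  by (simp add: at_within_Icc_at)

lemma clock_cont: "continuous_on {0..T} clock"
  unfolding clock_def by (rule indefinite_integral_continuous_1[OF integrable_continuous_real[OF A_cont]])

lemma clock_cont_on: "0 \<le> a \<Longrightarrow> b \<le> T \<Longrightarrow> continuous_on {a..b} clock"
  by (rule continuous_on_subset[OF clock_cont]) auto

lemma clock_bounds:
  assumes "0 \<le> r" "r \<le> t" "t \<le> T"
  shows "m * (t - r) \<le> clock t - clock r" "clock t - clock r \<le> M * (t - r)"
proof -
  have "m * t - m * r \<le> clock t - clock r"
  proof (rule nonpos_deriv_difference[OF assms(2)])
    fix s assume s: "r < s" "s < t"
    then have "((\<lambda>s. m * s) has_real_derivative m) (at s)" "(clock has_real_derivative A s) (at s)" "m \<le> A s"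
      using assms A_lower by (auto intro!: derivative_eq_intros clock_deriv)
    then show "\<exists>y g. ((\<lambda>s. m * s) has_real_derivative y) (at s) \<and> (clock has_real_derivative g) (at s) \<and> y \<le> g"
      by blast
  qed (use assms in \<open>auto intro!: continuous_intros clock_cont_on\<close>)
  then show "m * (t - r) \<le> clock t - clock r" by (simp add: algebra_simps)
  have "clock t - clock r \<le> M * t - M * r"
  proof (rule nonpos_deriv_difference[OF assms(2)])
    fix s assume s: "r < s" "s < t"
    then have "((\<lambda>s. M * s) has_real_derivative M) (at s)" "(clock has_real_derivative A s) (at s)" "A s \<le> M"
      using assms A_upper by (auto intro!: derivative_eq_intros clock_deriv)
    then show "\<exists>y g. (clock has_real_derivative y) (at s) \<and> ((\<lambda>s. M * s) has_real_derivative g) (at s) \<and> y \<le> g"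
      by blast
  qed (use assms in \<open>auto intro!: continuous_intros clock_cont_on\<close>)
  then show "clock t - clock r \<le> M * (t - r)" by (simp add: algebra_simps)
qed

text \<open>The factor \<open>min 1 (M x y)\<close> bounds the change of a mode with eigenvalue \<open>x\<close> over a time \<open>y\<close>; the
  exponential is its damping over the time \<open>u\<close> since the source acted. Their product is dominated, uniformly in the
  eigenvalue, by a kernel that is integrable in \<open>u\<close> with integral proportional to \<open>y\<close>.\<close>
lemma frequency_cut_kernel:
  assumes "0 < y" "0 \<le> u" "0 \<le> x"
  shows "(min 1 (M * x * y))\<^sup>2 * exp (- m * x * u) \<le> 4 * (M / m)\<^sup>2 * (y\<^sup>2 / (y\<^sup>2 + u\<^sup>2))"
proof (cases "u \<le> y")
  case True
  have a: "(min 1 (M * x * y))\<^sup>2 \<le> 1" using assms M_pos by (auto intro!: power_le_one simp: min_def)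
  have "(min 1 (M * x * y))\<^sup>2 * exp (- m * x * u) \<le> 1 * 1"
    by (rule mult_mono) (use a assms m_pos in auto)
  also have "\<dots> \<le> 4 * 1 * (1 / 2 :: real)" by simp
  also have "\<dots> \<le> 4 * (M / m)\<^sup>2 * (y\<^sup>2 / (y\<^sup>2 + u\<^sup>2))"
  proof (intro mult_mono)
    show "1 \<le> (M / m)\<^sup>2" using m_pos m_le_M by (simp add: one_le_power)
    have "u\<^sup>2 \<le> y\<^sup>2" using True assms by (simp add: power_mono)
    moreover have "0 < y\<^sup>2 + u\<^sup>2" using assms by (simp add: add_pos_nonneg)
    ultimately show "1 / 2 \<le> y\<^sup>2 / (y\<^sup>2 + u\<^sup>2)" by (simp add: field_simps)
  qed auto
  finally show ?thesis .
next
  case False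
  define z where "z = m * x * u"
  have z: "0 \<le> z" "u > 0" using assms False m_pos by (auto simp: z_def)
  have "z\<^sup>2 / 2 \<le> exp z" using exp_lower_Taylor_quadratic[OF z(1)] z by linarith
  then have ze: "z\<^sup>2 * exp (- z) \<le> 2" by (simp add: exp_minus field_simps)
  have "(min 1 (M * x * y))\<^sup>2 \<le> (M * x * y)\<^sup>2"
    using assms M_pos by (intro power_mono) auto
  also have "\<dots> = (M / m)\<^sup>2 * (y / u)\<^sup>2 * z\<^sup>2" using z m_pos by (simp add: z_def power_mult_distrib power_divide)
  finally have "(min 1 (M * x * y))\<^sup>2 * exp (- m * x * u) \<le> (M / m)\<^sup>2 * (y / u)\<^sup>2 * z\<^sup>2 * exp (- z)"
    by (simp add: z_def mult_right_mono)
  also have "\<dots> \<le> (M / m)\<^sup>2 * (y / u)\<^sup>2 * 2"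
    using mult_left_mono[OF ze, of "(M / m)\<^sup>2 * (y / u)\<^sup>2"] by (simp add: mult_ac)
  also have "\<dots> \<le> (M / m)\<^sup>2 * (2 * (y\<^sup>2 / (y\<^sup>2 + u\<^sup>2))) * 2"
  proof -
    have "y\<^sup>2 \<le> u\<^sup>2" using False assms by (simp add: power_mono)
    then have "(y / u)\<^sup>2 \<le> 2 * (y\<^sup>2 / (y\<^sup>2 + u\<^sup>2))"
      using z assms mult_right_mono[OF \<open>y\<^sup>2 \<le> u\<^sup>2\<close>, of "y\<^sup>2"] by (simp add: power_divide field_simps add_pos_pos)
    then show ?thesis by (intro mult_right_mono mult_left_mono) auto
  qed
  finally show ?thesis by simp
qed

text \<open>Summing the source contributions against the kernel gives order \<open>y\<close>, that is Hoelder exponent \<open>1/2\<close>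
  for the norm. The naive estimate through the second-order norm would lose a logarithm, because that norm is not
  bounded by the supremum of the source.\<close>
lemma frequency_cut_bound:
  assumes r: "0 \<le> r" "r \<le> T" and "0 < y"
  shows "(\<Sum>k<N. (min 1 (M * (\<kappa> k)\<^sup>2 * y))\<^sup>2 * (\<kappa> k * c r k)\<^sup>2)
    \<le> (\<Sum>k<N. (min 1 (M * (\<kappa> k)\<^sup>2 * y))\<^sup>2 * exp (- m * (\<kappa> k)\<^sup>2 * r) * (\<kappa> k * c 0 k)\<^sup>2)
       + 8 * H * M\<^sup>2 / m ^ 3 * y"
proof -
  define \<theta> where "\<theta> k = (min 1 (M * (\<kappa> k)\<^sup>2 * y))\<^sup>2" for k
  define C where "C = 4 * H * M\<^sup>2 / m ^ 3"
  have C: "0 \<le> C" using H_nonneg r m_pos by (simp add: C_def)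
  let ?Y = "\<lambda>s. \<Sum>k<N. \<theta> k * exp (- m * (\<kappa> k)\<^sup>2 * (r - s)) * (\<kappa> k * c s k)\<^sup>2"
  \<comment> \<open>the antiderivative of the kernel \<open>y\<^sup>2 / (y\<^sup>2 + (r - s)\<^sup>2)\<close>\<close>
  let ?G = "\<lambda>s. - C * y * arctan ((r - s) / y)"
  have "?Y r - ?Y 0 \<le> ?G r - ?G 0"
  proof (rule nonpos_deriv_difference[OF r(1)])
    show "continuous_on {0..r} ?Y" using r by (intro continuous_intros c_cont_on) auto
    show "continuous_on {0..r} ?G" using \<open>0 < y\<close> by (intro continuous_intros) auto
    fix s assume s: "0 < s" "s < r"
    have sT: "s \<in> {0..T}" using s r by auto
    let ?e = "\<lambda>k. \<theta> k * exp (- m * (\<kappa> k)\<^sup>2 * (r - s))"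
    let ?y = "\<lambda>k. ?e k * (m * (\<kappa> k)\<^sup>2 * (\<kappa> k * c s k)\<^sup>2
       + 2 * (\<kappa> k)\<^sup>2 * c s k * (- (\<kappa> k)\<^sup>2 * A s * c s k + h s k))"
    let ?g = "C * (y\<^sup>2 / (y\<^sup>2 + (r - s)\<^sup>2))"
    have "(?Y has_real_derivative (\<Sum>k<N. ?y k)) (at s)"
      using s r by (auto intro!: derivative_eq_intros c_deriv sum.cong simp: power2_eq_square algebra_simps)
    moreover have "(?G has_real_derivative ?g) (at s)"
    proof -
      have "(?G has_real_derivative - C * y * (inverse (1 + ((r - s) / y)\<^sup>2) * (- 1 / y))) (at s)"
        using \<open>0 < y\<close> by (auto intro!: derivative_eq_intros)
      moreover have "- C * y * (inverse (1 + ((r - s) / y)\<^sup>2) * (- 1 / y)) = ?g"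
      proof -
        have "1 + ((r - s) / y)\<^sup>2 = (y\<^sup>2 + (r - s)\<^sup>2) / y\<^sup>2"
          using \<open>0 < y\<close> by (simp add: field_simps power_divide)
        then show ?thesis using \<open>0 < y\<close> by simp
      qed
      ultimately show ?thesis by simp
    qed
    moreover have "(\<Sum>k<N. ?y k) \<le> (\<Sum>k<N. 4 * (M / m)\<^sup>2 * (y\<^sup>2 / (y\<^sup>2 + (r - s)\<^sup>2)) / m * (h s k)\<^sup>2)"
    proof (rule sum_mono)
      fix k
      have "m * (\<kappa> k)\<^sup>2 * (\<kappa> k * c s k)\<^sup>2 + 2 * (\<kappa> k)\<^sup>2 * c s k * (- (\<kappa> k)\<^sup>2 * A s * c s k + h s k)
          = m * ((\<kappa> k)\<^sup>2 * c s k)\<^sup>2 + (- 2 * A s * ((\<kappa> k)\<^sup>2 * c s k)\<^sup>2 + 2 * ((\<kappa> k)\<^sup>2 * c s k) * h s k)"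
        by (simp add: power2_eq_square algebra_simps)
      also have "\<dots> \<le> (h s k)\<^sup>2 / m"
        using damped_product_bound[OF A_lower[OF sT], of "(\<kappa> k)\<^sup>2 * c s k" "h s k"] by linarith
      finally have "?y k \<le> ?e k * ((h s k)\<^sup>2 / m)" by (rule mult_left_mono) (simp add: \<theta>_def)
      also have "\<dots> \<le> (4 * (M / m)\<^sup>2 * (y\<^sup>2 / (y\<^sup>2 + (r - s)\<^sup>2))) * ((h s k)\<^sup>2 / m)"
        unfolding \<theta>_def
        by (rule mult_right_mono[OF frequency_cut_kernel]) (use s \<open>0 < y\<close> m_pos in auto)
      finally show "?y k \<le> 4 * (M / m)\<^sup>2 * (y\<^sup>2 / (y\<^sup>2 + (r - s)\<^sup>2)) / m * (h s k)\<^sup>2" by simp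
    qed
    moreover have "\<dots> \<le> 4 * (M / m)\<^sup>2 * (y\<^sup>2 / (y\<^sup>2 + (r - s)\<^sup>2)) / m * H"
      unfolding sum_distrib_left[symmetric]
      by (rule mult_left_mono[OF h_bound[OF sT]]) (use m_pos in auto)
    moreover have "\<dots> = ?g" by (simp add: C_def power_divide power2_eq_square power3_eq_cube mult_ac)
    ultimately show "\<exists>y' g. (?Y has_real_derivative y') (at s) \<and> (?G has_real_derivative g) (at s) \<and> y' \<le> g"
      by (intro exI[of _ "\<Sum>k<N. ?y k"] exI[of _ ?g]) linarith
  qed
  moreover have "?G r - ?G 0 \<le> C * y * 2"
    using arctan_ubound[of "r / y"] pi_less_4 C \<open>0 < y\<close> by (simp add: mult_left_mono)
  ultimately show ?thesis by (simp add: \<theta>_def C_def)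
qed

text \<open>The increment splits into the response to the source after time \<open>r\<close>, whose energy grows at most
  linearly, and the decay of the state at time \<open>r\<close>, which is what the frequency cut measures.\<close>
lemma weighted_increment:
  assumes rt: "0 \<le> r" "r \<le> t" "t \<le> T"
  shows "(\<Sum>k<N. (\<kappa> k * (c t k - c r k))\<^sup>2)
    \<le> 2 * (H / m) * (t - r) + 2 * (\<Sum>k<N. (min 1 (M * (\<kappa> k)\<^sup>2 * (t - r)))\<^sup>2 * (\<kappa> k * c r k)\<^sup>2)"
proof -
  let ?E = "\<lambda>s k. exp (- (\<kappa> k)\<^sup>2 * (clock s - clock r))"
  let ?D = "\<lambda>s k. c s k - ?E s k * c r k"
  let ?Z = "\<lambda>s. \<Sum>k<N. (\<kappa> k * ?D s k)\<^sup>2"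
  have "?Z t - ?Z r \<le> H / m * t - H / m * r"
  proof (rule nonpos_deriv_difference[OF rt(2)])
    show "continuous_on {r..t} ?Z" using rt by (intro continuous_intros c_cont_on clock_cont_on) auto
    fix s assume s: "r < s" "s < t"
    have sT: "s \<in> {0..T}" using s rt by auto
    let ?y = "\<lambda>k. 2 * (\<kappa> k)\<^sup>2 * ?D s k * (- (\<kappa> k)\<^sup>2 * A s * ?D s k + h s k)"
    have "(?Z has_real_derivative (\<Sum>k<N. ?y k)) (at s)"
      using s rt by (auto intro!: derivative_eq_intros c_deriv clock_deriv sum.cong simp: power2_eq_square algebra_simps)
    moreover have "(\<Sum>k<N. ?y k) \<le> (\<Sum>k<N. (h s k)\<^sup>2 / m)"
    proof (rule sum_mono)
      fix k
      have "?y k = - 2 * A s * ((\<kappa> k)\<^sup>2 * ?D s k)\<^sup>2 + 2 * ((\<kappa> k)\<^sup>2 * ?D s k) * h s k"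
        by (simp add: power2_eq_square algebra_simps)
      also have "\<dots> \<le> - m * ((\<kappa> k)\<^sup>2 * ?D s k)\<^sup>2 + (h s k)\<^sup>2 / m"
        by (rule damped_product_bound[OF A_lower[OF sT]])
      also have "\<dots> \<le> (h s k)\<^sup>2 / m" using m_pos by simp
      finally show "?y k \<le> (h s k)\<^sup>2 / m" .
    qed
    moreover have "\<dots> \<le> H / m"
      unfolding sum_divide_distrib[symmetric] using h_bound[OF sT] m_pos by (simp add: divide_right_mono)
    moreover have "((\<lambda>s. H / m * s) has_real_derivative H / m) (at s)"
      using m_pos by (auto intro!: derivative_eq_intros)
    ultimately show "\<exists>y g. (?Z has_real_derivative y) (at s) \<and> ((\<lambda>s. H / m * s) has_real_derivative g) (at s) \<and> y \<le> g"
      by (intro exI[of _ "\<Sum>k<N. ?y k"] exI[of _ "H / m"]) linarith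
  qed (use m_pos in \<open>auto intro!: continuous_intros\<close>)
  then have Z: "?Z t \<le> H / m * (t - r)" by (simp add: right_diff_distrib)
  have "(\<Sum>k<N. (\<kappa> k * (c t k - c r k))\<^sup>2)
      \<le> (\<Sum>k<N. 2 * (\<kappa> k * ?D t k)\<^sup>2 + 2 * ((min 1 (M * (\<kappa> k)\<^sup>2 * (t - r)))\<^sup>2 * (\<kappa> k * c r k)\<^sup>2))"
  proof (rule sum_mono)
    fix k
    have "0 \<le> m * (t - r)" using m_pos rt by simp
    then have cl: "0 \<le> clock t - clock r" "clock t - clock r \<le> M * (t - r)"
      using clock_bounds[OF rt] by auto
    have "1 - ?E t k \<le> (\<kappa> k)\<^sup>2 * (clock t - clock r)"
      using exp_ge_add_one_self[of "- (\<kappa> k)\<^sup>2 * (clock t - clock r)"] by linarith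
    also have "\<dots> \<le> (\<kappa> k)\<^sup>2 * (M * (t - r))" by (rule mult_left_mono[OF cl(2)]) simp
    finally have E: "1 - ?E t k \<le> min 1 (M * (\<kappa> k)\<^sup>2 * (t - r))" "0 \<le> 1 - ?E t k"
      using cl(1) by (auto simp: mult_ac)
    have "(\<kappa> k * (c t k - c r k))\<^sup>2 = (\<kappa> k * ?D t k - (1 - ?E t k) * (\<kappa> k * c r k))\<^sup>2"
      by (simp add: algebra_simps)
    also have "\<dots> \<le> 2 * (\<kappa> k * ?D t k)\<^sup>2 + 2 * ((1 - ?E t k) * (\<kappa> k * c r k))\<^sup>2" by (rule power2_diff_le)
    also have "((1 - ?E t k) * (\<kappa> k * c r k))\<^sup>2 \<le> (min 1 (M * (\<kappa> k)\<^sup>2 * (t - r)))\<^sup>2 * (\<kappa> k * c r k)\<^sup>2"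
      unfolding power_mult_distrib[of "1 - ?E t k"] by (intro mult_right_mono power_mono E) simp
    finally show "(\<kappa> k * (c t k - c r k))\<^sup>2
       \<le> 2 * (\<kappa> k * ?D t k)\<^sup>2 + 2 * ((min 1 (M * (\<kappa> k)\<^sup>2 * (t - r)))\<^sup>2 * (\<kappa> k * c r k)\<^sup>2)" by simp
  qed
  also have "\<dots> = 2 * ?Z t + 2 * (\<Sum>k<N. (min 1 (M * (\<kappa> k)\<^sup>2 * (t - r)))\<^sup>2 * (\<kappa> k * c r k)\<^sup>2)"
    by (simp only: sum.distrib sum_distrib_left)
  finally show ?thesis using Z by simp
qed

text \<open>For initial data of finite energy the decay of the initial value over the time \<open>r\<close> supplies the missing
  smoothness, which is why the constant blows up as \<open>r\<close> tends to 0.\<close>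
lemma weighted_half_hoelder:
  assumes rt: "0 < r" "r < t" "t \<le> T"
    and P: "(\<Sum>k<N. (\<kappa> k * c 0 k)\<^sup>2) \<le> P"
  shows "(\<Sum>k<N. (\<kappa> k * (c t k - c r k))\<^sup>2) \<le> (2 * H / m + 2 * M * P / (m * r) + 16 * H * M\<^sup>2 / m ^ 3) * (t - r)"
proof -
  let ?\<theta> = "\<lambda>k. (min 1 (M * (\<kappa> k)\<^sup>2 * (t - r)))\<^sup>2"
  have "?\<theta> k * exp (- m * (\<kappa> k)\<^sup>2 * r) \<le> M * (t - r) / (m * r)" for k
  proof -
    let ?z = "m * (\<kappa> k)\<^sup>2 * r"
    have "?z * exp (- ?z) \<le> 1"
      by (rule mult_exp_minus_le_one)
    then have z: "M * (t - r) / (m * r) * (?z * exp (- ?z)) \<le> M * (t - r) / (m * r) * 1"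
      using M_pos m_pos rt by (intro mult_left_mono) auto
    have "?\<theta> k * exp (- ?z) \<le> M * (\<kappa> k)\<^sup>2 * (t - r) * exp (- ?z)"
      using M_pos rt by (intro mult_right_mono min_square_le) auto
    also have "\<dots> = M * (t - r) / (m * r) * (?z * exp (- ?z))" using m_pos rt by simp
    finally show ?thesis using z by simp
  qed
  then have "(\<Sum>k<N. ?\<theta> k * exp (- m * (\<kappa> k)\<^sup>2 * r) * (\<kappa> k * c 0 k)\<^sup>2) \<le> (\<Sum>k<N. M * (t - r) / (m * r) * (\<kappa> k * c 0 k)\<^sup>2)"
    by (intro sum_mono mult_right_mono) auto
  also have "\<dots> \<le> M * (t - r) / (m * r) * P"
    unfolding sum_distrib_left[symmetric] using M_pos m_pos rt by (intro mult_left_mono P) auto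
  finally have "(\<Sum>k<N. ?\<theta> k * (\<kappa> k * c r k)\<^sup>2) \<le> M * (t - r) / (m * r) * P + 8 * H * M\<^sup>2 / m ^ 3 * (t - r)"
    using frequency_cut_bound[of r "t - r" N] rt by auto
  then have "(\<Sum>k<N. (\<kappa> k * (c t k - c r k))\<^sup>2)
      \<le> 2 * (H / m) * (t - r) + 2 * (M * (t - r) / (m * r) * P + 8 * H * M\<^sup>2 / m ^ 3 * (t - r))"
    using weighted_increment[of r t N] rt by auto
  also have "\<dots> = (2 * H / m + 2 * M * P / (m * r) + 16 * H * M\<^sup>2 / m ^ 3) * (t - r)"
    by (simp add: ring_distribs mult_ac)
  finally show ?thesis .
qed

text \<open>If the initial value already has a second-order norm no smoothing is needed and the constant is
  uniform up to the initial time.\<close>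
lemma weighted_half_hoelder_smooth:
  assumes rt: "0 \<le> r" "r < t" "t \<le> T"
    and P: "(\<Sum>k<N. ((\<kappa> k)\<^sup>2 * c 0 k)\<^sup>2) \<le> P"
  shows "(\<Sum>k<N. (\<kappa> k * (c t k - c r k))\<^sup>2) \<le> (2 * H / m + 2 * M * P + 16 * H * M\<^sup>2 / m ^ 3) * (t - r)"
proof -
  let ?\<theta> = "\<lambda>k. (min 1 (M * (\<kappa> k)\<^sup>2 * (t - r)))\<^sup>2"
  have "?\<theta> k * exp (- m * (\<kappa> k)\<^sup>2 * r) * (\<kappa> k * c 0 k)\<^sup>2 \<le> M * (t - r) * ((\<kappa> k)\<^sup>2 * c 0 k)\<^sup>2" for k
  proof -
    have "?\<theta> k * exp (- m * (\<kappa> k)\<^sup>2 * r) \<le> (M * (\<kappa> k)\<^sup>2 * (t - r)) * 1"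
      using M_pos m_pos rt by (intro mult_mono min_square_le) auto
    then have "?\<theta> k * exp (- m * (\<kappa> k)\<^sup>2 * r) * (\<kappa> k * c 0 k)\<^sup>2 \<le> (M * (\<kappa> k)\<^sup>2 * (t - r)) * 1 * (\<kappa> k * c 0 k)\<^sup>2"
      by (rule mult_right_mono) simp
    then show ?thesis by (simp add: power2_eq_square mult_ac)
  qed
  then have "(\<Sum>k<N. ?\<theta> k * exp (- m * (\<kappa> k)\<^sup>2 * r) * (\<kappa> k * c 0 k)\<^sup>2) \<le> (\<Sum>k<N. M * (t - r) * ((\<kappa> k)\<^sup>2 * c 0 k)\<^sup>2)"
    by (intro sum_mono) auto
  also have "\<dots> \<le> M * (t - r) * P"
    unfolding sum_distrib_left[symmetric] using M_pos rt by (intro mult_left_mono P) auto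
  finally have "(\<Sum>k<N. ?\<theta> k * (\<kappa> k * c r k)\<^sup>2) \<le> M * (t - r) * P + 8 * H * M\<^sup>2 / m ^ 3 * (t - r)"
    using frequency_cut_bound[of r "t - r" N] rt by auto
  then have "(\<Sum>k<N. (\<kappa> k * (c t k - c r k))\<^sup>2)
      \<le> 2 * (H / m) * (t - r) + 2 * (M * (t - r) * P + 8 * H * M\<^sup>2 / m ^ 3 * (t - r))"
    using weighted_increment[of r t N] rt by auto
  also have "\<dots> = (2 * H / m + 2 * M * P + 16 * H * M\<^sup>2 / m ^ 3) * (t - r)"
    by (simp add: ring_distribs mult_ac)
  finally show ?thesis .
qed

text \<open>Freeze the quotient \<open>g = h / A\<close> at the final time \<open>t\<close>. Then \<open>\<kappa>\<^sup>2 c - g(t)\<close> relaxes exponentially, except for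
  a forcing \<open>\<kappa>\<^sup>2 A (g(s) - g(t))\<close>. With the weight \<open>exp (- m \<kappa>\<^sup>2 (t - s))\<close> the square of the defect \<open>R\<close>, summed over the
  modes, grows at rate at most a constant times \<open>B(t - s) / (t - s)\<close>: the factor \<open>\<kappa>\<^sup>2\<close> is traded for the singularity, and
  convergence of \<open>\<integral> B(u) / u du\<close> is exactly what remains.\<close>
lemma dini_remainder:
  assumes rt: "0 \<le> r" "r \<le> t" "t \<le> T"
    and J: "continuous_on {0..t - r} J" "J 0 = 0"
      "\<And>u. 0 < u \<Longrightarrow> u < t - r \<Longrightarrow> (J has_real_derivative B u / u) (at u)"
    and g: "\<And>s N. r < s \<Longrightarrow> s < t \<Longrightarrow> (\<Sum>k<N. (h s k / A s - h t k / A t)\<^sup>2) \<le> B (t - s)"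
  shows "(\<Sum>k<N. ((\<kappa> k)\<^sup>2 * c t k - h t k / A t
       - exp (- (\<kappa> k)\<^sup>2 * (clock t - clock r)) * ((\<kappa> k)\<^sup>2 * c r k - h t k / A t))\<^sup>2) \<le> M / m * J (t - r)"
proof -
  let ?E = "\<lambda>s k. exp (- (\<kappa> k)\<^sup>2 * (clock s - clock r))"
  let ?R = "\<lambda>s k. (\<kappa> k)\<^sup>2 * c s k - h t k / A t - ?E s k * ((\<kappa> k)\<^sup>2 * c r k - h t k / A t)"
  let ?V = "\<lambda>s. \<Sum>k<N. exp (- m * (\<kappa> k)\<^sup>2 * (t - s)) * (?R s k)\<^sup>2"
  let ?G = "\<lambda>s. - (M / m * J (t - s))"
  have "?V t - ?V r \<le> ?G t - ?G r"
  proof (rule nonpos_deriv_difference[OF rt(2)])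
    show "continuous_on {r..t} ?V" using rt by (intro continuous_intros c_cont_on clock_cont_on) auto
    show "continuous_on {r..t} ?G"
      by (intro continuous_intros continuous_on_compose2[OF J(1)]) auto
    fix s assume s: "r < s" "s < t"
    have sT: "s \<in> {0..T}" and As: "0 < A s" and At: "0 < A t" using s rt A_lower[of s] A_lower[of t] m_pos by auto
    let ?g = "\<lambda>k. h s k / A s - h t k / A t"
    let ?e = "\<lambda>k. exp (- m * (\<kappa> k)\<^sup>2 * (t - s))"
    let ?y = "\<lambda>k. ?e k * (m * (\<kappa> k)\<^sup>2 * (?R s k)\<^sup>2 + 2 * ?R s k * ((\<kappa> k)\<^sup>2 * (A s * (?g k - ?R s k))))"
    have Rd: "((\<lambda>s. ?R s k) has_real_derivative (\<kappa> k)\<^sup>2 * (A s * (?g k - ?R s k))) (at s)" for k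
      using s rt As At by (auto intro!: derivative_eq_intros c_deriv clock_deriv simp: algebra_simps)
    have "(?V has_real_derivative (\<Sum>k<N. ?y k)) (at s)"
    proof (rule DERIV_sum)
      fix k
      have weighted_square: "((\<lambda>s. exp (- m * x * (t - s)) * (f s)\<^sup>2) has_real_derivative
          exp (- m * x * (t - s)) * (m * x * (f s)\<^sup>2 + 2 * f s * f')) (at s)"
        if "(f has_real_derivative f') (at s)" for f f' x
        by (auto intro!: derivative_eq_intros that simp: algebra_simps)
      show "((\<lambda>s. exp (- m * (\<kappa> k)\<^sup>2 * (t - s)) * (?R s k)\<^sup>2) has_real_derivative ?y k) (at s)"
        by (rule weighted_square[OF Rd])
    qed
    moreover have "(?G has_real_derivative M / m * (B (t - s) / (t - s))) (at s)"
    proof -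
      have "((\<lambda>s. J (t - s)) has_real_derivative (B (t - s) / (t - s)) * (- 1)) (at s)"
        by (rule DERIV_chain2[OF J(3)]) (use s in \<open>auto intro!: derivative_eq_intros\<close>)
      from DERIV_minus[OF DERIV_cmult[OF this, of "M / m"]] show ?thesis by simp
    qed
    moreover have "(\<Sum>k<N. ?y k) \<le> (\<Sum>k<N. M / m / (t - s) * (?g k)\<^sup>2)"
    proof (rule sum_mono)
      fix k
      let ?z = "m * (\<kappa> k)\<^sup>2 * (t - s)"
      have factor: "e * (m * x * u + 2 * v * (x * w)) = e * (x * (m * u + 2 * v * w))" for e x u v w :: real
        by (simp add: algebra_simps)
      have rescale: "e * (x * (M * v)) = M * v / (m * (t - s)) * (m * x * (t - s) * e)" for e x v
        using m_pos s by simp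
      have "m * (?R s k)\<^sup>2 + 2 * ?R s k * (A s * (?g k - ?R s k)) \<le> A s * (?g k)\<^sup>2"
        by (rule damped_difference_bound[OF A_lower[OF sT]])
      also have "\<dots> \<le> M * (?g k)\<^sup>2" using A_upper[OF sT] by (rule mult_right_mono) simp
      finally have "?e k * ((\<kappa> k)\<^sup>2 * (m * (?R s k)\<^sup>2 + 2 * ?R s k * (A s * (?g k - ?R s k))))
          \<le> ?e k * ((\<kappa> k)\<^sup>2 * (M * (?g k)\<^sup>2))"
        by (intro mult_left_mono) auto
      moreover have "?y k = ?e k * ((\<kappa> k)\<^sup>2 * (m * (?R s k)\<^sup>2 + 2 * ?R s k * (A s * (?g k - ?R s k))))"
        by (rule factor)
      ultimately have "?y k \<le> M * (?g k)\<^sup>2 / (m * (t - s)) * (?z * exp (- ?z))"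
        unfolding rescale by simp
      also have "\<dots> \<le> M * (?g k)\<^sup>2 / (m * (t - s)) * 1"
      proof (rule mult_left_mono)
        show "?z * exp (- ?z) \<le> 1"
          by (rule mult_exp_minus_le_one)
      qed (use m_pos M_pos s in auto)
      finally show "?y k \<le> M / m / (t - s) * (?g k)\<^sup>2" by (simp add: mult_ac)
    qed
    moreover have "\<dots> \<le> M / m / (t - s) * B (t - s)"
      unfolding sum_distrib_left[symmetric] using M_pos m_pos s by (intro mult_left_mono g) auto
    ultimately show "\<exists>y g. (?V has_real_derivative y) (at s) \<and> (?G has_real_derivative g) (at s) \<and> y \<le> g"
      by (intro exI[of _ "\<Sum>k<N. ?y k"] exI[of _ "M / m * (B (t - s) / (t - s))"]) auto
  qed
  then show ?thesis using J(2) by simp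
qed

text \<open>The second-order tail consists of the defect, the tail of the frozen source, and the damped tail
  at the starting time \<open>r\<close>. The first is made small by choosing \<open>t - r\<close> small, the others by choosing \<open>K\<close> large.\<close>
lemma maximal_regularity_tail:
  assumes rt: "0 \<le> r" "r \<le> t" "t \<le> T"
    and J: "continuous_on {0..t - r} J" "J 0 = 0"
      "\<And>u. 0 < u \<Longrightarrow> u < t - r \<Longrightarrow> (J has_real_derivative B u / u) (at u)"
    and g: "\<And>s N. r < s \<Longrightarrow> s < t \<Longrightarrow> (\<Sum>k<N. (h s k / A s - h t k / A t)\<^sup>2) \<le> B (t - s)"
  shows "(\<Sum>k=K..<N. ((\<kappa> k)\<^sup>2 * c t k)\<^sup>2) \<le> 3 * (M / m * J (t - r)) + 3 / m\<^sup>2 * (\<Sum>k=K..<N. (h t k)\<^sup>2)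
     + 3 * (\<Sum>k=K..<N. exp (- 2 * m * (\<kappa> k)\<^sup>2 * (t - r)) * ((\<kappa> k)\<^sup>2 * c r k)\<^sup>2)"
proof -
  let ?E = "\<lambda>k. exp (- (\<kappa> k)\<^sup>2 * (clock t - clock r))"
  let ?R = "\<lambda>k. (\<kappa> k)\<^sup>2 * c t k - h t k / A t - ?E k * ((\<kappa> k)\<^sup>2 * c r k - h t k / A t)"
  let ?F = "\<lambda>k. exp (- 2 * m * (\<kappa> k)\<^sup>2 * (t - r)) * ((\<kappa> k)\<^sup>2 * c r k)\<^sup>2"
  have tT: "t \<in> {0..T}" using rt by auto
  have "(\<Sum>k=K..<N. ((\<kappa> k)\<^sup>2 * c t k)\<^sup>2) \<le> (\<Sum>k=K..<N. 3 * (?R k)\<^sup>2 + 3 / m\<^sup>2 * (h t k)\<^sup>2 + 3 * ?F k)"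
  proof (rule sum_mono)
    fix k
    have cl: "m * (t - r) \<le> clock t - clock r" by (rule clock_bounds(1)[OF rt])
    have sq3: "(x + y + z)\<^sup>2 \<le> 3 * x\<^sup>2 + 3 * y\<^sup>2 + 3 * z\<^sup>2" for x y z :: real
    proof -
      have "0 \<le> (x - y)\<^sup>2 + (y - z)\<^sup>2 + (x - z)\<^sup>2" by simp
      then show ?thesis by (simp add: power2_eq_square algebra_simps)
    qed
    have "((\<kappa> k)\<^sup>2 * c t k)\<^sup>2 = (?R k + (1 - ?E k) * (h t k / A t) + ?E k * ((\<kappa> k)\<^sup>2 * c r k))\<^sup>2"
      by (simp add: algebra_simps)
    also have "\<dots> \<le> 3 * (?R k)\<^sup>2 + 3 * ((1 - ?E k) * (h t k / A t))\<^sup>2 + 3 * (?E k * ((\<kappa> k)\<^sup>2 * c r k))\<^sup>2" by (rule sq3)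
    also have "((1 - ?E k) * (h t k / A t))\<^sup>2 \<le> (h t k)\<^sup>2 / m\<^sup>2"
    proof -
      have "0 \<le> m * (t - r)" using m_pos rt by simp
      then have "0 \<le> clock t - clock r" using cl by linarith
      then have "(1 - ?E k)\<^sup>2 \<le> 1" by (intro power_le_one) auto
      moreover have "(h t k / A t)\<^sup>2 \<le> (h t k)\<^sup>2 / m\<^sup>2"
        unfolding power_divide using A_lower[OF tT] m_pos by (intro divide_left_mono power_mono mult_pos_pos) auto
      ultimately have "(1 - ?E k)\<^sup>2 * (h t k / A t)\<^sup>2 \<le> 1 * ((h t k)\<^sup>2 / m\<^sup>2)"
        by (intro mult_mono) auto
      then show ?thesis by (simp only: power_mult_distrib mult_1)
    qed
    also have "(?E k * ((\<kappa> k)\<^sup>2 * c r k))\<^sup>2 \<le> ?F k"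
    proof -
      have "(?E k)\<^sup>2 \<le> (exp (- (\<kappa> k)\<^sup>2 * (m * (t - r))))\<^sup>2"
        using cl by (intro power_mono) (auto intro: mult_left_mono)
      also have "\<dots> = exp (- 2 * m * (\<kappa> k)\<^sup>2 * (t - r))" by (simp add: exp_double[symmetric] mult_ac)
      finally show ?thesis unfolding power_mult_distrib[of "?E k"] by (intro mult_right_mono) auto
    qed
    finally show "((\<kappa> k)\<^sup>2 * c t k)\<^sup>2 \<le> 3 * (?R k)\<^sup>2 + 3 / m\<^sup>2 * (h t k)\<^sup>2 + 3 * ?F k" by simp
  qed
  also have "\<dots> = 3 * (\<Sum>k=K..<N. (?R k)\<^sup>2) + 3 / m\<^sup>2 * (\<Sum>k=K..<N. (h t k)\<^sup>2) + 3 * (\<Sum>k=K..<N. ?F k)"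
    by (simp only: sum.distrib sum_distrib_left)
  also have "(\<Sum>k=K..<N. (?R k)\<^sup>2) \<le> (\<Sum>k<N. (?R k)\<^sup>2)" by (rule sum_mono2) auto
  also have "(\<Sum>k<N. (?R k)\<^sup>2) \<le> M / m * J (t - r)" by (rule dini_remainder[OF assms])
  finally show ?thesis by simp
qed

end

end

section \<open>Solving the diagonal linear flow\<close>

lemma ell2_cont_Un:
  assumes "ell2_cont S c" "ell2_cont T c" "closed S" "closed T"
  shows "ell2_cont (S \<union> T) c"
proof -
  have lim: "((\<lambda>s. ell2_norm (\<lambda>k. c s k - c t k)) \<longlongrightarrow> 0) (at t within U)"
    if "ell2_cont U c" "closed U" for t U
  proof (cases "t \<in> U")
    case True then show ?thesis using that by (auto simp: ell2_cont_def)
  next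
    case False
    then have "at t within U = bot" using that(2) by (meson closed_limpt trivial_limit_within)
    then show ?thesis by simp
  qed
  show ?thesis unfolding ell2_cont_def
    using lim[OF assms(1,3)] lim[OF assms(2,4)] assms(1,2) by (auto simp: Lim_within_Un ell2_cont_def)
qed

lemma ell2_cont_atLeast:
  assumes "\<And>T. ell2_cont {a..T} c"
  shows "ell2_cont {a..} c"
  unfolding ell2_cont_def
proof (intro ballI conjI)
  fix t assume t: "t \<in> {a..}"
  then show "c t \<in> ell2" using assms[of t] by (auto simp: ell2_cont_def)
  have "at t within {a..} = at t within {a..t + 1}"
    by (rule at_within_nhd[of _ "{..<t + 1}"]) auto
  then show "((\<lambda>s. ell2_norm (\<lambda>k. c s k - c t k)) \<longlongrightarrow> 0) (at t within {a..})"
    using assms[of "t + 1"] t by (auto simp: ell2_cont_def)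
qed

lemma ell2_cont_cong: "ell2_cont T c \<Longrightarrow> (\<And>t. t \<in> T \<Longrightarrow> c t = d t) \<Longrightarrow> ell2_cont T d"
proof -
  assume c: "ell2_cont T c" and eq: "\<And>t. t \<in> T \<Longrightarrow> c t = d t"
  have "((\<lambda>s. ell2_norm (\<lambda>k. d s k - d t k)) \<longlongrightarrow> 0) (at t within T)" if "t \<in> T" for t
  proof -
    have "((\<lambda>s. ell2_norm (\<lambda>k. c s k - c t k)) \<longlongrightarrow> 0) (at t within T)
        \<longleftrightarrow> ((\<lambda>s. ell2_norm (\<lambda>k. d s k - d t k)) \<longlongrightarrow> 0) (at t within T)"
      by (rule Lim_cong_within) (use eq that in auto)
    then show ?thesis using c that by (simp add: ell2_cont_def)
  qed
  then show ?thesis using c eq by (auto simp: ell2_cont_def)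
qed

context diagonal_flow
begin

lemma lin_sol_cong:
  assumes "lin_sol T A h c" "\<And>t. t \<in> {0..T} \<Longrightarrow> A t = A' t" "\<And>t. t \<in> {0..T} \<Longrightarrow> h t = h' t"
  shows "lin_sol T A' h' c"
proof -
  have "continuous_on {0..T} A'" by (rule continuous_on_eq[of _ A]) (use assms in \<open>auto simp: lin_sol_def\<close>)
  moreover have "continuous_on {0..T} (\<lambda>t. h' t k)" for k
    by (rule continuous_on_eq[of _ "\<lambda>t. h t k"]) (use assms in \<open>auto simp: lin_sol_def\<close>)
  ultimately show ?thesis using assms by (simp add: lin_sol_def)
qed

lemma lin_sol_integral:
  assumes "lin_sol T A h c" "t \<in> {0..T}"
  shows "c t k = c 0 k + integral {0..t} (\<lambda>s. - (\<kappa> k)\<^sup>2 * A s * c s k + h s k)"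
proof -
  have "((\<lambda>s. - (\<kappa> k)\<^sup>2 * A s * c s k + h s k) has_integral (c t k - c 0 k)) {0..t}"
  proof (rule fundamental_theorem_of_calculus_interior)
    show "continuous_on {0..t} (\<lambda>t. c t k)"
      using assms by (auto simp: lin_sol_def intro: continuous_on_subset)
    fix s assume "s \<in> {0<..<t}"
    then show "((\<lambda>t. c t k) has_vector_derivative - (\<kappa> k)\<^sup>2 * A s * c s k + h s k) (at s)"
      using assms by (auto simp: lin_sol_def has_real_derivative_iff_has_vector_derivative[symmetric])
  qed (use assms in simp_all)
  then show ?thesis by (simp add: integral_unique)
qed

text \<open>In integrated form the equation survives pointwise limits, so this is how limits of solutions are
  recognised as solutions.\<close>
lemma lin_solI_integral:
  assumes A: "continuous_on {0..T} A" "\<And>t. t \<in> {0..T} \<Longrightarrow> m \<le> A t \<and> A t \<le> M"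
    and h: "\<And>k. continuous_on {0..T} (\<lambda>t. h t k)" and c: "\<And>k. continuous_on {0..T} (\<lambda>t. c t k)"
    and eq: "\<And>t k. t \<in> {0..T} \<Longrightarrow> c t k = p k + integral {0..t} (\<lambda>s. - (\<kappa> k)\<^sup>2 * A s * c s k + h s k)"
  shows "lin_sol T A h c"
  unfolding lin_sol_def
proof (intro conjI ballI allI impI assms)
  fix k t assume t: "0 < t" "t < T"
  let ?g = "\<lambda>s. - (\<kappa> k)\<^sup>2 * A s * c s k + h s k"
  have "((\<lambda>t. integral {0..t} ?g) has_real_derivative ?g t) (at t within {0..T})"
    by (rule integral_has_real_derivative) (use t in \<open>auto intro!: continuous_intros A h c\<close>)
  then have "((\<lambda>t. integral {0..t} ?g) has_real_derivative ?g t) (at t)"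
    using t by (simp add: at_within_Icc_at)
  then have "((\<lambda>t. p k + integral {0..t} ?g) has_real_derivative ?g t) (at t)"
    by (auto intro!: derivative_eq_intros)
  then show "((\<lambda>t. c t k) has_real_derivative ?g t) (at t)"
    by (rule DERIV_cong_ev[THEN iffD1, rotated 3])
      (use t eq in \<open>auto intro!: eventually_mono[OF eventually_nhds_in_open[of "{0<..<T}" t]]\<close>)
qed (use assms in auto)

definition duhamel :: "(nat \<Rightarrow> real) \<Rightarrow> (real \<Rightarrow> real) \<Rightarrow> (real \<Rightarrow> nat \<Rightarrow> real) \<Rightarrow> real \<Rightarrow> nat \<Rightarrow> real" where
  "duhamel p A h t k = exp (- (\<kappa> k)\<^sup>2 * integral {0..t} A) *
     (p k + integral {0..t} (\<lambda>s. exp ((\<kappa> k)\<^sup>2 * integral {0..s} A) * h s k))"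

lemma duhamel_0: "duhamel p A h 0 = p"
  by (simp add: duhamel_def fun_eq_iff)

lemma duhamel_cong:
  assumes "\<And>s. s \<in> {0..t} \<Longrightarrow> A s = A' s" "\<And>s. s \<in> {0..t} \<Longrightarrow> h s = h' s"
  shows "duhamel p A h t = duhamel p A' h' t"
proof -
  have I: "integral {0..s} A = integral {0..s} A'" if "s \<in> {0..t}" for s
    using that assms by (intro integral_cong) auto
  show ?thesis
  proof (cases "0 \<le> t")
    case True
    have "integral {0..t} (\<lambda>s. exp ((\<kappa> k)\<^sup>2 * integral {0..s} A) * h s k)
        = integral {0..t} (\<lambda>s. exp ((\<kappa> k)\<^sup>2 * integral {0..s} A') * h' s k)" for k
      by (rule integral_cong) (use I assms in auto)
    then show ?thesis using I[of t] True by (simp add: duhamel_def fun_eq_iff)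
  qed (simp add: duhamel_def fun_eq_iff)
qed

lemma lin_sol_duhamel:
  assumes A: "continuous_on {0..T} A" "\<And>t. t \<in> {0..T} \<Longrightarrow> m \<le> A t \<and> A t \<le> M"
    and h: "\<And>k. continuous_on {0..T} (\<lambda>t. h t k)"
  shows "lin_sol T A h (duhamel p A h)"
  unfolding lin_sol_def
proof (intro conjI ballI allI impI assms)
  have IA: "continuous_on {0..T} (\<lambda>t. integral {0..t} A)"
    by (rule indefinite_integral_continuous_1[OF integrable_continuous_real[OF A(1)]])
  have g: "continuous_on {0..T} (\<lambda>s. exp ((\<kappa> k)\<^sup>2 * integral {0..s} A) * h s k)" for k
    by (intro continuous_intros IA h)
  have Ig: "continuous_on {0..T} (\<lambda>t. integral {0..t} (\<lambda>s. exp ((\<kappa> k)\<^sup>2 * integral {0..s} A) * h s k))" for k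
    by (rule indefinite_integral_continuous_1[OF integrable_continuous_real[OF g]])
  show "continuous_on {0..T} (\<lambda>t. duhamel p A h t k)" for k
    unfolding duhamel_def by (intro continuous_intros IA Ig)
  fix k t assume t: "0 < t" "t < T"
  have "((\<lambda>t. integral {0..t} A) has_real_derivative A t) (at t)"
    using integral_has_real_derivative[OF A(1), of t] t by (simp add: at_within_Icc_at)
  moreover have "((\<lambda>t. integral {0..t} (\<lambda>s. exp ((\<kappa> k)\<^sup>2 * integral {0..s} A) * h s k))
      has_real_derivative exp ((\<kappa> k)\<^sup>2 * integral {0..t} A) * h t k) (at t)"
    using integral_has_real_derivative[OF g, of t] t by (simp add: at_within_Icc_at)
  ultimately show "((\<lambda>t. duhamel p A h t k) has_real_derivative
      - (\<kappa> k)\<^sup>2 * A t * duhamel p A h t k + h t k) (at t)"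
    unfolding duhamel_def
    by (auto intro!: derivative_eq_intros simp: exp_minus field_simps)
qed (use assms in auto)

definition X1 :: "(nat \<Rightarrow> real) set" where "X1 = {c. (\<lambda>k. \<kappa> k * c k) \<in> ell2}"

definition X1_norm :: "(nat \<Rightarrow> real) \<Rightarrow> real" where "X1_norm c = ell2_norm (\<lambda>k. \<kappa> k * c k)"

lemma X1_ell2:
  assumes "c \<in> X1" shows "c \<in> ell2" "ell2_norm c \<le> X1_norm c / \<kappa> 0"
proof -
  have k0: "\<kappa> 0 \<le> \<kappa> k" for k using \<kappa>_mono by (simp add: monoD)
  have *: "\<bar>c k\<bar> \<le> \<bar>(1 / \<kappa> 0) * (\<kappa> k * c k)\<bar>" for k
    using \<kappa>_pos[of 0] k0[of k] by (auto simp: abs_mult field_simps intro!: mult_right_mono)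
  from assms have X: "(\<lambda>k. \<kappa> k * c k) \<in> ell2" by (simp add: X1_def)
  show "c \<in> ell2" by (rule ell2_mono(1)[OF ell2_scale(1)[OF X] *])
  show "ell2_norm c \<le> X1_norm c / \<kappa> 0"
    using ell2_mono(2)[OF ell2_scale(1)[OF X] *] ell2_scale(2)[OF X, of "1 / \<kappa> 0"] \<kappa>_pos[of 0]
    by (simp add: X1_norm_def)
qed

lemma X1_diff: "c \<in> X1 \<Longrightarrow> d \<in> X1 \<Longrightarrow> (\<lambda>k. c k - d k) \<in> X1"
  unfolding X1_def using ell2_diff(1)[of "\<lambda>k. \<kappa> k * c k" "\<lambda>k. \<kappa> k * d k"] by (simp add: right_diff_distrib)

lemma X1_norm_nonneg: "c \<in> X1 \<Longrightarrow> 0 \<le> X1_norm c"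
  by (simp add: X1_def X1_norm_def ell2_norm_nonneg)

abbreviation X1_cont :: "real set \<Rightarrow> (real \<Rightarrow> nat \<Rightarrow> real) \<Rightarrow> bool" where
  "X1_cont T c \<equiv> ell2_cont T (\<lambda>t k. \<kappa> k * c t k)"

lemma X1_cont_iff: "X1_cont T c \<longleftrightarrow> (\<forall>t\<in>T. c t \<in> X1 \<and>
     ((\<lambda>s. X1_norm (\<lambda>k. c s k - c t k)) \<longlongrightarrow> 0) (at t within T))"
  by (simp add: ell2_cont_def X1_def X1_norm_def right_diff_distrib)

lemma X1_cont_coord: "X1_cont T c \<Longrightarrow> continuous_on T (\<lambda>t. c t k)"
  using ell2_cont_coord[of T "\<lambda>t k. \<kappa> k * c t k" k] continuous_on_mult_left[of T "\<lambda>t. \<kappa> k * c t k" "1 / \<kappa> k"]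
    \<kappa>_pos[of k] by (simp add: less_imp_neq[symmetric])

text \<open>The cutoff \<open>K\<close> depends only on the initial value and the bound for the source, not on the coefficient or
  the source themselves; hence one \<open>K\<close> serves a whole sequence of approximate solutions.\<close>
lemma uniform_weighted_tail:
  assumes p: "p \<in> X1" and "0 < e"
  shows "\<exists>K. \<forall>T A h c. lin_sol T A h c \<longrightarrow> (\<forall>t\<in>{0..T}. \<forall>N. (\<Sum>k<N. (h t k)\<^sup>2) \<le> H) \<longrightarrow> c 0 = p \<longrightarrow>
     (\<forall>t\<in>{0..T}. \<forall>N. (\<Sum>k=K..<N. (\<kappa> k * c t k)\<^sup>2) \<le> e)"
proof -
  obtain K1 where K1: "\<And>N. (\<Sum>k=K1..<N. (\<kappa> k * p k)\<^sup>2) \<le> e / 2"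
    using ell2_tail[of "\<lambda>k. \<kappa> k * p k" "e/2"] p half_gt_zero[OF \<open>0 < e\<close>] unfolding X1_def by blast
  have "filterlim (\<lambda>K. m * \<kappa> K) at_top sequentially"
    by (rule filterlim_tendsto_pos_mult_at_top[OF tendsto_const m_pos \<kappa>_top])
  then have lim: "(\<lambda>K. H * (inverse (m * \<kappa> K))\<^sup>2) \<longlonglongrightarrow> H * 0\<^sup>2"
    by (rule tendsto_mult[OF tendsto_const tendsto_power[OF tendsto_inverse_0_at_top]])
  have "H * 0\<^sup>2 < e / 2" using \<open>0 < e\<close> by simp
  from order_tendstoD(2)[OF lim this] have "eventually (\<lambda>K. H / (m * \<kappa> K)\<^sup>2 < e / 2) sequentially"
    by (simp only: divide_inverse power_inverse)
  then obtain K2 where K2: "\<And>K. K \<ge> K2 \<Longrightarrow> H / (m * \<kappa> K)\<^sup>2 < e / 2"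
    by (auto simp: eventually_sequentially)
  have "(\<Sum>k=max K1 K2..<N. (\<kappa> k * c t k)\<^sup>2) \<le> e"
    if sol: "lin_sol T A h c" and hb: "\<forall>t\<in>{0..T}. \<forall>N. (\<Sum>k<N. (h t k)\<^sup>2) \<le> H" and c0: "c 0 = p" and t: "t \<in> {0..T}"
    for T A h c t N
  proof -
    have "(\<Sum>k=max K1 K2..<N. (\<kappa> k * c t k)\<^sup>2)
        \<le> (\<Sum>k=max K1 K2..<N. (\<kappa> k * c 0 k)\<^sup>2) + H / (m * \<kappa> (max K1 K2))\<^sup>2"
      by (rule weighted_tail_bound[OF sol _ t]) (use hb in blast)
    also have "(\<Sum>k=max K1 K2..<N. (\<kappa> k * c 0 k)\<^sup>2) \<le> (\<Sum>k=K1..<N. (\<kappa> k * p k)\<^sup>2)"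
      unfolding c0 by (rule sum_mono2) auto
    also have "\<dots> \<le> e / 2" by (rule K1)
    finally show ?thesis using K2[OF max.cobounded2[of K2 K1]] by linarith
  qed
  then show ?thesis by blast
qed

lemma lin_sol_X1_cont:
  assumes sol: "lin_sol T A h c" and hb: "\<And>t N. t \<in> {0..T} \<Longrightarrow> (\<Sum>k<N. (h t k)\<^sup>2) \<le> H" and c0: "c 0 \<in> X1"
  shows "X1_cont {0..T} c"
proof -
  have tails: "\<exists>K. \<forall>t\<in>{0..T}. \<forall>N. (\<Sum>k=K..<N. (\<kappa> k * c t k)\<^sup>2) \<le> e" if "e > 0" for e
    using uniform_weighted_tail[OF c0 that, of H] sol hb by blast
  show ?thesis
  proof (rule ell2_contI)
    show "continuous_on {0..T} (\<lambda>t. \<kappa> k * c t k)" for k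
      using sol by (auto simp: lin_sol_def intro!: continuous_intros)
    show "\<exists>K. eventually (\<lambda>s. \<forall>N. (\<Sum>k=K..<N. (\<kappa> k * c s k)\<^sup>2) \<le> e) (at t within {0..T})" if "e > 0" for e t
    proof -
      obtain K where K: "\<forall>t\<in>{0..T}. \<forall>N. (\<Sum>k=K..<N. (\<kappa> k * c t k)\<^sup>2) \<le> e" using tails[OF \<open>e > 0\<close>] by blast
      show ?thesis by (rule exI[of _ K]) (rule eventually_mono[OF eventually_in_within], use K in blast)
    qed
    fix t assume t: "t \<in> {0..T}"
    show "(\<lambda>k. \<kappa> k * c t k) \<in> ell2"
    proof (rule ell2_bounded_sums)
      fix N
      have "(\<Sum>k=0..<N. (\<kappa> k * c t k)\<^sup>2) \<le> (\<Sum>k=0..<N. (\<kappa> k * c 0 k)\<^sup>2) + H / (m * \<kappa> 0)\<^sup>2"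
        by (rule weighted_tail_bound[OF sol hb t])
      also have "\<dots> \<le> (X1_norm (c 0))\<^sup>2 + H / (m * \<kappa> 0)\<^sup>2"
        using sum_le_ell2_norm_sq[of "\<lambda>k. \<kappa> k * c 0 k" "{0..<N}"] c0 by (simp add: X1_def X1_norm_def)
      finally show "(\<Sum>k<N. (\<kappa> k * c t k)\<^sup>2) \<le> (X1_norm (c 0))\<^sup>2 + H / (m * \<kappa> 0)\<^sup>2"
        by (simp add: atLeast0LessThan)
    qed
  qed
qed

text \<open>The hypothesis lets the source grow like the asserted bound itself. The bound for one iterate
  therefore reproduces itself for the next, in place of a Gronwall argument for the nonlinear equation.\<close>
lemma lin_sol_exponential_growth:
  assumes sol: "lin_sol T A h c" and "0 \<le> G"
    and hb: "\<And>t. t \<in> {0..T} \<Longrightarrow> (\<Sum>k<N. (h t k)\<^sup>2) \<le> D * G * exp ((1 + D) * t)"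
    and c0: "(\<Sum>k<N. (c 0 k)\<^sup>2) \<le> G" and t: "t \<in> {0..T}"
  shows "(\<Sum>k<N. (c t k)\<^sup>2) \<le> G * exp ((1 + D) * t)"
proof -
  let ?Y = "\<lambda>s. \<Sum>k<N. (c s k)\<^sup>2"
  let ?e = "\<lambda>s. G * exp ((1 + D) * s)"
  let ?Z = "\<lambda>s. exp (- s) * (?Y s - ?e s)"
  have "?Z t - ?Z 0 \<le> (\<lambda>_. 0::real) t - (\<lambda>_. 0) 0"
  proof (rule nonpos_deriv_difference[where Y = ?Z and G = "\<lambda>_. 0"])
    show "continuous_on {0..t} ?Z"
    proof (intro continuous_intros)
      show "continuous_on {0..t} (\<lambda>s. c s k)" for k
        by (rule continuous_on_subset[of "{0..T}"]) (use sol t in \<open>auto simp: lin_sol_def\<close>)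
    qed
    fix s assume s: "0 < s" "s < t"
    have "\<forall>t\<in>{0..T}. m \<le> A t" using sol unfolding lin_sol_def by blast
    moreover have "s \<in> {0..T}" using s t by auto
    ultimately have As: "0 < A s" using m_pos by force
    let ?y = "\<lambda>k. 2 * c s k * (- (\<kappa> k)\<^sup>2 * A s * c s k + h s k)"
    have Y: "(?Y has_real_derivative (\<Sum>k<N. ?y k)) (at s)"
    proof -
      have cd: "((\<lambda>s. c s k) has_real_derivative - (\<kappa> k)\<^sup>2 * A s * c s k + h s k) (at s)" for k
        using sol s t unfolding lin_sol_def by auto
      show ?thesis by (auto intro!: derivative_eq_intros cd sum.cong)
    qed
    have "(?Z has_real_derivative exp (- s) * ((\<Sum>k<N. ?y k) - ?Y s - D * ?e s)) (at s)"
    proof -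
      have damped: "((\<lambda>s. exp (- s) * (y s - ?e s)) has_real_derivative exp (- s) * (y' - y s - D * ?e s)) (at s)"
        if "(y has_real_derivative y') (at s)" for y y'
        by (auto intro!: derivative_eq_intros that simp: algebra_simps)
      show ?thesis by (rule damped[OF Y])
    qed
    moreover have "exp (- s) * ((\<Sum>k<N. ?y k) - ?Y s - D * ?e s) \<le> 0"
    proof (rule mult_nonneg_nonpos)
      have "(\<Sum>k<N. ?y k) \<le> (\<Sum>k<N. (c s k)\<^sup>2 + (h s k)\<^sup>2)"
      proof (rule sum_mono)
        fix k
        have "0 \<le> (c s k - h s k)\<^sup>2" "0 \<le> 2 * ((\<kappa> k)\<^sup>2 * A s * (c s k)\<^sup>2)" using As by auto
        then show "?y k \<le> (c s k)\<^sup>2 + (h s k)\<^sup>2" by (simp add: power2_eq_square algebra_simps)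
      qed
      also have "\<dots> \<le> ?Y s + D * ?e s" using hb[of s] s t by (simp add: sum.distrib)
      finally show "(\<Sum>k<N. ?y k) - ?Y s - D * ?e s \<le> 0" by simp
    qed simp
    ultimately show "\<exists>y g. (?Z has_real_derivative y) (at s) \<and> ((\<lambda>_. 0::real) has_real_derivative g) (at s) \<and> y \<le> g"
      by (intro exI[of _ "exp (- s) * ((\<Sum>k<N. ?y k) - ?Y s - D * ?e s)"] exI[of _ 0]) auto
  qed (use t in auto)
  then have "exp (- t) * (?Y t - ?e t) \<le> 0" using c0 by simp
  then show ?thesis by (simp add: mult_le_0_iff)
qed

end

section \<open>The nonlocal equation with retarded nonlinearities\<close>

lemma ell2_cont_shift:
  assumes w: "ell2_cont {a..} w" and "a \<le> b - d"
  shows "ell2_cont {b..} (\<lambda>s. w (s - d))"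
  unfolding ell2_cont_def
proof (intro ballI conjI)
  fix t :: real assume t: "t \<in> {b..}"
  then have td: "t - d \<in> {a..}" using assms(2) by auto
  then show "w (t - d) \<in> ell2" using w by (auto simp: ell2_cont_def)
  have "filterlim (\<lambda>s. s - d) (at (t - d) within {a..}) (at t within {b..})"
    unfolding filterlim_at
    by (intro conjI tendsto_intros) (auto simp: eventually_at_filter intro!: always_eventually, use assms(2) in auto)
  then show "((\<lambda>s. ell2_norm (\<lambda>k. w (s - d) k - w (t - d) k)) \<longlongrightarrow> 0) (at t within {b..})"
    using w td by (auto simp: ell2_cont_def intro: filterlim_compose)
qed

text \<open>The nonlinear problem in coefficients: \<open>al\<close> is the nonlocal diffusion coefficient, \<open>F\<close> the
  reaction term, \<open>q\<close> the history. One modulus \<open>\<nu>\<close> dominates all the moduli of continuity as well as the identity, so that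
  Hoelder errors need no separate treatment. The Dini condition is stated through an antiderivative for the
  square of the modulus, which is the form in which the comparison of derivatives meets it.\<close>
locale nonlocal_delay = diagonal_flow \<kappa> m M for \<kappa> :: "nat \<Rightarrow> real" and m M :: real +
  fixes al :: "(nat \<Rightarrow> real) \<Rightarrow> real" and F :: "(nat \<Rightarrow> real) \<Rightarrow> nat \<Rightarrow> real"
    and \<gamma> \<rho> \<beta> Kf Cg :: real and \<nu> :: "real \<Rightarrow> real" and q :: "real \<Rightarrow> nat \<Rightarrow> real"
  assumes al_range: "c \<in> X1 \<Longrightarrow> m \<le> al c \<and> al c \<le> M"
    and al_modulus: "c \<in> X1 \<Longrightarrow> d \<in> X1 \<Longrightarrow> \<bar>al c - al d\<bar> \<le> \<nu> (X1_norm (\<lambda>k. c k - d k))"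
    and F_modulus: "c \<in> X1 \<Longrightarrow> d \<in> X1 \<Longrightarrow> (\<Sum>k<N. (F c k - F d k)\<^sup>2) \<le> (\<nu> (Kf * X1_norm (\<lambda>k. c k - d k)))\<^sup>2"
    and F_growth: "c \<in> X1 \<Longrightarrow> (\<Sum>k<N. (F c k)\<^sup>2) \<le> Cg * (1 + (ell2_norm c)\<^sup>2)"
    and Kf: "1 \<le> Kf" and Cg: "0 \<le> Cg" and \<rho>: "0 < \<rho>" and \<beta>: "0 < \<beta>" "\<beta> < 1 / 2"
    and q_cont: "X1_cont {-\<rho>..0} q"
    and q_modulus: "s \<in> {-\<rho>..0} \<Longrightarrow> t \<in> {-\<rho>..0} \<Longrightarrow> ell2_norm (\<lambda>k. q s k - q t k) \<le> \<nu> (\<bar>s - t\<bar> powr \<beta>)"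
    and \<nu>_cont: "continuous_on {0..} \<nu>" and \<nu>_mono: "mono_on {0..} \<nu>" and \<nu>_0: "\<nu> 0 = 0"
    and \<nu>_ge: "0 \<le> x \<Longrightarrow> x \<le> \<nu> x"
    and dini: "0 < C \<Longrightarrow> \<exists>J. continuous_on {0..1} J \<and> J 0 = 0 \<and>
       (\<forall>u. 0 < u \<longrightarrow> u < 1 \<longrightarrow> (J has_real_derivative (\<nu> (C * u powr \<beta>))\<^sup>2 / u) (at u))"
begin

lemma \<nu>_tendsto:
  assumes "eventually (\<lambda>i. 0 \<le> x i) Fl" "(x \<longlongrightarrow> 0) Fl"
  shows "((\<lambda>i. \<nu> (x i)) \<longlongrightarrow> 0) Fl"
  using continuous_on_tendsto_compose[OF \<nu>_cont assms(2)] assms(1) \<nu>_0 by simp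

lemma al_tendsto:
  assumes x: "eventually (\<lambda>i. x i \<in> X1) Fl" and d: "d \<in> X1" and lim: "((\<lambda>i. X1_norm (\<lambda>k. x i k - d k)) \<longlongrightarrow> 0) Fl"
  shows "((\<lambda>i. al (x i)) \<longlongrightarrow> al d) Fl"
proof (subst Lim_null, rule Lim_null_comparison)
  show "eventually (\<lambda>i. norm (al (x i) - al d) \<le> \<nu> (X1_norm (\<lambda>k. x i k - d k))) Fl"
    using x by eventually_elim (use al_modulus d in auto)
  show "((\<lambda>i. \<nu> (X1_norm (\<lambda>k. x i k - d k))) \<longlongrightarrow> 0) Fl"
    by (rule \<nu>_tendsto[OF _ lim], use x in eventually_elim) (intro X1_norm_nonneg X1_diff d)
qed

lemma F_coord_tendsto:
  assumes x: "eventually (\<lambda>i. x i \<in> X1) Fl" and d: "d \<in> X1" and lim: "((\<lambda>i. X1_norm (\<lambda>k. x i k - d k)) \<longlongrightarrow> 0) Fl"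
  shows "((\<lambda>i. F (x i) j) \<longlongrightarrow> F d j) Fl"
proof (subst Lim_null, rule Lim_null_comparison)
  have nn: "eventually (\<lambda>i. 0 \<le> Kf * X1_norm (\<lambda>k. x i k - d k)) Fl"
    using x by eventually_elim (use Kf in \<open>auto intro!: mult_nonneg_nonneg X1_norm_nonneg X1_diff d\<close>)
  show "eventually (\<lambda>i. norm (F (x i) j - F d j) \<le> \<nu> (Kf * X1_norm (\<lambda>k. x i k - d k))) Fl"
    using x nn
  proof eventually_elim
    case (elim i)
    have "(F (x i) j - F d j)\<^sup>2 \<le> (\<Sum>k<Suc j. (F (x i) k - F d k)\<^sup>2)"
      by (rule member_le_sum) auto
    also have "\<dots> \<le> (\<nu> (Kf * X1_norm (\<lambda>k. x i k - d k)))\<^sup>2" by (rule F_modulus[OF elim(1) d])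
    finally show ?case using order_trans[OF elim(2) \<nu>_ge[OF elim(2)]] by (simp add: abs_le_square_iff[symmetric])
  qed
  have "((\<lambda>i. Kf * X1_norm (\<lambda>k. x i k - d k)) \<longlongrightarrow> 0) Fl" using tendsto_mult_left[OF lim, of Kf] by simp
  then show "((\<lambda>i. \<nu> (Kf * X1_norm (\<lambda>k. x i k - d k))) \<longlongrightarrow> 0) Fl"
    by (rule \<nu>_tendsto[OF nn])
qed

text \<open>The rate in the bound of the source by the growth envelope \<open>G exp ((1 + D) t)\<close> of the state.\<close>
definition D where "D = 4 * Cg + 2 * \<gamma>\<^sup>2"
definition G where "G = max 1 ((ell2_norm (q 0) + \<nu> (\<rho> powr \<beta>))\<^sup>2)"

lemma D_nonneg: "0 \<le> D" and G_ge_1: "1 \<le> G"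
  using Cg by (auto simp: D_def G_def)

text \<open>The retardation \<open>\<delta>\<close> applies to the nonlinear terms only; \<open>\<delta> = 0\<close> is the original problem. For
  \<open>\<delta> \<le> \<rho>\<close> the linear delay term never looks at more recent values than the nonlinear ones do.\<close>
definition diffusion :: "real \<Rightarrow> (real \<Rightarrow> nat \<Rightarrow> real) \<Rightarrow> real \<Rightarrow> real" where
  "diffusion \<delta> w s = al (w (s - \<delta>))"

definition forcing :: "real \<Rightarrow> (real \<Rightarrow> nat \<Rightarrow> real) \<Rightarrow> real \<Rightarrow> nat \<Rightarrow> real" where
  "forcing \<delta> w s k = F (w (s - \<delta>)) k + \<gamma> * w (s - \<rho>) k"

lemma diffusion_cong: "w (t - \<delta>) = v (t - \<delta>) \<Longrightarrow> diffusion \<delta> w t = diffusion \<delta> v t"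
  by (simp add: diffusion_def)

lemma forcing_cong: "w (t - \<delta>) = v (t - \<delta>) \<Longrightarrow> w (t - \<rho>) = v (t - \<rho>) \<Longrightarrow> forcing \<delta> w t = forcing \<delta> v t"
  by (rule ext) (simp add: forcing_def)

text \<open>The growth envelope is part of the definition so that the iterates below, and their limits, satisfy
  bounds that depend on neither the iteration step nor the retardation.\<close>
definition admissible :: "(real \<Rightarrow> nat \<Rightarrow> real) \<Rightarrow> bool" where
  "admissible w \<longleftrightarrow> X1_cont {-\<rho>..} w \<and> (\<forall>t\<in>{-\<rho>..0}. w t = q t) \<and>
     (\<forall>t\<ge>-\<rho>. \<forall>N. (\<Sum>k<N. (w t k)\<^sup>2) \<le> G * exp ((1 + D) * max 0 t))"

lemma q_X1: "t \<in> {-\<rho>..0} \<Longrightarrow> q t \<in> X1"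
  using q_cont by (auto simp: X1_cont_iff)

lemma q_bound:
  assumes t: "t \<in> {-\<rho>..0}" shows "(\<Sum>k<N. (q t k)\<^sup>2) \<le> G"
proof -
  have q: "q t \<in> ell2" "q 0 \<in> ell2" using t \<rho> by (auto intro!: X1_ell2 q_X1)
  have "ell2_norm (q t) \<le> ell2_norm (q 0) + ell2_norm (\<lambda>k. q t k - q 0 k)"
    using ell2_add(2)[OF q(2) ell2_diff(1)[OF q]] by simp
  also have "ell2_norm (\<lambda>k. q t k - q 0 k) \<le> \<nu> (\<bar>t - 0\<bar> powr \<beta>)" using t \<rho> by (intro q_modulus) auto
  also have "\<dots> \<le> \<nu> (\<rho> powr \<beta>)"
    using t \<rho> \<beta> by (intro mono_onD[OF \<nu>_mono] powr_mono2) auto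
  finally have "(ell2_norm (q t))\<^sup>2 \<le> (ell2_norm (q 0) + \<nu> (\<rho> powr \<beta>))\<^sup>2"
    using ell2_norm_nonneg[OF q(1)] by (intro power_mono) auto
  then show ?thesis using sum_le_ell2_norm_sq[OF q(1), of "{..<N}"] by (auto simp: G_def)
qed

context
  fixes w \<delta> assumes w: "admissible w" and \<delta>: "0 \<le> \<delta>" "\<delta> \<le> \<rho>"
begin

lemma admissible_X1: "-\<rho> \<le> t \<Longrightarrow> w t \<in> X1"
  using w by (auto simp: admissible_def X1_cont_iff)

lemma shifted_X1_cont: "d \<le> \<rho> \<Longrightarrow> X1_cont {0..} (\<lambda>s. w (s - d))"
  using w ell2_cont_shift[of "-\<rho>" "\<lambda>t k. \<kappa> k * w t k" 0 d] by (auto simp: admissible_def)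

lemma shifted_within:
  assumes "t \<in> {0..T}" "d \<le> \<rho>"
  shows "eventually (\<lambda>s. w (s - d) \<in> X1) (at t within {0..T})" "w (t - d) \<in> X1"
    "((\<lambda>s. X1_norm (\<lambda>k. w (s - d) k - w (t - d) k)) \<longlongrightarrow> 0) (at t within {0..T})"
proof -
  have c: "X1_cont {0..T} (\<lambda>s. w (s - d))"
    by (rule ell2_cont_subset[OF shifted_X1_cont[OF assms(2)]]) auto
  show "w (t - d) \<in> X1" using c assms by (auto simp: X1_cont_iff)
  show "((\<lambda>s. X1_norm (\<lambda>k. w (s - d) k - w (t - d) k)) \<longlongrightarrow> 0) (at t within {0..T})"
    using c assms by (auto simp: X1_cont_iff)
  show "eventually (\<lambda>s. w (s - d) \<in> X1) (at t within {0..T})"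
    by (rule eventually_mono[OF eventually_in_within]) (use c in \<open>auto simp: X1_cont_iff\<close>)
qed

lemma diffusion_cont: "continuous_on {0..T} (diffusion \<delta> w)"
  unfolding continuous_on_def diffusion_def
  by (intro ballI al_tendsto shifted_within \<delta>(2))

lemma diffusion_range: "t \<in> {0..T} \<Longrightarrow> m \<le> diffusion \<delta> w t \<and> diffusion \<delta> w t \<le> M"
  unfolding diffusion_def using shifted_within(2) \<delta>(2) by (intro al_range) blast

lemma forcing_cont: "continuous_on {0..T} (\<lambda>t. forcing \<delta> w t k)"
proof -
  have "continuous_on {0..T} (\<lambda>t. F (w (t - \<delta>)) k)"
    unfolding continuous_on_def by (intro ballI F_coord_tendsto shifted_within \<delta>(2))
  moreover have "continuous_on {0..T} (\<lambda>s. w (s - \<rho>) k)"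
    by (rule continuous_on_subset[OF X1_cont_coord[OF shifted_X1_cont]]) auto
  ultimately show ?thesis unfolding forcing_def by (intro continuous_intros)
qed

lemma admissible_bound:
  assumes "0 \<le> t" "-\<rho> \<le> s" "s \<le> t"
  shows "(\<Sum>k<N. (w s k)\<^sup>2) \<le> G * exp ((1 + D) * t)"
proof -
  have "(\<Sum>k<N. (w s k)\<^sup>2) \<le> G * exp ((1 + D) * max 0 s)"
    using w assms by (auto simp: admissible_def)
  also have "\<dots> \<le> G * exp ((1 + D) * t)"
    using G_ge_1 D_nonneg assms by (intro mult_left_mono) auto
  finally show ?thesis .
qed

lemma forcing_bound:
  assumes "0 \<le> t"
  shows "(\<Sum>k<N. (forcing \<delta> w t k)\<^sup>2) \<le> D * G * exp ((1 + D) * t)"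
proof -
  let ?e = "G * exp ((1 + D) * t)"
  have "0 \<le> (1 + D) * t" using D_nonneg assms by auto
  then have "1 * 1 \<le> ?e" using G_ge_1 by (intro mult_mono) auto
  then have e1: "1 \<le> ?e" by simp
  have X: "w (t - \<delta>) \<in> X1" using assms \<delta> by (intro admissible_X1) auto
  have "(\<Sum>k<N. (forcing \<delta> w t k)\<^sup>2) \<le> (\<Sum>k<N. 2 * (F (w (t - \<delta>)) k)\<^sup>2 + 2 * \<gamma>\<^sup>2 * (w (t - \<rho>) k)\<^sup>2)"
    unfolding forcing_def
    by (rule sum_mono) (use power2_add_le in \<open>auto simp: power_mult_distrib[symmetric] mult.assoc\<close>)
  also have "\<dots> = 2 * (\<Sum>k<N. (F (w (t - \<delta>)) k)\<^sup>2) + 2 * \<gamma>\<^sup>2 * (\<Sum>k<N. (w (t - \<rho>) k)\<^sup>2)"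
    by (simp only: sum.distrib sum_distrib_left)
  finally have split: "(\<Sum>k<N. (forcing \<delta> w t k)\<^sup>2)
      \<le> 2 * (\<Sum>k<N. (F (w (t - \<delta>)) k)\<^sup>2) + 2 * \<gamma>\<^sup>2 * (\<Sum>k<N. (w (t - \<rho>) k)\<^sup>2)" .
  have "(\<Sum>k<N. (w (t - \<rho>) k)\<^sup>2) \<le> ?e" using assms \<rho> by (intro admissible_bound) auto
  then have delay: "2 * \<gamma>\<^sup>2 * (\<Sum>k<N. (w (t - \<rho>) k)\<^sup>2) \<le> 2 * \<gamma>\<^sup>2 * ?e" by (rule mult_left_mono) simp
  have "(ell2_norm (w (t - \<delta>)))\<^sup>2 \<le> ?e"
    by (rule ell2_bounded_sums(2), rule admissible_bound) (use assms \<delta> in auto)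
  then have "Cg * (1 + (ell2_norm (w (t - \<delta>)))\<^sup>2) \<le> Cg * (2 * ?e)"
    using e1 Cg by (intro mult_left_mono) auto
  then have "(\<Sum>k<N. (F (w (t - \<delta>)) k)\<^sup>2) \<le> Cg * (2 * ?e)"
    using F_growth[OF X, of N] by linarith
  with split delay have "(\<Sum>k<N. (forcing \<delta> w t k)\<^sup>2) \<le> 2 * (Cg * (2 * ?e)) + 2 * \<gamma>\<^sup>2 * ?e" by linarith
  also have "\<dots> = D * G * exp ((1 + D) * t)" unfolding D_def by (simp add: distrib_right)
  finally show ?thesis .
qed

lemma forcing_bound_upto:
  assumes "t \<in> {0..T}"
  shows "(\<Sum>k<N. (forcing \<delta> w t k)\<^sup>2) \<le> D * G * exp ((1 + D) * T)"
  using forcing_bound[of t N] assms D_nonneg G_ge_1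
  by (auto intro!: order_trans[OF forcing_bound] mult_left_mono)

lemma lin_sol_admissible:
  assumes sol: "\<And>T. lin_sol T (diffusion \<delta> w) (forcing \<delta> w) v" and past: "\<And>t. t \<in> {-\<rho>..0} \<Longrightarrow> v t = q t"
  shows "admissible v"
  unfolding admissible_def
proof (intro conjI ballI allI impI past)
  have v0: "v 0 \<in> X1" using past[of 0] q_X1[of 0] \<rho> by auto
  have "X1_cont {0..} v"
    by (rule ell2_cont_atLeast, rule lin_sol_X1_cont[OF sol forcing_bound_upto v0])
  moreover have "X1_cont {-\<rho>..0} v"
    using q_cont past by (rule_tac ell2_cont_cong) auto
  moreover have "{-\<rho>..0} \<union> {0..} = {-\<rho>..}" using \<rho> by auto
  ultimately show "X1_cont {-\<rho>..} v" using ell2_cont_Un[of "{-\<rho>..0}" _ "{0..}"] by simp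
  fix t N assume t: "-\<rho> \<le> t"
  show "(\<Sum>k<N. (v t k)\<^sup>2) \<le> G * exp ((1 + D) * max 0 t)"
  proof (cases "t \<le> 0")
    case True
    then show ?thesis using t past[of t] q_bound[of t N] by auto
  next
    case False
    have "(\<Sum>k<N. (v t k)\<^sup>2) \<le> G * exp ((1 + D) * t)"
      by (rule lin_sol_exponential_growth[OF sol[of t]])
        (use False G_ge_1 forcing_bound q_bound[of 0] past[of 0] \<rho> in auto)
    then show ?thesis using False by simp
  qed
qed

end

definition tonelli_step :: "real \<Rightarrow> (real \<Rightarrow> nat \<Rightarrow> real) \<Rightarrow> real \<Rightarrow> nat \<Rightarrow> real" where
  "tonelli_step \<delta> w t = (if t \<le> 0 then q t else duhamel (q 0) (diffusion \<delta> w) (forcing \<delta> w) t)"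

lemma tonelli_step_cong:
  assumes "\<And>s d. s \<le> t \<Longrightarrow> \<delta> \<le> d \<Longrightarrow> w (s - d) = v (s - d)" "\<delta> \<le> \<rho>"
  shows "tonelli_step \<delta> w t = tonelli_step \<delta> v t"
proof (cases "t \<le> 0")
  case False
  have "duhamel (q 0) (diffusion \<delta> w) (forcing \<delta> w) t = duhamel (q 0) (diffusion \<delta> v) (forcing \<delta> v) t"
    by (intro duhamel_cong diffusion_cong forcing_cong) (use assms in auto)
  then show ?thesis using False by (simp add: tonelli_step_def)
qed (simp add: tonelli_step_def)

lemma tonelli_step:
  assumes w: "admissible w" and \<delta>: "0 \<le> \<delta>" "\<delta> \<le> \<rho>"
  shows "lin_sol T (diffusion \<delta> w) (forcing \<delta> w) (tonelli_step \<delta> w)" and "admissible (tonelli_step \<delta> w)"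
proof -
  show sol: "lin_sol T (diffusion \<delta> w) (forcing \<delta> w) (tonelli_step \<delta> w)" for T
  proof -
    have d: "lin_sol T (diffusion \<delta> w) (forcing \<delta> w) (duhamel (q 0) (diffusion \<delta> w) (forcing \<delta> w))" (is "lin_sol T _ _ ?d")
      by (rule lin_sol_duhamel) (use assms diffusion_cont diffusion_range forcing_cont in auto)
    have eq: "tonelli_step \<delta> w t = ?d t" if "0 \<le> t" for t
      using that by (auto simp: tonelli_step_def duhamel_0)
    show ?thesis
      unfolding lin_sol_def
    proof (intro conjI allI impI)
      fix k t assume t: "0 < t" "t < T"
      have "((\<lambda>t. ?d t k) has_real_derivative - (\<kappa> k)\<^sup>2 * diffusion \<delta> w t * ?d t k + forcing \<delta> w t k) (at t)"
        using d t by (auto simp: lin_sol_def)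
      then have "((\<lambda>t. tonelli_step \<delta> w t k) has_real_derivative - (\<kappa> k)\<^sup>2 * diffusion \<delta> w t * ?d t k + forcing \<delta> w t k) (at t)"
        by (rule DERIV_cong_ev[THEN iffD1, rotated 3])
          (use t eq in \<open>auto intro!: eventually_mono[OF eventually_nhds_in_open[of "{0<..}" t]]\<close>)
      then show "((\<lambda>t. tonelli_step \<delta> w t k) has_real_derivative
          - (\<kappa> k)\<^sup>2 * diffusion \<delta> w t * tonelli_step \<delta> w t k + forcing \<delta> w t k) (at t)"
        using eq t by simp
    next
      show "continuous_on {0..T} (\<lambda>t. tonelli_step \<delta> w t k)" for k
        using d eq by (auto simp: lin_sol_def cong: continuous_on_cong_simp)
    qed (use d in \<open>auto simp: lin_sol_def\<close>)
  qed
  show "admissible (tonelli_step \<delta> w)"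
    by (rule lin_sol_admissible[OF w \<delta> sol]) (auto simp: tonelli_step_def)
qed

lemma admissible_constant_extension: "admissible (\<lambda>t. q (min t 0))"
  unfolding admissible_def
proof (intro conjI ballI allI impI)
  have "X1_cont {0..} (\<lambda>t. q (min t 0))"
  proof (rule ell2_cont_cong)
    show "ell2_cont {0..} (\<lambda>_ k. \<kappa> k * q 0 k)"
      using q_X1[of 0] \<rho> by (simp add: ell2_cont_def X1_def ell2_norm_def)
  qed auto
  moreover have "X1_cont {-\<rho>..0} (\<lambda>t. q (min t 0))"
    by (rule ell2_cont_cong[OF q_cont]) auto
  moreover have "{-\<rho>..0} \<union> {0..} = {-\<rho>..}" using \<rho> by auto
  ultimately show "X1_cont {-\<rho>..} (\<lambda>t. q (min t 0))" using ell2_cont_Un[of "{-\<rho>..0}" _ "{0..}"] by simp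
  fix t N assume t: "-\<rho> \<le> t"
  have "0 \<le> (1 + D) * max 0 t" using D_nonneg by auto
  then have "G * 1 \<le> G * exp ((1 + D) * max 0 t)" using G_ge_1 by (intro mult_left_mono) auto
  then show "(\<Sum>k<N. (q (min t 0) k)\<^sup>2) \<le> G * exp ((1 + D) * max 0 t)"
    using q_bound[of "min t 0" N] t \<rho> by auto
qed auto

text \<open>Tonelli's method: each application of \<open>tonelli_step\<close> determines the solution on one more interval of
  length \<open>\<delta>\<close>, after which further iterations no longer change it there.\<close>
lemma delayed_solution:
  assumes \<delta>: "0 < \<delta>" "\<delta> \<le> \<rho>"
  shows "\<exists>w. admissible w \<and> lin_sol T (diffusion \<delta> w) (forcing \<delta> w) w"
proof -
  define W where "W j = (tonelli_step \<delta> ^^ j) (\<lambda>t. q (min t 0))" for j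
  have W_Suc: "W (Suc j) = tonelli_step \<delta> (W j)" for j by (simp add: W_def)
  have adm: "admissible (W j)" for j
    by (induction j) (use \<delta> tonelli_step(2) in \<open>auto simp: W_Suc\<close>, simp add: W_def admissible_constant_extension)
  have agree: "W (Suc j) t = W j t" if "t \<le> real j * \<delta>" for j t
    using that
  proof (induction j arbitrary: t)
    case 0
    then show ?case by (simp add: W_def tonelli_step_def)
  next
    case (Suc j)
    \<comment> \<open>\<open>d\<close> stands for both delays, \<open>\<delta>\<close> and \<open>\<rho>\<close>\<close>
    have eq: "W (Suc j) (s - d) = W j (s - d)" if "s \<le> t" "\<delta> \<le> d" for s d
      using that Suc.prems by (intro Suc.IH) (auto simp: algebra_simps)
    have "tonelli_step \<delta> (W (Suc j)) t = tonelli_step \<delta> (W j) t"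
      by (rule tonelli_step_cong) (use eq \<delta> in auto)
    then show ?case by (simp add: W_Suc)
  qed
  obtain j where j: "T < real j * \<delta>" using \<delta>(1) reals_Archimedean3 by blast
  have "lin_sol T (diffusion \<delta> (W j)) (forcing \<delta> (W j)) (W (Suc j))"
    unfolding W_Suc using \<delta> by (intro tonelli_step adm) auto
  then have "lin_sol T (diffusion \<delta> (W (Suc j))) (forcing \<delta> (W (Suc j))) (W (Suc j))"
  proof (rule lin_sol_cong)
    fix t assume "t \<in> {0..T}"
    then have "W (Suc j) (t - d) = W j (t - d)" if "\<delta> \<le> d" for d
      using that j \<delta> by (intro agree) auto
    then show "diffusion \<delta> (W j) t = diffusion \<delta> (W (Suc j)) t" "forcing \<delta> (W j) t = forcing \<delta> (W (Suc j)) t"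
      using \<delta> by (auto intro: diffusion_cong forcing_cong)
  qed
  then show ?thesis using adm by blast
qed

end

section \<open>Removing the retardation\<close>

context diagonal_flow
begin

lemma lin_sol_subset: "lin_sol T A h c \<Longrightarrow> S \<le> T \<Longrightarrow> lin_sol S A h c"
  unfolding lin_sol_def using continuous_on_subset[of "{0..T}" _ "{0..S}"] by auto

end

context nonlocal_delay
begin

context
  fixes v :: "nat \<Rightarrow> real \<Rightarrow> nat \<Rightarrow> real" and \<epsilon> :: "nat \<Rightarrow> real"
  assumes adm: "\<And>n. admissible (v n)"
    and \<epsilon>: "\<And>n. 0 < \<epsilon> n" "\<And>n. \<epsilon> n \<le> \<rho>" "\<epsilon> \<longlonglongrightarrow> 0"
    and sol: "\<And>n T. T \<le> real n \<Longrightarrow> lin_sol T (diffusion (\<epsilon> n) (v n)) (forcing (\<epsilon> n) (v n)) (v n)"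
begin

text \<open>Bounds for the modes and for their speed, common to all approximate solutions.\<close>
definition radius :: "real \<Rightarrow> real" where "radius T = sqrt (G * exp ((1 + D) * T))"

definition speed :: "real \<Rightarrow> nat \<Rightarrow> real" where
  "speed T k = (\<kappa> k)\<^sup>2 * M * radius T + sqrt (D * G * exp ((1 + D) * T))"

lemma radius_pos: "0 < radius T"
  using G_ge_1 by (auto simp: radius_def)

lemma speed_nonneg: "0 \<le> speed T k"
  using radius_pos[of T] M_pos D_nonneg G_ge_1 by (auto simp: speed_def)

lemma approx_past: "t \<in> {-\<rho>..0} \<Longrightarrow> v n t = q t"
  using adm[of n] by (auto simp: admissible_def)

lemma approx_coord_bound:
  assumes "0 \<le> T" "-\<rho> \<le> t" "t \<le> T" shows "\<bar>v n t k\<bar> \<le> radius T"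
proof -
  have "(v n t k)\<^sup>2 \<le> (\<Sum>k<Suc k. (v n t k)\<^sup>2)" by (rule member_le_sum) auto
  also have "\<dots> \<le> G * exp ((1 + D) * T)"
    by (rule admissible_bound[OF adm, of 0]) (use assms \<rho> in auto)
  finally show ?thesis unfolding radius_def by (rule real_le_rsqrt[of "\<bar>v n t k\<bar>", simplified])
qed

lemma approx_forcing_bound:
  assumes "t \<in> {0..T}"
  shows "(\<Sum>k<N. (forcing (\<epsilon> n) (v n) t k)\<^sup>2) \<le> D * G * exp ((1 + D) * T)"
  by (rule forcing_bound_upto[OF adm _ \<epsilon>(2) assms]) (use \<epsilon>(1)[of n] in simp)

lemma approx_forcing_coord_bound:
  assumes "t \<in> {0..T}"
  shows "\<bar>forcing (\<epsilon> n) (v n) t k\<bar> \<le> sqrt (D * G * exp ((1 + D) * T))"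
proof -
  have "(forcing (\<epsilon> n) (v n) t k)\<^sup>2 \<le> (\<Sum>k<Suc k. (forcing (\<epsilon> n) (v n) t k)\<^sup>2)" by (rule member_le_sum) auto
  also have "\<dots> \<le> D * G * exp ((1 + D) * T)" by (rule approx_forcing_bound[OF assms])
  finally show ?thesis by (rule real_le_rsqrt[of "\<bar>x\<bar>" for x, simplified])
qed

lemma approx_lipschitz:
  assumes "T \<le> real n" "s \<in> {0..T}" "t \<in> {0..T}"
  shows "\<bar>v n t k - v n s k\<bar> \<le> speed T k * \<bar>t - s\<bar>"
  unfolding speed_def
proof (rule coord_lipschitz[OF sol[OF assms(1)] _ _ _ assms(2,3)])
  show "(\<Sum>k<N. (forcing (\<epsilon> n) (v n) t k)\<^sup>2) \<le> D * G * exp ((1 + D) * T)" if "t \<in> {0..T}" for t N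
    by (rule approx_forcing_bound[OF that])
  show "\<bar>v n t k\<bar> \<le> radius T" if "t \<in> {0..T}" for t
    using that \<rho> by (intro approx_coord_bound) auto
qed (rule approx_forcing_coord_bound)

lemma approx_uniform_tail:
  assumes "0 < e"
  shows "\<exists>K. \<forall>n N. \<forall>t\<in>{0..T}. T \<le> real n \<longrightarrow> (\<Sum>k=K..<N. (\<kappa> k * v n t k)\<^sup>2) \<le> e"
proof -
  have p: "q 0 \<in> X1" using \<rho> by (intro q_X1) auto
  from uniform_weighted_tail[OF this assms, of "D * G * exp ((1 + D) * T)"]
  obtain K where K: "\<And>A h c. lin_sol T A h c \<Longrightarrow>
     \<forall>t\<in>{0..T}. \<forall>N. (\<Sum>k<N. (h t k)\<^sup>2) \<le> D * G * exp ((1 + D) * T) \<Longrightarrow> c 0 = q 0 \<Longrightarrow>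
     \<forall>t\<in>{0..T}. \<forall>N. (\<Sum>k=K..<N. (\<kappa> k * c t k)\<^sup>2) \<le> e" by blast
  have "\<forall>t\<in>{0..T}. \<forall>N. (\<Sum>k=K..<N. (\<kappa> k * v n t k)\<^sup>2) \<le> e" if "T \<le> real n" for n
    by (rule K[OF sol[OF that]]) (use approx_forcing_bound approx_past[of 0] \<rho> in auto)
  then show ?thesis by blast
qed

context
  fixes c :: "real \<Rightarrow> nat \<Rightarrow> real"
  assumes conv: "\<And>t k. -\<rho> \<le> t \<Longrightarrow> (\<lambda>n. v n t k) \<longlonglongrightarrow> c t k"
begin

lemma large_index: "eventually (\<lambda>n. T \<le> real n) sequentially"
  by real_asymp

lemma limit_past: "t \<in> {-\<rho>..0} \<Longrightarrow> c t = q t"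
proof
  fix k assume t: "t \<in> {-\<rho>..0}"
  then have "(\<lambda>n. v n t k) \<longlonglongrightarrow> q t k" by (simp add: approx_past)
  then show "c t k = q t k" using conv[of t k] t by (auto intro: LIMSEQ_unique)
qed

lemma limit_lipschitz:
  assumes "s \<in> {0..T}" "t \<in> {0..T}" shows "\<bar>c t k - c s k\<bar> \<le> speed T k * \<bar>t - s\<bar>"
proof (rule tendsto_upperbound)
  show "(\<lambda>n. \<bar>v n t k - v n s k\<bar>) \<longlonglongrightarrow> \<bar>c t k - c s k\<bar>"
    using assms \<rho> by (intro tendsto_intros conv) auto
  show "eventually (\<lambda>n. \<bar>v n t k - v n s k\<bar> \<le> speed T k * \<bar>t - s\<bar>) sequentially"
    using large_index[of T] by eventually_elim (rule approx_lipschitz[OF _ assms])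
qed simp

lemma limit_coord_cont: "continuous_on {0..T} (\<lambda>t. c t k)"
proof (rule continuous_onI)
  fix t e assume t: "t \<in> {0..T}" and "0 < (e::real)"
  show "\<exists>d>0. \<forall>s\<in>{0..T}. dist s t < d \<longrightarrow> dist (c s k) (c t k) \<le> e"
  proof (intro exI[of _ "e / (speed T k + 1)"] conjI ballI impI)
    show "0 < e / (speed T k + 1)" using speed_nonneg[of T k] \<open>0 < e\<close> by simp
    fix s assume s: "s \<in> {0..T}" and d: "dist s t < e / (speed T k + 1)"
    have "\<bar>c s k - c t k\<bar> \<le> (speed T k + 1) * \<bar>s - t\<bar>"
      using limit_lipschitz[OF t s, of k] by (simp add: distrib_right)
    also have "\<dots> \<le> (speed T k + 1) * (e / (speed T k + 1))"
      using d speed_nonneg[of T k] by (intro mult_left_mono) (auto simp: dist_real_def)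
    also have "\<dots> = e" using speed_nonneg[of T k] by simp
    finally show "dist (c s k) (c t k) \<le> e" by (simp add: dist_real_def)
  qed
qed

lemma limit_uniform_tail:
  assumes "0 < e"
  shows "\<exists>K. \<forall>N. \<forall>t\<in>{0..T}. (\<Sum>k=K..<N. (\<kappa> k * c t k)\<^sup>2) \<le> e"
proof -
  from approx_uniform_tail[OF assms, of T] obtain K where
    K: "\<And>n N t. t \<in> {0..T} \<Longrightarrow> T \<le> real n \<Longrightarrow> (\<Sum>k=K..<N. (\<kappa> k * v n t k)\<^sup>2) \<le> e" by blast
  have "(\<Sum>k=K..<N. (\<kappa> k * c t k)\<^sup>2) \<le> e" if t: "t \<in> {0..T}" for t N
  proof (rule tendsto_upperbound)
    show "(\<lambda>n. \<Sum>k=K..<N. (\<kappa> k * v n t k)\<^sup>2) \<longlonglongrightarrow> (\<Sum>k=K..<N. (\<kappa> k * c t k)\<^sup>2)"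
      using t \<rho> by (intro tendsto_intros conv) auto
    show "eventually (\<lambda>n. (\<Sum>k=K..<N. (\<kappa> k * v n t k)\<^sup>2) \<le> e) sequentially"
      using large_index[of T] by eventually_elim (rule K[OF t])
  qed simp
  then show ?thesis by blast
qed

lemma limit_X1_cont: "X1_cont {0..T} c"
proof (rule ell2_contI)
  show "continuous_on {0..T} (\<lambda>t. \<kappa> k * c t k)" for k
    by (intro continuous_intros limit_coord_cont)
  show "\<exists>K. eventually (\<lambda>s. \<forall>N. (\<Sum>k=K..<N. (\<kappa> k * c s k)\<^sup>2) \<le> e) (at t within {0..T})" if "0 < e" for e t
  proof -
    obtain K where "\<And>N t. t \<in> {0..T} \<Longrightarrow> (\<Sum>k=K..<N. (\<kappa> k * c t k)\<^sup>2) \<le> e"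
      using limit_uniform_tail[OF \<open>0 < e\<close>, of T] by blast
    then show ?thesis
      by (intro exI[of _ K] eventually_mono[OF eventually_in_within[of "{0..T}" t]]) blast
  qed
  fix t assume t: "t \<in> {0..T}"
  obtain K where K: "\<And>N t. t \<in> {0..T} \<Longrightarrow> (\<Sum>k=K..<N. (\<kappa> k * c t k)\<^sup>2) \<le> 1"
    using limit_uniform_tail[OF zero_less_one, of T] by blast
  show "(\<lambda>k. \<kappa> k * c t k) \<in> ell2"
  proof (rule ell2_bounded_sums)
    show "(\<Sum>k<N. (\<kappa> k * c t k)\<^sup>2) \<le> (\<Sum>k<K. (\<kappa> k * c t k)\<^sup>2) + 1" for N
      using sum_split_at[of "\<lambda>k. (\<kappa> k * c t k)\<^sup>2" N K] K[OF t, of N] by simp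
  qed
qed

lemma limit_admissible: "admissible c"
  unfolding admissible_def
proof (intro conjI ballI allI impI limit_past)
  have "X1_cont {0..} c" by (rule ell2_cont_atLeast[OF limit_X1_cont])
  moreover have "X1_cont {-\<rho>..0} c"
    by (rule ell2_cont_cong[OF q_cont]) (simp add: limit_past)
  moreover have "{-\<rho>..0} \<union> {0..} = {-\<rho>..}" using \<rho> by auto
  ultimately show "X1_cont {-\<rho>..} c" using ell2_cont_Un[of "{-\<rho>..0}" _ "{0..}"] by simp
  fix t N assume t: "-\<rho> \<le> t"
  show "(\<Sum>k<N. (c t k)\<^sup>2) \<le> G * exp ((1 + D) * max 0 t)"
  proof (rule tendsto_upperbound)
    show "(\<lambda>n. \<Sum>k<N. (v n t k)\<^sup>2) \<longlonglongrightarrow> (\<Sum>k<N. (c t k)\<^sup>2)"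
      using t by (intro tendsto_intros conv)
    show "eventually (\<lambda>n. (\<Sum>k<N. (v n t k)\<^sup>2) \<le> G * exp ((1 + D) * max 0 t)) sequentially"
      using adm t by (auto simp: admissible_def)
  qed simp
qed

text \<open>The nonlinearities see \<open>v n\<close> at the retarded time. Modewise the retardation is harmless by the Lipschitz bound;
  the uniform tails then give convergence in the energy norm, which is what the nonlinearities require. At the initial
  time the retarded argument falls into the history.\<close>
lemma approx_delayed_convergence:
  assumes s: "0 \<le> s"
  shows "(\<lambda>n. X1_norm (\<lambda>k. v n (s - \<epsilon> n) k - c s k)) \<longlonglongrightarrow> 0"
proof (cases "s = 0")
  case True
  have "filterlim (\<lambda>n. - \<epsilon> n) (at 0 within {-\<rho>..0}) sequentially"
    unfolding filterlim_at
  proof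
    show "eventually (\<lambda>n. - \<epsilon> n \<in> {-\<rho>..0} \<and> - \<epsilon> n \<noteq> 0) sequentially"
    proof (rule always_eventually, rule allI)
      show "- \<epsilon> n \<in> {-\<rho>..0} \<and> - \<epsilon> n \<noteq> 0" for n using \<epsilon>(1)[of n] \<epsilon>(2)[of n] by simp
    qed
    show "(\<lambda>n. - \<epsilon> n) \<longlonglongrightarrow> 0" using tendsto_minus[OF \<epsilon>(3)] by simp
  qed
  moreover have "((\<lambda>t. X1_norm (\<lambda>k. q t k - q 0 k)) \<longlongrightarrow> 0) (at 0 within {-\<rho>..0})"
    using q_cont \<rho> by (auto simp: X1_cont_iff)
  ultimately have "(\<lambda>n. X1_norm (\<lambda>k. q (- \<epsilon> n) k - q 0 k)) \<longlonglongrightarrow> 0" by (rule filterlim_compose[rotated])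
  moreover have "v n (s - \<epsilon> n) = q (- \<epsilon> n)" for n
    using True \<epsilon>(1,2)[of n] by (simp add: approx_past)
  moreover have "c s = q 0" using True \<rho> by (simp add: limit_past)
  ultimately show ?thesis by simp
next
  case False
  then have "0 < s" using s by simp
  have in_range: "eventually (\<lambda>n. s - \<epsilon> n \<in> {0..s} \<and> s \<le> real n) sequentially"
    using order_tendstoD(2)[OF \<epsilon>(3) \<open>0 < s\<close>] large_index[of s]
    by eventually_elim (use \<epsilon>(1) in \<open>auto intro: less_imp_le\<close>)
  have "((\<lambda>n. ell2_norm (\<lambda>k. \<kappa> k * v n (s - \<epsilon> n) k - \<kappa> k * c s k)) \<longlongrightarrow> 0) sequentially"
  proof (rule ell2_convergence(3))
    fix k
    have "(\<lambda>n. v n (s - \<epsilon> n) k - v n s k) \<longlonglongrightarrow> 0"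
    proof (rule Lim_null_comparison)
      show "eventually (\<lambda>n. norm (v n (s - \<epsilon> n) k - v n s k) \<le> speed s k * \<epsilon> n) sequentially"
        using in_range
      proof eventually_elim
        case (elim n)
        then show ?case
          using approx_lipschitz[of s n s "s - \<epsilon> n" k] s less_imp_le[OF \<epsilon>(1)[of n]] by simp
      qed
      show "(\<lambda>n. speed s k * \<epsilon> n) \<longlonglongrightarrow> 0" using tendsto_mult_left[OF \<epsilon>(3), of "speed s k"] by simp
    qed
    moreover have "(\<lambda>n. v n s k) \<longlonglongrightarrow> c s k" using s \<rho> by (intro conv) auto
    ultimately have "(\<lambda>n. v n (s - \<epsilon> n) k) \<longlonglongrightarrow> c s k" by (rule Lim_transform[rotated])
    then show "(\<lambda>n. \<kappa> k * v n (s - \<epsilon> n) k) \<longlonglongrightarrow> \<kappa> k * c s k" by (rule tendsto_mult_left)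
  next
    fix e :: real assume "0 < e"
    then obtain K where K: "\<And>n N t. t \<in> {0..s} \<Longrightarrow> s \<le> real n \<Longrightarrow> (\<Sum>k=K..<N. (\<kappa> k * v n t k)\<^sup>2) \<le> e"
      using approx_uniform_tail[of e s] by blast
    have "eventually (\<lambda>n. \<forall>N. (\<Sum>k=K..<N. (\<kappa> k * v n (s - \<epsilon> n) k)\<^sup>2) \<le> e) sequentially"
      using in_range by eventually_elim (use K in blast)
    then show "\<exists>K. eventually (\<lambda>n. \<forall>N. (\<Sum>k=K..<N. (\<kappa> k * v n (s - \<epsilon> n) k)\<^sup>2) \<le> e) sequentially" by blast
  qed simp
  then show ?thesis by (simp add: X1_norm_def right_diff_distrib)
qed

lemma limit_integral_equation:
  assumes t: "t \<in> {0..T}"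
  shows "c t k = q 0 k + integral {0..t} (\<lambda>s. - (\<kappa> k)\<^sup>2 * diffusion 0 c s * c s k + forcing 0 c s k)"
proof -
  obtain n0 :: nat where n0: "t \<le> real n0" using real_arch_simple by blast
  let ?f = "\<lambda>n s. - (\<kappa> k)\<^sup>2 * diffusion (\<epsilon> n) (v n) s * v n s k + forcing (\<epsilon> n) (v n) s k"
  let ?g = "\<lambda>s. - (\<kappa> k)\<^sup>2 * diffusion 0 c s * c s k + forcing 0 c s k"
  have e0: "0 \<le> \<epsilon> n" for n using \<epsilon>(1)[of n] by simp
  have "(\<lambda>n. integral {0..t} (?f (n + n0))) \<longlonglongrightarrow> integral {0..t} ?g"
  proof (rule dominated_convergence(2))
    show "?f (n + n0) integrable_on {0..t}" for n
    proof (rule integrable_continuous_real)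
      have "lin_sol t (diffusion (\<epsilon> (n + n0)) (v (n + n0))) (forcing (\<epsilon> (n + n0)) (v (n + n0))) (v (n + n0))"
        by (rule sol) (use n0 in simp)
      then show "continuous_on {0..t} (?f (n + n0))"
        unfolding lin_sol_def by (intro continuous_intros) auto
    qed
    show "(\<lambda>_. speed t k) integrable_on {0..t}" by (rule integrable_const_ivl)
    show "norm (?f (n + n0) s) \<le> speed t k" if s: "s \<in> {0..t}" for n s
    proof -
      have d: "m \<le> diffusion (\<epsilon> (n + n0)) (v (n + n0)) s \<and> diffusion (\<epsilon> (n + n0)) (v (n + n0)) s \<le> M"
        by (rule diffusion_range[OF adm e0 \<epsilon>(2) s])
      have "\<bar>- (\<kappa> k)\<^sup>2 * diffusion (\<epsilon> (n + n0)) (v (n + n0)) s * v (n + n0) s k\<bar> \<le> (\<kappa> k)\<^sup>2 * M * radius t"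
      proof -
        have "\<bar>v (n + n0) s k\<bar> \<le> radius t" using s \<rho> by (intro approx_coord_bound) auto
        then show ?thesis unfolding abs_mult using d m_pos by (intro mult_mono) auto
      qed
      with approx_forcing_coord_bound[OF s, of "n + n0" k] show ?thesis unfolding speed_def by simp
    qed
    show "(\<lambda>n. ?f (n + n0) s) \<longlonglongrightarrow> ?g s" if s: "s \<in> {0..t}" for s
    proof (rule LIMSEQ_ignore_initial_segment[of "\<lambda>n. ?f n s"])
      have mem: "eventually (\<lambda>n. v n (s - \<epsilon> n) \<in> X1) sequentially"
      proof (rule always_eventually, rule allI)
        show "v n (s - \<epsilon> n) \<in> X1" for n
          by (rule admissible_X1[OF adm, of 0]) (use s \<epsilon>(2)[of n] \<rho> in auto)
      qed
      have cs: "c s \<in> X1" by (rule admissible_X1[OF limit_admissible, of 0]) (use s \<rho> in auto)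
      have lim: "(\<lambda>n. X1_norm (\<lambda>k. v n (s - \<epsilon> n) k - c s k)) \<longlonglongrightarrow> 0"
        by (rule approx_delayed_convergence) (use s in auto)
      show "(\<lambda>n. ?f n s) \<longlonglongrightarrow> ?g s"
        unfolding diffusion_def forcing_def diff_0_right
      proof (rule tendsto_add[OF tendsto_mult[OF tendsto_mult[OF tendsto_const al_tendsto[OF mem cs lim]]]
            tendsto_add[OF F_coord_tendsto[OF mem cs lim] tendsto_mult[OF tendsto_const]]])
        show "(\<lambda>n. v n s k) \<longlonglongrightarrow> c s k" by (rule conv) (use s \<rho> in auto)
        show "(\<lambda>n. v n (s - \<rho>) k) \<longlonglongrightarrow> c (s - \<rho>) k" by (rule conv) (use s in auto)
      qed
    qed
  qed
  then have lim1: "(\<lambda>n. q 0 k + integral {0..t} (?f (n + n0))) \<longlonglongrightarrow> q 0 k + integral {0..t} ?g"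
    by (rule tendsto_add[OF tendsto_const])
  have eq: "v (n + n0) t k = q 0 k + integral {0..t} (?f (n + n0))" for n
  proof -
    have past: "v (n + n0) 0 = q 0" using \<rho> by (intro approx_past) auto
    have "v (n + n0) t k = v (n + n0) 0 k + integral {0..t} (?f (n + n0))"
      by (rule lin_sol_integral[OF sol[of t "n + n0"]]) (use n0 t in auto)
    then show ?thesis unfolding past .
  qed
  have lim2: "(\<lambda>n. v (n + n0) t k) \<longlonglongrightarrow> c t k"
    by (rule LIMSEQ_ignore_initial_segment[OF conv]) (use t \<rho> in auto)
  have "eventually (\<lambda>n. q 0 k + integral {0..t} (?f (n + n0)) = v (n + n0) t k) sequentially"
    by (rule always_eventually) (rule allI, rule eq[symmetric])
  with lim1 have "(\<lambda>n. v (n + n0) t k) \<longlonglongrightarrow> q 0 k + integral {0..t} ?g"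
    by (rule Lim_transform_eventually)
  with lim2 show ?thesis by (rule LIMSEQ_unique)
qed

lemma limit_solution: "lin_sol T (diffusion 0 c) (forcing 0 c) c"
proof (rule lin_solI_integral[where p = "q 0"])
  have 0: "0 \<le> (0::real)" "0 \<le> \<rho>" using \<rho> by auto
  show "continuous_on {0..T} (diffusion 0 c)" by (rule diffusion_cont[OF limit_admissible 0])
  show "m \<le> diffusion 0 c t \<and> diffusion 0 c t \<le> M" if "t \<in> {0..T}" for t
    by (rule diffusion_range[OF limit_admissible 0 that])
  show "continuous_on {0..T} (\<lambda>t. forcing 0 c t k)" for k by (rule forcing_cont[OF limit_admissible 0])
  show "continuous_on {0..T} (\<lambda>t. c t k)" for k by (rule limit_coord_cont)
  show "c t k = q 0 k + integral {0..t} (\<lambda>s. - (\<kappa> k)\<^sup>2 * diffusion 0 c s * c s k + forcing 0 c s k)"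
    if "t \<in> {0..T}" for t k by (rule limit_integral_equation[OF that])
qed

end

text \<open>A diagonal argument gives convergence of all modes at rational times, and the Lipschitz bounds,
  uniform in \<open>n\<close>, extend it to all times.\<close>
lemma approx_subsequence:
  obtains r where "strict_mono (r :: nat \<Rightarrow> nat)" "\<And>t k. -\<rho> \<le> t \<Longrightarrow> convergent (\<lambda>n. v (r n) t k)"
proof -
  \<comment> \<open>the selection theorem asks for one bound valid on the whole index set, hence the division\<close>
  let ?f = "\<lambda>n (k, t). if 0 \<le> t then v n t k / radius t else 0"
  have "countable ((UNIV :: nat set) \<times> \<rat>)"
    by (intro countable_SIGMA countableI_type countable_rat)
  then obtain r where r: "strict_mono (r :: nat \<Rightarrow> nat)"
    and lim: "\<And>x. x \<in> UNIV \<times> \<rat> \<Longrightarrow> \<exists>l. (\<lambda>n. ?f (r n) x) \<longlonglongrightarrow> l"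
  proof (rule function_convergent_subsequence[where f = ?f and M = 1])
    show "norm (?f n x) \<le> 1" for n and x :: "nat \<times> real"
      using approx_coord_bound[of "snd x" "snd x" n "fst x"] radius_pos[of "snd x"] \<rho>
      by (auto simp: case_prod_beta)
  qed blast
  have rat: "Cauchy (\<lambda>n. v (r n) p k)" if p: "p \<in> \<rat>" "0 \<le> p" for p k
  proof -
    from lim[of "(k, p)"] p obtain l where "(\<lambda>n. v (r n) p k / radius p) \<longlonglongrightarrow> l" by auto
    from tendsto_mult_right[OF this, of "radius p"] radius_pos[of p]
    have "(\<lambda>n. v (r n) p k) \<longlonglongrightarrow> l * radius p" by simp
    then show ?thesis by (intro convergent_Cauchy convergentI)
  qed
  have "Cauchy (\<lambda>n. v (r n) t k)" if t: "0 \<le> t" for t k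
  proof (rule metric_CauchyI)
    fix e :: real assume e: "0 < e"
    let ?S = "speed (t + 1) k"
    define d where "d = min 1 (e / (4 * (?S + 1)))"
    have d: "0 < d" "?S * d \<le> e / 4"
    proof -
      show "0 < d" using e speed_nonneg[of "t + 1" k] by (simp add: d_def)
      have "?S * d \<le> (?S + 1) * (e / (4 * (?S + 1)))"
        using e speed_nonneg[of "t + 1" k] by (intro mult_mono) (auto simp: d_def)
      also have "\<dots> = e / 4" using speed_nonneg[of "t + 1" k] by (simp add: field_simps)
      finally show "?S * d \<le> e / 4" .
    qed
    obtain p where p: "p \<in> \<rat>" "t < p" "p < t + d" using Rats_dense_in_real[of t "t + d"] d by auto
    have p1: "p \<le> t + 1" "0 \<le> p" using p t by (auto simp: d_def)
    obtain N1 where N1: "\<And>a b. a \<ge> N1 \<Longrightarrow> b \<ge> N1 \<Longrightarrow> dist (v (r a) p k) (v (r b) p k) < e / 4"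
      using metric_CauchyD[OF rat[OF p(1) p1(2)], of "e / 4"] e by (meson divide_pos_pos zero_less_numeral)
    obtain N2 :: nat where N2: "t + 1 \<le> real N2" using real_arch_simple by blast
    have near: "\<bar>v (r a) p k - v (r a) t k\<bar> \<le> e / 4" if "a \<ge> N2" for a
    proof -
      have "t + 1 \<le> real (r a)" using N2 that seq_suble[OF r, of a] by linarith
      from approx_lipschitz[OF this, of t p k] p p1 t
      have "\<bar>v (r a) p k - v (r a) t k\<bar> \<le> ?S * (p - t)" by auto
      also have "\<dots> \<le> ?S * d" using p speed_nonneg by (intro mult_left_mono) auto
      finally show ?thesis using d by linarith
    qed
    show "\<exists>N. \<forall>a\<ge>N. \<forall>b\<ge>N. dist (v (r a) t k) (v (r b) t k) < e"
    proof (intro exI[of _ "max N1 N2"] allI impI)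
      fix a b assume "max N1 N2 \<le> a" "max N1 N2 \<le> b"
      then have ab: "a \<ge> N1" "b \<ge> N1" "a \<ge> N2" "b \<ge> N2" by auto
      have "\<bar>v (r a) t k - v (r b) t k\<bar>
          \<le> \<bar>v (r a) p k - v (r a) t k\<bar> + \<bar>v (r a) p k - v (r b) p k\<bar> + \<bar>v (r b) p k - v (r b) t k\<bar>" by linarith
      then show "dist (v (r a) t k) (v (r b) t k) < e"
        using N1[OF ab(1,2)] near[OF ab(3)] near[OF ab(4)] e unfolding dist_real_def by linarith
    qed
  qed
  moreover have "convergent (\<lambda>n. v (r n) t k)" if "t \<in> {-\<rho>..0}" for t k
    using that by (simp add: approx_past convergent_const)
  ultimately have "convergent (\<lambda>n. v (r n) t k)" if "-\<rho> \<le> t" for t k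
    using that by (cases "0 \<le> t") (auto simp: Cauchy_convergent_iff)
  with r show thesis by (rule that)
qed

end

theorem nonlocal_solution_exists:
  "\<exists>c. admissible c \<and> (\<forall>T. lin_sol T (diffusion 0 c) (forcing 0 c) c)"
proof -
  define \<delta> where "\<delta> n = \<rho> / real (Suc n)" for n
  have \<delta>: "0 < \<delta> n" "\<delta> n \<le> \<rho>" for n using \<rho> by (auto simp: \<delta>_def field_simps)
  have \<delta>_lim: "\<delta> \<longlonglongrightarrow> 0" unfolding \<delta>_def by real_asymp
  have "\<forall>n. \<exists>w. admissible w \<and> lin_sol (real n) (diffusion (\<delta> n) w) (forcing (\<delta> n) w) w"
    using delayed_solution \<delta> by blast
  then obtain w where w: "\<And>n. admissible (w n)"
      "\<And>n. lin_sol (real n) (diffusion (\<delta> n) (w n)) (forcing (\<delta> n) (w n)) (w n)" by metis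
  have sol0: "lin_sol T (diffusion (\<delta> n) (w n)) (forcing (\<delta> n) (w n)) (w n)" if "T \<le> real n" for n T
    by (rule lin_sol_subset[OF w(2) that])
  obtain r where r: "strict_mono (r :: nat \<Rightarrow> nat)" "\<And>t k. -\<rho> \<le> t \<Longrightarrow> convergent (\<lambda>n. w (r n) t k)"
  proof (rule approx_subsequence[OF w(1) \<delta> \<delta>_lim sol0])
    fix r :: "nat \<Rightarrow> nat"
    assume "strict_mono r" "\<And>t k. -\<rho> \<le> t \<Longrightarrow> convergent (\<lambda>n. w (r n) t k)"
    then show thesis by (rule that)
  qed
  define c where "c t k = lim (\<lambda>n. w (r n) t k)" for t k
  have conv: "(\<lambda>n. w (r n) t k) \<longlonglongrightarrow> c t k" if "-\<rho> \<le> t" for t k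
    using r(2)[OF that] by (simp add: c_def convergent_LIMSEQ_iff)
  have \<delta>r: "(\<lambda>n. \<delta> (r n)) \<longlonglongrightarrow> 0" using LIMSEQ_subseq_LIMSEQ[OF \<delta>_lim r(1)] by (simp add: o_def)
  have sol: "lin_sol T (diffusion (\<delta> (r n)) (w (r n))) (forcing (\<delta> (r n)) (w (r n))) (w (r n))" if "T \<le> real n" for n T
    by (rule lin_sol_subset[OF w(2)]) (use that seq_suble[OF r(1), of n] in linarith)
  have "admissible c" by (rule limit_admissible[OF w(1) \<delta> \<delta>r sol conv])
  moreover have "lin_sol T (diffusion 0 c) (forcing 0 c) c" for T
    by (rule limit_solution[OF w(1) \<delta> \<delta>r sol conv])
  ultimately show ?thesis by blast
qed

end

section \<open>Second-order regularity from Dini continuity\<close>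

lemma ell2_cont_nearD:
  assumes c: "ell2_cont T c" and t: "t \<in> T" and e: "0 < e"
  shows "\<exists>K. \<exists>d>0. \<forall>s\<in>T. \<bar>s - t\<bar> < d \<longrightarrow> (\<forall>N. (\<Sum>k=K..<N. (c s k)\<^sup>2) \<le> e)"
proof -
  obtain K1 where K1: "eventually (\<lambda>s. \<forall>N. (\<Sum>k=K1..<N. (c s k)\<^sup>2) \<le> e) (at t within T)"
    using ell2_cont_tails[OF assms] by blast
  obtain K2 where K2: "\<forall>N. (\<Sum>k=K2..<N. (c t k)\<^sup>2) \<le> e"
    using ell2_tail[OF _ e, of "c t"] c t by (auto simp: ell2_cont_def)
  obtain d where d: "d > 0" "\<And>s. s \<in> T \<Longrightarrow> s \<noteq> t \<Longrightarrow> dist s t < d \<Longrightarrow> \<forall>N. (\<Sum>k=K1..<N. (c s k)\<^sup>2) \<le> e"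
    using K1 unfolding eventually_at by blast
  have mono: "(\<Sum>k=max K1 K2..<N. x k) \<le> (\<Sum>k=K..<N. x k)"
    if "K \<le> max K1 K2" "\<And>k. 0 \<le> x k" for x :: "nat \<Rightarrow> real" and K N
    by (rule sum_mono2) (use that in auto)
  have "(\<Sum>k=max K1 K2..<N. (c s k)\<^sup>2) \<le> e" if s: "s \<in> T" "\<bar>s - t\<bar> < d" for s N
  proof (cases "s = t")
    case True
    then show ?thesis using K2 mono[of K2 "\<lambda>k. (c s k)\<^sup>2" N] order_trans by fastforce
  next
    case False
    then show ?thesis using d(2)[OF s(1) False] s(2) mono[of K1 "\<lambda>k. (c s k)\<^sup>2" N] order_trans
      by (fastforce simp: dist_real_def)
  qed
  then show ?thesis using d(1) by blast
qed

text \<open>Unlike the criterion through punctured neighbourhoods, this form includes the point itself, as the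
  regularity estimate naturally does, and so yields membership as well.\<close>
lemma ell2_cont_nearI:
  assumes coord: "\<And>k. continuous_on T (\<lambda>t. c t k)"
    and near: "\<And>t e. t \<in> T \<Longrightarrow> 0 < e \<Longrightarrow>
      \<exists>K. \<exists>d>0. \<forall>s\<in>T. \<bar>s - t\<bar> < d \<longrightarrow> (\<forall>N. (\<Sum>k=K..<N. (c s k)\<^sup>2) \<le> e)"
  shows "ell2_cont T c"
proof (rule ell2_contI[OF _ coord])
  fix t assume t: "t \<in> T"
  obtain K d where "d > 0" "\<forall>s\<in>T. \<bar>s - t\<bar> < d \<longrightarrow> (\<forall>N. (\<Sum>k=K..<N. (c s k)\<^sup>2) \<le> 1)"
    using near[OF t zero_less_one] by blast
  then have K: "(\<Sum>k=K..<N. (c t k)\<^sup>2) \<le> 1" for N using t by force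
  show "c t \<in> ell2"
  proof (rule ell2_bounded_sums)
    show "(\<Sum>k<N. (c t k)\<^sup>2) \<le> (\<Sum>k<K. (c t k)\<^sup>2) + 1" for N
      using sum_split_at[of "\<lambda>k. (c t k)\<^sup>2" N K] K[of N] by simp
  qed
  fix e :: real assume e: "0 < e"
  obtain K d where "d > 0" "\<forall>s\<in>T. \<bar>s - t\<bar> < d \<longrightarrow> (\<forall>N. (\<Sum>k=K..<N. (c s k)\<^sup>2) \<le> e)"
    using near[OF t e] by blast
  then show "\<exists>K. eventually (\<lambda>s. \<forall>N. (\<Sum>k=K..<N. (c s k)\<^sup>2) \<le> e) (at t within T)"
    unfolding eventually_at dist_real_def by blast
qed

text \<open>Used to absorb the unknown vector after the mean value theorem has been applied to its inner product
  with a curve.\<close>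
lemma sum_square_cauchy_schwarz:
  fixes x y :: "nat \<Rightarrow> real"
  assumes "(\<Sum>k<N. (x k)\<^sup>2) = (\<Sum>k<N. x k * y k)"
  shows "(\<Sum>k<N. (x k)\<^sup>2) \<le> (\<Sum>k<N. (y k)\<^sup>2)"
proof -
  have "0 \<le> (\<Sum>k<N. (x k - y k)\<^sup>2)" by (simp add: sum_nonneg)
  also have "\<dots> = (\<Sum>k<N. (x k)\<^sup>2) - 2 * (\<Sum>k<N. x k * y k) + (\<Sum>k<N. (y k)\<^sup>2)"
    by (simp add: power2_diff sum.distrib sum_subtractf sum_distrib_left mult.assoc)
  finally show ?thesis using assms by simp
qed

lemma half_power_le_powr:
  fixes u \<beta> C x :: real
  assumes "0 < u" "u \<le> 1" "\<beta> < 1 / 2" "0 \<le> C" "x\<^sup>2 \<le> C * u"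
  shows "x \<le> sqrt C * u powr \<beta>"
proof -
  have "x \<le> sqrt (C * u)" using assms(5) by (rule real_le_rsqrt)
  also have "\<dots> = sqrt C * u powr (1/2)" using assms by (simp add: real_sqrt_mult powr_half_sqrt)
  also have "u powr (1/2) \<le> u powr \<beta>" using assms by (intro powr_mono') auto
  finally show ?thesis using assms by (simp add: mult_left_mono)
qed

context nonlocal_delay
begin

context
  fixes c
  assumes adm: "admissible c" and sol: "\<And>T. lin_sol T (diffusion 0 c) (forcing 0 c) c"
begin

definition bnd :: "real \<Rightarrow> real" where "bnd T = D * G * exp ((1 + D) * T)"

lemma bnd_nonneg: "0 \<le> bnd T" using D_nonneg G_ge_1 by (simp add: bnd_def)

lemma source_bound: "t \<in> {0..T} \<Longrightarrow> (\<Sum>k<N. (forcing 0 c t k)\<^sup>2) \<le> bnd T"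
  unfolding bnd_def by (rule forcing_bound_upto[OF adm]) (use \<rho> in auto)

lemma c0_eq: "c 0 = q 0"
  using adm \<rho> by (simp add: admissible_def)

lemma c_X1: "-\<rho> \<le> t \<Longrightarrow> c t \<in> X1"
  by (rule admissible_X1[OF adm, of 0]) (use \<rho> in auto)

lemma x1_bound:
  assumes t: "t \<in> {0..T}"
  shows "(\<Sum>k<N. (\<kappa> k * c t k)\<^sup>2) \<le> (X1_norm (q 0))\<^sup>2 + bnd T / (m * \<kappa> 0)\<^sup>2"
proof -
  have "(\<Sum>k=0..<N. (\<kappa> k * c t k)\<^sup>2) \<le> (\<Sum>k=0..<N. (\<kappa> k * c 0 k)\<^sup>2) + bnd T / (m * \<kappa> 0)\<^sup>2"
    by (rule weighted_tail_bound[OF sol source_bound t])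
  also have "(\<Sum>k=0..<N. (\<kappa> k * c 0 k)\<^sup>2) \<le> (X1_norm (q 0))\<^sup>2"
    using sum_le_ell2_norm_sq[of "\<lambda>k. \<kappa> k * c 0 k" "{0..<N}"] c_X1[of 0] \<rho> c0_eq
    by (simp add: X1_def X1_norm_def)
  finally show ?thesis by (simp add: atLeast0LessThan)
qed

lemma l2_hoelder: "\<exists>C\<ge>0. \<forall>s t. 0 \<le> s \<longrightarrow> s \<le> t \<longrightarrow> t \<le> T \<longrightarrow> (ell2_norm (\<lambda>k. c t k - c s k))\<^sup>2 \<le> C * (t - s)"
proof (intro exI conjI allI impI)
  let ?C = "M * ((X1_norm (q 0))\<^sup>2 + bnd T / (m * \<kappa> 0)\<^sup>2) + bnd T / (m * (\<kappa> 0)\<^sup>2)"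
  show "0 \<le> ?C" using M_pos m_pos bnd_nonneg by simp
  fix s t assume st: "0 \<le> s" "s \<le> t" "t \<le> T"
  show "(ell2_norm (\<lambda>k. c t k - c s k))\<^sup>2 \<le> ?C * (t - s)"
  proof (rule ell2_bounded_sums(2))
    fix N
    have "(\<Sum>k<N. (c t k - c s k)\<^sup>2) \<le> (M * (\<Sum>k<N. (\<kappa> k * c s k)\<^sup>2) + bnd T / (m * (\<kappa> 0)\<^sup>2)) * (t - s)"
      by (rule l2_half_hoelder[OF sol source_bound st])
    also have "\<dots> \<le> ?C * (t - s)"
      using M_pos st by (intro mult_right_mono add_right_mono mult_left_mono x1_bound) auto
    finally show "(\<Sum>k<N. (c t k - c s k)\<^sup>2) \<le> ?C * (t - s)" .
  qed
qed

text \<open>Common interface of the two energy estimates: \<open>r > 0\<close> for general initial values, \<open>r = 0\<close> for smooth ones.\<close>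
definition x1_half_hoelder :: "real \<Rightarrow> real \<Rightarrow> bool" where
  "x1_half_hoelder r T \<longleftrightarrow> (\<exists>C\<ge>0. \<forall>s t. r \<le> s \<longrightarrow> s < t \<longrightarrow> t \<le> T \<longrightarrow> (X1_norm (\<lambda>k. c t k - c s k))\<^sup>2 \<le> C * (t - s))"

lemma x1_hoelder_interior:
  assumes r: "0 < r" shows "x1_half_hoelder r T"
  unfolding x1_half_hoelder_def
proof (intro exI conjI allI impI)
  let ?P = "(X1_norm (q 0))\<^sup>2"
  let ?C = "2 * bnd T / m + 2 * M * ?P / (m * r) + 16 * bnd T * M\<^sup>2 / m ^ 3"
  show "0 \<le> ?C" using M_pos m_pos bnd_nonneg r by simp
  fix s t assume st: "r \<le> s" "s < t" "t \<le> T"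
  show "(X1_norm (\<lambda>k. c t k - c s k))\<^sup>2 \<le> ?C * (t - s)"
    unfolding X1_norm_def[of "\<lambda>k. c t k - c s k"]
  proof (rule ell2_bounded_sums(2))
    fix N
    have "(\<Sum>k<N. (\<kappa> k * (c t k - c s k))\<^sup>2)
        \<le> (2 * bnd T / m + 2 * M * ?P / (m * s) + 16 * bnd T * M\<^sup>2 / m ^ 3) * (t - s)"
    proof (rule weighted_half_hoelder[OF sol source_bound])
      show "(\<Sum>k<N. (\<kappa> k * c 0 k)\<^sup>2) \<le> ?P"
        using sum_le_ell2_norm_sq[of "\<lambda>k. \<kappa> k * c 0 k" "{..<N}"] c_X1[of 0] \<rho> c0_eq
        by (simp add: X1_def X1_norm_def)
    qed (use st r in auto)
    also have "\<dots> \<le> ?C * (t - s)"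
      using st r M_pos m_pos by (intro mult_right_mono add_right_mono add_left_mono divide_left_mono) auto
    finally show "(\<Sum>k<N. (\<kappa> k * (c t k - c s k))\<^sup>2) \<le> ?C * (t - s)" .
  qed
qed

lemma x1_hoelder_smooth:
  assumes q: "(\<lambda>k. (\<kappa> k)\<^sup>2 * q 0 k) \<in> ell2" shows "x1_half_hoelder 0 T"
  unfolding x1_half_hoelder_def
proof (intro exI conjI allI impI)
  let ?P = "(ell2_norm (\<lambda>k. (\<kappa> k)\<^sup>2 * q 0 k))\<^sup>2"
  let ?C = "2 * bnd T / m + 2 * M * ?P + 16 * bnd T * M\<^sup>2 / m ^ 3"
  show "0 \<le> ?C" using M_pos m_pos bnd_nonneg by simp
  fix s t assume st: "0 \<le> s" "s < t" "t \<le> T"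
  show "(X1_norm (\<lambda>k. c t k - c s k))\<^sup>2 \<le> ?C * (t - s)"
    unfolding X1_norm_def[of "\<lambda>k. c t k - c s k"]
  proof (rule ell2_bounded_sums(2))
    show "(\<Sum>k<N. (\<kappa> k * (c t k - c s k))\<^sup>2) \<le> ?C * (t - s)" for N
      by (rule weighted_half_hoelder_smooth[OF sol source_bound])
        (use st sum_le_ell2_norm_sq[OF q, of "{..<N}"] c0_eq in auto)
  qed
qed

text \<open>The delayed argument may lie in the history, in the future, or on both sides of the initial time; in the last case
  the path is cut at 0, whence the factor 2.\<close>
lemma delayed_modulus:
  "\<exists>C\<ge>1. \<forall>s t. 0 \<le> s \<longrightarrow> s < t \<longrightarrow> t \<le> T \<longrightarrow> t - s \<le> 1 \<longrightarrow>
     ell2_norm (\<lambda>k. c (t - \<rho>) k - c (s - \<rho>) k) \<le> 2 * \<nu> (C * (t - s) powr \<beta>)"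
proof -
  obtain C where C: "0 \<le> C" "\<And>s t. 0 \<le> s \<Longrightarrow> s \<le> t \<Longrightarrow> t \<le> T \<Longrightarrow> (ell2_norm (\<lambda>k. c t k - c s k))\<^sup>2 \<le> C * (t - s)"
    using l2_hoelder[of T] by blast
  let ?C = "max 1 (sqrt C)"
  have \<nu>_C: "\<nu> (x powr \<beta>) \<le> \<nu> (?C * y powr \<beta>)" if "0 \<le> x" "x \<le> y" for x y
  proof (rule mono_onD[OF \<nu>_mono])
    have "x powr \<beta> \<le> 1 * y powr \<beta>" using that \<beta> by (simp add: powr_mono2)
    also have "\<dots> \<le> ?C * y powr \<beta>" by (intro mult_right_mono) auto
    finally show "x powr \<beta> \<le> ?C * y powr \<beta>" .
  qed auto
  have pos: "ell2_norm (\<lambda>k. c t k - c s k) \<le> \<nu> (?C * y powr \<beta>)"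
    if st: "0 \<le> s" "s \<le> t" "t \<le> T" "t - s \<le> y" "0 < y" "y \<le> 1" for s t y
  proof -
    have "(ell2_norm (\<lambda>k. c t k - c s k))\<^sup>2 \<le> C * (t - s)" by (rule C(2)) (use st in auto)
    also have "\<dots> \<le> C * y" using C(1) st by (intro mult_left_mono) auto
    finally have "ell2_norm (\<lambda>k. c t k - c s k) \<le> sqrt C * y powr \<beta>"
      using st C(1) \<beta> by (intro half_power_le_powr) auto
    also have "\<dots> \<le> ?C * y powr \<beta>" by (intro mult_right_mono) auto
    also have "\<dots> \<le> \<nu> (?C * y powr \<beta>)" by (intro \<nu>_ge) auto
    finally show ?thesis .
  qed
  have neg: "ell2_norm (\<lambda>k. c t k - c s k) \<le> \<nu> (?C * y powr \<beta>)"
    if st: "-\<rho> \<le> s" "s \<le> t" "t \<le> 0" "t - s \<le> y" for s t y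
  proof -
    have "c t = q t" "c s = q s" using adm st by (auto simp: admissible_def)
    then have "ell2_norm (\<lambda>k. c t k - c s k) \<le> \<nu> (\<bar>t - s\<bar> powr \<beta>)" using q_modulus[of t s] st by simp
    also have "\<dots> \<le> \<nu> (?C * y powr \<beta>)" by (rule \<nu>_C) (use st in auto)
    finally show ?thesis .
  qed
  have "ell2_norm (\<lambda>k. c (t - \<rho>) k - c (s - \<rho>) k) \<le> 2 * \<nu> (?C * (t - s) powr \<beta>)"
    if st: "0 \<le> s" "s < t" "t \<le> T" "t - s \<le> 1" for s t
  proof -
    have nn: "0 \<le> \<nu> (?C * (t - s) powr \<beta>)"
      by (rule order_trans[OF _ \<nu>_ge]) auto
    consider "t \<le> \<rho>" | "\<rho> \<le> s" | "s < \<rho>" "\<rho> < t" by linarith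
    then show ?thesis
    proof cases
      case 1
      then show ?thesis using neg[of "s - \<rho>" "t - \<rho>" "t - s"] st nn by simp
    next
      case 2
      then show ?thesis using pos[of "s - \<rho>" "t - \<rho>" "t - s"] st nn \<rho> by simp
    next
      case 3
      have e: "c (t - \<rho>) \<in> ell2" "c 0 \<in> ell2" "c (s - \<rho>) \<in> ell2"
        using st 3 \<rho> by (auto intro!: X1_ell2 c_X1)
      have "ell2_norm (\<lambda>k. c (t - \<rho>) k - c (s - \<rho>) k)
          \<le> ell2_norm (\<lambda>k. c (t - \<rho>) k - c 0 k) + ell2_norm (\<lambda>k. c 0 k - c (s - \<rho>) k)"
        using ell2_add(2)[OF ell2_diff(1)[OF e(1,2)] ell2_diff(1)[OF e(2,3)]] by simp
      also have "\<dots> \<le> \<nu> (?C * (t - s) powr \<beta>) + \<nu> (?C * (t - s) powr \<beta>)"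
        using 3 st \<rho> by (intro add_mono pos neg) auto
      finally show ?thesis by simp
    qed
  qed
  then show ?thesis by (intro exI[of _ ?C]) auto
qed

text \<open>This is where all moduli meet: the increment of \<open>h / A\<close> involves the reaction and the diffusion
  coefficient through the energy-norm increment, and the delay term through the \<open>L\<^sup>2\<close> increment. Both are at most a
  constant times \<open>(t - s)\<^sup>\<beta>\<close> for \<open>t - s \<le> 1\<close>, since \<open>\<beta> < 1/2\<close>.\<close>
lemma quotient_modulus:
  assumes X: "x1_half_hoelder r T" and r: "0 \<le> r"
  shows "\<exists>C1 C2. 0 \<le> C1 \<and> 0 < C2 \<and> (\<forall>s t N. r \<le> s \<longrightarrow> s < t \<longrightarrow> t \<le> T \<longrightarrow> t - s \<le> 1 \<longrightarrow>
    (\<Sum>k<N. (forcing 0 c s k / diffusion 0 c s - forcing 0 c t k / diffusion 0 c t)\<^sup>2)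
      \<le> C1 * (\<nu> (C2 * (t - s) powr \<beta>))\<^sup>2)"
proof -
  obtain C where C: "0 \<le> C" "\<And>s t. r \<le> s \<Longrightarrow> s < t \<Longrightarrow> t \<le> T \<Longrightarrow> (X1_norm (\<lambda>k. c t k - c s k))\<^sup>2 \<le> C * (t - s)"
    using X unfolding x1_half_hoelder_def by blast
  obtain C' where C': "1 \<le> C'" "\<And>s t. 0 \<le> s \<Longrightarrow> s < t \<Longrightarrow> t \<le> T \<Longrightarrow> t - s \<le> 1 \<Longrightarrow>
     ell2_norm (\<lambda>k. c (t - \<rho>) k - c (s - \<rho>) k) \<le> 2 * \<nu> (C' * (t - s) powr \<beta>)"
    using delayed_modulus[of T] by blast
  define C2 where "C2 = max C' (Kf * sqrt C)"
  define C1 where "C1 = 2 / m\<^sup>2 * (2 + 8 * \<gamma>\<^sup>2) + 2 * bnd T / m ^ 4"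
  have "(\<Sum>k<N. (forcing 0 c s k / diffusion 0 c s - forcing 0 c t k / diffusion 0 c t)\<^sup>2)
      \<le> C1 * (\<nu> (C2 * (t - s) powr \<beta>))\<^sup>2"
    if st: "r \<le> s" "s < t" "t \<le> T" "t - s \<le> 1" for s t N
  proof -
    define y where "y = C2 * (t - s) powr \<beta>"
    define V where "V = \<nu> y"
    have s0: "0 \<le> s" and t0: "0 \<le> t" using st r by auto
    have sX: "c s \<in> X1" "c t \<in> X1" using s0 t0 \<rho> by (auto intro: c_X1)
    have xs: "X1_norm (\<lambda>k. c t k - c s k) \<le> sqrt C * (t - s) powr \<beta>"
      using st C \<beta> by (intro half_power_le_powr) auto
    have xn: "0 \<le> X1_norm (\<lambda>k. c s k - c t k)" by (intro X1_norm_nonneg X1_diff sX)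
    have sym: "X1_norm (\<lambda>k. c s k - c t k) = X1_norm (\<lambda>k. c t k - c s k)"
      unfolding X1_norm_def right_diff_distrib by (rule ell2_norm_minus_commute)
    have "Kf * X1_norm (\<lambda>k. c s k - c t k) \<le> Kf * (sqrt C * (t - s) powr \<beta>)"
      unfolding sym using xs Kf by (intro mult_left_mono) auto
    also have "\<dots> \<le> y" unfolding y_def mult.assoc[symmetric] C2_def by (intro mult_right_mono) auto
    finally have Ky: "Kf * X1_norm (\<lambda>k. c s k - c t k) \<le> y" .
    have "1 * X1_norm (\<lambda>k. c s k - c t k) \<le> Kf * X1_norm (\<lambda>k. c s k - c t k)"
      using Kf xn by (intro mult_right_mono)
    with Ky have y1: "X1_norm (\<lambda>k. c s k - c t k) \<le> y" by simp
    have V0: "0 \<le> V" unfolding V_def using y1 xn by (intro order_trans[OF _ \<nu>_ge]) auto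
    have A: "\<bar>diffusion 0 c s - diffusion 0 c t\<bar> \<le> V"
    proof -
      have "\<bar>al (c s) - al (c t)\<bar> \<le> \<nu> (X1_norm (\<lambda>k. c s k - c t k))" by (rule al_modulus[OF sX])
      also have "\<dots> \<le> V" unfolding V_def by (rule mono_onD[OF \<nu>_mono]) (use y1 xn in auto)
      finally show ?thesis by (simp add: diffusion_def)
    qed
    have F: "(\<Sum>k<N. (F (c s) k - F (c t) k)\<^sup>2) \<le> V\<^sup>2"
    proof -
      have "0 \<le> Kf * X1_norm (\<lambda>k. c s k - c t k)" using Kf xn by simp
      then have "\<nu> (Kf * X1_norm (\<lambda>k. c s k - c t k)) \<le> V" "0 \<le> \<nu> (Kf * X1_norm (\<lambda>k. c s k - c t k))"
        unfolding V_def using mono_onD[OF \<nu>_mono _ _ Ky] Ky \<nu>_ge[of "Kf * X1_norm (\<lambda>k. c s k - c t k)"] by auto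
      then have "(\<nu> (Kf * X1_norm (\<lambda>k. c s k - c t k)))\<^sup>2 \<le> V\<^sup>2" by (intro power_mono)
      with F_modulus[OF sX, of N] show ?thesis by linarith
    qed
    have De: "(\<Sum>k<N. (c (s - \<rho>) k - c (t - \<rho>) k)\<^sup>2) \<le> 4 * V\<^sup>2"
    proof -
      have e: "c (t - \<rho>) \<in> ell2" "c (s - \<rho>) \<in> ell2" using s0 t0 by (auto intro!: X1_ell2 c_X1)
      have "C' * (t - s) powr \<beta> \<le> y" unfolding y_def C2_def by (intro mult_right_mono) auto
      moreover have "0 \<le> C' * (t - s) powr \<beta>" using C'(1) by simp
      ultimately have "\<nu> (C' * (t - s) powr \<beta>) \<le> V" unfolding V_def by (intro mono_onD[OF \<nu>_mono]) auto
      then have "ell2_norm (\<lambda>k. c (t - \<rho>) k - c (s - \<rho>) k) \<le> 2 * V" using C'(2)[OF s0 st(2-4)] by linarith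
      then have "(ell2_norm (\<lambda>k. c (t - \<rho>) k - c (s - \<rho>) k))\<^sup>2 \<le> (2 * V)\<^sup>2"
        by (rule power_mono) (intro ell2_norm_nonneg ell2_diff(1) e)
      then show ?thesis
        using sum_le_ell2_norm_sq[OF ell2_diff(1)[OF e], of "{..<N}"] by (simp add: power2_commute power_mult_distrib)
    qed
    have dh: "(\<Sum>k<N. (forcing 0 c s k - forcing 0 c t k)\<^sup>2) \<le> (2 + 8 * \<gamma>\<^sup>2) * V\<^sup>2"
    proof -
      have "(\<Sum>k<N. (forcing 0 c s k - forcing 0 c t k)\<^sup>2)
          \<le> (\<Sum>k<N. 2 * (F (c s) k - F (c t) k)\<^sup>2 + 2 * \<gamma>\<^sup>2 * (c (s - \<rho>) k - c (t - \<rho>) k)\<^sup>2)"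
      proof (rule sum_mono)
        fix k
        have "forcing 0 c s k - forcing 0 c t k = (F (c s) k - F (c t) k) + \<gamma> * (c (s - \<rho>) k - c (t - \<rho>) k)"
          by (simp add: forcing_def algebra_simps)
        then show "(forcing 0 c s k - forcing 0 c t k)\<^sup>2
            \<le> 2 * (F (c s) k - F (c t) k)\<^sup>2 + 2 * \<gamma>\<^sup>2 * (c (s - \<rho>) k - c (t - \<rho>) k)\<^sup>2"
          using power2_add_le[of "F (c s) k - F (c t) k" "\<gamma> * (c (s - \<rho>) k - c (t - \<rho>) k)"]
          by (simp add: power_mult_distrib)
      qed
      also have "\<dots> = 2 * (\<Sum>k<N. (F (c s) k - F (c t) k)\<^sup>2) + 2 * \<gamma>\<^sup>2 * (\<Sum>k<N. (c (s - \<rho>) k - c (t - \<rho>) k)\<^sup>2)"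
        by (simp only: sum.distrib sum_distrib_left)
      also have "\<dots> \<le> 2 * V\<^sup>2 + 2 * \<gamma>\<^sup>2 * (4 * V\<^sup>2)"
        by (intro add_mono mult_left_mono F De) auto
      finally show ?thesis by (simp add: distrib_right)
    qed
    have As: "m \<le> diffusion 0 c s" and At: "m \<le> diffusion 0 c t"
      using diffusion_range[OF adm, of 0 s s] diffusion_range[OF adm, of 0 t t] s0 t0 \<rho> by auto
    have "(\<Sum>k<N. (forcing 0 c s k / diffusion 0 c s - forcing 0 c t k / diffusion 0 c t)\<^sup>2)
        \<le> (\<Sum>k<N. 2 / m\<^sup>2 * (forcing 0 c s k - forcing 0 c t k)\<^sup>2 + 2 * V\<^sup>2 / m ^ 4 * (forcing 0 c t k)\<^sup>2)"
    proof (rule sum_mono)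
      fix k
      let ?a = "diffusion 0 c s" and ?b = "diffusion 0 c t" and ?f = "forcing 0 c s k" and ?g = "forcing 0 c t k"
      have ab: "0 < ?a" "0 < ?b" using As At m_pos by auto
      have "?f / ?a - ?g / ?b = (?f - ?g) / ?a + ?g * ((?b - ?a) / (?a * ?b))"
        using ab by (simp add: field_simps)
      then have "(?f / ?a - ?g / ?b)\<^sup>2 \<le> 2 * ((?f - ?g) / ?a)\<^sup>2 + 2 * (?g * ((?b - ?a) / (?a * ?b)))\<^sup>2"
        using power2_add_le[of "(?f - ?g) / ?a" "?g * ((?b - ?a) / (?a * ?b))"] by simp
      also have "((?f - ?g) / ?a)\<^sup>2 \<le> (?f - ?g)\<^sup>2 / m\<^sup>2"
        unfolding power_divide using As m_pos by (intro divide_left_mono power_mono mult_pos_pos) auto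
      also have "(?g * ((?b - ?a) / (?a * ?b)))\<^sup>2 \<le> ?g\<^sup>2 * (V\<^sup>2 / m ^ 4)"
        unfolding power_mult_distrib[of ?g] power_divide
      proof (intro mult_left_mono frac_le)
        show "(?b - ?a)\<^sup>2 \<le> V\<^sup>2" using A V0 by (simp add: abs_le_square_iff[symmetric] abs_minus_commute)
        have "m * m \<le> ?a * ?b" using As At m_pos by (intro mult_mono) auto
        then have "(m * m)\<^sup>2 \<le> (?a * ?b)\<^sup>2" using m_pos by (intro power_mono) auto
        then show "m ^ 4 \<le> (?a * ?b)\<^sup>2" by (simp add: power2_eq_square power4_eq_xxxx)
      qed (use m_pos in auto)
      finally show "(?f / ?a - ?g / ?b)\<^sup>2 \<le> 2 / m\<^sup>2 * (?f - ?g)\<^sup>2 + 2 * V\<^sup>2 / m ^ 4 * ?g\<^sup>2"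
        by (simp add: mult_ac)
    qed
    also have "\<dots> = 2 / m\<^sup>2 * (\<Sum>k<N. (forcing 0 c s k - forcing 0 c t k)\<^sup>2) + 2 * V\<^sup>2 / m ^ 4 * (\<Sum>k<N. (forcing 0 c t k)\<^sup>2)"
      by (simp only: sum.distrib sum_distrib_left)
    also have "\<dots> \<le> 2 / m\<^sup>2 * ((2 + 8 * \<gamma>\<^sup>2) * V\<^sup>2) + 2 * V\<^sup>2 / m ^ 4 * bnd T"
      by (intro add_mono mult_left_mono dh source_bound) (use st t0 m_pos in auto)
    also have "\<dots> = C1 * V\<^sup>2" by (simp add: C1_def algebra_simps add_divide_distrib)
    finally show ?thesis by (simp add: V_def y_def)
  qed
  moreover have "0 \<le> C1" using bnd_nonneg m_pos by (simp add: C1_def)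
  moreover have "0 < C2" using C'(1) by (simp add: C2_def)
  ultimately show ?thesis by blast
qed

lemma source_ell2_cont: "ell2_cont {0..} (forcing 0 c)"
  unfolding ell2_cont_def
proof (intro ballI conjI)
  fix t :: real assume t: "t \<in> {0..}"
  have mem: "forcing 0 c s \<in> ell2" if "s \<in> {0..}" for s
    by (rule ell2_bounded_sums(1), rule source_bound[of s s]) (use that in auto)
  show "forcing 0 c t \<in> ell2" by (rule mem[OF t])
  let ?x = "\<lambda>s. \<nu> (Kf * X1_norm (\<lambda>k. c s k - c t k))"
  let ?y = "\<lambda>s. X1_norm (\<lambda>k. c (s - \<rho>) k - c (t - \<rho>) k)"
  have X: "X1_cont {0..} (\<lambda>s. c (s - d))" if "d \<le> \<rho>" for d
    by (rule shifted_X1_cont[OF adm _ _ that, of 0]) (use \<rho> in auto)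
  have Kx: "((\<lambda>s. Kf * X1_norm (\<lambda>k. c s k - c t k)) \<longlongrightarrow> Kf * 0) (at t within {0..})"
    using X[of 0] \<rho> t by (intro tendsto_mult_left) (auto simp: X1_cont_iff)
  have nn: "0 \<le> Kf * X1_norm (\<lambda>k. c s k - c t k)" if "s \<in> {0..}" for s
    using Kf that t \<rho> by (auto intro!: mult_nonneg_nonneg X1_norm_nonneg X1_diff c_X1)
  have "(?x \<longlongrightarrow> 0) (at t within {0..})"
  proof (rule \<nu>_tendsto)
    show "eventually (\<lambda>s. 0 \<le> Kf * X1_norm (\<lambda>k. c s k - c t k)) (at t within {0..})"
      by (rule eventually_mono[OF eventually_in_within]) (rule nn)
  qed (use Kx in simp)
  moreover have "(?y \<longlongrightarrow> 0) (at t within {0..})"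
    using X[of \<rho>] t by (auto simp: X1_cont_iff)
  ultimately have lim: "((\<lambda>s. ?x s + \<bar>\<gamma>\<bar> / \<kappa> 0 * ?y s) \<longlongrightarrow> 0 + \<bar>\<gamma>\<bar> / \<kappa> 0 * 0) (at t within {0..})"
    by (intro tendsto_intros)
  have bound: "ell2_norm (\<lambda>k. forcing 0 c s k - forcing 0 c t k) \<le> ?x s + \<bar>\<gamma>\<bar> / \<kappa> 0 * ?y s" if s: "s \<in> {0..}" for s
  proof -
    have cX: "c s \<in> X1" "c t \<in> X1" "c (s - \<rho>) \<in> X1" "c (t - \<rho>) \<in> X1" using s t \<rho> by (auto intro!: c_X1)
    let ?dF = "\<lambda>k. F (c s) k - F (c t) k" and ?dw = "\<lambda>k. c (s - \<rho>) k - c (t - \<rho>) k"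
    have dF: "?dF \<in> ell2" by (rule ell2_bounded_sums(1)[OF F_modulus[OF cX(1,2)]])
    have dFn: "ell2_norm ?dF \<le> ?x s"
      by (rule ell2_norm_le[OF dF _ F_modulus[OF cX(1,2)]]) (rule order_trans[OF nn[OF s] \<nu>_ge[OF nn[OF s]]])
    have dw: "?dw \<in> ell2" "ell2_norm ?dw \<le> ?y s / \<kappa> 0" using X1_ell2[OF X1_diff[OF cX(3,4)]] by auto
    have "(\<lambda>k. forcing 0 c s k - forcing 0 c t k) = (\<lambda>k. ?dF k + \<gamma> * ?dw k)"
      by (auto simp: forcing_def algebra_simps)
    then have "ell2_norm (\<lambda>k. forcing 0 c s k - forcing 0 c t k) \<le> ell2_norm ?dF + \<bar>\<gamma>\<bar> * ell2_norm ?dw"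
      using ell2_add(2)[OF dF ell2_scale(1)[OF dw(1), of \<gamma>]] ell2_scale(2)[OF dw(1), of \<gamma>] by simp
    also have "\<dots> \<le> ?x s + \<bar>\<gamma>\<bar> * (?y s / \<kappa> 0)" by (intro add_mono dFn mult_left_mono dw) auto
    finally show ?thesis by simp
  qed
  show "((\<lambda>s. ell2_norm (\<lambda>k. forcing 0 c s k - forcing 0 c t k)) \<longlongrightarrow> 0) (at t within {0..})"
  proof (rule tendsto_0_le[where K = 1])
    show "((\<lambda>s. ?x s + \<bar>\<gamma>\<bar> / \<kappa> 0 * ?y s) \<longlongrightarrow> 0) (at t within {0..})" using lim by simp
    show "eventually (\<lambda>s. norm (ell2_norm (\<lambda>k. forcing 0 c s k - forcing 0 c t k)) \<le> norm (?x s + \<bar>\<gamma>\<bar> / \<kappa> 0 * ?y s) * 1)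
        (at t within {0..})"
    proof (rule eventually_mono[OF eventually_in_within])
      fix s :: real assume s: "s \<in> {0..}"
      then show "norm (ell2_norm (\<lambda>k. forcing 0 c s k - forcing 0 c t k)) \<le> norm (?x s + \<bar>\<gamma>\<bar> / \<kappa> 0 * ?y s) * 1"
        using bound[OF s] ell2_norm_nonneg[OF ell2_diff(1)[OF mem[OF s] mem[OF t]]] by simp
    qed
  qed
qed

lemma second_order_coord_cont: "continuous_on {0..} (\<lambda>t. (\<kappa> k)\<^sup>2 * c t k)"
proof -
  have "continuous_on {0..} (\<lambda>t. c t k)"
    using X1_cont_coord[OF shifted_X1_cont[OF adm, of 0 0]] \<rho> by simp
  then show ?thesis by (intro continuous_intros)
qed

lemma dini_antiderivative:
  assumes X: "x1_half_hoelder r T" and r: "0 \<le> r"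
  shows "\<exists>J B. continuous_on {0..1} J \<and> J 0 = 0 \<and>
     (\<forall>u. 0 < u \<longrightarrow> u < 1 \<longrightarrow> (J has_real_derivative B u / u) (at u)) \<and>
     (\<forall>s t N. r \<le> s \<longrightarrow> s < t \<longrightarrow> t \<le> T \<longrightarrow> t - s \<le> 1 \<longrightarrow>
       (\<Sum>k<N. (forcing 0 c s k / diffusion 0 c s - forcing 0 c t k / diffusion 0 c t)\<^sup>2) \<le> B (t - s))"
proof -
  from quotient_modulus[OF assms] obtain C1 C2 where C: "0 < C2" and g: "\<And>s t N. r \<le> s \<Longrightarrow> s < t \<Longrightarrow> t \<le> T \<Longrightarrow> t - s \<le> 1 \<Longrightarrow>
    (\<Sum>k<N. (forcing 0 c s k / diffusion 0 c s - forcing 0 c t k / diffusion 0 c t)\<^sup>2)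
      \<le> C1 * (\<nu> (C2 * (t - s) powr \<beta>))\<^sup>2" by blast
  from dini[OF C] obtain J where J: "continuous_on {0..1} J" "J 0 = 0"
    "\<And>u. 0 < u \<Longrightarrow> u < 1 \<Longrightarrow> (J has_real_derivative (\<nu> (C2 * u powr \<beta>))\<^sup>2 / u) (at u)" by blast
  show ?thesis
  proof (rule exI[of _ "\<lambda>u. C1 * J u"], rule exI[of _ "\<lambda>u. C1 * (\<nu> (C2 * u powr \<beta>))\<^sup>2"], intro conjI allI impI)
    show "continuous_on {0..1} (\<lambda>u. C1 * J u)" by (intro continuous_intros J)
    show "((\<lambda>u. C1 * J u) has_real_derivative C1 * (\<nu> (C2 * u powr \<beta>))\<^sup>2 / u) (at u)" if "0 < u" "u < 1" for u
      using DERIV_cmult[OF J(3)[OF that], of C1] by simp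
  qed (use J(2) g in auto)
qed

lemma regularity_tail:
  assumes J: "continuous_on {0..1} J" "J 0 = 0"
      "\<And>u. 0 < u \<Longrightarrow> u < 1 \<Longrightarrow> (J has_real_derivative B u / u) (at u)"
    and g: "\<And>s t N. r0 \<le> s \<Longrightarrow> s < t \<Longrightarrow> t \<le> T \<Longrightarrow> t - s \<le> 1 \<Longrightarrow>
       (\<Sum>k<N. (forcing 0 c s k / diffusion 0 c s - forcing 0 c t k / diffusion 0 c t)\<^sup>2) \<le> B (t - s)"
    and rt: "0 \<le> r" "r0 \<le> r" "r \<le> t" "t \<le> T" "t - r \<le> 1"
  shows "(\<Sum>k=K..<N. ((\<kappa> k)\<^sup>2 * c t k)\<^sup>2)
     \<le> 3 * (M / m * J (t - r)) + 3 / m\<^sup>2 * (\<Sum>k=K..<N. (forcing 0 c t k)\<^sup>2)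
     + 3 * (\<Sum>k=K..<N. exp (- 2 * m * (\<kappa> k)\<^sup>2 * (t - r)) * ((\<kappa> k)\<^sup>2 * c r k)\<^sup>2)"
proof (rule maximal_regularity_tail[OF sol source_bound rt(1,3,4), where B = B])
  show "continuous_on {0..t - r} J" by (rule continuous_on_subset[OF J(1)]) (use rt in auto)
qed (use J g rt in auto)

text \<open>The relaxation time \<open>\<eta>\<close> is fixed first, so that the Dini remainder is small; only then is the
  cutoff \<open>K\<close> chosen, depending on \<open>\<eta>\<close> through the factor \<open>1 / (2 m \<eta>)\<close> paid for smoothing.\<close>
lemma second_order_near_interior:
  assumes t0: "0 < t0" and e: "0 < e"
  shows "\<exists>K. \<exists>d>0. \<forall>t. \<bar>t - t0\<bar> < d \<longrightarrow> (\<forall>N. (\<Sum>k=K..<N. ((\<kappa> k)\<^sup>2 * c t k)\<^sup>2) \<le> e)"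
proof -
  define T where "T = t0 + 1"
  obtain J B where J: "continuous_on {0..1} J" "J 0 = 0"
      "\<And>u. 0 < u \<Longrightarrow> u < 1 \<Longrightarrow> (J has_real_derivative B u / u) (at u)"
    and g: "\<And>s t N. t0 / 2 \<le> s \<Longrightarrow> s < t \<Longrightarrow> t \<le> T \<Longrightarrow> t - s \<le> 1 \<Longrightarrow>
       (\<Sum>k<N. (forcing 0 c s k / diffusion 0 c s - forcing 0 c t k / diffusion 0 c t)\<^sup>2) \<le> B (t - s)"
    using dini_antiderivative[OF x1_hoelder_interior, of "t0 / 2" T] t0 by force
  obtain \<eta> where \<eta>: "0 < \<eta>" "\<eta> \<le> 1" "\<eta> \<le> t0 / 4" "3 * (M / m * J \<eta>) \<le> e / 3"
  proof -
    have "(J \<longlongrightarrow> J 0) (at 0 within {0..1})" using J(1) by (simp add: continuous_on_def)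
    then have "((\<lambda>u. 3 * (M / m * J u)) \<longlongrightarrow> 3 * (M / m * J 0)) (at 0 within {0..1})" by (intro tendsto_intros)
    moreover have "3 * (M / m * J 0) < e / 3" using J(2) e by simp
    ultimately have "eventually (\<lambda>u. 3 * (M / m * J u) < e / 3) (at 0 within {0..1})" by (rule order_tendstoD)
    then obtain d where d: "0 < d" "\<And>u. u \<in> {0..1} \<Longrightarrow> u \<noteq> 0 \<Longrightarrow> \<bar>u\<bar> < d \<Longrightarrow> 3 * (M / m * J u) < e / 3"
      unfolding eventually_at dist_real_def by auto
    show thesis
      by (rule that[of "min (d / 2) (min 1 (t0 / 4))"]) (use d(1) t0 less_imp_le[OF d(2)] in \<open>auto simp: min_def\<close>)
  qed
  obtain K1 d1 where d1: "d1 > 0" and K1: "\<And>t N. t \<in> {0..} \<Longrightarrow> \<bar>t - t0\<bar> < d1 \<Longrightarrow> (\<Sum>k=K1..<N. (forcing 0 c t k)\<^sup>2) \<le> m\<^sup>2 * e / 9"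
  proof -
    have "t0 \<in> {0..}" "0 < m\<^sup>2 * e / 9" using t0 e m_pos by auto
    from ell2_cont_nearD[OF source_ell2_cont this] show thesis using that by blast
  qed
  have q: "q 0 \<in> X1" using \<rho> by (intro q_X1) auto
  have "0 < 2 * m * \<eta> * e / 9" using m_pos \<eta> e by simp
  from uniform_weighted_tail[OF q this, of "bnd T"] obtain K2 where
    K2: "\<And>t N. t \<in> {0..T} \<Longrightarrow> (\<Sum>k=K2..<N. (\<kappa> k * c t k)\<^sup>2) \<le> 2 * m * \<eta> * e / 9"
    using sol[of T] source_bound[of _ T] c0_eq by blast
  define K where "K = max K1 K2"
  have "(\<Sum>k=K..<N. ((\<kappa> k)\<^sup>2 * c t k)\<^sup>2) \<le> e" if t: "\<bar>t - t0\<bar> < min d1 (min 1 (t0 / 4))" for t N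
  proof -
    define r where "r = t - \<eta>"
    have tr: "0 \<le> r" "t0 / 2 \<le> r" "r \<le> t" "t \<le> T" "t - r \<le> 1" "0 \<le> t" "t - r = \<eta>"
    proof -
      have "\<bar>t - t0\<bar> < t0 / 4" "\<bar>t - t0\<bar> < 1" using t by auto
      then have "t0 - t0 / 4 < t" "t < t0 + 1" by linarith+
      then show "0 \<le> r" "t0 / 2 \<le> r" "r \<le> t" "t \<le> T" "t - r \<le> 1" "0 \<le> t" "t - r = \<eta>"
        using \<eta> t0 unfolding r_def T_def by linarith+
    qed
    have "(\<Sum>k=K..<N. (forcing 0 c t k)\<^sup>2) \<le> (\<Sum>k=K1..<N. (forcing 0 c t k)\<^sup>2)"
      by (rule sum_mono2) (auto simp: K_def)
    also have "\<dots> \<le> m\<^sup>2 * e / 9" by (rule K1) (use t tr in auto)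
    finally have "3 / m\<^sup>2 * (\<Sum>k=K..<N. (forcing 0 c t k)\<^sup>2) \<le> 3 / m\<^sup>2 * (m\<^sup>2 * e / 9)"
      by (rule mult_left_mono) simp
    then have src: "3 / m\<^sup>2 * (\<Sum>k=K..<N. (forcing 0 c t k)\<^sup>2) \<le> e / 3" using m_pos by simp
    have "(\<Sum>k=K..<N. exp (- 2 * m * (\<kappa> k)\<^sup>2 * (t - r)) * ((\<kappa> k)\<^sup>2 * c r k)\<^sup>2)
        \<le> (\<Sum>k=K..<N. 1 / (2 * m * \<eta>) * (\<kappa> k * c r k)\<^sup>2)"
    proof (rule sum_mono)
      fix k
      let ?z = "2 * m * (\<kappa> k)\<^sup>2 * \<eta>"
      have "exp (- 2 * m * (\<kappa> k)\<^sup>2 * (t - r)) * ((\<kappa> k)\<^sup>2 * c r k)\<^sup>2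
          = 1 / (2 * m * \<eta>) * (?z * exp (- ?z)) * (\<kappa> k * c r k)\<^sup>2"
        using m_pos \<eta> tr by (simp add: power_mult_distrib power2_eq_square)
      also have "\<dots> \<le> 1 / (2 * m * \<eta>) * 1 * (\<kappa> k * c r k)\<^sup>2"
        using m_pos \<eta> by (intro mult_right_mono mult_left_mono mult_exp_minus_le_one) auto
      finally show "exp (- 2 * m * (\<kappa> k)\<^sup>2 * (t - r)) * ((\<kappa> k)\<^sup>2 * c r k)\<^sup>2 \<le> 1 / (2 * m * \<eta>) * (\<kappa> k * c r k)\<^sup>2" by simp
    qed
    also have "\<dots> = 1 / (2 * m * \<eta>) * (\<Sum>k=K..<N. (\<kappa> k * c r k)\<^sup>2)" by (simp only: sum_distrib_left)
    also have "\<dots> \<le> 1 / (2 * m * \<eta>) * (2 * m * \<eta> * e / 9)"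
    proof (rule mult_left_mono)
      have "(\<Sum>k=K..<N. (\<kappa> k * c r k)\<^sup>2) \<le> (\<Sum>k=K2..<N. (\<kappa> k * c r k)\<^sup>2)"
        by (rule sum_mono2) (auto simp: K_def)
      also have "\<dots> \<le> 2 * m * \<eta> * e / 9" by (rule K2) (use tr in auto)
      finally show "(\<Sum>k=K..<N. (\<kappa> k * c r k)\<^sup>2) \<le> 2 * m * \<eta> * e / 9" .
    qed (use m_pos \<eta> in simp)
    also have "\<dots> = e / 9" using m_pos \<eta> by simp
    finally show ?thesis
      using regularity_tail[OF J g tr(1-5), of K N] src \<eta>(4) unfolding tr(7) by linarith
  qed
  then show ?thesis using d1 t0 by (intro exI[of _ K] exI[of _ "min d1 (min 1 (t0 / 4))"]) auto
qed

text \<open>Near the initial time there is no room to smooth: the estimate starts at 0 and uses the tail of the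
  initial second-order coefficients directly.\<close>
lemma second_order_near_zero:
  assumes q: "(\<lambda>k. (\<kappa> k)\<^sup>2 * q 0 k) \<in> ell2" and e: "0 < e"
  shows "\<exists>K. \<exists>d>0. \<forall>t\<in>{0..}. \<bar>t - 0\<bar> < d \<longrightarrow> (\<forall>N. (\<Sum>k=K..<N. ((\<kappa> k)\<^sup>2 * c t k)\<^sup>2) \<le> e)"
proof -
  obtain J B where J: "continuous_on {0..1} J" "J 0 = 0"
      "\<And>u. 0 < u \<Longrightarrow> u < 1 \<Longrightarrow> (J has_real_derivative B u / u) (at u)"
    and g: "\<And>s t N. 0 \<le> s \<Longrightarrow> s < t \<Longrightarrow> t \<le> 1 \<Longrightarrow> t - s \<le> 1 \<Longrightarrow>
       (\<Sum>k<N. (forcing 0 c s k / diffusion 0 c s - forcing 0 c t k / diffusion 0 c t)\<^sup>2) \<le> B (t - s)"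
    using dini_antiderivative[OF x1_hoelder_smooth[OF q], of 1] by force
  obtain d0 where d0: "0 < d0" "d0 \<le> 1" "\<And>u. 0 \<le> u \<Longrightarrow> u < d0 \<Longrightarrow> 3 * (M / m * J u) \<le> e / 3"
  proof -
    have "(J \<longlongrightarrow> J 0) (at 0 within {0..1})" using J(1) by (simp add: continuous_on_def)
    then have "((\<lambda>u. 3 * (M / m * J u)) \<longlongrightarrow> 3 * (M / m * J 0)) (at 0 within {0..1})" by (intro tendsto_intros)
    moreover have J0: "3 * (M / m * J 0) < e / 3" using J(2) e by simp
    ultimately have "eventually (\<lambda>u. 3 * (M / m * J u) < e / 3) (at 0 within {0..1})" by (rule order_tendstoD)
    then obtain d where d: "0 < d" "\<And>u. u \<in> {0..1} \<Longrightarrow> u \<noteq> 0 \<Longrightarrow> \<bar>u\<bar> < d \<Longrightarrow> 3 * (M / m * J u) < e / 3"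
      unfolding eventually_at dist_real_def by auto
    have "3 * (M / m * J u) \<le> e / 3" if "0 \<le> u" "u < min d 1" for u
      using that J0 less_imp_le[OF d(2)[of u]] by (cases "u = 0") auto
    then show thesis using d(1) by (intro that[of "min d 1"]) auto
  qed
  obtain K1 d1 where d1: "d1 > 0" and K1: "\<And>t N. t \<in> {0..} \<Longrightarrow> \<bar>t - 0\<bar> < d1 \<Longrightarrow> (\<Sum>k=K1..<N. (forcing 0 c t k)\<^sup>2) \<le> m\<^sup>2 * e / 9"
  proof -
    have "0 \<in> {0::real..}" "0 < m\<^sup>2 * e / 9" using e m_pos by auto
    from ell2_cont_nearD[OF source_ell2_cont this] show thesis using that by blast
  qed
  obtain K2 where K2: "\<And>N. (\<Sum>k=K2..<N. ((\<kappa> k)\<^sup>2 * q 0 k)\<^sup>2) \<le> e / 9"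
    using ell2_tail[OF q, of "e / 9"] e by force
  define K where "K = max K1 K2"
  have "(\<Sum>k=K..<N. ((\<kappa> k)\<^sup>2 * c t k)\<^sup>2) \<le> e" if t: "t \<in> {0..}" "\<bar>t - 0\<bar> < min d1 d0" for t N
  proof -
    have "(\<Sum>k=K..<N. (forcing 0 c t k)\<^sup>2) \<le> (\<Sum>k=K1..<N. (forcing 0 c t k)\<^sup>2)"
      by (rule sum_mono2) (auto simp: K_def)
    also have "\<dots> \<le> m\<^sup>2 * e / 9" by (rule K1) (use t in auto)
    finally have "3 / m\<^sup>2 * (\<Sum>k=K..<N. (forcing 0 c t k)\<^sup>2) \<le> 3 / m\<^sup>2 * (m\<^sup>2 * e / 9)"
      by (rule mult_left_mono) simp
    then have src: "3 / m\<^sup>2 * (\<Sum>k=K..<N. (forcing 0 c t k)\<^sup>2) \<le> e / 3" using m_pos by simp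
    have "(\<Sum>k=K..<N. exp (- 2 * m * (\<kappa> k)\<^sup>2 * (t - 0)) * ((\<kappa> k)\<^sup>2 * c 0 k)\<^sup>2)
        \<le> (\<Sum>k=K..<N. 1 * ((\<kappa> k)\<^sup>2 * q 0 k)\<^sup>2)"
      unfolding c0_eq using m_pos t by (intro sum_mono mult_right_mono) auto
    also have "\<dots> \<le> (\<Sum>k=K2..<N. ((\<kappa> k)\<^sup>2 * q 0 k)\<^sup>2)"
      unfolding mult_1 by (rule sum_mono2) (auto simp: K_def)
    also have "\<dots> \<le> e / 9" by (rule K2)
    finally have initial: "(\<Sum>k=K..<N. exp (- 2 * m * (\<kappa> k)\<^sup>2 * (t - 0)) * ((\<kappa> k)\<^sup>2 * c 0 k)\<^sup>2) \<le> e / 9" .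
    have t1: "0 \<le> t" "t \<le> 1" "t - 0 \<le> 1" "t < d0" using t d0(2) by auto
    have "3 * (M / m * J (t - 0)) \<le> e / 3" using d0(3)[OF t1(1,4)] by simp
    then show ?thesis
      using regularity_tail[OF J g order_refl order_refl t1(1-3), where K = K and N = N] src initial by linarith
  qed
  then show ?thesis using d1 d0 by (intro exI[of _ K] exI[of _ "min d1 d0"]) auto
qed

lemma second_order_cont: "ell2_cont {0<..} (\<lambda>t k. (\<kappa> k)\<^sup>2 * c t k)"
proof (rule ell2_cont_nearI)
  show "continuous_on {0<..} (\<lambda>t. (\<kappa> k)\<^sup>2 * c t k)" for k
    by (rule continuous_on_subset[OF second_order_coord_cont]) auto
  fix t e :: real assume "t \<in> {0<..}" "0 < e"
  then show "\<exists>K. \<exists>d>0. \<forall>s\<in>{0<..}. \<bar>s - t\<bar> < d \<longrightarrow> (\<forall>N. (\<Sum>k=K..<N. ((\<kappa> k)\<^sup>2 * c s k)\<^sup>2) \<le> e)"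
    using second_order_near_interior[of t e] by auto
qed

lemma second_order_cont_smooth:
  assumes q: "(\<lambda>k. (\<kappa> k)\<^sup>2 * q 0 k) \<in> ell2"
  shows "ell2_cont {0..} (\<lambda>t k. (\<kappa> k)\<^sup>2 * c t k)"
proof (rule ell2_cont_nearI[OF second_order_coord_cont])
  fix t e :: real assume "t \<in> {0..}" "0 < e"
  then show "\<exists>K. \<exists>d>0. \<forall>s\<in>{0..}. \<bar>s - t\<bar> < d \<longrightarrow> (\<forall>N. (\<Sum>k=K..<N. ((\<kappa> k)\<^sup>2 * c s k)\<^sup>2) \<le> e)"
    using second_order_near_interior[of t e] second_order_near_zero[OF q, of e]
    by (cases "t = 0") auto
qed

definition velocity :: "real \<Rightarrow> nat \<Rightarrow> real" where
  "velocity t k = - (\<kappa> k)\<^sup>2 * diffusion 0 c t * c t k + forcing 0 c t k"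

lemma velocity_cont: "ell2_cont {0<..} velocity"
proof (rule ell2_cont_nearI)
  have A: "continuous_on {0..} (diffusion 0 c)"
    unfolding continuous_on_def
  proof
    fix t :: real assume t: "t \<in> {0..}"
    have "at t within {0..} = at t within {0..t + 1}"
      by (rule at_within_nhd[of _ "{..<t + 1}"]) (use t in auto)
    moreover have "continuous_on {0..t + 1} (diffusion 0 c)"
      by (rule diffusion_cont[OF adm]) (use \<rho> in auto)
    then have "(diffusion 0 c \<longlongrightarrow> diffusion 0 c t) (at t within {0..t + 1})"
      unfolding continuous_on_def by (rule bspec) (use t in auto)
    ultimately show "(diffusion 0 c \<longlongrightarrow> diffusion 0 c t) (at t within {0..})" by (simp only:)
  qed
  show "continuous_on {0<..} (\<lambda>t. velocity t k)" for k
  proof -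
    have "continuous_on {0..} (\<lambda>t. - diffusion 0 c t * ((\<kappa> k)\<^sup>2 * c t k) + forcing 0 c t k)"
      by (rule continuous_on_add[OF continuous_on_mult[OF continuous_on_minus[OF A] second_order_coord_cont]
            ell2_cont_coord[OF source_ell2_cont]])
    moreover have "- diffusion 0 c t * ((\<kappa> k)\<^sup>2 * c t k) + forcing 0 c t k = velocity t k" for t
      by (simp add: velocity_def)
    ultimately have "continuous_on {0..} (\<lambda>t. velocity t k)" by simp
    then show ?thesis by (rule continuous_on_subset) auto
  qed
  fix t e :: real assume t: "t \<in> {0<..}" and e: "0 < e"
  obtain K1 d1 where 1: "d1 > 0" "\<And>s N. \<bar>s - t\<bar> < d1 \<Longrightarrow> (\<Sum>k=K1..<N. ((\<kappa> k)\<^sup>2 * c s k)\<^sup>2) \<le> e / (4 * M\<^sup>2)"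
  proof -
    have "0 < t" "0 < e / (4 * M\<^sup>2)" using t e M_pos by auto
    from second_order_near_interior[OF this] show thesis using that by blast
  qed
  obtain K2 d2 where 2: "d2 > 0" "\<And>s N. s \<in> {0..} \<Longrightarrow> \<bar>s - t\<bar> < d2 \<Longrightarrow> (\<Sum>k=K2..<N. (forcing 0 c s k)\<^sup>2) \<le> e / 4"
  proof -
    have "t \<in> {0..}" "0 < e / 4" using t e by auto
    from ell2_cont_nearD[OF source_ell2_cont this] show thesis using that by blast
  qed
  define K where "K = max K1 K2"
  have "(\<Sum>k=K..<N. (velocity s k)\<^sup>2) \<le> e" if s: "0 < s" "\<bar>s - t\<bar> < min d1 d2" for s N
  proof -
    have near: "\<bar>s - t\<bar> < d1" "\<bar>s - t\<bar> < d2" "s \<in> {0..}" using s by auto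
    have A: "0 \<le> diffusion 0 c s" "diffusion 0 c s \<le> M"
      using diffusion_range[OF adm, of 0 s s] s \<rho> m_pos by auto
    have "(\<Sum>k=K..<N. (velocity s k)\<^sup>2) \<le> (\<Sum>k=K..<N. 2 * M\<^sup>2 * ((\<kappa> k)\<^sup>2 * c s k)\<^sup>2 + 2 * (forcing 0 c s k)\<^sup>2)"
    proof (rule sum_mono)
      fix k
      have "(velocity s k)\<^sup>2 \<le> 2 * (diffusion 0 c s * ((\<kappa> k)\<^sup>2 * c s k))\<^sup>2 + 2 * (forcing 0 c s k)\<^sup>2"
        using power2_add_le[of "- (\<kappa> k)\<^sup>2 * diffusion 0 c s * c s k" "forcing 0 c s k"]
        by (simp add: velocity_def mult_ac)
      also have "(diffusion 0 c s * ((\<kappa> k)\<^sup>2 * c s k))\<^sup>2 \<le> M\<^sup>2 * ((\<kappa> k)\<^sup>2 * c s k)\<^sup>2"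
        unfolding power_mult_distrib[of "diffusion 0 c s"] using A by (intro mult_right_mono power_mono) auto
      finally show "(velocity s k)\<^sup>2 \<le> 2 * M\<^sup>2 * ((\<kappa> k)\<^sup>2 * c s k)\<^sup>2 + 2 * (forcing 0 c s k)\<^sup>2" by simp
    qed
    also have "\<dots> = 2 * M\<^sup>2 * (\<Sum>k=K..<N. ((\<kappa> k)\<^sup>2 * c s k)\<^sup>2) + 2 * (\<Sum>k=K..<N. (forcing 0 c s k)\<^sup>2)"
      by (simp only: sum.distrib sum_distrib_left)
    also have "\<dots> \<le> 2 * M\<^sup>2 * (e / (4 * M\<^sup>2)) + 2 * (e / 4)"
    proof (intro add_mono mult_left_mono)
      have "(\<Sum>k=K..<N. ((\<kappa> k)\<^sup>2 * c s k)\<^sup>2) \<le> (\<Sum>k=K1..<N. ((\<kappa> k)\<^sup>2 * c s k)\<^sup>2)"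
        by (rule sum_mono2) (auto simp: K_def)
      then show "(\<Sum>k=K..<N. ((\<kappa> k)\<^sup>2 * c s k)\<^sup>2) \<le> e / (4 * M\<^sup>2)"
        using 1(2)[OF near(1), of N] by (rule order_trans)
      have "(\<Sum>k=K..<N. (forcing 0 c s k)\<^sup>2) \<le> (\<Sum>k=K2..<N. (forcing 0 c s k)\<^sup>2)"
        by (rule sum_mono2) (auto simp: K_def)
      then show "(\<Sum>k=K..<N. (forcing 0 c s k)\<^sup>2) \<le> e / 4"
        using 2(2)[OF near(3,2), of N] by (rule order_trans)
    qed auto
    also have "\<dots> = e" using M_pos by simp
    finally show ?thesis .
  qed
  then show "\<exists>K. \<exists>d>0. \<forall>s\<in>{0<..}. \<bar>s - t\<bar> < d \<longrightarrow> (\<forall>N. (\<Sum>k=K..<N. (velocity s k)\<^sup>2) \<le> e)"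
    using 1(1) 2(1) by (intro exI[of _ K] exI[of _ "min d1 d2"]) auto
qed

text \<open>The coordinatewise derivative is a derivative in norm because it is continuous in norm. To avoid vector-valued
  integration the mean value theorem is applied to the inner product of the curve with the error vector itself.\<close>
lemma velocity_derivative:
  assumes t: "0 < t"
  shows "((\<lambda>h. ell2_norm (\<lambda>k. (c (t + h) k - c t k) / h - velocity t k)) \<longlongrightarrow> 0) (at 0)"
proof -
  have vel: "((\<lambda>s. c s k) has_real_derivative velocity s k) (at s)" if "0 < s" for s k
    unfolding velocity_def using sol[of "s + 1"] that by (auto simp: lin_sol_def)
  have vm: "velocity s \<in> ell2" if "0 < s" for s using velocity_cont that by (auto simp: ell2_cont_def)
  have mem: "eventually (\<lambda>h. (\<lambda>k. (c (t + h) k - c t k) / h - velocity t k) \<in> ell2) (at 0)"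
  proof (rule eventually_mono)
    show "eventually (\<lambda>h. t + h > 0) (at 0)"
      using order_tendstoD(1)[OF tendsto_add[OF tendsto_const[of t] tendsto_ident_at[of 0 UNIV]], of 0] t by simp
    fix h assume "t + h > 0"
    then have "c (t + h) \<in> ell2" "c t \<in> ell2" using t \<rho> by (auto intro!: X1_ell2 c_X1)
    from ell2_diff(1)[OF ell2_scale(1)[OF ell2_diff(1)[OF this], of "1 / h"] vm[OF t]]
    show "(\<lambda>k. (c (t + h) k - c t k) / h - velocity t k) \<in> ell2" by simp
  qed
  show ?thesis
  proof (subst tendsto_ell2_norm_iff[OF mem], intro allI impI)
    fix e :: real assume e: "0 < e"
    have "((\<lambda>s. ell2_norm (\<lambda>k. velocity s k - velocity t k)) \<longlongrightarrow> 0) (at t within {0<..})"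
      using velocity_cont t by (auto simp: ell2_cont_def)
    moreover have "eventually (\<lambda>s. (\<lambda>k. velocity s k - velocity t k) \<in> ell2) (at t within {0<..})"
      by (rule eventually_mono[OF eventually_in_within]) (use vm t in \<open>auto intro: ell2_diff\<close>)
    ultimately have "eventually (\<lambda>s. \<forall>N. (\<Sum>k<N. (velocity s k - velocity t k)\<^sup>2) \<le> e) (at t within {0<..})"
      using e by (simp add: tendsto_ell2_norm_iff)
    then obtain d where d: "0 < d" "\<And>s N. 0 < s \<Longrightarrow> s \<noteq> t \<Longrightarrow> \<bar>s - t\<bar> < d \<Longrightarrow> (\<Sum>k<N. (velocity s k - velocity t k)\<^sup>2) \<le> e"
      unfolding eventually_at dist_real_def by auto
    have "(\<Sum>k<N. ((c (t + h) k - c t k) / h - velocity t k)\<^sup>2) \<le> e"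
      if h: "h \<noteq> 0" "\<bar>h\<bar> < min d t" for h N
    proof -
      define z where "z k = (c (t + h) k - c t k) / h - velocity t k" for k
      let ?\<psi> = "\<lambda>s. \<Sum>k<N. z k * (c s k - s * velocity t k)"
      have D: "(?\<psi> has_real_derivative (\<Sum>k<N. z k * (velocity s k - velocity t k))) (at s)" if "0 < s" for s
        by (auto intro!: derivative_eq_intros vel that sum.cong simp: algebra_simps)
      obtain \<xi> where \<xi>: "min t (t + h) < \<xi>" "\<xi> < max t (t + h)"
        and mv: "?\<psi> (t + h) - ?\<psi> t = h * (\<Sum>k<N. z k * (velocity \<xi> k - velocity t k))"
      proof (cases "0 < h")
        case True
        then show thesis
          using MVT2[of t "t + h" ?\<psi>, OF _ D] t that by auto
      next
        case False
        then have "t + h < t" using h by auto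
        have "\<exists>\<xi>>t + h. \<xi> < t \<and> ?\<psi> t - ?\<psi> (t + h) = (t - (t + h)) * (\<Sum>k<N. z k * (velocity \<xi> k - velocity t k))"
          by (rule MVT2[OF \<open>t + h < t\<close>], rule D) (use h in auto)
        then obtain \<xi> where "t + h < \<xi>" "\<xi> < t"
          "?\<psi> t - ?\<psi> (t + h) = (t - (t + h)) * (\<Sum>k<N. z k * (velocity \<xi> k - velocity t k))" by blast
        then show thesis using that[of \<xi>] \<open>t + h < t\<close> by auto
      qed
      have "?\<psi> (t + h) - ?\<psi> t = (\<Sum>k<N. z k * (c (t + h) k - c t k - h * velocity t k))"
        by (simp add: sum_subtractf[symmetric] algebra_simps)
      also have "\<dots> = (\<Sum>k<N. h * (z k)\<^sup>2)"
      proof (rule sum.cong)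
        fix k
        have "c (t + h) k - c t k - h * velocity t k = h * z k" using h by (simp add: z_def field_simps)
        then show "z k * (c (t + h) k - c t k - h * velocity t k) = h * (z k)\<^sup>2"
          by (simp add: power2_eq_square)
      qed simp
      also have "\<dots> = h * (\<Sum>k<N. (z k)\<^sup>2)" by (simp only: sum_distrib_left)
      finally have "(\<Sum>k<N. (z k)\<^sup>2) = (\<Sum>k<N. z k * (velocity \<xi> k - velocity t k))" using mv h by simp
      then have "(\<Sum>k<N. (z k)\<^sup>2) \<le> (\<Sum>k<N. (velocity \<xi> k - velocity t k)\<^sup>2)" by (rule sum_square_cauchy_schwarz)
      also have "\<dots> \<le> e" by (rule d(2)) (use \<xi> h t in \<open>auto simp: min_def max_def split: if_splits\<close>)
      finally show ?thesis by (simp add: z_def)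
    qed
    then show "eventually (\<lambda>h. \<forall>N. (\<Sum>k<N. ((c (t + h) k - c t k) / h - velocity t k)\<^sup>2) \<le> e) (at 0)"
      unfolding eventually_at dist_real_def using d(1) t by (intro exI[of _ "min d t"]) auto
  qed
qed

end

theorem nonlocal_strong_solution:
  obtains c dc where "X1_cont {-\<rho>..} c" "\<And>t. t \<in> {-\<rho>..0} \<Longrightarrow> c t = q t"
    "ell2_cont {0<..} (\<lambda>t k. (\<kappa> k)\<^sup>2 * c t k)"
    "(\<lambda>k. (\<kappa> k)\<^sup>2 * q 0 k) \<in> ell2 \<Longrightarrow> ell2_cont {0..} (\<lambda>t k. (\<kappa> k)\<^sup>2 * c t k)"
    "ell2_cont {0<..} dc"
    "\<And>t. 0 < t \<Longrightarrow> ((\<lambda>h. ell2_norm (\<lambda>k. (c (t + h) k - c t k) / h - dc t k)) \<longlongrightarrow> 0) (at 0)"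
    "\<And>t k. dc t k = - (\<kappa> k)\<^sup>2 * al (c t) * c t k + F (c t) k + \<gamma> * c (t - \<rho>) k"
proof -
  obtain c where c: "admissible c" "\<And>T. lin_sol T (diffusion 0 c) (forcing 0 c) c"
    using nonlocal_solution_exists by blast
  show thesis
  proof (rule that[of c "velocity c"])
    show "X1_cont {-\<rho>..} c" "\<And>t. t \<in> {-\<rho>..0} \<Longrightarrow> c t = q t" using c(1) by (auto simp: admissible_def)
    show "velocity c t k = - (\<kappa> k)\<^sup>2 * al (c t) * c t k + F (c t) k + \<gamma> * c (t - \<rho>) k" for t k
      by (simp add: velocity_def[OF c] diffusion_def forcing_def)
  qed (use second_order_cont[OF c] second_order_cont_smooth[OF c] velocity_cont[OF c] velocity_derivative[OF c] in auto)
qed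

end

section \<open>The space of square-integrable functions on the unit interval\<close>

lemma finite_measure_leb01: "finite_measure leb01"
  by (rule finite_measureI) (simp add: emeasure_restrict_space)

interpretation leb01: finite_measure leb01
  by (rule finite_measure_leb01)

lemma measure_leb01: "measure leb01 (space leb01) = 1"
  by (simp add: measure_restrict_space)

lemma L2_measurable [measurable_dest]: "u \<in> L2 \<Longrightarrow> u \<in> borel_measurable leb01"
  by (simp add: L2_def)

lemma L2_square_integrable: "u \<in> L2 \<Longrightarrow> integrable leb01 (\<lambda>x. (u x)\<^sup>2)"
  by (simp add: L2_def)

definition L2_inner :: "(real \<Rightarrow> real) \<Rightarrow> (real \<Rightarrow> real) \<Rightarrow> real" where
  "L2_inner u v = (LINT x|leb01. u x * v x)"

lemma L2_mult_integrable:
  assumes "u \<in> L2" "v \<in> L2"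
  shows "integrable leb01 (\<lambda>x. u x * v x)"
proof (rule Bochner_Integration.integrable_bound)
  show "integrable leb01 (\<lambda>x. (u x)\<^sup>2 + (v x)\<^sup>2)"
    using assms by (intro Bochner_Integration.integrable_add L2_square_integrable)
  show "(\<lambda>x. u x * v x) \<in> borel_measurable leb01" using assms by measurable
  show "AE x in leb01. norm (u x * v x) \<le> norm ((u x)\<^sup>2 + (v x)\<^sup>2)"
  proof (rule AE_I2)
    fix x
    have "2 * \<bar>u x * v x\<bar> \<le> (u x)\<^sup>2 + (v x)\<^sup>2"
      using zero_le_power2[of "\<bar>u x\<bar> - \<bar>v x\<bar>"] by (simp add: power2_diff abs_mult)
    then have "\<bar>u x * v x\<bar> \<le> (u x)\<^sup>2 + (v x)\<^sup>2" by linarith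
    then show "norm (u x * v x) \<le> norm ((u x)\<^sup>2 + (v x)\<^sup>2)" by simp
  qed
qed

lemma bounded_L2:
  assumes "u \<in> borel_measurable leb01" "\<And>x. 0 < x \<Longrightarrow> x < 1 \<Longrightarrow> \<bar>u x\<bar> \<le> B" "0 \<le> B"
  shows "u \<in> L2" and "L2_norm u \<le> B"
proof -
  have b: "(u x)\<^sup>2 \<le> B\<^sup>2" if "0 < x" "x < 1" for x
    using assms(2)[OF that] assms(3) abs_le_square_iff[of "u x" B] by simp
  have i: "integrable leb01 (\<lambda>x. (u x)\<^sup>2)"
    by (rule leb01.integrable_const_bound[where B = "B\<^sup>2"]) (use assms b in \<open>auto intro!: AE_I2\<close>)
  then show "u \<in> L2" using assms(1) by (simp add: L2_def)
  have "(LINT x|leb01. (u x)\<^sup>2) \<le> (LINT x|leb01. B\<^sup>2)"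
    by (rule integral_mono[OF i]) (use b in auto)
  also have "\<dots> = B\<^sup>2" using measure_leb01 by simp
  finally show "L2_norm u \<le> B" unfolding L2_norm_def using assms(3) by (rule real_le_lsqrt[rotated])
qed

lemma continuous_measurable_leb01: "continuous_on {0<..<1} u \<Longrightarrow> (u :: real \<Rightarrow> real) \<in> borel_measurable leb01"
  by (rule continuous_imp_measurable_on_sets_lebesgue) auto

lemma continuous_L2:
  assumes "continuous_on {0..1} u"
  shows "u \<in> L2"
proof -
  have "bounded (u ` {0..1})"
    by (rule compact_imp_bounded[OF compact_continuous_image[OF assms]]) simp
  then obtain B where B: "\<forall>x\<in>{0..1}. \<bar>u x\<bar> \<le> B" by (auto simp: bounded_iff)
  have "0 \<le> B" using bspec[OF B, of 0] by auto
  show ?thesis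
    by (rule bounded_L2(1)[OF continuous_measurable_leb01 _ \<open>0 \<le> B\<close>])
      (use B in \<open>auto intro: continuous_on_subset[OF assms]\<close>)
qed

lemma L2_add: "u \<in> L2 \<Longrightarrow> v \<in> L2 \<Longrightarrow> (\<lambda>x. u x + v x) \<in> L2"
proof -
  assume uv: "u \<in> L2" "v \<in> L2"
  have "integrable leb01 (\<lambda>x. (u x)\<^sup>2 + 2 * (u x * v x) + (v x)\<^sup>2)"
    using uv by (intro Bochner_Integration.integrable_add L2_square_integrable integrable_mult_right L2_mult_integrable)
  then have "integrable leb01 (\<lambda>x. (u x + v x)\<^sup>2)" by (simp add: power2_sum algebra_simps)
  then show ?thesis using uv unfolding L2_def by auto
qed

lemma L2_scale: "u \<in> L2 \<Longrightarrow> (\<lambda>x. r * u x) \<in> L2"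
  unfolding L2_def by (auto simp: power_mult_distrib)

lemma L2_diff: "u \<in> L2 \<Longrightarrow> v \<in> L2 \<Longrightarrow> (\<lambda>x. u x - v x) \<in> L2"
  using L2_add[of u "\<lambda>x. (-1) * v x"] L2_scale[of v "-1"] by simp

lemma L2_zero: "(\<lambda>x. 0) \<in> L2"
  by (simp add: L2_def)

lemma L2_sum: "(\<And>i. i \<in> I \<Longrightarrow> u i \<in> L2) \<Longrightarrow> (\<lambda>x. \<Sum>i\<in>I. u i x) \<in> L2"
  by (induction I rule: infinite_finite_induct) (auto intro: L2_add L2_zero)

lemma L2_norm_nonneg: "0 \<le> L2_norm u"
  by (simp add: L2_norm_def)

lemma L2_norm_sq: "(L2_norm u)\<^sup>2 = (LINT x|leb01. (u x)\<^sup>2)"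
  by (simp add: L2_norm_def)

lemma L2_norm_sq_inner: "(L2_norm u)\<^sup>2 = L2_inner u u"
  unfolding L2_norm_sq L2_inner_def by (simp add: power2_eq_square)

lemma L2_inner_commute: "L2_inner u v = L2_inner v u"
  by (simp add: L2_inner_def mult.commute)

lemma L2_inner_add: "u \<in> L2 \<Longrightarrow> v \<in> L2 \<Longrightarrow> w \<in> L2 \<Longrightarrow> L2_inner (\<lambda>x. u x + v x) w = L2_inner u w + L2_inner v w"
  by (simp add: L2_inner_def distrib_right Bochner_Integration.integral_add L2_mult_integrable)

lemma L2_inner_diff: "u \<in> L2 \<Longrightarrow> v \<in> L2 \<Longrightarrow> w \<in> L2 \<Longrightarrow> L2_inner (\<lambda>x. u x - v x) w = L2_inner u w - L2_inner v w"
  by (simp add: L2_inner_def left_diff_distrib Bochner_Integration.integral_diff L2_mult_integrable)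

lemma L2_inner_scale: "L2_inner (\<lambda>x. r * u x) w = r * L2_inner u w"
  by (simp add: L2_inner_def mult.assoc)

lemma L2_inner_sum:
  "(\<And>i. i \<in> I \<Longrightarrow> u i \<in> L2) \<Longrightarrow> w \<in> L2 \<Longrightarrow> L2_inner (\<lambda>x. \<Sum>i\<in>I. u i x) w = (\<Sum>i\<in>I. L2_inner (u i) w)"
  by (simp add: L2_inner_def sum_distrib_right Bochner_Integration.integral_sum L2_mult_integrable)

lemma L2_norm_minus_commute: "L2_norm (\<lambda>x. u x - v x) = L2_norm (\<lambda>x. v x - u x)"
  by (simp add: L2_norm_def power2_commute)

lemma L2_cauchy_schwarz:
  assumes "u \<in> L2" "v \<in> L2"
  shows "\<bar>L2_inner u v\<bar> \<le> L2_norm u * L2_norm v"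
proof -
  have q: "0 \<le> (L2_norm u)\<^sup>2 - 2 * t * L2_inner u v + t\<^sup>2 * (L2_norm v)\<^sup>2" for t
  proof -
    have "0 \<le> (L2_norm (\<lambda>x. u x - t * v x))\<^sup>2" by simp
    also have "\<dots> = L2_inner u u - 2 * t * L2_inner u v + t\<^sup>2 * L2_inner v v"
    proof -
      have d: "(\<lambda>x. u x - t * v x) \<in> L2" by (intro L2_diff L2_scale assms)
      have r: "L2_inner w (\<lambda>x. u x - t * v x) = L2_inner w u - t * L2_inner w v" if "w \<in> L2" for w
        using L2_inner_diff[OF assms(1) L2_scale[OF assms(2), of t] that] L2_inner_scale[of t v w]
        by (simp add: L2_inner_commute[of w])
      have "L2_inner (\<lambda>x. u x - t * v x) (\<lambda>x. u x - t * v x)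
          = (L2_inner u u - t * L2_inner u v) - t * (L2_inner v u - t * L2_inner v v)"
        using L2_inner_diff[OF assms(1) L2_scale[OF assms(2), of t] d] L2_inner_scale[of t v]
          r[OF assms(1)] r[OF assms(2)] by simp
      then show ?thesis unfolding L2_norm_sq_inner L2_inner_commute[of v u]
        by (simp add: power2_eq_square algebra_simps)
    qed
    finally show ?thesis by (simp add: L2_norm_sq_inner)
  qed
  show ?thesis
  proof (cases "L2_norm v = 0")
    case True
    have "L2_inner u v = 0"
    proof (rule ccontr)
      assume a: "L2_inner u v \<noteq> 0"
      \<comment> \<open>a multiple for which the quadratic expression, now affine in \<open>t\<close>, equals \<open>- 1\<close>\<close>
      from q[of "((L2_norm u)\<^sup>2 + 1) / (2 * L2_inner u v)"] a True show False by simp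
    qed
    then show ?thesis using True by simp
  next
    case False
    have "0 \<le> (L2_norm u)\<^sup>2 - (L2_inner u v)\<^sup>2 / (L2_norm v)\<^sup>2"
      using q[of "L2_inner u v / (L2_norm v)\<^sup>2"] False by (simp add: power2_eq_square field_simps)
    then have "(L2_inner u v)\<^sup>2 \<le> (L2_norm u * L2_norm v)\<^sup>2"
      using False by (simp add: field_simps power_mult_distrib)
    then show ?thesis using L2_norm_nonneg[of u] L2_norm_nonneg[of v] abs_le_square_iff[of "L2_inner u v" "L2_norm u * L2_norm v"] by simp
  qed
qed

lemma L2_triangle:
  assumes "u \<in> L2" "v \<in> L2"
  shows "L2_norm (\<lambda>x. u x + v x) \<le> L2_norm u + L2_norm v"
proof (rule power2_le_imp_le)
  have "(L2_norm (\<lambda>x. u x + v x))\<^sup>2 = (L2_norm u)\<^sup>2 + 2 * L2_inner u v + (L2_norm v)\<^sup>2"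
  proof -
    have s: "(\<lambda>x. u x + v x) \<in> L2" by (rule L2_add[OF assms])
    have r: "L2_inner w (\<lambda>x. u x + v x) = L2_inner w u + L2_inner w v" if "w \<in> L2" for w
      using L2_inner_add[OF assms that] by (simp add: L2_inner_commute[of w])
    show ?thesis
      unfolding L2_norm_sq_inner using L2_inner_add[OF assms s] r[OF assms(1)] r[OF assms(2)] L2_inner_commute[of v u] by simp
  qed
  also have "\<dots> \<le> (L2_norm u + L2_norm v)\<^sup>2"
    using L2_cauchy_schwarz[OF assms] by (simp add: power2_sum)
  finally show "(L2_norm (\<lambda>x. u x + v x))\<^sup>2 \<le> (L2_norm u + L2_norm v)\<^sup>2" .
qed (simp add: L2_norm_nonneg)

lemma L2_triangle_diff:
  assumes "u \<in> L2" "v \<in> L2" "w \<in> L2"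
  shows "L2_norm (\<lambda>x. u x - w x) \<le> L2_norm (\<lambda>x. u x - v x) + L2_norm (\<lambda>x. v x - w x)"
  using L2_triangle[OF L2_diff[OF assms(1,2)] L2_diff[OF assms(2,3)]] by simp

lemma L2_norm_cong_AE:
  assumes "u \<in> borel_measurable leb01" "v \<in> borel_measurable leb01" "AE x in leb01. u x = v x"
  shows "L2_norm u = L2_norm v"
proof -
  have "(LINT x|leb01. (u x)\<^sup>2) = (LINT x|leb01. (v x)\<^sup>2)"
    by (rule integral_cong_AE) (use assms in auto)
  then show ?thesis by (simp add: L2_norm_def)
qed

lemma L2_inner_tendsto:
  assumes "\<And>n. u n \<in> L2" "w \<in> L2" "v \<in> L2" "(\<lambda>n. L2_norm (\<lambda>x. u n x - w x)) \<longlonglongrightarrow> 0"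
  shows "(\<lambda>n. L2_inner (u n) v) \<longlonglongrightarrow> L2_inner w v"
proof (subst Lim_null, rule Lim_null_comparison)
  show "eventually (\<lambda>n. norm (L2_inner (u n) v - L2_inner w v) \<le> L2_norm (\<lambda>x. u n x - w x) * L2_norm v) sequentially"
    using L2_cauchy_schwarz[OF L2_diff[OF assms(1,2)] assms(3)] L2_inner_diff[OF assms(1,2,3)] by simp
  show "(\<lambda>n. L2_norm (\<lambda>x. u n x - w x) * L2_norm v) \<longlonglongrightarrow> 0"
    using tendsto_mult_right[OF assms(4), of "L2_norm v"] by simp
qed

lemma L1_le_L2:
  assumes "u \<in> L2" shows "(LINT x|leb01. \<bar>u x\<bar>) \<le> L2_norm u"
proof -
  have a: "(\<lambda>x. \<bar>u x\<bar>) \<in> L2" using assms by (auto simp: L2_def)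
  have one: "(\<lambda>x. 1) \<in> L2" "L2_norm (\<lambda>x. 1) = 1"
    using measure_leb01 by (auto simp: L2_def L2_norm_def)
  have "L2_norm (\<lambda>x. \<bar>u x\<bar>) = L2_norm u" by (simp add: L2_norm_def)
  then show ?thesis using L2_cauchy_schwarz[OF a one(1)] one(2) by (simp add: L2_inner_def)
qed

lemma L2_integrable: "u \<in> L2 \<Longrightarrow> integrable leb01 u"
  using L2_mult_integrable[of u "\<lambda>x. 1"] by (simp add: L2_def)

text \<open>Along a subsequence with geometrically decreasing increments the sum of the absolute increments
  is integrable, hence finite almost everywhere; the limit is then identified in norm by Fatou's lemma.\<close>
lemma L2_complete:
  assumes s: "\<And>n. s n \<in> L2"
    and cauchy: "\<And>e. 0 < e \<Longrightarrow> \<exists>N. \<forall>a\<ge>N. \<forall>b\<ge>N. L2_norm (\<lambda>x. s a x - s b x) < e"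
  obtains u where "u \<in> L2" "(\<lambda>n. L2_norm (\<lambda>x. s n x - u x)) \<longlonglongrightarrow> 0"
proof -
  have "\<exists>N. \<forall>a\<ge>N. \<forall>b\<ge>N. L2_norm (\<lambda>x. s a x - s b x) < (1/2)^j" for j :: nat
    by (rule cauchy) simp
  then obtain N0 where N0: "\<And>j a b. a \<ge> N0 j \<Longrightarrow> b \<ge> N0 j \<Longrightarrow> L2_norm (\<lambda>x. s a x - s b x) < (1/2)^j" by metis
  \<comment> \<open>summing the thresholds makes the index monotone, and adding \<open>j\<close> makes it unbounded\<close>
  define r where "r j = (\<Sum>i\<le>j. N0 i) + j" for j
  have rN: "N0 j \<le> r j" "r j \<le> r (Suc j)" for j
    unfolding r_def using member_le_sum[of j "{..j}" N0] by auto
  have rj: "j \<le> r j" for j by (simp add: r_def)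
  define d where "d j x = s (r (Suc j)) x - s (r j) x" for j x
  have dL: "d j \<in> L2" for j unfolding d_def by (intro L2_diff s)
  have dn: "L2_norm (d j) < (1/2)^j" for j
    unfolding d_def by (rule N0) (use rN order_trans in blast)+
  have AEsum: "AE x in leb01. summable (\<lambda>j. \<bar>d j x\<bar>)"
  proof -
    have [measurable]: "d j \<in> borel_measurable leb01" for j using dL by measurable
    have "(\<integral>\<^sup>+x. (\<Sum>j. ennreal \<bar>d j x\<bar>) \<partial>leb01) = (\<Sum>j. \<integral>\<^sup>+x. ennreal \<bar>d j x\<bar> \<partial>leb01)"
      by (rule nn_integral_suminf) measurable
    also have "\<dots> \<le> (\<Sum>j. ennreal ((1/2)^j))"
    proof (rule suminf_le)
      fix j
      have "(\<integral>\<^sup>+x. ennreal \<bar>d j x\<bar> \<partial>leb01) = ennreal (LINT x|leb01. \<bar>d j x\<bar>)"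
        by (rule nn_integral_eq_integral) (use L2_integrable[OF dL] in auto)
      also have "\<dots> \<le> ennreal ((1/2)^j)" using L1_le_L2[OF dL, of j] dn[of j] by (intro ennreal_leI) linarith
      finally show "(\<integral>\<^sup>+x. ennreal \<bar>d j x\<bar> \<partial>leb01) \<le> ennreal ((1/2)^j)" .
    qed auto
    also have "\<dots> = ennreal (\<Sum>j. (1/2)^j)" by (intro suminf_ennreal2) (auto intro: summable_geometric)
    also have "\<dots> < \<infinity>" by simp
    finally have "AE x in leb01. (\<Sum>j. ennreal \<bar>d j x\<bar>) \<noteq> \<infinity>"
      by (intro nn_integral_PInf_AE) auto
    then show ?thesis by eventually_elim (rule summable_suminf_not_top, auto)
  qed
  define u where "u x = lim (\<lambda>j. s (r j) x)" for x
  have [measurable]: "s n \<in> borel_measurable leb01" for n using s by measurable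
  have um [measurable]: "u \<in> borel_measurable leb01" unfolding u_def by measurable
  have conv: "AE x in leb01. (\<lambda>j. s (r j) x) \<longlonglongrightarrow> u x"
    using AEsum
  proof eventually_elim
    case (elim x)
    have "summable (\<lambda>j. d j x)" by (rule summable_rabs_cancel[OF elim])
    then have "(\<lambda>n. \<Sum>j<n. d j x) \<longlonglongrightarrow> (\<Sum>j. d j x)" by (rule summable_LIMSEQ)
    moreover have "(\<Sum>j<n. d j x) = s (r n) x - s (r 0) x" for n
      unfolding d_def by (rule sum_lessThan_telescope)
    ultimately have "(\<lambda>n. s (r n) x - s (r 0) x + s (r 0) x) \<longlonglongrightarrow> (\<Sum>j. d j x) + s (r 0) x"
      by (intro tendsto_add tendsto_const) simp
    then have "(\<lambda>n. s (r n) x) \<longlonglongrightarrow> (\<Sum>j. d j x) + s (r 0) x" by simp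
    then show ?case unfolding u_def by (simp add: limI)
  qed
  have close: "integrable leb01 (\<lambda>x. (s a x - u x)\<^sup>2) \<and> (LINT x|leb01. (s a x - u x)\<^sup>2) \<le> e\<^sup>2"
    if a: "\<And>b. b \<ge> N \<Longrightarrow> L2_norm (\<lambda>x. s a x - s b x) \<le> e" and "0 \<le> e" for a e N
  proof -
    have "(\<integral>\<^sup>+x. ennreal ((s a x - u x)\<^sup>2) \<partial>leb01) = (\<integral>\<^sup>+x. liminf (\<lambda>j. ennreal ((s a x - s (r j) x)\<^sup>2)) \<partial>leb01)"
    proof (rule nn_integral_cong_AE)
      show "AE x in leb01. ennreal ((s a x - u x)\<^sup>2) = liminf (\<lambda>j. ennreal ((s a x - s (r j) x)\<^sup>2))"
        using conv
      proof eventually_elim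
        case (elim x)
        have "(\<lambda>j. ennreal ((s a x - s (r j) x)\<^sup>2)) \<longlonglongrightarrow> ennreal ((s a x - u x)\<^sup>2)"
          by (intro tendsto_ennrealI tendsto_intros elim)
        then show ?case using lim_imp_Liminf[OF trivial_limit_sequentially] by metis
      qed
    qed
    also have "\<dots> \<le> liminf (\<lambda>j. \<integral>\<^sup>+x. ennreal ((s a x - s (r j) x)\<^sup>2) \<partial>leb01)"
      by (rule nn_integral_liminf) measurable
    also have "\<dots> \<le> ennreal (e\<^sup>2)"
    proof (rule Liminf_le)
      show "eventually (\<lambda>j. (\<integral>\<^sup>+x. ennreal ((s a x - s (r j) x)\<^sup>2) \<partial>leb01) \<le> ennreal (e\<^sup>2)) sequentially"
        using eventually_ge_at_top[of N]
      proof eventually_elim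
        case (elim j)
        have "(\<integral>\<^sup>+x. ennreal ((s a x - s (r j) x)\<^sup>2) \<partial>leb01) = ennreal (LINT x|leb01. (s a x - s (r j) x)\<^sup>2)"
          by (rule nn_integral_eq_integral[OF L2_square_integrable[OF L2_diff[OF s s]]]) auto
        also have "\<dots> = ennreal ((L2_norm (\<lambda>x. s a x - s (r j) x))\<^sup>2)" by (simp add: L2_norm_sq)
        also have "\<dots> \<le> ennreal (e\<^sup>2)"
          using a[of "r j"] elim rj[of j] L2_norm_nonneg by (intro ennreal_leI power_mono) auto
        finally show ?case .
      qed
    qed simp
    finally have le: "(\<integral>\<^sup>+x. ennreal ((s a x - u x)\<^sup>2) \<partial>leb01) \<le> ennreal (e\<^sup>2)" .
    have i: "integrable leb01 (\<lambda>x. (s a x - u x)\<^sup>2)"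
      by (rule integrableI_bounded) (use le in \<open>auto simp: order_le_less_trans\<close>)
    have "ennreal (LINT x|leb01. (s a x - u x)\<^sup>2) \<le> ennreal (e\<^sup>2)"
      using le nn_integral_eq_integral[OF i] by simp
    then show ?thesis using i by (simp add: ennreal_le_iff)
  qed
  obtain N1 where N1: "\<And>a b. a \<ge> N1 \<Longrightarrow> b \<ge> N1 \<Longrightarrow> L2_norm (\<lambda>x. s a x - s b x) < 1" using cauchy[of 1] by auto
  have "(\<lambda>x. s N1 x - u x) \<in> L2"
    using close[of N1 N1 1] N1 by (auto simp: L2_def less_imp_le)
  from L2_diff[OF s[of N1] this] have uL: "u \<in> L2" by simp
  moreover have "(\<lambda>n. L2_norm (\<lambda>x. s n x - u x)) \<longlonglongrightarrow> 0"
  proof (rule LIMSEQ_I)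
    fix e :: real assume "0 < e"
    then obtain N where N: "\<And>a b. a \<ge> N \<Longrightarrow> b \<ge> N \<Longrightarrow> L2_norm (\<lambda>x. s a x - s b x) < e / 2" using cauchy[of "e/2"] by auto
    have "L2_norm (\<lambda>x. s n x - u x) < e" if "n \<ge> N" for n
    proof -
      have "(LINT x|leb01. (s n x - u x)\<^sup>2) \<le> (e/2)\<^sup>2" using close[of N n "e/2"] N[OF that] \<open>0 < e\<close> by (auto simp: less_imp_le)
      then have "L2_norm (\<lambda>x. s n x - u x) \<le> e / 2"
        unfolding L2_norm_def using \<open>0 < e\<close> by (intro real_le_lsqrt) auto
      then show ?thesis using \<open>0 < e\<close> by simp
    qed
    then show "\<exists>N. \<forall>n\<ge>N. norm (L2_norm (\<lambda>x. s n x - u x) - 0) < e"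
      using L2_norm_nonneg by (intro exI[of _ N]) auto
  qed
  ultimately show thesis by (rule that)
qed

section \<open>Smooth cutoffs and the fundamental lemma\<close>

definition smooth :: "(real \<Rightarrow> real) \<Rightarrow> bool" where
  "smooth f \<longleftrightarrow> (\<forall>n x. ((deriv ^^ n) f) field_differentiable at x)"

text \<open>Smoothness is verified by exhibiting a class of functions that is closed under differentiation.\<close>
lemma smooth_coinduct:
  assumes "f \<in> X" and step: "\<And>f. f \<in> X \<Longrightarrow> (\<forall>x. f field_differentiable at x) \<and> deriv f \<in> X"
  shows "smooth f"
proof -
  have "(deriv ^^ n) f \<in> X" for n by (induction n) (use assms in auto)
  then show ?thesis using step by (simp add: smooth_def)
qed

lemma smooth_deriv: "smooth f \<Longrightarrow> smooth (deriv f)"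
  unfolding smooth_def by (metis funpow_Suc_right o_apply)

lemma smooth_has_deriv: "smooth f \<Longrightarrow> (f has_real_derivative deriv f x) (at x)"
  unfolding smooth_def by (metis funpow_0 field_differentiable_derivI)

lemma smooth_continuous: "smooth f \<Longrightarrow> continuous_on A f"
  by (meson DERIV_isCont continuous_at_imp_continuous_on smooth_has_deriv)

lemma smooth_coinduct_deriv:
  assumes "f \<in> X" and step: "\<And>f. f \<in> X \<Longrightarrow> \<exists>f'\<in>X. \<forall>x. (f has_real_derivative f' x) (at x)"
  shows "smooth f"
proof (rule smooth_coinduct[OF assms(1)])
  fix f assume "f \<in> X"
  then obtain f' where f': "f' \<in> X" "\<And>x. (f has_real_derivative f' x) (at x)" using step by blast
  then have "deriv f = f'" by (auto intro: DERIV_imp_deriv)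
  then show "(\<forall>x. f field_differentiable at x) \<and> deriv f \<in> X"
    using f' by (auto simp: field_differentiable_def)
qed

lemma smooth_const: "smooth (\<lambda>x. c)"
  by (rule smooth_coinduct_deriv[of _ "range (\<lambda>c x. c)"]) (auto intro!: exI derivative_eq_intros)

lemma smooth_add: "smooth f \<Longrightarrow> smooth g \<Longrightarrow> smooth (\<lambda>x. f x + g x)"
proof (rule smooth_coinduct_deriv[of _ "{\<lambda>x. f x + g x | f g. smooth f \<and> smooth g}"])
  fix h assume "h \<in> {\<lambda>x. f x + g x | f g. smooth f \<and> smooth g}"
  then obtain f g where "h = (\<lambda>x. f x + g x)" "smooth f" "smooth g" by blast
  then show "\<exists>h'\<in>{\<lambda>x. f x + g x | f g. smooth f \<and> smooth g}. \<forall>x. (h has_real_derivative h' x) (at x)"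
    by (intro bexI[of _ "\<lambda>x. deriv f x + deriv g x"]) (auto intro: DERIV_add smooth_has_deriv smooth_deriv)
qed auto

text \<open>Sums of products of smooth functions form the smallest class that contains products and is closed
  under the Leibniz rule.\<close>
inductive_set smooth_products :: "(real \<Rightarrow> real) set" where
  prod: "smooth f \<Longrightarrow> smooth g \<Longrightarrow> (\<lambda>x. f x * g x) \<in> smooth_products"
| add: "p \<in> smooth_products \<Longrightarrow> q \<in> smooth_products \<Longrightarrow> (\<lambda>x. p x + q x) \<in> smooth_products"

lemma smooth_mult: "smooth f \<Longrightarrow> smooth g \<Longrightarrow> smooth (\<lambda>x. f x * g x)"
proof (rule smooth_coinduct_deriv[of _ smooth_products])
  fix h assume "h \<in> smooth_products"
  then show "\<exists>h'\<in>smooth_products. \<forall>x. (h has_real_derivative h' x) (at x)"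
  proof induction
    case (prod f g)
    then show ?case
      by (intro bexI[of _ "\<lambda>x. deriv f x * g x + deriv g x * f x"])
        (auto intro!: DERIV_mult smooth_has_deriv smooth_products.intros smooth_deriv)
  next
    case (add p q)
    then obtain p' q' where "p' \<in> smooth_products" "\<forall>x. (p has_real_derivative p' x) (at x)"
      "q' \<in> smooth_products" "\<forall>x. (q has_real_derivative q' x) (at x)" by blast
    then show ?case
      by (intro bexI[of _ "\<lambda>x. p' x + q' x"]) (auto intro!: DERIV_add smooth_products.intros)
  qed
qed (rule smooth_products.prod)

lemma smooth_affine: "smooth f \<Longrightarrow> smooth (\<lambda>x. f (a * x + b))"
proof (rule smooth_coinduct_deriv[of _ "{\<lambda>x. c * f (a * x + b) | c f. smooth f}"])
  fix h assume "h \<in> {\<lambda>x. c * f (a * x + b) | c f. smooth f}"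
  then obtain c f where h: "h = (\<lambda>x. c * f (a * x + b))" and f: "smooth f" by blast
  have "(h has_real_derivative (c * a) * deriv f (a * x + b)) (at x)" for x
    unfolding h by (auto intro!: derivative_eq_intros DERIV_chain2[OF smooth_has_deriv[OF f]])
  moreover have "(\<lambda>x. (c * a) * deriv f (a * x + b)) \<in> {\<lambda>x. c * f (a * x + b) | c f. smooth f}"
    using smooth_deriv[OF f] by blast
  ultimately show "\<exists>h'\<in>{\<lambda>x. c * f (a * x + b) | c f. smooth f}. \<forall>x. (h has_real_derivative h' x) (at x)"
    by (intro bexI[of _ "\<lambda>x. (c * a) * deriv f (a * x + b)"] allI)
next
  assume "smooth f"
  then show "(\<lambda>x. f (a * x + b)) \<in> {\<lambda>x. c * f (a * x + b) | c f. smooth f}"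
    by (intro CollectI exI[of _ 1] exI[of _ f]) auto
qed

lemma smooth_scale: "smooth f \<Longrightarrow> smooth (\<lambda>x. c * f x)"
  by (rule smooth_mult[OF smooth_const])

lemma smooth_sum: "(\<And>i. i \<in> I \<Longrightarrow> smooth (f i)) \<Longrightarrow> smooth (\<lambda>x. \<Sum>i\<in>I. f i x)"
  by (induction I rule: infinite_finite_induct) (auto intro: smooth_add smooth_const)

lemma smooth_sin_cos: "smooth (\<lambda>x. a * sin x + b * cos x)"
proof (rule smooth_coinduct_deriv[of _ "{\<lambda>x. a * sin x + b * cos x | a b. True}"])
  fix h :: "real \<Rightarrow> real" assume "h \<in> {\<lambda>x. a * sin x + b * cos x | a b. True}"
  then obtain a b where h: "h = (\<lambda>x. a * sin x + b * cos x)" by blast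
  have "(h has_real_derivative (- b) * sin x + a * cos x) (at x)" for x
    unfolding h by (auto intro!: derivative_eq_intros)
  then show "\<exists>h'\<in>{\<lambda>x. a * sin x + b * cos x | a b. True}. \<forall>x. (h has_real_derivative h' x) (at x)"
    by (intro bexI[of _ "\<lambda>x. (- b) * sin x + a * cos x"]) blast+
qed blast

lemma smooth_sin: "smooth (\<lambda>x. sin (w * x))"
  using smooth_affine[OF smooth_sin_cos[of 1 0], of w 0] by simp

text \<open>The standard smooth function that vanishes to infinite order at 0.\<close>
definition flat :: "real \<Rightarrow> real" where
  "flat x = (if 0 < x then exp (- 1 / x) else 0)"

lemma poly_exp_minus_tendsto_0: "((\<lambda>y. poly p y * exp (- y)) \<longlongrightarrow> (0::real)) at_top"
proof -
  have "((\<lambda>y. \<Sum>i\<le>degree p. coeff p i * (y ^ i / exp y)) \<longlongrightarrow> (\<Sum>i\<le>degree p. coeff p i * 0)) at_top"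
    by (intro tendsto_sum tendsto_mult tendsto_const tendsto_power_div_exp_0)
  moreover have "(\<lambda>y. \<Sum>i\<le>degree p. coeff p i * (y ^ i / exp y)) = (\<lambda>y. poly p y * exp (- y))"
    by (simp add: poly_altdef sum_distrib_right exp_minus divide_inverse mult.assoc)
  ultimately show ?thesis by simp
qed

text \<open>Derivatives of the flat function are polynomials in \<open>1 / x\<close> times the function; the exponential
  beats every such polynomial at 0, so that the one-sided pieces fit together.\<close>
lemma flat_poly_deriv:
  "((\<lambda>x. poly p (1 / x) * flat x) has_real_derivative
     poly (monom 1 2 * (p - pderiv p)) (1 / x) * flat x) (at x)"
proof -
  consider "x > 0" | "x < 0" | "x = 0" by linarith
  then show ?thesis
  proof cases
    case 1
    have "((\<lambda>x. poly p (1 / x) * exp (- 1 / x)) has_real_derivative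
       poly (pderiv p) (1 / x) * (- 1 / x\<^sup>2) * exp (- 1 / x) + (exp (- 1 / x) * (1 / x\<^sup>2)) * poly p (1 / x)) (at x)"
      using 1 by (auto intro!: derivative_eq_intros DERIV_chain2[OF poly_DERIV] simp: power2_eq_square)
    also have "poly (pderiv p) (1 / x) * (- 1 / x\<^sup>2) * exp (- 1 / x) + (exp (- 1 / x) * (1 / x\<^sup>2)) * poly p (1 / x)
        = poly (monom 1 2 * (p - pderiv p)) (1 / x) * flat x"
      using 1 by (simp add: flat_def poly_monom algebra_simps power_divide)
    finally show ?thesis
      by (rule DERIV_cong_ev[THEN iffD1, rotated 3])
        (use 1 in \<open>auto intro!: eventually_mono[OF eventually_nhds_in_open[of "{0<..}" x]] simp: flat_def\<close>)
  next
    case 2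
    have "((\<lambda>x. 0) has_real_derivative 0) (at x)" by simp
    then have "((\<lambda>x. poly p (1 / x) * flat x) has_real_derivative 0) (at x)"
      by (rule DERIV_cong_ev[THEN iffD1, rotated 3])
        (use 2 in \<open>auto intro!: eventually_mono[OF eventually_nhds_in_open[of "{..<0}" x]] simp: flat_def\<close>)
    then show ?thesis using 2 by (simp add: flat_def)
  next
    case 3
    let ?g = "\<lambda>h. poly p (1 / h) * flat h / h"
    have "((\<lambda>y. poly (pCons 0 p) y * exp (- y)) \<longlongrightarrow> 0) at_top" by (rule poly_exp_minus_tendsto_0)
    moreover have "filterlim (\<lambda>h::real. 1 / h) at_top (at_right 0)"
      using filterlim_inverse_at_top_right by (simp add: inverse_eq_divide)
    ultimately have "((\<lambda>h. poly (pCons 0 p) (1 / h) * exp (- (1 / h))) \<longlongrightarrow> 0) (at_right 0)"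
      by (rule filterlim_compose)
    then have r: "(?g \<longlongrightarrow> 0) (at_right 0)"
      by (rule Lim_transform_eventually)
        (auto simp: eventually_at_filter flat_def intro!: always_eventually)
    have l: "(?g \<longlongrightarrow> 0) (at_left 0)"
      by (rule Lim_transform_eventually[OF tendsto_const])
        (auto simp: eventually_at_filter flat_def intro!: always_eventually)
    have "(?g \<longlongrightarrow> 0) (at 0)" using l r by (rule filterlim_split_at)
    then have "((\<lambda>x. poly p (1 / x) * flat x) has_real_derivative 0) (at 0)"
      by (simp add: DERIV_def) (simp add: flat_def)
    then show ?thesis using 3 by (simp add: flat_def)
  qed
qed

lemma smooth_flat: "smooth flat"
proof (rule smooth_coinduct_deriv[of _ "range (\<lambda>p x. poly p (1 / x) * flat x)"])
  show "flat \<in> range (\<lambda>p x. poly p (1 / x) * flat x)"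
    by (rule range_eqI[of _ _ 1]) simp
  fix f assume "f \<in> range (\<lambda>p x. poly p (1 / x) * flat x)"
  then obtain p where "f = (\<lambda>x. poly p (1 / x) * flat x)" by blast
  then show "\<exists>f'\<in>range (\<lambda>p x. poly p (1 / x) * flat x). \<forall>x. (f has_real_derivative f' x) (at x)"
    by (intro bexI[of _ "\<lambda>x. poly (monom 1 2 * (p - pderiv p)) (1 / x) * flat x"])
      (use flat_poly_deriv in blast)+
qed

lemma flat_deriv: "(flat has_real_derivative (1 / x)\<^sup>2 * flat x) (at x)"
  using flat_poly_deriv[of 1 x] by (simp add: poly_monom)

lemma flat_bounds: "0 \<le> flat x" "flat x \<le> 1"
  by (auto simp: flat_def)

lemma flat_square_bound: "0 < x \<Longrightarrow> (1 / x)\<^sup>2 * flat x \<le> 2"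
proof -
  assume x: "0 < x"
  have "y\<^sup>2 * exp (- y) \<le> 2" if "0 \<le> y" for y :: real
  proof -
    have "y\<^sup>2 / 2 \<le> exp y" using exp_lower_Taylor_quadratic[OF that] that by linarith
    then show ?thesis by (simp add: exp_minus field_simps)
  qed
  from this[of "1 / x"] x have "(1 / x)\<^sup>2 * exp (- (1 / x)) \<le> 2" by simp
  then show ?thesis using x by (simp add: flat_def)
qed

text \<open>The zeros of the two factors are shifted inwards by \<open>1 / n\<close> to keep the support inside the open interval. Scaling
  the argument instead of the value makes the cutoffs tend to the indicator, without a normalised mollifier.\<close>
definition cutoff :: "real \<Rightarrow> real \<Rightarrow> nat \<Rightarrow> real \<Rightarrow> real" where
  "cutoff a b n x = flat (real n * (x - a) - 1) * flat (real n * (b - x) - 1)"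

lemma smooth_cutoff: "smooth (cutoff a b n)"
proof -
  have "smooth (\<lambda>x. flat (real n * x + (- real n * a - 1)) * flat (- real n * x + (real n * b - 1)))"
    by (intro smooth_mult smooth_affine smooth_flat)
  then show ?thesis unfolding cutoff_def[abs_def] by (simp add: algebra_simps)
qed

lemma cutoff_bounds: "0 \<le> cutoff a b n x" "cutoff a b n x \<le> 1"
  using flat_bounds by (auto simp: cutoff_def intro: mult_le_one)

lemma cutoff_eq_0: "x \<le> a + 1 / real n \<or> b - 1 / real n \<le> x \<Longrightarrow> 0 < n \<Longrightarrow> cutoff a b n x = 0"
  by (auto simp: cutoff_def flat_def field_simps)

lemma flat_scaled_tendsto:
  assumes "0 < y" shows "(\<lambda>n. flat (real n * y - 1)) \<longlonglongrightarrow> 1"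
proof -
  have top: "filterlim (\<lambda>n. real n * y - 1) at_top sequentially" using assms by real_asymp
  then have "(\<lambda>n. inverse (real n * y - 1)) \<longlonglongrightarrow> 0" by (rule tendsto_inverse_0_at_top)
  then have "(\<lambda>n. exp (- inverse (real n * y - 1))) \<longlonglongrightarrow> exp (- 0)" by (intro tendsto_intros)
  moreover have "eventually (\<lambda>n. exp (- inverse (real n * y - 1)) = flat (real n * y - 1)) sequentially"
    using filterlim_at_top_dense[THEN iffD1, OF top, rule_format, of 0]
    by eventually_elim (simp add: flat_def inverse_eq_divide)
  ultimately show ?thesis using Lim_transform_eventually by force
qed

lemma cutoff_tendsto: "(\<lambda>n. cutoff a b n x) \<longlonglongrightarrow> indicator {a<..<b} x"
proof (cases "a < x \<and> x < b")
  case True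
  then have "(\<lambda>n. cutoff a b n x) \<longlonglongrightarrow> 1 * 1"
    unfolding cutoff_def by (intro tendsto_mult flat_scaled_tendsto) auto
  then show ?thesis using True by simp
next
  case False
  have neg: "flat (real n * y - 1) = 0" if "y \<le> 0" for y n
    using mult_nonneg_nonpos[of "real n" y] that by (simp add: flat_def)
  have "cutoff a b n x = 0" for n
    using False neg[of "x - a" n] neg[of "b - x" n] unfolding cutoff_def by (cases "a < x") auto
  moreover have "indicator {a<..<b} x = (0::real)" using False by auto
  ultimately show ?thesis by simp
qed

lemma test_functionI:
  assumes "smooth \<psi>" "0 < a" "b < 1" "\<And>x. x < a \<or> b < x \<Longrightarrow> \<psi> x = 0"
  shows "\<psi> \<in> test_functions"
proof -
  have "{x. \<psi> x \<noteq> 0} \<subseteq> {a..b}" using assms(4) by force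
  then have cl: "closure {x. \<psi> x \<noteq> 0} \<subseteq> {a..b}" by (rule closure_minimal) simp
  then have "bounded (closure {x. \<psi> x \<noteq> 0})" using bounded_subset bounded_closed_interval by blast
  then have "compact (closure {x. \<psi> x \<noteq> 0})" by (simp add: compact_eq_bounded_closed)
  then show ?thesis using assms cl by (auto simp: test_functions_def smooth_def)
qed

lemma test_function_smooth: "\<psi> \<in> test_functions \<Longrightarrow> smooth \<psi>"
  by (simp add: test_functions_def smooth_def)

lemma test_function_support:
  assumes "\<psi> \<in> test_functions"
  obtains a b where "0 < a" "a < b" "b < 1" "\<And>x. x < a \<or> b < x \<Longrightarrow> \<psi> x = 0"
proof (cases "{x. \<psi> x \<noteq> 0} = {}")
  case True
  then show thesis by (intro that[of "1/3" "2/3"]) auto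
next
  case False
  let ?K = "closure {x. \<psi> x \<noteq> 0}"
  have K: "compact ?K" "?K \<subseteq> {0<..<1}" "?K \<noteq> {}" using assms False by (auto simp: test_functions_def)
  obtain s where s: "s \<in> ?K" "\<And>x. x \<in> ?K \<Longrightarrow> s \<le> x" using compact_attains_inf[OF K(1,3)] by blast
  obtain t where t: "t \<in> ?K" "\<And>x. x \<in> ?K \<Longrightarrow> x \<le> t" using compact_attains_sup[OF K(1,3)] by blast
  have "0 < s" "s \<le> t" "t < 1" using s t K(2) by auto
  moreover have "\<psi> x = 0" if "x < s \<or> t < x" for x
    using that s(2)[of x] t(2)[of x] closure_subset[of "{x. \<psi> x \<noteq> 0}"] by force
  ultimately show thesis by (intro that[of "s / 2" "(t + 1) / 2"]) auto
qed

lemma integrable_mult_bounded: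
  fixes f g :: "real \<Rightarrow> real"
  assumes g: "integrable leb01 g" and f: "f \<in> borel_measurable leb01" "\<And>x. 0 < x \<Longrightarrow> x < 1 \<Longrightarrow> \<bar>f x\<bar> \<le> B"
  shows "integrable leb01 (\<lambda>x. g x * f x)"
proof (rule Bochner_Integration.integrable_bound)
  show "integrable leb01 (\<lambda>x. B * g x)" using g by simp
  show "(\<lambda>x. g x * f x) \<in> borel_measurable leb01" using g f(1) by measurable
  show "AE x in leb01. norm (g x * f x) \<le> norm (B * g x)"
  proof (rule AE_I2)
    fix x assume "x \<in> space leb01"
    then have "\<bar>f x\<bar> \<le> B" using f(2) by simp
    then have "\<bar>f x\<bar> \<le> \<bar>B\<bar>" by linarith
    then show "norm (g x * f x) \<le> norm (B * g x)" by (simp add: abs_mult mult.commute[of "\<bar>g x\<bar>"] mult_right_mono)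
  qed
qed

text \<open>A function that annihilates the cutoffs has zero integral over every interval. The sets over which its
  integral vanishes form a Dynkin system, so they include all Borel sets and, up to null sets, all measurable ones.\<close>
lemma fundamental_lemma:
  assumes g: "integrable leb01 g" and ann: "\<And>\<psi>. \<psi> \<in> test_functions \<Longrightarrow> (LINT x|leb01. g x * \<psi> x) = 0"
  shows "AE x in leb01. g x = 0"
proof -
  let ?I = "\<lambda>A. set_lebesgue_integral leb01 A g"
  have gm: "g \<in> borel_measurable leb01" using g by (rule borel_measurable_integrable)
  have im: "(\<lambda>x. indicator A x :: real) \<in> borel_measurable leb01" if "A \<in> sets lebesgue" for A
    using that by (intro measurable_restrict_space1) simp
  have si: "set_integrable leb01 A g" if "A \<in> sets lebesgue" for A
  proof -
    have "(\<lambda>x. indicator A x :: real) \<in> borel_measurable leb01" by (rule im[OF that])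
    then show ?thesis unfolding set_integrable_def
      using integrable_mult_bounded[OF g, of "indicator A" 1] by (simp add: mult.commute indicator_le_1)
  qed
  have interval: "?I {a<..<b} = 0" for a b :: real
  proof -
    \<comment> \<open>only the part inside the unit interval counts, and test functions must be supported there\<close>
    define a' b' where "a' = max a 0" and "b' = min b 1"
    have z: "(LINT x|leb01. g x * cutoff a' b' n x) = 0" for n
    proof (cases "n = 0")
      case True
      then show ?thesis by (simp add: cutoff_def flat_def)
    next
      case False
      have "0 < 1 / real n" using False by simp
      moreover have "0 \<le> a'" "b' \<le> 1" by (auto simp: a'_def b'_def)
      ultimately have ab: "0 < a' + 1 / real n" "b' - 1 / real n < 1" by linarith+
      have "cutoff a' b' n x = 0" if "x < a' + 1 / real n \<or> b' - 1 / real n < x" for x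
        by (rule cutoff_eq_0) (use that False in auto)
      then have "cutoff a' b' n \<in> test_functions"
        by (rule test_functionI[OF smooth_cutoff ab])
      then show ?thesis by (rule ann)
    qed
    have cm: "cutoff a' b' n \<in> borel_measurable leb01" for n
      by (rule continuous_measurable_leb01[OF smooth_continuous[OF smooth_cutoff]])
    have "(\<lambda>n. LINT x|leb01. g x * cutoff a' b' n x) \<longlonglongrightarrow> (LINT x|leb01. g x * indicator {a'<..<b'} x)"
    proof (rule integral_dominated_convergence)
      show "integrable leb01 (\<lambda>x. \<bar>g x\<bar>)" using g by simp
      show "(\<lambda>x. g x * indicator {a'<..<b'} x) \<in> borel_measurable leb01"
        by (rule borel_measurable_times[OF gm im]) simp
      show "AE x in leb01. norm (g x * cutoff a' b' n x) \<le> \<bar>g x\<bar>" for n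
        using cutoff_bounds by (auto simp: abs_mult intro!: AE_I2 mult_left_le)
      show "AE x in leb01. (\<lambda>n. g x * cutoff a' b' n x) \<longlonglongrightarrow> g x * indicator {a'<..<b'} x"
        by (intro AE_I2 tendsto_mult tendsto_const cutoff_tendsto)
      show "(\<lambda>x. g x * cutoff a' b' n x) \<in> borel_measurable leb01" for n
        using g cm by measurable
    qed
    then have "(LINT x|leb01. g x * indicator {a'<..<b'} x) = 0" unfolding z by (simp add: LIMSEQ_const_iff)
    moreover have "(LINT x|leb01. g x * indicator {a'<..<b'} x) = ?I {a<..<b}"
      unfolding set_lebesgue_integral_def
      by (rule Bochner_Integration.integral_cong) (auto simp: a'_def b'_def indicator_def)
    ultimately show ?thesis by simp
  qed
  have whole: "?I UNIV = 0"
  proof -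
    have "?I UNIV = ?I {0<..<1}" unfolding set_lebesgue_integral_def
      by (rule Bochner_Integration.integral_cong) auto
    then show ?thesis using interval by simp
  qed
  have borel: "?I A = 0" if "A \<in> sets borel" for A
  proof -
    have A: "A \<in> sigma_sets UNIV (range (\<lambda>(a, b). box a b :: real set))"
      using that by (simp add: borel_eq_box)
    have sb: "sigma_sets UNIV (range (\<lambda>(a, b). box a b :: real set)) = sets borel"
      by (simp add: borel_eq_box)
    have stable: "Int_stable (range (\<lambda>(a, b). box a b :: real set))"
    proof (rule Int_stableI)
      fix A B assume "A \<in> range (\<lambda>(a, b). box a b :: real set)" "B \<in> range (\<lambda>(a, b). box a b :: real set)"
      then obtain a b c d where "A = {a<..<b}" "B = {c<..<d}" by (auto simp: box_real)
      then have "A \<inter> B = box (max a c) (min b d)" by (auto simp: box_real)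
      then show "A \<inter> B \<in> range (\<lambda>(a, b). box a b :: real set)" by auto
    qed
    have sub: "range (\<lambda>(a, b). box a b :: real set) \<subseteq> Pow UNIV" by simp
    from stable sub A show ?thesis
    proof (induct rule: sigma_sets_induct_disjoint)
      case (basic A)
      then show ?case using interval by (auto simp: box_real)
    next
      case empty
      show ?case by (simp add: set_lebesgue_integral_def)
    next
      case (compl A)
      have A: "A \<in> sets borel" using compl(1) sb by simp
      have "?I (A \<union> (UNIV - A)) = ?I A + ?I (UNIV - A)"
        by (rule set_integral_Un) (use A in \<open>auto intro!: si\<close>)
      then show ?case using compl(2) whole by (simp add: Un_commute)
    next
      case (union A)
      have A: "A i \<in> sets borel" for i using union(2) sb by auto
      have "?I (\<Union>i. {0<..<1} \<inter> A i) = (\<Sum>i. ?I ({0<..<1} \<inter> A i))"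
      proof (rule lebesgue_integral_countable_add)
        show "{0<..<1} \<inter> A i \<in> sets leb01" for i
          using A by (auto simp: sets_restrict_space)
        show "({0<..<1} \<inter> A i) \<inter> ({0<..<1} \<inter> A j) = {}" if "i \<noteq> j" for i j
          using union(1) that by (auto simp: disjoint_family_on_def)
        show "set_integrable leb01 (\<Union>i. {0<..<1} \<inter> A i) g" by (rule si) (use A in auto)
      qed
      moreover have "?I ({0<..<1} \<inter> B) = ?I B" for B unfolding set_lebesgue_integral_def
        by (rule Bochner_Integration.integral_cong) (auto simp: indicator_def)
      ultimately have "?I (\<Union>i. A i) = (\<Sum>i. ?I (A i))" by (simp add: Int_UN_distrib[symmetric] del: Int_UN_distrib UN_simps)
      then show ?case using union(3) by simp
    qed
  qed
  show ?thesis
  proof (rule leb01.density_zero[OF g])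
    fix A assume "A \<in> sets leb01"
    then obtain B where "A = {0<..<1} \<inter> B" "B \<in> sets lebesgue" by (auto simp: sets_restrict_space)
    then have Al: "A \<in> sets (completion lborel)" by auto
    then obtain S N N' where SN: "A = S \<union> N" "N \<subseteq> N'" "N' \<in> null_sets lborel" "S \<in> sets lborel"
      by (rule sets_completionE)
    have "N' \<in> null_sets lebesgue" using SN(3) by (rule null_sets_completionI)
    then have "AE x in lebesgue. x \<notin> N'" by (rule AE_not_in)
    then have "AE x in leb01. x \<notin> N'" by (auto simp: AE_restrict_space_iff elim: eventually_mono)
    then have "?I A = ?I S"
      unfolding set_lebesgue_integral_def real_scaleR_def
    proof (intro integral_cong_AE)
      show "(\<lambda>x. indicator A x * g x) \<in> borel_measurable leb01"
        by (rule borel_measurable_times[OF im gm]) (use Al in simp)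
      show "(\<lambda>x. indicator S x * g x) \<in> borel_measurable leb01"
        by (rule borel_measurable_times[OF im gm]) (use SN(4) in auto)
    qed (use SN(1,2) in \<open>auto elim!: eventually_mono simp: indicator_def\<close>)
    then show "?I A = 0" using borel[of S] SN(4) by simp
  qed
qed

section \<open>Weak derivatives and orthonormal systems\<close>

lemma is_weak_deriv_inner:
  "is_weak_deriv u v \<longleftrightarrow> (\<forall>\<psi>\<in>test_functions. L2_inner u (deriv \<psi>) = - L2_inner v \<psi>)"
  by (simp add: is_weak_deriv_def L2_inner_def)

lemma smooth_L2: "smooth f \<Longrightarrow> f \<in> L2"
  by (rule continuous_L2[OF smooth_continuous])

lemma test_function_L2: "\<psi> \<in> test_functions \<Longrightarrow> \<psi> \<in> L2" "\<psi> \<in> test_functions \<Longrightarrow> deriv \<psi> \<in> L2"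
  by (auto intro: smooth_L2 smooth_deriv test_function_smooth)

lemma is_weak_deriv_unique:
  assumes "v1 \<in> L2" "v2 \<in> L2" "is_weak_deriv u v1" "is_weak_deriv u v2"
  shows "AE x in leb01. v1 x = v2 x"
proof -
  have "AE x in leb01. v1 x - v2 x = 0"
  proof (rule fundamental_lemma)
    show "integrable leb01 (\<lambda>x. v1 x - v2 x)" by (rule L2_integrable[OF L2_diff[OF assms(1,2)]])
    fix \<psi> assume \<psi>: "\<psi> \<in> test_functions"
    then have "L2_inner v1 \<psi> = L2_inner v2 \<psi>" using assms(3,4) by (simp add: is_weak_deriv_inner)
    then show "(LINT x|leb01. (v1 x - v2 x) * \<psi> x) = 0"
      using L2_inner_diff[OF assms(1,2) test_function_L2(1)[OF \<psi>]] by (simp add: L2_inner_def)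
  qed
  then show ?thesis by simp
qed

lemma weak_deriv_props:
  assumes "u \<in> H1" shows "u \<in> L2" "weak_deriv u \<in> L2" "is_weak_deriv u (weak_deriv u)"
proof -
  have "\<exists>v. v \<in> L2 \<and> is_weak_deriv u v" using assms by (auto simp: H1_def)
  from someI_ex[OF this] show "weak_deriv u \<in> L2" "is_weak_deriv u (weak_deriv u)"
    by (simp_all add: weak_deriv_def)
  show "u \<in> L2" using assms by (simp add: H1_def)
qed

lemma H1I: "u \<in> L2 \<Longrightarrow> v \<in> L2 \<Longrightarrow> is_weak_deriv u v \<Longrightarrow> u \<in> H1"
  by (auto simp: H1_def)

lemma weak_deriv_AE:
  assumes "u \<in> L2" "v \<in> L2" "is_weak_deriv u v"
  shows "AE x in leb01. weak_deriv u x = v x"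
  using is_weak_deriv_unique[OF weak_deriv_props(2) assms(2) weak_deriv_props(3) assms(3)] H1I[OF assms] by blast

lemma L2_norm_weak_deriv:
  assumes "u \<in> L2" "v \<in> L2" "is_weak_deriv u v"
  shows "L2_norm (weak_deriv u) = L2_norm v"
  by (rule L2_norm_cong_AE[OF _ _ weak_deriv_AE[OF assms]])
    (use assms weak_deriv_props(2)[OF H1I[OF assms]] in \<open>auto simp: L2_def\<close>)

lemma is_weak_deriv_diff:
  assumes "u1 \<in> L2" "u2 \<in> L2" "v1 \<in> L2" "v2 \<in> L2" "is_weak_deriv u1 v1" "is_weak_deriv u2 v2"
  shows "is_weak_deriv (\<lambda>x. u1 x - u2 x) (\<lambda>x. v1 x - v2 x)"
  unfolding is_weak_deriv_inner
proof
  fix \<psi> assume \<psi>: "\<psi> \<in> test_functions"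
  then show "L2_inner (\<lambda>x. u1 x - u2 x) (deriv \<psi>) = - L2_inner (\<lambda>x. v1 x - v2 x) \<psi>"
    using assms(5,6) L2_inner_diff[OF assms(1,2) test_function_L2(2)[OF \<psi>]]
      L2_inner_diff[OF assms(3,4) test_function_L2(1)[OF \<psi>]] by (simp add: is_weak_deriv_inner)
qed

text \<open>Both sides of the defining identity are continuous in the norm; in this way term-by-term
  differentiation of orthogonal series needs no pointwise convergence of the differentiated series.\<close>
lemma is_weak_deriv_limit:
  assumes "\<And>n. u n \<in> L2" "\<And>n. v n \<in> L2" "U \<in> L2" "V \<in> L2" "\<And>n. is_weak_deriv (u n) (v n)"
    and "(\<lambda>n. L2_norm (\<lambda>x. u n x - U x)) \<longlonglongrightarrow> 0" "(\<lambda>n. L2_norm (\<lambda>x. v n x - V x)) \<longlonglongrightarrow> 0"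
  shows "is_weak_deriv U V"
  unfolding is_weak_deriv_inner
proof
  fix \<psi> assume \<psi>: "\<psi> \<in> test_functions"
  have "(\<lambda>n. L2_inner (u n) (deriv \<psi>)) \<longlonglongrightarrow> L2_inner U (deriv \<psi>)"
    by (rule L2_inner_tendsto[OF assms(1,3) test_function_L2(2)[OF \<psi>] assms(6)])
  moreover have "(\<lambda>n. - L2_inner (v n) \<psi>) \<longlonglongrightarrow> - L2_inner V \<psi>"
    by (rule tendsto_minus[OF L2_inner_tendsto[OF assms(2,4) test_function_L2(1)[OF \<psi>] assms(7)]])
  moreover have "L2_inner (u n) (deriv \<psi>) = - L2_inner (v n) \<psi>" for n
    using assms(5)[of n] \<psi> by (simp add: is_weak_deriv_inner)
  ultimately show "L2_inner U (deriv \<psi>) = - L2_inner V \<psi>" by (auto intro: LIMSEQ_unique)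
qed

lemma L2_inner_cong_AE:
  assumes "u \<in> L2" "v \<in> L2" "w \<in> L2" "AE x in leb01. u x = v x"
  shows "L2_inner u w = L2_inner v w"
  unfolding L2_inner_def
  by (rule integral_cong_AE) (use assms L2_mult_integrable in \<open>auto intro: borel_measurable_integrable elim: eventually_mono\<close>)

lemma is_weak_deriv_cong_AE:
  assumes "u \<in> L2" "u' \<in> L2" "AE x in leb01. u x = u' x" "is_weak_deriv u v"
  shows "is_weak_deriv u' v"
  using assms(4) L2_inner_cong_AE[OF assms(1,2) test_function_L2(2) assms(3)]
  unfolding is_weak_deriv_inner by metis

lemma leb01_FTC:
  assumes F: "\<And>x. (F has_real_derivative f x) (at x)" and f: "continuous_on UNIV f"
  shows "(LINT x|leb01. f x) = F 1 - F 0"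
proof -
  have i: "integrable leb01 f"
    by (rule L2_integrable[OF continuous_L2]) (rule continuous_on_subset[OF f], simp)
  have "(f has_integral (F 1 - F 0)) {0..1}"
    by (rule fundamental_theorem_of_calculus)
      (auto simp: has_real_derivative_iff_has_vector_derivative[symmetric] intro: has_field_derivative_at_within F)
  then have "integral {0<..<1} f = F 1 - F 0"
    using integral_open_interval[of 0 1 f] by (simp add: box_real integral_unique)
  then show ?thesis using lebesgue_integral_eq_integral[OF i] by simp
qed

text \<open>Boundary terms vanish since the support is a compact subset of the open interval.\<close>
lemma integration_by_parts_test:
  assumes u: "\<And>x. (u has_real_derivative u' x) (at x)" and u': "continuous_on UNIV u'" and \<psi>: "\<psi> \<in> test_functions"
  shows "L2_inner u (deriv \<psi>) = - L2_inner u' \<psi>"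
proof -
  have cu: "continuous_on A u" for A
    by (meson DERIV_isCont continuous_at_imp_continuous_on u)
  have s: "smooth \<psi>" by (rule test_function_smooth[OF \<psi>])
  obtain a b where ab: "0 < a" "a < b" "b < 1" "\<And>x. x < a \<or> b < x \<Longrightarrow> \<psi> x = 0"
    using test_function_support[OF \<psi>] by blast
  have "(LINT x|leb01. u' x * \<psi> x + deriv \<psi> x * u x) = u 1 * \<psi> 1 - u 0 * \<psi> 0"
    by (rule leb01_FTC) (intro DERIV_mult u smooth_has_deriv[OF s] continuous_intros u' cu
        smooth_continuous[OF s] smooth_continuous[OF smooth_deriv[OF s]])+
  also have "\<dots> = 0" using ab(4)[of 0] ab(4)[of 1] ab(1-3) by simp
  finally have z: "(LINT x|leb01. u' x * \<psi> x + deriv \<psi> x * u x) = 0" .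
  have L: "u \<in> L2" "u' \<in> L2" by (auto intro!: continuous_L2 cu continuous_on_subset[OF u'])
  have "(LINT x|leb01. u' x * \<psi> x + deriv \<psi> x * u x) = L2_inner u' \<psi> + L2_inner (deriv \<psi>) u"
    unfolding L2_inner_def
    by (intro Bochner_Integration.integral_add L2_mult_integrable L test_function_L2 \<psi>)
  then show ?thesis using z by (simp add: L2_inner_commute)
qed

lemma classical_weak_deriv:
  assumes "\<And>x. (u has_real_derivative u' x) (at x)" "continuous_on UNIV u'"
  shows "is_weak_deriv u u'"
  using integration_by_parts_test[OF assms] by (simp add: is_weak_deriv_inner)

definition orthonormal :: "(nat \<Rightarrow> real \<Rightarrow> real) \<Rightarrow> bool" where
  "orthonormal \<phi> \<longleftrightarrow> (\<forall>k. \<phi> k \<in> L2) \<and> (\<forall>j k. L2_inner (\<phi> j) (\<phi> k) = (if j = k then 1 else 0))"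

lemma orthonormal_sum_inner:
  assumes "orthonormal \<phi>" "finite I"
  shows "L2_inner (\<lambda>x. \<Sum>k\<in>I. c k * \<phi> k x) (\<phi> j) = (if j \<in> I then c j else 0)"
proof -
  have "L2_inner (\<lambda>x. \<Sum>k\<in>I. c k * \<phi> k x) (\<phi> j) = (\<Sum>k\<in>I. L2_inner (\<lambda>x. c k * \<phi> k x) (\<phi> j))"
    by (rule L2_inner_sum) (use assms in \<open>auto simp: orthonormal_def intro: L2_scale\<close>)
  also have "\<dots> = (\<Sum>k\<in>I. if k = j then c k else 0)"
    by (rule sum.cong) (use assms in \<open>auto simp: orthonormal_def L2_inner_scale\<close>)
  also have "\<dots> = (if j \<in> I then c j else 0)" using assms(2) by simp
  finally show ?thesis .
qed

lemma orthonormal_sum_L2: "orthonormal \<phi> \<Longrightarrow> (\<lambda>x. \<Sum>k\<in>I. c k * \<phi> k x) \<in> L2"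
  by (intro L2_sum L2_scale) (simp add: orthonormal_def)

lemma orthonormal_sum_norm:
  assumes "orthonormal \<phi>" "finite I"
  shows "(L2_norm (\<lambda>x. \<Sum>k\<in>I. c k * \<phi> k x))\<^sup>2 = (\<Sum>k\<in>I. (c k)\<^sup>2)"
proof -
  let ?s = "\<lambda>x. \<Sum>k\<in>I. c k * \<phi> k x"
  have "L2_inner ?s ?s = (\<Sum>k\<in>I. L2_inner (\<lambda>x. c k * \<phi> k x) ?s)"
    by (rule L2_inner_sum) (use assms orthonormal_sum_L2[OF assms(1)] in \<open>auto simp: orthonormal_def intro: L2_scale\<close>)
  also have "\<dots> = (\<Sum>k\<in>I. c k * c k)"
  proof (rule sum.cong)
    fix k assume "k \<in> I"
    then have "L2_inner (\<phi> k) ?s = c k" using orthonormal_sum_inner[OF assms, of c k] by (simp add: L2_inner_commute)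
    then show "L2_inner (\<lambda>x. c k * \<phi> k x) ?s = c k * c k" by (simp add: L2_inner_scale)
  qed simp
  finally show ?thesis unfolding L2_norm_sq_inner by (simp add: power2_eq_square)
qed

lemma bessel:
  assumes \<phi>: "orthonormal \<phi>" and u: "u \<in> L2"
  shows "(\<lambda>k. L2_inner u (\<phi> k)) \<in> ell2" and "ell2_norm (\<lambda>k. L2_inner u (\<phi> k)) \<le> L2_norm u"
proof -
  let ?c = "\<lambda>k. L2_inner u (\<phi> k)"
  have b: "(\<Sum>k<N. (?c k)\<^sup>2) \<le> (L2_norm u)\<^sup>2" for N
  proof -
    let ?s = "\<lambda>x. \<Sum>k<N. ?c k * \<phi> k x"
    have sL: "?s \<in> L2" by (rule orthonormal_sum_L2[OF \<phi>])
    have "L2_inner ?s u = (\<Sum>k<N. L2_inner (\<lambda>x. ?c k * \<phi> k x) u)"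
      by (rule L2_inner_sum) (use \<phi> u in \<open>auto simp: orthonormal_def intro: L2_scale\<close>)
    also have "\<dots> = (\<Sum>k<N. (?c k)\<^sup>2)"
      by (simp add: L2_inner_scale power2_eq_square L2_inner_commute[of _ u])
    finally have su: "L2_inner ?s u = (\<Sum>k<N. (?c k)\<^sup>2)" .
    have "(\<Sum>k<N. (?c k)\<^sup>2) \<le> L2_norm ?s * L2_norm u"
      using L2_cauchy_schwarz[OF sL u] unfolding su by linarith
    also have "\<dots> \<le> ((L2_norm ?s)\<^sup>2 + (L2_norm u)\<^sup>2) / 2"
      using zero_le_power2[of "L2_norm ?s - L2_norm u"] by (simp add: power2_diff)
    finally show ?thesis using orthonormal_sum_norm[OF \<phi>, of "{..<N}" ?c] by simp
  qed
  show c: "?c \<in> ell2" by (rule ell2_bounded_sums(1)[OF b])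
  show "ell2_norm ?c \<le> L2_norm u" by (rule ell2_norm_le[OF c L2_norm_nonneg b])
qed

text \<open>The sum is only determined up to null sets; for coefficients without further decay there is no
  pointwise sum to name.\<close>
lemma riesz_fischer:
  assumes \<phi>: "orthonormal \<phi>" and c: "c \<in> ell2"
  obtains u where "u \<in> L2" "(\<lambda>n. L2_norm (\<lambda>x. (\<Sum>k<n. c k * \<phi> k x) - u x)) \<longlonglongrightarrow> 0"
proof -
  have sL: "(\<lambda>x. \<Sum>k<n. c k * \<phi> k x) \<in> L2" for n by (rule orthonormal_sum_L2[OF \<phi>])
  have cauchy: "\<exists>N. \<forall>a\<ge>N. \<forall>b\<ge>N. L2_norm (\<lambda>x. (\<Sum>k<a. c k * \<phi> k x) - (\<Sum>k<b. c k * \<phi> k x)) < e"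
    if e: "0 < e" for e
  proof -
  obtain K where K: "\<And>N. (\<Sum>k=K..<N. (c k)\<^sup>2) \<le> (e/2)\<^sup>2" using ell2_tail[OF c, of "(e/2)\<^sup>2"] e by auto
  have *: "L2_norm (\<lambda>x. (\<Sum>k<b. c k * \<phi> k x) - (\<Sum>k<a. c k * \<phi> k x)) < e" if "K \<le> a" "a \<le> b" for a b
  proof -
    have "(\<Sum>k<b. f k) - (\<Sum>k<a. f k) = (\<Sum>k=a..<b. f k)" for f :: "nat \<Rightarrow> real"
      using sum_diff_nat_ivl[of 0 a b f] that by (simp add: atLeast0LessThan)
    then have "(L2_norm (\<lambda>x. (\<Sum>k<b. c k * \<phi> k x) - (\<Sum>k<a. c k * \<phi> k x)))\<^sup>2 = (\<Sum>k=a..<b. (c k)\<^sup>2)"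
      using orthonormal_sum_norm[OF \<phi>, of "{a..<b}" c] by simp
    also have "\<dots> \<le> (\<Sum>k=K..<b. (c k)\<^sup>2)" by (rule sum_mono2) (use that in auto)
    also have "\<dots> \<le> (e/2)\<^sup>2" by (rule K)
    finally have "L2_norm (\<lambda>x. (\<Sum>k<b. c k * \<phi> k x) - (\<Sum>k<a. c k * \<phi> k x)) \<le> e / 2"
      by (rule power2_le_imp_le) (use e in simp)
    then show ?thesis using e by simp
  qed
  have "L2_norm (\<lambda>x. (\<Sum>k<a. c k * \<phi> k x) - (\<Sum>k<b. c k * \<phi> k x)) < e" if "K \<le> a" "K \<le> b" for a b
    using *[of a b] *[of b a] that L2_norm_minus_commute[of "\<lambda>x. \<Sum>k<a. c k * \<phi> k x"]
    by (cases "a \<le> b") auto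
  then show ?thesis by blast
  qed
  show thesis by (rule L2_complete[OF sL cauchy that])
qed

lemma riesz_fischer_limit:
  assumes \<phi>: "orthonormal \<phi>" and u: "u \<in> L2"
    and lim: "(\<lambda>n. L2_norm (\<lambda>x. (\<Sum>k<n. c k * \<phi> k x) - u x)) \<longlonglongrightarrow> 0"
  shows "L2_inner u (\<phi> j) = c j" and "c \<in> ell2" and "L2_norm u = ell2_norm c"
proof -
  let ?s = "\<lambda>n x. \<Sum>k<n. c k * \<phi> k x"
  have sL: "?s n \<in> L2" for n by (rule orthonormal_sum_L2[OF \<phi>])
  have coef: "L2_inner u (\<phi> j) = c j" for j
  proof -
    have "(\<lambda>n. L2_inner (?s n) (\<phi> j)) \<longlonglongrightarrow> L2_inner u (\<phi> j)"
      by (rule L2_inner_tendsto[OF sL u _ lim]) (use \<phi> in \<open>simp add: orthonormal_def\<close>)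
    moreover have "eventually (\<lambda>n. L2_inner (?s n) (\<phi> j) = c j) sequentially"
      using eventually_gt_at_top[of j] by eventually_elim (simp add: orthonormal_sum_inner[OF \<phi>])
    ultimately have "(\<lambda>n. c j) \<longlonglongrightarrow> L2_inner u (\<phi> j)" by (rule Lim_transform_eventually)
    then show ?thesis by (simp add: LIMSEQ_const_iff)
  qed
  then show "L2_inner u (\<phi> j) = c j" .
  have "(\<lambda>k. L2_inner u (\<phi> k)) = c" using coef by auto
  then show c: "c \<in> ell2" using bessel(1)[OF \<phi> u] by simp
  have le: "ell2_norm c \<le> L2_norm u" using \<open>(\<lambda>k. L2_inner u (\<phi> k)) = c\<close> bessel(2)[OF \<phi> u] by simp
  have "L2_norm u \<le> ell2_norm c"
  proof (rule LIMSEQ_le_const)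
    show "(\<lambda>n. L2_norm (\<lambda>x. ?s n x - u x) + ell2_norm c) \<longlonglongrightarrow> ell2_norm c"
      using tendsto_add[OF lim tendsto_const[of "ell2_norm c"]] by simp
    have "L2_norm u \<le> L2_norm (\<lambda>x. ?s n x - u x) + ell2_norm c" for n
    proof -
      have "L2_norm u \<le> L2_norm (\<lambda>x. u x - ?s n x) + L2_norm (?s n)"
        using L2_triangle[OF L2_diff[OF u sL] sL, of n n] by simp
      also have "L2_norm (?s n) \<le> ell2_norm c"
      proof (rule power2_le_imp_le)
        show "(L2_norm (?s n))\<^sup>2 \<le> (ell2_norm c)\<^sup>2"
          using orthonormal_sum_norm[OF \<phi>, of "{..<n}" c] sum_le_ell2_norm_sq[OF c, of "{..<n}"] by simp
      qed (rule ell2_norm_nonneg[OF c])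
      finally show ?thesis using L2_norm_minus_commute[of u "?s n"] by simp
    qed
    then show "\<exists>N. \<forall>n\<ge>N. L2_norm u \<le> L2_norm (\<lambda>x. ?s n x - u x) + ell2_norm c" by blast
  qed
  with le show "L2_norm u = ell2_norm c" by simp
qed

definition freq :: "nat \<Rightarrow> real" where "freq k = real (Suc k) * pi"

definition sine :: "nat \<Rightarrow> real \<Rightarrow> real" where "sine k x = sqrt 2 * sin (freq k * x)"

definition cosine :: "nat \<Rightarrow> real \<Rightarrow> real" where "cosine k x = sqrt 2 * cos (freq k * x)"

lemma freq_pos: "0 < freq k" by (simp add: freq_def)

lemma sine_deriv: "(sine k has_real_derivative freq k * cosine k x) (at x)"
  unfolding sine_def[abs_def] cosine_def by (auto intro!: derivative_eq_intros)

lemma cosine_deriv: "(cosine k has_real_derivative - freq k * sine k x) (at x)"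
  unfolding sine_def cosine_def[abs_def] by (auto intro!: derivative_eq_intros)

lemma sine_cont: "continuous_on A (sine k)" and cosine_cont: "continuous_on A (cosine k)"
  unfolding sine_def[abs_def] cosine_def[abs_def] by (intro continuous_intros)+

lemma sine_L2: "sine k \<in> L2" and cosine_L2: "cosine k \<in> L2"
  by (auto intro: continuous_L2 sine_cont cosine_cont)

lemma sine_abs_le: "\<bar>sine k x\<bar> \<le> sqrt 2"
  unfolding sine_def by (simp add: abs_mult mult_left_le)

lemma integral_cos_multiple: "(LINT x|leb01. cos (of_int n * pi * x)) = (if n = 0 then 1 else 0)"
proof (cases "n = 0")
  case True
  then show ?thesis using measure_leb01 by simp
next
  case False
  have "(LINT x|leb01. cos (of_int n * pi * x)) = sin (of_int n * pi * 1) / (of_int n * pi) - sin (of_int n * pi * 0) / (of_int n * pi)"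
    by (rule leb01_FTC) (use False in \<open>auto intro!: derivative_eq_intros continuous_intros\<close>)
  also have "sin (of_int n * pi * 1) = 0" using sin_npi_int[of n] by (simp add: mult.commute)
  finally show ?thesis using False by simp
qed

lemma cos_product_integral:
  "(LINT x|leb01. cos ((freq j - freq k) * x) + s * cos ((freq j + freq k) * x)) = (if j = k then 1 else 0)"
proof -
  have d: "freq j - freq k = of_int (int j - int k) * pi" by (simp add: freq_def algebra_simps)
  have a: "freq j + freq k = of_int (int j + int k + 2) * pi" by (simp add: freq_def algebra_simps)
  have i: "integrable leb01 (\<lambda>x. cos (w * x))" for w :: real
    by (rule L2_integrable[OF continuous_L2]) (intro continuous_intros)
  have "(LINT x|leb01. cos ((freq j - freq k) * x) + s * cos ((freq j + freq k) * x))
      = (LINT x|leb01. cos ((freq j - freq k) * x)) + s * (LINT x|leb01. cos ((freq j + freq k) * x))"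
    using i by simp
  then show ?thesis unfolding d a integral_cos_multiple by auto
qed

lemma orthonormal_sine: "orthonormal sine"
  unfolding orthonormal_def
proof (intro conjI allI sine_L2)
  fix j k
  have "sine j x * sine k x = cos ((freq j - freq k) * x) + (- 1) * cos ((freq j + freq k) * x)" for x
    by (simp add: sine_def cos_diff cos_add left_diff_distrib distrib_right)
  then show "L2_inner (sine j) (sine k) = (if j = k then 1 else 0)"
    unfolding L2_inner_def using cos_product_integral[of j k "- 1"] by simp
qed

lemma orthonormal_cosine: "orthonormal cosine"
  unfolding orthonormal_def
proof (intro conjI allI cosine_L2)
  fix j k
  have "cosine j x * cosine k x = cos ((freq j - freq k) * x) + 1 * cos ((freq j + freq k) * x)" for x
    by (simp add: cosine_def cos_diff cos_add left_diff_distrib distrib_right)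
  then show "L2_inner (cosine j) (cosine k) = (if j = k then 1 else 0)"
    unfolding L2_inner_def using cos_product_integral[of j k 1] by simp
qed

section \<open>Completeness of the sines and approximation by test functions\<close>

definition sine_coeff :: "(real \<Rightarrow> real) \<Rightarrow> nat \<Rightarrow> real" where
  "sine_coeff u k = L2_inner u (sine k)"

text \<open>By \<open>2 sin (k \<theta>) cos \<theta> = sin ((k + 1) \<theta>) + sin ((k - 1) \<theta>)\<close> each product is a combination of
  sines. The lowest mode has no predecessor, and the second term is then zero.\<close>
lemma sine_times_cos_power:
  assumes u: "u \<in> L2" and z: "\<And>k. sine_coeff u k = 0"
  shows "L2_inner (\<lambda>x. sine k x * cos (pi * x) ^ j) u = 0"
proof (induction j arbitrary: k)
  case 0
  then show ?case using z[of k] by (simp add: sine_coeff_def L2_inner_commute)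
next
  case (Suc j)
  define s where "s x = (if k = 0 then 0 else sine (k - 1) x)" for x
  have L: "(\<lambda>x. sine i x * cos (pi * x) ^ j) \<in> L2" for i
    by (intro continuous_L2 continuous_intros sine_cont)
  have Ls: "(\<lambda>x. s x * cos (pi * x) ^ j) \<in> L2"
    using L[of "k - 1"] by (cases "k = 0") (auto simp: s_def L2_zero)
  have s0: "L2_inner (\<lambda>x. s x * cos (pi * x) ^ j) u = 0"
    using Suc.IH[of "k - 1"] by (cases "k = 0") (auto simp: s_def L2_inner_def)
  have step: "sine k x * cos (pi * x) = (1/2) * (sine (Suc k) x + s x)" for x
  proof -
    have "sine (Suc k) x = sqrt 2 * sin (freq k * x + pi * x)"
      by (simp add: sine_def freq_def algebra_simps)
    moreover have "s x = sqrt 2 * sin (freq k * x - pi * x)"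
      by (cases k) (simp_all add: s_def sine_def freq_def algebra_simps)
    ultimately show ?thesis by (simp add: sine_def sin_add sin_diff algebra_simps)
  qed
  have eq: "sine k x * cos (pi * x) ^ Suc j
      = (1/2) * (sine (Suc k) x * cos (pi * x) ^ j + s x * cos (pi * x) ^ j)" for x
  proof -
    have "sine k x * cos (pi * x) ^ Suc j = (sine k x * cos (pi * x)) * cos (pi * x) ^ j" by simp
    then show ?thesis unfolding step by (simp add: algebra_simps)
  qed
  show ?case
    unfolding eq L2_inner_scale L2_inner_add[OF L Ls u] using Suc.IH[of "Suc k"] s0 by simp
qed

text \<open>A test function is \<open>sin (\<pi> x)\<close> times a continuous function of \<open>cos (\<pi> x)\<close>, because \<open>cos\<close> is injective on \<open>[0, \<pi>]\<close> and the
  support stays away from the zeros of the sine. Approximating that continuous function uniformly by polynomials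
  reduces the claim to products that are already annihilated.\<close>
lemma sine_complete_test:
  assumes u: "u \<in> L2" and z: "\<And>k. sine_coeff u k = 0" and \<psi>: "\<psi> \<in> test_functions"
  shows "(LINT x|leb01. u x * \<psi> x) = 0"
proof -
  obtain a b where ab: "0 < a" "a < b" "b < 1" "\<And>x. x < a \<or> b < x \<Longrightarrow> \<psi> x = 0"
    using test_function_support[OF \<psi>] by blast
  have "continuous_on {a..b} (\<lambda>x. sin (pi * x))" by (intro continuous_intros)
  then obtain x0 where x0: "x0 \<in> {a..b}" "\<And>x. x \<in> {a..b} \<Longrightarrow> sin (pi * x0) \<le> sin (pi * x)"
    using continuous_attains_inf[of "{a..b}" "\<lambda>x. sin (pi * x)"] ab by auto
  define m0 where "m0 = sin (pi * x0)"
  have m0: "0 < m0" unfolding m0_def using x0(1) ab by (intro sin_gt_zero) auto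
  \<comment> \<open>the maximum keeps the quotient continuous where the sine vanishes and changes nothing on the support\<close>
  define \<eta> where "\<eta> x = \<psi> x / max (sin (pi * x)) m0" for x
  have \<eta>_cont: "continuous_on A \<eta>" for A
    unfolding \<eta>_def using m0 smooth_continuous[OF test_function_smooth[OF \<psi>], of A]
    by (intro continuous_intros) (auto simp: max_def split: if_splits)
  have \<psi>_eq: "\<psi> x = sin (pi * x) * \<eta> x" for x
  proof (cases "x \<in> {a..b}")
    case True
    then have "m0 \<le> sin (pi * x)" using x0(2) by (simp add: m0_def)
    then show ?thesis using m0 by (simp add: \<eta>_def max_def)
  next
    case False
    then show ?thesis using ab(4)[of x] by (auto simp: \<eta>_def)
  qed
  define g where "g y = \<eta> (arccos y / pi)" for y
  have "continuous_on {-1..1} g"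
    unfolding g_def by (rule continuous_on_compose2[OF \<eta>_cont[of UNIV]]) (auto intro!: continuous_intros continuous_on_arccos')
  have g_eq: "g (cos (pi * x)) = \<eta> x" if "0 < x" "x < 1" for x
    using that by (simp add: g_def arccos_cos)
  have small: "\<bar>LINT x|leb01. u x * \<psi> x\<bar> \<le> e * L2_norm u" if e: "0 < e" for e
  proof -
    obtain p where p: "real_polynomial_function p" "\<And>y. y \<in> {-1..1} \<Longrightarrow> \<bar>g y - p y\<bar> < e"
      using Stone_Weierstrass_real_polynomial_function[of "{-1..1::real}" g e] \<open>continuous_on {-1..1} g\<close> e by auto
    obtain c n where pc: "p = (\<lambda>y. \<Sum>i\<le>n. c i * y ^ i)"
      using real_polynomial_function_imp_sum[OF p(1)] by blast
    let ?q = "\<lambda>x. \<Sum>i\<le>n. (c i / sqrt 2) * (sine 0 x * cos (pi * x) ^ i)"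
    have q_eq: "?q x = sin (pi * x) * p (cos (pi * x))" for x
      by (simp add: pc sine_def freq_def sum_distrib_left mult_ac)
    have iL: "(\<lambda>x. (c i / sqrt 2) * (sine 0 x * cos (pi * x) ^ i)) \<in> L2" for i
      by (intro continuous_L2 continuous_intros sine_cont)
    have qL: "?q \<in> L2" by (rule L2_sum) (rule iL)
    have "L2_inner ?q u = (\<Sum>i\<le>n. L2_inner (\<lambda>x. (c i / sqrt 2) * (sine 0 x * cos (pi * x) ^ i)) u)"
      by (rule L2_inner_sum[OF iL u])
    also have "\<dots> = 0" by (simp only: L2_inner_scale sine_times_cos_power[OF u z]) simp
    finally have q0: "L2_inner ?q u = 0" .
    have \<psi>L: "\<psi> \<in> L2" by (rule test_function_L2[OF \<psi>])
    have d: "L2_norm (\<lambda>x. \<psi> x - ?q x) \<le> e"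
    proof (rule bounded_L2(2))
      show "(\<lambda>x. \<psi> x - ?q x) \<in> borel_measurable leb01" using L2_diff[OF \<psi>L qL] by (rule L2_measurable)
      fix x :: real assume x: "0 < x" "x < 1"
      have "\<psi> x - ?q x = sin (pi * x) * (g (cos (pi * x)) - p (cos (pi * x)))"
        unfolding q_eq g_eq[OF x] by (simp add: \<psi>_eq right_diff_distrib)
      then have "\<bar>\<psi> x - ?q x\<bar> = \<bar>sin (pi * x)\<bar> * \<bar>g (cos (pi * x)) - p (cos (pi * x))\<bar>" by (simp add: abs_mult)
      also have "\<dots> \<le> 1 * e" using p(2)[of "cos (pi * x)"] by (intro mult_mono) auto
      finally show "\<bar>\<psi> x - ?q x\<bar> \<le> e" by simp
    qed (use e in simp)
    have "L2_inner (\<lambda>x. \<psi> x - ?q x) u = (LINT x|leb01. u x * \<psi> x)"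
      using L2_inner_diff[OF \<psi>L qL u] q0 by (simp add: L2_inner_def mult.commute)
    then have "\<bar>LINT x|leb01. u x * \<psi> x\<bar> \<le> L2_norm (\<lambda>x. \<psi> x - ?q x) * L2_norm u"
      using L2_cauchy_schwarz[OF L2_diff[OF \<psi>L qL] u] by simp
    also have "\<dots> \<le> e * L2_norm u" using d by (rule mult_right_mono) (rule L2_norm_nonneg)
    finally show ?thesis .
  qed
  have "\<bar>LINT x|leb01. u x * \<psi> x\<bar> \<le> 0"
  proof (rule field_le_epsilon)
    fix e :: real assume "0 < e"
    have n: "0 < L2_norm u + 1" using L2_norm_nonneg[of u] by linarith
    have "\<bar>LINT x|leb01. u x * \<psi> x\<bar> \<le> e / (L2_norm u + 1) * L2_norm u"
      by (rule small) (use \<open>0 < e\<close> n in simp)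
    also have "\<dots> \<le> e" using \<open>0 < e\<close> n L2_norm_nonneg[of u] by (simp add: field_simps)
    finally show "\<bar>LINT x|leb01. u x * \<psi> x\<bar> \<le> 0 + e" by simp
  qed
  then show ?thesis by simp
qed

lemma sine_complete:
  assumes "u \<in> L2" "\<And>k. sine_coeff u k = 0"
  shows "AE x in leb01. u x = 0"
  by (rule fundamental_lemma[OF L2_integrable[OF assms(1)] sine_complete_test[OF assms]])

lemma sine_coeff_diff: "u \<in> L2 \<Longrightarrow> v \<in> L2 \<Longrightarrow> sine_coeff (\<lambda>x. u x - v x) k = sine_coeff u k - sine_coeff v k"
  by (simp add: sine_coeff_def L2_inner_diff sine_L2)

lemma sine_coeff_add: "u \<in> L2 \<Longrightarrow> v \<in> L2 \<Longrightarrow> sine_coeff (\<lambda>x. u x + v x) k = sine_coeff u k + sine_coeff v k"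
  by (simp add: sine_coeff_def L2_inner_add sine_L2)

lemma sine_coeff_scale: "sine_coeff (\<lambda>x. r * u x) k = r * sine_coeff u k"
  by (simp add: sine_coeff_def L2_inner_scale)

lemma sine_coeff_cong_AE:
  assumes "u \<in> L2" "v \<in> L2" "AE x in leb01. u x = v x" shows "sine_coeff u k = sine_coeff v k"
  unfolding sine_coeff_def by (rule L2_inner_cong_AE[OF assms(1,2) sine_L2 assms(3)])

lemma sine_coeff_eq_AE:
  assumes "u \<in> L2" "v \<in> L2" "\<And>k. sine_coeff u k = sine_coeff v k"
  shows "AE x in leb01. u x = v x"
  using sine_complete[OF L2_diff[OF assms(1,2)]] assms by (simp add: sine_coeff_diff)

lemma sine_coeff_ell2: "u \<in> L2 \<Longrightarrow> sine_coeff u \<in> ell2"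
  using bessel(1)[OF orthonormal_sine, of u] by (simp add: sine_coeff_def[abs_def])

lemma sine_parseval:
  assumes u: "u \<in> L2" shows "L2_norm u = ell2_norm (sine_coeff u)"
proof -
  obtain v where v: "v \<in> L2" "(\<lambda>n. L2_norm (\<lambda>x. (\<Sum>k<n. sine_coeff u k * sine k x) - v x)) \<longlonglongrightarrow> 0"
    by (rule riesz_fischer[OF orthonormal_sine sine_coeff_ell2[OF u]])
  note lim = riesz_fischer_limit[OF orthonormal_sine v]
  have "AE x in leb01. u x = v x"
    by (rule sine_coeff_eq_AE[OF u v(1)]) (simp add: sine_coeff_def lim(1))
  then have "L2_norm u = L2_norm v" using u v(1) by (intro L2_norm_cong_AE L2_measurable)
  then show ?thesis using lim(3) by simp
qed

lemma L2_norm_dominated_tendsto_0: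
  assumes g: "\<And>n. g n \<in> borel_measurable leb01" and b: "\<And>n x. 0 < x \<Longrightarrow> x < 1 \<Longrightarrow> \<bar>g n x\<bar> \<le> B"
    and lim: "\<And>x. 0 < x \<Longrightarrow> x < 1 \<Longrightarrow> (\<lambda>n. g n x) \<longlonglongrightarrow> 0"
  shows "(\<lambda>n. L2_norm (g n)) \<longlonglongrightarrow> 0"
proof -
  have "(\<lambda>n. LINT x|leb01. (g n x)\<^sup>2) \<longlonglongrightarrow> (LINT x|leb01. 0)"
  proof (rule integral_dominated_convergence)
    show "integrable leb01 (\<lambda>_. B\<^sup>2)" by simp
    show "(\<lambda>x. (g n x)\<^sup>2) \<in> borel_measurable leb01" for n using g[of n] by measurable
    show "AE x in leb01. (\<lambda>n. (g n x)\<^sup>2) \<longlonglongrightarrow> 0"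
    proof (rule AE_I2)
      fix x assume "x \<in> space leb01"
      then show "(\<lambda>n. (g n x)\<^sup>2) \<longlonglongrightarrow> 0" using tendsto_power[OF lim[of x], of 2] by simp
    qed
    show "AE x in leb01. norm ((g n x)\<^sup>2) \<le> B\<^sup>2" for n
    proof (rule AE_I2)
      fix x assume "x \<in> space leb01"
      then have "\<bar>g n x\<bar>\<^sup>2 \<le> B\<^sup>2" using b[of x n] by (intro power_mono) auto
      then show "norm ((g n x)\<^sup>2) \<le> B\<^sup>2" by simp
    qed
  qed simp
  then have "(\<lambda>n. sqrt (LINT x|leb01. (g n x)\<^sup>2)) \<longlonglongrightarrow> sqrt 0" by (intro tendsto_real_sqrt) simp
  then show ?thesis by (simp add: L2_norm_def)
qed

text \<open>The derivative of the cutoff is of size \<open>n\<close> on a layer of width \<open>1 / n\<close> at the boundary. A function that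
  vanishes linearly there, \<open>\<bar>z\<bar> \<le> L y\<close> at distance \<open>y\<close>, compensates the factor \<open>n\<close>.\<close>
lemma layer_bound:
  assumes "\<bar>z\<bar> \<le> L * y" "0 < y"
  shows "\<bar>z * (real n * ((1 / (real n * y - 1))\<^sup>2 * flat (real n * y - 1)))\<bar> \<le> 3 * L"
    (is "\<bar>z * (real n * ?f)\<bar> \<le> _")
proof -
  let ?w = "real n * y - 1"
  have L: "0 \<le> L * y" using assms(1) by linarith
  then have L0: "0 \<le> L" using assms(2) by (simp add: zero_le_mult_iff)
  have f0: "0 \<le> ?f" using flat_bounds by simp
  have w: "(?w + 1) * ?f \<le> 3"
  proof (cases "0 < ?w")
    case True
    have 1: "?f \<le> 2" by (rule flat_square_bound[OF True])
    have "1 / ?w * exp (- (1 / ?w)) \<le> 1" by (rule mult_exp_minus_le_one)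
    moreover have "?w * ?f = 1 / ?w * exp (- (1 / ?w))"
      using True by (simp add: flat_def power2_eq_square)
    moreover have "(?w + 1) * ?f = ?w * ?f + ?f" by (simp only: distrib_right mult_1)
    ultimately show ?thesis using 1 by linarith
  next
    case False
    then show ?thesis by (simp add: flat_def)
  qed
  have "\<bar>z * (real n * ?f)\<bar> = \<bar>z\<bar> * (real n * ?f)" using f0 by (simp add: abs_mult flat_bounds(1))
  also have "\<dots> \<le> L * y * (real n * ?f)" using assms(1) f0 by (intro mult_right_mono) auto
  also have "\<dots> = L * ((?w + 1) * ?f)" by simp
  also have "\<dots> \<le> L * 3" by (rule mult_left_mono[OF w L0])
  finally show ?thesis by simp
qed

lemma layer_tendsto:
  assumes "0 < y"
  shows "(\<lambda>n. z * (real n * ((1 / (real n * y - 1))\<^sup>2 * flat (real n * y - 1)))) \<longlonglongrightarrow> 0"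
proof -
  have "(\<lambda>n. real n * (1 / (real n * y - 1))\<^sup>2) \<longlonglongrightarrow> 0" using assms by real_asymp
  then have "(\<lambda>n. real n * (1 / (real n * y - 1))\<^sup>2 * flat (real n * y - 1)) \<longlonglongrightarrow> 0 * 1"
    by (intro tendsto_mult flat_scaled_tendsto assms)
  from tendsto_mult_left[OF this, of z] show ?thesis by (simp add: mult_ac)
qed

text \<open>The product rule leaves one dangerous term, the function times the derivative of the cutoff. It is
  bounded because the function vanishes linearly at the boundary, and it tends to zero pointwise; dominated convergence
  does the rest.\<close>
lemma smooth_vanishing_approx:
  assumes f: "smooth f" "f 0 = 0" "f 1 = 0"
  obtains \<psi> where "\<And>n::nat. \<psi> n \<in> test_functions" "(\<lambda>n. L2_norm (\<lambda>x. f x - \<psi> n x)) \<longlonglongrightarrow> 0"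
    "(\<lambda>n. L2_norm (\<lambda>x. deriv f x - deriv (\<psi> n) x)) \<longlonglongrightarrow> 0"
proof -
  have "bounded (deriv f ` {0..1})"
    by (rule compact_imp_bounded[OF compact_continuous_image[OF smooth_continuous[OF smooth_deriv[OF f(1)]]]]) simp
  then obtain L where L: "\<forall>x\<in>{0..1}. \<bar>deriv f x\<bar> \<le> L" by (auto simp: bounded_iff)
  have lip: "\<bar>f y - f x\<bar> \<le> L * (y - x)" if xy: "0 \<le> x" "x < y" "y \<le> 1" for x y
  proof -
    obtain z where z: "x < z" "z < y" "f y - f x = (y - x) * deriv f z"
      using MVT2[OF xy(2), of f "deriv f"] smooth_has_deriv[OF f(1)] by blast
    have "\<bar>deriv f z\<bar> \<le> L" using L z xy by auto
    then show ?thesis using z xy by (simp add: abs_mult mult.commute mult_left_mono)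
  qed
  have fb: "\<bar>f x\<bar> \<le> L * x" "\<bar>f x\<bar> \<le> L * (1 - x)" if "0 < x" "x < 1" for x
    using lip[of 0 x] lip[of x 1] that f(2,3) by auto
  have L0: "0 \<le> L" using L[rule_format, of 0] by auto
  have fL: "\<bar>f x\<bar> \<le> L" if "0 < x" "x < 1" for x
    using fb(1)[OF that] mult_left_le[of x L] that L0 by linarith
  define \<psi> where "\<psi> n x = f x * cutoff 0 1 (Suc n) x" for n x
  have \<psi>s: "smooth (\<psi> n)" for n unfolding \<psi>_def[abs_def] by (rule smooth_mult[OF f(1) smooth_cutoff])
  have \<psi>t: "\<psi> n \<in> test_functions" for n
  proof (rule test_functionI[OF \<psi>s, of "1 / real (Suc n)" "1 - 1 / real (Suc n)"])
    fix x assume "x < 1 / real (Suc n) \<or> 1 - 1 / real (Suc n) < x"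
    then have "cutoff 0 1 (Suc n) x = 0" by (intro cutoff_eq_0) auto
    then show "\<psi> n x = 0" by (simp add: \<psi>_def)
  qed auto
  define l1 where "l1 n x = real (Suc n) * ((1 / (real (Suc n) * x - 1))\<^sup>2 * flat (real (Suc n) * x - 1))" for n x
  have cd: "(cutoff 0 1 (Suc n) has_real_derivative
      l1 n x * flat (real (Suc n) * (1 - x) - 1) - l1 n (1 - x) * flat (real (Suc n) * x - 1)) (at x)" for n x
  proof -
    have 1: "((\<lambda>x. flat (real (Suc n) * (x - 0) - 1)) has_real_derivative l1 n x) (at x)"
    proof -
      have "((\<lambda>x. real (Suc n) * (x - 0) - 1) has_real_derivative real (Suc n)) (at x)"
        by (auto intro!: derivative_eq_intros)
      from DERIV_chain2[OF flat_deriv this] show ?thesis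
        unfolding l1_def by (rule DERIV_cong) (simp add: mult.commute)
    qed
    have 2: "((\<lambda>x. flat (real (Suc n) * (1 - x) - 1)) has_real_derivative - l1 n (1 - x)) (at x)"
    proof -
      have "((\<lambda>x. real (Suc n) * (1 - x) - 1) has_real_derivative - real (Suc n)) (at x)"
        by (auto intro!: derivative_eq_intros)
      from DERIV_chain2[OF flat_deriv this] show ?thesis
        unfolding l1_def by (rule DERIV_cong) (simp only: mult_minus_right mult.commute[of "real (Suc n)"])
    qed
    show ?thesis unfolding cutoff_def[abs_def]
      using DERIV_mult[OF 1 2] by (rule DERIV_cong) simp
  qed
  have \<psi>d: "deriv (\<psi> n) x = deriv f x * cutoff 0 1 (Suc n) x
      + (f x * l1 n x * flat (real (Suc n) * (1 - x) - 1) - f x * l1 n (1 - x) * flat (real (Suc n) * x - 1))" for n x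
    unfolding \<psi>_def[abs_def]
    by (rule DERIV_imp_deriv, rule DERIV_cong[OF DERIV_mult[OF smooth_has_deriv[OF f(1)] cd]])
      (simp add: algebra_simps)
  have cut1: "(\<lambda>n. cutoff 0 1 (Suc n) x) \<longlonglongrightarrow> 1" if "0 < x" "x < 1" for x
    using LIMSEQ_Suc[OF cutoff_tendsto[of 0 1 x]] that by simp
  have b1: "\<bar>f x * l1 n x\<bar> \<le> 3 * L" "\<bar>f x * l1 n (1 - x)\<bar> \<le> 3 * L" if "0 < x" "x < 1" for n x
    using layer_bound[OF fb(1)[OF that], of "Suc n"] layer_bound[OF fb(2)[OF that], of "Suc n"] that
    unfolding l1_def by auto
  have t1: "(\<lambda>n. f x * l1 n x) \<longlonglongrightarrow> 0" "(\<lambda>n. f x * l1 n (1 - x)) \<longlonglongrightarrow> 0" if "0 < x" "x < 1" for x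
    using LIMSEQ_Suc[OF layer_tendsto[of x "f x"]] LIMSEQ_Suc[OF layer_tendsto[of "1 - x" "f x"]] that
    unfolding l1_def by auto
  have fm: "g \<in> borel_measurable leb01" if "smooth g" for g
    using smooth_L2[OF that] by (rule L2_measurable)
  show thesis
  proof (rule that[OF \<psi>t])
    show "(\<lambda>n. L2_norm (\<lambda>x. f x - \<psi> n x)) \<longlonglongrightarrow> 0"
    proof (rule L2_norm_dominated_tendsto_0[where B = L])
      show "(\<lambda>x. f x - \<psi> n x) \<in> borel_measurable leb01" for n
        using fm[OF f(1)] fm[OF \<psi>s[of n]] by measurable
      fix x :: real assume x: "0 < x" "x < 1"
      have eq: "f x - \<psi> n x = f x * (1 - cutoff 0 1 (Suc n) x)" for n by (simp add: \<psi>_def algebra_simps)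
      show "\<bar>f x - \<psi> n x\<bar> \<le> L" for n
      proof -
        have "\<bar>f x\<bar> * \<bar>1 - cutoff 0 1 (Suc n) x\<bar> \<le> \<bar>f x\<bar> * 1"
          using cutoff_bounds[of 0 1 "Suc n" x] by (intro mult_left_mono) auto
        then show ?thesis unfolding eq abs_mult using fL[OF x] by linarith
      qed
      have "(\<lambda>n. f x * (1 - cutoff 0 1 (Suc n) x)) \<longlonglongrightarrow> f x * (1 - 1)"
        by (intro tendsto_intros cut1 x)
      then show "(\<lambda>n. f x - \<psi> n x) \<longlonglongrightarrow> 0" by (simp add: eq)
    qed
    show "(\<lambda>n. L2_norm (\<lambda>x. deriv f x - deriv (\<psi> n) x)) \<longlonglongrightarrow> 0"
    proof (rule L2_norm_dominated_tendsto_0[where B = "7 * L"])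
      show "(\<lambda>x. deriv f x - deriv (\<psi> n) x) \<in> borel_measurable leb01" for n
        using fm[OF smooth_deriv[OF f(1)]] fm[OF smooth_deriv[OF \<psi>s[of n]]] by measurable
      fix x :: real assume x: "0 < x" "x < 1"
      let ?p = "\<lambda>n. f x * l1 n x * flat (real (Suc n) * (1 - x) - 1)"
      let ?q = "\<lambda>n. f x * l1 n (1 - x) * flat (real (Suc n) * x - 1)"
      have eq: "deriv f x - deriv (\<psi> n) x = deriv f x * (1 - cutoff 0 1 (Suc n) x) - (?p n - ?q n)" for n
        unfolding \<psi>d by (simp add: algebra_simps)
      have pq: "\<bar>?p n\<bar> \<le> \<bar>f x * l1 n x\<bar>" "\<bar>?q n\<bar> \<le> \<bar>f x * l1 n (1 - x)\<bar>" for n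
        unfolding abs_mult[of "f x * l1 n x"] abs_mult[of "f x * l1 n (1 - x)"]
        using flat_bounds by (auto intro!: mult_left_le)
      show "\<bar>deriv f x - deriv (\<psi> n) x\<bar> \<le> 7 * L" for n
      proof -
        have "\<bar>deriv f x\<bar> \<le> L" using L x by auto
        moreover have "\<bar>1 - cutoff 0 1 (Suc n) x\<bar> \<le> 1" using cutoff_bounds[of 0 1 "Suc n" x] by auto
        ultimately have "\<bar>deriv f x * (1 - cutoff 0 1 (Suc n) x)\<bar> \<le> L * 1"
          unfolding abs_mult by (intro mult_mono) (use L0 in auto)
        then show ?thesis unfolding eq using pq[of n] b1[OF x, of n] by linarith
      qed
      have "?p \<longlonglongrightarrow> 0"
        by (rule Lim_null_comparison[OF _ tendsto_rabs_zero[OF t1(1)[OF x]]]) (use pq in simp)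
      moreover have "?q \<longlonglongrightarrow> 0"
        by (rule Lim_null_comparison[OF _ tendsto_rabs_zero[OF t1(2)[OF x]]]) (use pq in simp)
      ultimately have "(\<lambda>n. deriv f x * (1 - cutoff 0 1 (Suc n) x) - (?p n - ?q n)) \<longlonglongrightarrow> deriv f x * (1 - 1) - (0 - 0)"
        by (intro tendsto_diff tendsto_mult tendsto_const cut1 x)
      then show "(\<lambda>n. deriv f x - deriv (\<psi> n) x) \<longlonglongrightarrow> 0" unfolding eq by simp
    qed
  qed
qed

section \<open>Sobolev spaces in terms of sine coefficients\<close>

lemma freq_ge_1: "1 \<le> freq k"
proof -
  have "1 * 1 \<le> real (Suc k) * pi" using pi_ge_two by (intro mult_mono) auto
  then show ?thesis by (simp add: freq_def)
qed

lemma freq_mono: "mono freq"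
  by (auto simp: mono_def freq_def)

lemma freq_at_top: "filterlim freq at_top sequentially"
  unfolding freq_def by real_asymp

lemma inverse_freq_ell2: "(\<lambda>k. 1 / freq k) \<in> ell2"
proof -
  have "summable (\<lambda>n. inverse (real n ^ 2))" by (rule inverse_power_summable) simp
  then have "summable (\<lambda>k. inverse (real (Suc k) ^ 2))" by (subst summable_Suc_iff)
  then have "summable (\<lambda>k. (1 / pi\<^sup>2) * inverse (real (Suc k) ^ 2))" by (rule summable_mult)
  then show ?thesis by (simp add: ell2_def freq_def power_mult_distrib divide_inverse power_inverse mult_ac)
qed

lemma ell2_of_freq_weighted: "(\<lambda>k. freq k * c k) \<in> ell2 \<Longrightarrow> c \<in> ell2"
proof (rule ell2_mono(1))
  fix k
  have "1 * \<bar>c k\<bar> \<le> freq k * \<bar>c k\<bar>" using freq_ge_1[of k] by (rule mult_right_mono) simp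
  then show "\<bar>c k\<bar> \<le> \<bar>freq k * c k\<bar>" using freq_pos[of k] by (simp add: abs_mult)
qed

definition embedding_const :: real where
  "embedding_const = sqrt 2 * ell2_norm (\<lambda>k. 1 / freq k)"

text \<open>The one-dimensional Sobolev embedding: \<open>\<Sum> 1 / \<kappa>\<^sub>k\<^sup>2\<close> converges, so finite energy makes the
  coefficients absolutely summable.\<close>
lemma sum_abs_le_weighted:
  assumes c: "(\<lambda>k. freq k * c k) \<in> ell2"
  shows "(\<Sum>k<N. \<bar>c k\<bar>) \<le> ell2_norm (\<lambda>k. 1 / freq k) * ell2_norm (\<lambda>k. freq k * c k)"
proof -
  have "(\<Sum>k<N. \<bar>c k\<bar>) = (\<Sum>k<N. \<bar>1 / freq k\<bar> * \<bar>freq k * c k\<bar>)"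
    using freq_pos by (intro sum.cong) (auto simp: abs_mult less_imp_neq[symmetric])
  also have "\<dots> \<le> L2_set (\<lambda>k. 1 / freq k) {..<N} * L2_set (\<lambda>k. freq k * c k) {..<N}"
    by (rule L2_set_mult_ineq)
  also have "\<dots> \<le> ell2_norm (\<lambda>k. 1 / freq k) * ell2_norm (\<lambda>k. freq k * c k)"
    by (intro mult_mono ell2_L2_set_le inverse_freq_ell2 c ell2_norm_nonneg L2_set_nonneg) auto
  finally show ?thesis .
qed

text \<open>For coefficients of finite energy the series converges uniformly, and its sum is a canonical
  continuous representative of an element of \<open>H10\<close>.\<close>
definition synth :: "(nat \<Rightarrow> real) \<Rightarrow> real \<Rightarrow> real" where
  "synth c x = (\<Sum>k. c k * sine k x)"

context
  fixes c assumes c: "(\<lambda>k. freq k * c k) \<in> ell2"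
begin

lemma coeff_abs_summable: "summable (\<lambda>k. \<bar>c k\<bar>)"
  by (rule summableI_nonneg_bounded[OF _ sum_abs_le_weighted[OF c]]) simp

lemma coeff_term_le: "norm (c k * sine k x) \<le> sqrt 2 * \<bar>c k\<bar>"
  using mult_left_mono[OF sine_abs_le[of k x], of "\<bar>c k\<bar>"] by (simp add: abs_mult mult.commute)

lemma synth_summable: "summable (\<lambda>k. c k * sine k x)"
  by (rule summable_comparison_test'[OF summable_mult[OF coeff_abs_summable, of "sqrt 2"] coeff_term_le])

lemma synth_uniform_limit: "uniform_limit UNIV (\<lambda>n x. \<Sum>k<n. c k * sine k x) (synth c) sequentially"
  unfolding synth_def[abs_def]
  by (rule Weierstrass_m_test[OF coeff_term_le summable_mult[OF coeff_abs_summable]])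

lemma synth_cont: "continuous_on A (synth c)"
proof (rule continuous_on_subset)
  show "continuous_on UNIV (synth c)"
    by (rule uniform_limit_theorem[OF _ synth_uniform_limit])
      (auto intro!: always_eventually continuous_intros sine_cont)
qed simp

lemma synth_L2: "synth c \<in> L2"
  by (rule continuous_L2[OF synth_cont])

lemma synth_abs_le: "\<bar>synth c x\<bar> \<le> embedding_const * ell2_norm (\<lambda>k. freq k * c k)"
proof -
  have s: "summable (\<lambda>k. sqrt 2 * \<bar>c k\<bar>)" by (rule summable_mult[OF coeff_abs_summable])
  have sn: "summable (\<lambda>k. norm (c k * sine k x))"
    by (rule summable_comparison_test'[OF s]) (use coeff_term_le in auto)
  have "\<bar>synth c x\<bar> \<le> (\<Sum>k. norm (c k * sine k x))"
    unfolding synth_def using summable_norm[OF sn] by simp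
  also have "\<dots> \<le> (\<Sum>k. sqrt 2 * \<bar>c k\<bar>)" by (rule suminf_le[OF coeff_term_le sn s])
  also have "\<dots> \<le> embedding_const * ell2_norm (\<lambda>k. freq k * c k)"
  proof (rule suminf_le_const[OF s])
    fix n
    have "sqrt 2 * (\<Sum>k<n. \<bar>c k\<bar>) \<le> sqrt 2 * (ell2_norm (\<lambda>k. 1 / freq k) * ell2_norm (\<lambda>k. freq k * c k))"
      by (rule mult_left_mono[OF sum_abs_le_weighted[OF c]]) simp
    then show "(\<Sum>k<n. sqrt 2 * \<bar>c k\<bar>) \<le> embedding_const * ell2_norm (\<lambda>k. freq k * c k)"
      by (simp add: embedding_const_def sum_distrib_left mult.assoc)
  qed
  finally show ?thesis .
qed

lemma partial_sum_L2: "(\<lambda>x. \<Sum>k<n. c k * sine k x) \<in> L2"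
  by (rule orthonormal_sum_L2[OF orthonormal_sine])

lemma synth_L2_limit: "(\<lambda>n. L2_norm (\<lambda>x. (\<Sum>k<n. c k * sine k x) - synth c x)) \<longlonglongrightarrow> 0"
proof (rule LIMSEQ_I)
  fix e :: real assume e: "0 < e"
  obtain N where N: "\<And>n x. n \<ge> N \<Longrightarrow> dist (\<Sum>k<n. c k * sine k x) (synth c x) < e / 2"
    using uniform_limitD[OF synth_uniform_limit half_gt_zero[OF e]] by (auto simp: eventually_sequentially)
  have "L2_norm (\<lambda>x. (\<Sum>k<n. c k * sine k x) - synth c x) \<le> e / 2" if "n \<ge> N" for n
    by (rule bounded_L2(2)[OF L2_measurable[OF L2_diff[OF partial_sum_L2 synth_L2]]])
      (use N[OF that] e in \<open>auto simp: dist_real_def less_imp_le\<close>)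
  then show "\<exists>N. \<forall>n\<ge>N. norm (L2_norm (\<lambda>x. (\<Sum>k<n. c k * sine k x) - synth c x) - 0) < e"
    using e L2_norm_nonneg by (intro exI[of _ N]) fastforce
qed

lemma synth_coeff: "sine_coeff (synth c) k = c k"
  unfolding sine_coeff_def by (rule riesz_fischer_limit(1)[OF orthonormal_sine synth_L2 synth_L2_limit])

lemma synth_norm: "L2_norm (synth c) = ell2_norm c"
  by (rule riesz_fischer_limit(3)[OF orthonormal_sine synth_L2 synth_L2_limit])

lemma partial_sum_deriv:
  "((\<lambda>x. \<Sum>k<n. c k * sine k x) has_real_derivative (\<Sum>k<n. (freq k * c k) * cosine k x)) (at x)"
  by (auto intro!: derivative_eq_intros sine_deriv sum.cong)

lemma partial_sum_smooth: "smooth (\<lambda>x. \<Sum>k<n. c k * sine k x)"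
  unfolding sine_def by (intro smooth_sum smooth_scale smooth_sin)

lemma synth_weak_deriv_exists:
  obtains v where "v \<in> L2" "(\<lambda>n. L2_norm (\<lambda>x. (\<Sum>k<n. (freq k * c k) * cosine k x) - v x)) \<longlonglongrightarrow> 0"
    "is_weak_deriv (synth c) v" "L2_norm v = ell2_norm (\<lambda>k. freq k * c k)"
proof -
  obtain v where v: "v \<in> L2" "(\<lambda>n. L2_norm (\<lambda>x. (\<Sum>k<n. (freq k * c k) * cosine k x) - v x)) \<longlonglongrightarrow> 0"
    by (rule riesz_fischer[OF orthonormal_cosine c])
  have "is_weak_deriv (synth c) v"
  proof (rule is_weak_deriv_limit[OF partial_sum_L2 _ synth_L2 v(1) _ synth_L2_limit v(2)])
    show "(\<lambda>x. \<Sum>k<n. (freq k * c k) * cosine k x) \<in> L2" for n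
      by (rule orthonormal_sum_L2[OF orthonormal_cosine])
    show "is_weak_deriv (\<lambda>x. \<Sum>k<n. c k * sine k x) (\<lambda>x. \<Sum>k<n. (freq k * c k) * cosine k x)" for n
      by (rule classical_weak_deriv[OF partial_sum_deriv]) (intro continuous_intros cosine_cont)
  qed
  moreover have "L2_norm v = ell2_norm (\<lambda>k. freq k * c k)"
    by (rule riesz_fischer_limit(3)[OF orthonormal_cosine v])
  ultimately show thesis using v by (intro that)
qed

lemma synth_H1: "synth c \<in> H1"
  by (rule synth_weak_deriv_exists) (rule H1I[OF synth_L2])

lemma H10_norm_synth: "H10_norm (synth c) = ell2_norm (\<lambda>k. freq k * c k)"
  unfolding H10_norm_def by (rule synth_weak_deriv_exists) (simp add: L2_norm_weak_deriv[OF synth_L2])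

text \<open>A partial sum that is close to the series in the \<open>H1\<close> norm is smooth and vanishes at both end points, so
  a test function lies close to it.\<close>
lemma synth_H10: "synth c \<in> H10"
proof -
  obtain v where v: "v \<in> L2" "(\<lambda>n. L2_norm (\<lambda>x. (\<Sum>k<n. (freq k * c k) * cosine k x) - v x)) \<longlonglongrightarrow> 0"
    "is_weak_deriv (synth c) v" "L2_norm v = ell2_norm (\<lambda>k. freq k * c k)" by (rule synth_weak_deriv_exists)
  have "\<exists>\<psi>\<in>test_functions. H1_norm (\<lambda>x. synth c x - \<psi> x) < e" if e: "0 < e" for e
  proof -
    let ?s = "\<lambda>n x. \<Sum>k<n. c k * sine k x" and ?d = "\<lambda>n x. \<Sum>k<n. (freq k * c k) * cosine k x"
    have e8: "0 < e / 8" using e by simp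
    have "eventually (\<lambda>n. L2_norm (\<lambda>x. ?s n x - synth c x) < e / 8 \<and> L2_norm (\<lambda>x. ?d n x - v x) < e / 8) sequentially"
      by (intro eventually_conj order_tendstoD(2)[OF synth_L2_limit e8] order_tendstoD(2)[OF v(2) e8])
    then obtain n where n: "L2_norm (\<lambda>x. ?s n x - synth c x) < e / 8" "L2_norm (\<lambda>x. ?d n x - v x) < e / 8"
      by (auto simp: eventually_sequentially)
    have sd: "deriv (?s n) = ?d n" by (rule ext, rule DERIV_imp_deriv, rule partial_sum_deriv)
    have "sine k 0 = 0" "sine k 1 = 0" for k
      using sin_npi[of "Suc k"] by (auto simp: sine_def freq_def)
    then have s01: "?s n 0 = 0" "?s n 1 = 0" by auto
    obtain \<psi> where \<psi>: "\<And>j::nat. \<psi> j \<in> test_functions" "(\<lambda>j. L2_norm (\<lambda>x. ?s n x - \<psi> j x)) \<longlonglongrightarrow> 0"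
      "(\<lambda>j. L2_norm (\<lambda>x. deriv (?s n) x - deriv (\<psi> j) x)) \<longlonglongrightarrow> 0"
    proof (rule smooth_vanishing_approx[OF partial_sum_smooth s01])
      fix \<psi> :: "nat \<Rightarrow> real \<Rightarrow> real"
      assume "\<And>j. \<psi> j \<in> test_functions" "(\<lambda>j. L2_norm (\<lambda>x. ?s n x - \<psi> j x)) \<longlonglongrightarrow> 0"
        "(\<lambda>j. L2_norm (\<lambda>x. deriv (?s n) x - deriv (\<psi> j) x)) \<longlonglongrightarrow> 0"
      then show thesis by (rule that)
    qed
    have "eventually (\<lambda>j. L2_norm (\<lambda>x. ?s n x - \<psi> j x) < e / 8 \<and> L2_norm (\<lambda>x. deriv (?s n) x - deriv (\<psi> j) x) < e / 8) sequentially"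
      by (intro eventually_conj order_tendstoD(2)[OF \<psi>(2) e8] order_tendstoD(2)[OF \<psi>(3) e8])
    then obtain j where j: "L2_norm (\<lambda>x. ?s n x - \<psi> j x) < e / 8" "L2_norm (\<lambda>x. ?d n x - deriv (\<psi> j) x) < e / 8"
      unfolding sd by (auto simp: eventually_sequentially)
    note \<psi>L = test_function_L2[OF \<psi>(1)[of j]]
    have dL: "?d n \<in> L2" by (rule orthonormal_sum_L2[OF orthonormal_cosine])
    have 1: "L2_norm (\<lambda>x. synth c x - \<psi> j x) \<le> e / 4"
      using L2_triangle_diff[OF synth_L2 partial_sum_L2 \<psi>L(1), of n] n(1) j(1)
        L2_norm_minus_commute[of "?s n" "synth c"] by linarith
    have 2: "L2_norm (\<lambda>x. v x - deriv (\<psi> j) x) \<le> e / 4"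
      using L2_triangle_diff[OF v(1) dL \<psi>L(2)] n(2) j(2) L2_norm_minus_commute[of "?d n" v] by linarith
    have s\<psi>: "smooth (\<psi> j)" by (rule test_function_smooth[OF \<psi>(1)])
    have w: "is_weak_deriv (\<lambda>x. synth c x - \<psi> j x) (\<lambda>x. v x - deriv (\<psi> j) x)"
      by (rule is_weak_deriv_diff[OF synth_L2 \<psi>L(1) v(1) \<psi>L(2) v(3)
            classical_weak_deriv[OF smooth_has_deriv[OF s\<psi>] smooth_continuous[OF smooth_deriv[OF s\<psi>]]]])
    have "H1_norm (\<lambda>x. synth c x - \<psi> j x) = sqrt ((L2_norm (\<lambda>x. synth c x - \<psi> j x))\<^sup>2 + (L2_norm (\<lambda>x. v x - deriv (\<psi> j) x))\<^sup>2)"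
      unfolding H1_norm_def L2_norm_weak_deriv[OF L2_diff[OF synth_L2 \<psi>L(1)] L2_diff[OF v(1) \<psi>L(2)] w] ..
    also have "\<dots> \<le> L2_norm (\<lambda>x. synth c x - \<psi> j x) + L2_norm (\<lambda>x. v x - deriv (\<psi> j) x)"
      by (rule sqrt_sum_squares_le_sum) (rule L2_norm_nonneg)+
    also have "\<dots> < e" using 1 2 e by simp
    finally show ?thesis using \<psi>(1) by blast
  qed
  then have "\<forall>n. \<exists>\<psi>\<in>test_functions. H1_norm (\<lambda>x. synth c x - \<psi> x) < 1 / real (Suc n)" by simp
  then obtain \<psi> where \<psi>: "\<And>n. \<psi> n \<in> test_functions" "\<And>n. H1_norm (\<lambda>x. synth c x - \<psi> n x) < 1 / real (Suc n)"
    by metis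
  have "(\<lambda>n. H1_norm (\<lambda>x. synth c x - \<psi> n x)) \<longlonglongrightarrow> 0"
  proof (rule tendsto_sandwich[OF _ _ tendsto_const])
    show "eventually (\<lambda>n. 0 \<le> H1_norm (\<lambda>x. synth c x - \<psi> n x)) sequentially"
      by (auto simp: H1_norm_def)
    show "eventually (\<lambda>n. H1_norm (\<lambda>x. synth c x - \<psi> n x) \<le> 1 / real (Suc n)) sequentially"
      by (intro always_eventually allI less_imp_le \<psi>(2))
    show "(\<lambda>n. 1 / real (Suc n)) \<longlonglongrightarrow> 0" by real_asymp
  qed
  then show ?thesis using synth_H1 \<psi>(1) by (auto simp: H10_def)
qed

end

lemma synth_diff:
  assumes "(\<lambda>k. freq k * c k) \<in> ell2" "(\<lambda>k. freq k * d k) \<in> ell2"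
  shows "synth c x - synth d x = synth (\<lambda>k. c k - d k) x"
  using suminf_diff[OF synth_summable[OF assms(1)] synth_summable[OF assms(2)], of x x]
  by (simp add: synth_def left_diff_distrib)

lemma H10_approx:
  assumes "u \<in> H10"
  obtains \<psi> where "\<And>n::nat. \<psi> n \<in> test_functions" "(\<lambda>n. L2_norm (\<lambda>x. \<psi> n x - u x)) \<longlonglongrightarrow> 0"
    "(\<lambda>n. L2_norm (\<lambda>x. deriv (\<psi> n) x - weak_deriv u x)) \<longlonglongrightarrow> 0"
proof -
  have u: "u \<in> H1" using assms by (simp add: H10_def)
  note U = weak_deriv_props[OF u]
  obtain \<psi> where \<psi>: "\<And>n::nat. \<psi> n \<in> test_functions" and lim: "(\<lambda>n. H1_norm (\<lambda>x. u x - \<psi> n x)) \<longlonglongrightarrow> 0"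
    using assms by (auto simp: H10_def)
  note \<psi>L = test_function_L2[OF \<psi>]
  have w: "L2_norm (weak_deriv (\<lambda>x. u x - \<psi> n x)) = L2_norm (\<lambda>x. weak_deriv u x - deriv (\<psi> n) x)" for n
  proof (rule L2_norm_weak_deriv[OF L2_diff[OF U(1) \<psi>L(1)] L2_diff[OF U(2) \<psi>L(2)]])
    have s: "smooth (\<psi> n)" by (rule test_function_smooth[OF \<psi>])
    show "is_weak_deriv (\<lambda>x. u x - \<psi> n x) (\<lambda>x. weak_deriv u x - deriv (\<psi> n) x)"
      by (rule is_weak_deriv_diff[OF U(1) \<psi>L(1) U(2) \<psi>L(2) U(3)
            classical_weak_deriv[OF smooth_has_deriv[OF s] smooth_continuous[OF smooth_deriv[OF s]]]])
  qed
  show thesis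
  proof (rule that[OF \<psi>])
    show "(\<lambda>n. L2_norm (\<lambda>x. \<psi> n x - u x)) \<longlonglongrightarrow> 0"
    proof (rule tendsto_sandwich[OF _ _ tendsto_const lim])
      show "eventually (\<lambda>n. L2_norm (\<lambda>x. \<psi> n x - u x) \<le> H1_norm (\<lambda>x. u x - \<psi> n x)) sequentially"
        by (intro always_eventually allI)
          (simp add: H1_norm_def L2_norm_minus_commute[of _ u] real_le_rsqrt)
    qed (simp add: L2_norm_nonneg)
    show "(\<lambda>n. L2_norm (\<lambda>x. deriv (\<psi> n) x - weak_deriv u x)) \<longlonglongrightarrow> 0"
    proof (rule tendsto_sandwich[OF _ _ tendsto_const lim])
      show "eventually (\<lambda>n. L2_norm (\<lambda>x. deriv (\<psi> n) x - weak_deriv u x) \<le> H1_norm (\<lambda>x. u x - \<psi> n x)) sequentially"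
        by (intro always_eventually allI)
          (simp add: H1_norm_def w L2_norm_minus_commute[of _ "weak_deriv u"] real_le_rsqrt)
    qed (simp add: L2_norm_nonneg)
  qed
qed

lemma H10_L2: "u \<in> H10 \<Longrightarrow> u \<in> L2"
  using weak_deriv_props(1) by (auto simp: H10_def)

text \<open>The factor \<open>f\<close> need not vanish at the boundary, since functions in \<open>H10\<close> are limits of test
  functions. With \<open>f\<close> a cosine this computes the coefficients of the derivative.\<close>
lemma H10_integration_by_parts:
  assumes u: "u \<in> H10" and f: "\<And>x. (f has_real_derivative f' x) (at x)" "continuous_on UNIV f'"
  shows "L2_inner (weak_deriv u) f = - L2_inner u f'"
proof -
  obtain \<psi> where \<psi>: "\<And>n::nat. \<psi> n \<in> test_functions" "(\<lambda>n. L2_norm (\<lambda>x. \<psi> n x - u x)) \<longlonglongrightarrow> 0"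
    "(\<lambda>n. L2_norm (\<lambda>x. deriv (\<psi> n) x - weak_deriv u x)) \<longlonglongrightarrow> 0"
  proof (rule H10_approx[OF u])
    fix \<psi> :: "nat \<Rightarrow> real \<Rightarrow> real"
    assume "\<And>n. \<psi> n \<in> test_functions" "(\<lambda>n. L2_norm (\<lambda>x. \<psi> n x - u x)) \<longlonglongrightarrow> 0"
      "(\<lambda>n. L2_norm (\<lambda>x. deriv (\<psi> n) x - weak_deriv u x)) \<longlonglongrightarrow> 0"
    then show thesis by (rule that)
  qed
  have U: "u \<in> L2" "weak_deriv u \<in> L2" using u weak_deriv_props by (auto simp: H10_def)
  have fL: "f \<in> L2" "f' \<in> L2"
    by (auto intro!: continuous_L2 continuous_on_subset[OF f(2)])
      (meson DERIV_isCont continuous_at_imp_continuous_on f(1))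
  have "L2_inner (deriv (\<psi> n)) f = - L2_inner (\<psi> n) f'" for n
    using integration_by_parts_test[OF f \<psi>(1)[of n]] by (simp add: L2_inner_commute)
  moreover have "(\<lambda>n. L2_inner (deriv (\<psi> n)) f) \<longlonglongrightarrow> L2_inner (weak_deriv u) f"
    by (rule L2_inner_tendsto[OF test_function_L2(2)[OF \<psi>(1)] U(2) fL(1) \<psi>(3)])
  moreover have "(\<lambda>n. - L2_inner (\<psi> n) f') \<longlonglongrightarrow> - L2_inner u f'"
    by (rule tendsto_minus[OF L2_inner_tendsto[OF test_function_L2(1)[OF \<psi>(1)] U(1) fL(2) \<psi>(2)]])
  ultimately show ?thesis by (auto intro: LIMSEQ_unique)
qed

text \<open>The cosine coefficients of the derivative are \<open>\<kappa>\<^sub>k\<close> times the sine coefficients of the function, so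
  Bessel's inequality gives finite energy. The function then agrees with its series, and uniqueness of weak derivatives
  turns the inequality into equality of norms.\<close>
lemma H10_coeff:
  assumes u: "u \<in> H10"
  shows "(\<lambda>k. freq k * sine_coeff u k) \<in> ell2" and "AE x in leb01. u x = synth (sine_coeff u) x"
    and "H10_norm u = ell2_norm (\<lambda>k. freq k * sine_coeff u k)"
proof -
  have U: "u \<in> L2" "weak_deriv u \<in> L2" "is_weak_deriv u (weak_deriv u)"
    using u weak_deriv_props by (auto simp: H10_def)
  have "L2_inner (weak_deriv u) (cosine k) = freq k * sine_coeff u k" for k
  proof -
    have "L2_inner (weak_deriv u) (cosine k) = - L2_inner u (\<lambda>x. - freq k * sine k x)"
      by (rule H10_integration_by_parts[OF u cosine_deriv]) (intro continuous_intros sine_cont)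
    also have "\<dots> = freq k * sine_coeff u k"
      using L2_inner_scale[of "- freq k" "sine k" u] by (simp add: sine_coeff_def L2_inner_commute[of u])
    finally show ?thesis .
  qed
  then show c: "(\<lambda>k. freq k * sine_coeff u k) \<in> ell2"
    using bessel(1)[OF orthonormal_cosine U(2)] by simp
  show ae: "AE x in leb01. u x = synth (sine_coeff u) x"
    by (rule sine_coeff_eq_AE[OF U(1) synth_L2[OF c]]) (simp add: synth_coeff[OF c])
  have "is_weak_deriv (synth (sine_coeff u)) (weak_deriv u)"
    by (rule is_weak_deriv_cong_AE[OF U(1) synth_L2[OF c] ae U(3)])
  then have "L2_norm (weak_deriv (synth (sine_coeff u))) = L2_norm (weak_deriv u)"
    by (rule L2_norm_weak_deriv[OF synth_L2[OF c] U(2)])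
  then show "H10_norm u = ell2_norm (\<lambda>k. freq k * sine_coeff u k)"
    using H10_norm_synth[OF c] by (simp add: H10_norm_def)
qed

text \<open>The second weak derivative is tested with sines, which are admissible because they are themselves limits of
  test functions; moving one derivative over to the sine and the other one back gives the factor \<open>- \<kappa>\<^sub>k\<^sup>2\<close>.\<close>
lemma H2_coeff:
  assumes u: "u \<in> H10" "u \<in> H2"
  shows "(\<lambda>k. (freq k)\<^sup>2 * sine_coeff u k) \<in> ell2"
proof -
  have V: "weak_deriv u \<in> H1" using u(2) by (simp add: H2_def)
  note W = weak_deriv_props[OF V]
  have c: "(\<lambda>k. freq k * c k) \<in> ell2" if "c = (\<lambda>i. if i = k then 1 else 0)" for c :: "nat \<Rightarrow> real" and k
    unfolding ell2_def that by (auto intro!: summable_finite[of "{k}"] split: if_splits)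
  have "L2_inner (weak_deriv (weak_deriv u)) (sine k) = - ((freq k)\<^sup>2 * sine_coeff u k)" for k
  proof -
    have s10: "sine k \<in> H10"
    proof -
      let ?c = "\<lambda>i. if i = k then 1 else 0 :: real"
      have "synth ?c x = sine k x" for x
        unfolding synth_def using suminf_finite[of "{k}" "\<lambda>i. ?c i * sine i x"] by simp
      then show ?thesis using synth_H10[OF c[OF refl, of k]] by (metis ext)
    qed
    obtain \<psi> where \<psi>: "\<And>n::nat. \<psi> n \<in> test_functions" "(\<lambda>n. L2_norm (\<lambda>x. \<psi> n x - sine k x)) \<longlonglongrightarrow> 0"
      "(\<lambda>n. L2_norm (\<lambda>x. deriv (\<psi> n) x - weak_deriv (sine k) x)) \<longlonglongrightarrow> 0"
    proof (rule H10_approx[OF s10])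
      fix \<psi> :: "nat \<Rightarrow> real \<Rightarrow> real"
      assume "\<And>n. \<psi> n \<in> test_functions" "(\<lambda>n. L2_norm (\<lambda>x. \<psi> n x - sine k x)) \<longlonglongrightarrow> 0"
        "(\<lambda>n. L2_norm (\<lambda>x. deriv (\<psi> n) x - weak_deriv (sine k) x)) \<longlonglongrightarrow> 0"
      then show thesis by (rule that)
    qed
    have wd: "is_weak_deriv (sine k) (\<lambda>x. freq k * cosine k x)"
      by (rule classical_weak_deriv[OF sine_deriv]) (intro continuous_intros cosine_cont)
    have cL: "(\<lambda>x. freq k * cosine k x) \<in> L2" by (rule L2_scale[OF cosine_L2])
    have sW: "weak_deriv (sine k) \<in> L2" using s10 weak_deriv_props(2) by (simp add: H10_def)
    have "L2_inner (weak_deriv u) (deriv (\<psi> n)) = - L2_inner (weak_deriv (weak_deriv u)) (\<psi> n)" for n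
      using W(3) \<psi>(1) by (simp add: is_weak_deriv_inner)
    moreover have "(\<lambda>n. L2_inner (weak_deriv u) (deriv (\<psi> n))) \<longlonglongrightarrow> L2_inner (weak_deriv u) (weak_deriv (sine k))"
      unfolding L2_inner_commute[of "weak_deriv u"]
      by (rule L2_inner_tendsto[OF test_function_L2(2)[OF \<psi>(1)] sW W(1) \<psi>(3)])
    moreover have "(\<lambda>n. - L2_inner (weak_deriv (weak_deriv u)) (\<psi> n)) \<longlonglongrightarrow> - L2_inner (weak_deriv (weak_deriv u)) (sine k)"
      unfolding L2_inner_commute[of "weak_deriv (weak_deriv u)"]
      by (rule tendsto_minus[OF L2_inner_tendsto[OF test_function_L2(1)[OF \<psi>(1)] sine_L2 W(2) \<psi>(2)]])
    ultimately have "L2_inner (weak_deriv u) (weak_deriv (sine k)) = - L2_inner (weak_deriv (weak_deriv u)) (sine k)"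
      by (auto intro: LIMSEQ_unique)
    moreover have "L2_inner (weak_deriv (sine k)) (weak_deriv u) = L2_inner (\<lambda>x. freq k * cosine k x) (weak_deriv u)"
      by (rule L2_inner_cong_AE[OF sW cL W(1) weak_deriv_AE[OF sine_L2 cL wd]])
    moreover have "L2_inner (weak_deriv u) (cosine k) = - L2_inner u (\<lambda>x. - freq k * sine k x)"
      by (rule H10_integration_by_parts[OF u(1) cosine_deriv]) (intro continuous_intros sine_cont)
    ultimately show ?thesis
      using L2_inner_scale[of "- freq k" "sine k" u] L2_inner_scale[of "freq k" "cosine k" "weak_deriv u"]
      by (simp add: sine_coeff_def L2_inner_commute power2_eq_square)
  qed
  then have "(\<lambda>k. - ((freq k)\<^sup>2 * sine_coeff u k)) \<in> ell2"
    using bessel(1)[OF orthonormal_sine W(2)] by simp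
  then show ?thesis by (simp add: ell2_def)
qed

lemma synth_H2:
  assumes c1: "(\<lambda>k. freq k * c k) \<in> ell2" and c2: "(\<lambda>k. (freq k)\<^sup>2 * c k) \<in> ell2"
  shows "synth c \<in> H2"
    and "weak_deriv (weak_deriv (synth c)) \<in> L2"
    and "sine_coeff (weak_deriv (weak_deriv (synth c))) k = - ((freq k)\<^sup>2 * c k)"
proof -
  obtain v where v: "v \<in> L2" "(\<lambda>n. L2_norm (\<lambda>x. (\<Sum>k<n. (freq k * c k) * cosine k x) - v x)) \<longlonglongrightarrow> 0"
    "is_weak_deriv (synth c) v" "L2_norm v = ell2_norm (\<lambda>k. freq k * c k)" by (rule synth_weak_deriv_exists[OF c1])
  have c2': "(\<lambda>k. - ((freq k)\<^sup>2 * c k)) \<in> ell2" using c2 by (simp add: ell2_def)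
  obtain z where z: "z \<in> L2" "(\<lambda>n. L2_norm (\<lambda>x. (\<Sum>k<n. - ((freq k)\<^sup>2 * c k) * sine k x) - z x)) \<longlonglongrightarrow> 0"
    by (rule riesz_fischer[OF orthonormal_sine c2'])
  have vz: "is_weak_deriv v z"
  proof (rule is_weak_deriv_limit[OF _ _ v(1) z(1) _ v(2) z(2)])
    show "(\<lambda>x. \<Sum>k<n. (freq k * c k) * cosine k x) \<in> L2" for n
      by (rule orthonormal_sum_L2[OF orthonormal_cosine])
    show "(\<lambda>x. \<Sum>k<n. - ((freq k)\<^sup>2 * c k) * sine k x) \<in> L2" for n
      by (rule orthonormal_sum_L2[OF orthonormal_sine])
    show "is_weak_deriv (\<lambda>x. \<Sum>k<n. (freq k * c k) * cosine k x) (\<lambda>x. \<Sum>k<n. - ((freq k)\<^sup>2 * c k) * sine k x)" for n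
      by (rule classical_weak_deriv)
        (auto intro!: derivative_eq_intros cosine_deriv sum.cong continuous_intros sine_cont simp: power2_eq_square)
  qed
  have u1: "synth c \<in> H1" by (rule synth_H1[OF c1])
  note W = weak_deriv_props[OF u1]
  have ae: "AE x in leb01. v x = weak_deriv (synth c) x"
    using weak_deriv_AE[OF W(1) v(1) v(3)] by (auto elim: eventually_mono)
  have wz: "is_weak_deriv (weak_deriv (synth c)) z" by (rule is_weak_deriv_cong_AE[OF v(1) W(2) ae vz])
  show "synth c \<in> H2" using u1 H1I[OF W(2) z(1) wz] by (simp add: H2_def)
  then have w1: "weak_deriv (synth c) \<in> H1" by (simp add: H2_def)
  show zL: "weak_deriv (weak_deriv (synth c)) \<in> L2" by (rule weak_deriv_props(2)[OF w1])
  have "sine_coeff (weak_deriv (weak_deriv (synth c))) k = sine_coeff z k"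
    by (rule sine_coeff_cong_AE[OF zL z(1) weak_deriv_AE[OF W(2) z(1) wz]])
  also have "\<dots> = - ((freq k)\<^sup>2 * c k)"
    unfolding sine_coeff_def by (rule riesz_fischer_limit(1)[OF orthonormal_sine z])
  finally show "sine_coeff (weak_deriv (weak_deriv (synth c))) k = - ((freq k)\<^sup>2 * c k)" .
qed

lemma H2_norm_synth:
  assumes c1: "(\<lambda>k. freq k * c k) \<in> ell2" and c2: "(\<lambda>k. (freq k)\<^sup>2 * c k) \<in> ell2"
  shows "H2_norm (synth c) = sqrt ((ell2_norm c)\<^sup>2 + (ell2_norm (\<lambda>k. freq k * c k))\<^sup>2 + (ell2_norm (\<lambda>k. (freq k)\<^sup>2 * c k))\<^sup>2)"
proof -
  have "L2_norm (weak_deriv (weak_deriv (synth c))) = ell2_norm (sine_coeff (weak_deriv (weak_deriv (synth c))))"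
    by (rule sine_parseval[OF synth_H2(2)[OF assms]])
  also have "\<dots> = ell2_norm (\<lambda>k. (freq k)\<^sup>2 * c k)"
    by (simp add: ell2_norm_def synth_H2(3)[OF assms])
  finally show ?thesis
    using synth_norm[OF c1] H10_norm_synth[OF c1] by (simp add: H2_norm_def H10_norm_def)
qed

section \<open>The strong solution\<close>

text \<open>Allows moduli stated for differences in \<open>H10\<close> to be read as moduli for coefficients.\<close>
lemma synth_coeff_H10_norm_diff:
  assumes u: "u \<in> H10" and v: "v \<in> H10"
  shows "H10_norm (\<lambda>x. u x - v x) = ell2_norm (\<lambda>k. freq k * (sine_coeff u k - sine_coeff v k))"
proof -
  let ?c = "\<lambda>k. sine_coeff u k - sine_coeff v k"
  note cu = H10_coeff[OF u] and cv = H10_coeff[OF v]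
  have c: "(\<lambda>k. freq k * ?c k) \<in> ell2" using ell2_diff(1)[OF cu(1) cv(1)] by (simp add: right_diff_distrib)
  have L: "(\<lambda>x. u x - v x) \<in> L2" by (intro L2_diff H10_L2 u v)
  have ae: "AE x in leb01. synth ?c x = u x - v x"
    using cu(2) cv(2)
  proof eventually_elim
    case (elim x)
    then show ?case using synth_diff[OF cu(1) cv(1), of x] by simp
  qed
  obtain d where d: "d \<in> L2" "is_weak_deriv (synth ?c) d" "L2_norm d = ell2_norm (\<lambda>k. freq k * ?c k)"
    by (rule synth_weak_deriv_exists[OF c])
  have "is_weak_deriv (\<lambda>x. u x - v x) d" by (rule is_weak_deriv_cong_AE[OF synth_L2[OF c] L ae d(2)])
  then show ?thesis unfolding H10_norm_def using L2_norm_weak_deriv[OF L d(1)] d(3) by simp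
qed

text \<open>Reach \<open>u\<close> from 0 in at most \<open>\<bar>u\<bar> + 1\<close> steps of length at most 1. This growth bound is what keeps
  solutions global in time.\<close>
lemma modulus_linear_growth:
  fixes f \<mu> :: "real \<Rightarrow> real"
  assumes f: "\<And>s s'. \<bar>f s - f s'\<bar> \<le> \<mu> \<bar>s - s'\<bar>" and \<mu>: "mono_on {0..} \<mu>"
  shows "\<bar>f u\<bar> \<le> \<bar>f 0\<bar> + (\<bar>u\<bar> + 1) * \<mu> 1"
proof -
  have \<mu>1: "0 \<le> \<mu> 1" using f[of 1 0] by simp
  define n where "n = nat \<lceil>\<bar>u\<bar>\<rceil>"
  have step: "\<bar>f (real i * (u / real n)) - f 0\<bar> \<le> real i * \<mu> 1" if "0 < n" for i
  proof (induction i)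
    case (Suc i)
    have "\<bar>u\<bar> \<le> real n" unfolding n_def by linarith
    then have "\<bar>u / real n\<bar> \<le> 1" using that by simp
    then have "\<mu> \<bar>u / real n\<bar> \<le> \<mu> 1" by (intro mono_onD[OF \<mu>]) auto
    moreover have "real (Suc i) * (u / real n) - real i * (u / real n) = u / real n" by (simp add: algebra_simps add_divide_distrib)
    ultimately have "\<bar>f (real (Suc i) * (u / real n)) - f (real i * (u / real n))\<bar> \<le> \<mu> 1"
      using f[of "real (Suc i) * (u / real n)" "real i * (u / real n)"] by simp
    then show ?case using Suc by (simp add: distrib_right)
  qed simp
  have "\<bar>f u - f 0\<bar> \<le> (\<bar>u\<bar> + 1) * \<mu> 1"
  proof (cases "n = 0")
    case True
    then have "u = 0" unfolding n_def by simp
    then show ?thesis using \<mu>1 by simp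
  next
    case False
    have "\<bar>f u - f 0\<bar> \<le> real n * \<mu> 1" using step[of n] False by simp
    also have "real n \<le> \<bar>u\<bar> + 1" unfolding n_def by linarith
    finally show ?thesis using \<mu>1 by (simp add: mult_right_mono)
  qed
  then show ?thesis by linarith
qed

text \<open>The Dini condition is invariant under rescaling: with \<open>D = C\<^bsup>1/\<beta>\<^esup>\<close> one has \<open>C u\<^sup>\<beta> = (D u)\<^sup>\<beta>\<close>, so the factor
  \<open>C\<close> only changes the scale of the integration variable. One factor of the square is bounded by \<open>\<nu> C\<close>, the other is the
  integrable one; the linear part of \<open>\<nu>\<close> contributes \<open>u\<^bsup>\<beta> - 1\<^esup>\<close>.\<close>
lemma dini_modulus_antiderivative:
  fixes \<mu> \<nu> :: "real \<Rightarrow> real"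
  assumes \<mu>: "continuous_on {0..} \<mu>" "mono_on {0..} \<mu>" "\<And>x. 0 \<le> x \<Longrightarrow> 0 \<le> \<mu> x"
    and \<beta>: "0 < \<beta>" and dini: "set_integrable lborel {0<..1} (\<lambda>s. inverse s * \<mu> (s powr \<beta>))"
    and L: "0 \<le> L" and \<nu>: "\<And>x. \<nu> x = L * \<mu> x + x" and C: "0 < C"
  shows "\<exists>J. continuous_on {0..1} J \<and> J 0 = 0 \<and>
    (\<forall>u. 0 < u \<longrightarrow> u < 1 \<longrightarrow> (J has_real_derivative (\<nu> (C * u powr \<beta>))\<^sup>2 / u) (at u))"
proof -
  define b where "b u = (\<nu> (C * u powr \<beta>))\<^sup>2 / u" for u
  define D where "D = C powr (1 / \<beta>)"
  have D: "0 < D" using C by (simp add: D_def)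
  have DC: "(D * u) powr \<beta> = C * u powr \<beta>" if "0 < u" for u
    using C \<beta> that by (simp add: D_def powr_mult powr_powr)
  define g where "g s = inverse s * \<mu> (s powr \<beta>)" for s
  have \<nu>_cont: "continuous_on {0..} \<nu>" unfolding \<nu>[abs_def] by (intro continuous_intros \<mu>)
  have \<nu>0: "0 \<le> \<nu> x" if "0 \<le> x" for x using \<mu>(3)[OF that] L that by (simp add: \<nu>)
  have \<nu>_mono: "\<nu> x \<le> \<nu> y" if "0 \<le> x" "x \<le> y" for x y
    unfolding \<nu> using that L mono_onD[OF \<mu>(2), of x y] by (intro add_mono mult_left_mono) auto
  have b_cont: "continuous_on {0<..1} b"
  proof -
    have "continuous_on {0<..1::real} (\<lambda>u. C * u powr \<beta>)"
      by (intro continuous_intros) (auto intro: order_less_imp_le)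
    then have "continuous_on {0<..1} (\<lambda>u. \<nu> (C * u powr \<beta>))"
      by (rule continuous_on_compose2[OF \<nu>_cont]) (use C in \<open>auto intro!: mult_nonneg_nonneg\<close>)
    then show ?thesis unfolding b_def
      by (rule continuous_on_divide[OF continuous_on_power continuous_on_id]) auto
  qed
  have i1: "integrable lebesgue (\<lambda>u. indicator {0<..1} (D * u) * g (D * u))"
  proof -
    have "integrable lborel (\<lambda>s. indicator {0<..1} s * g s)"
      using dini by (simp add: set_integrable_def g_def)
    from lborel_integrable_real_affine[OF this, of D 0] D
    have i: "integrable lborel (\<lambda>u. indicator {0<..1} (D * u) * g (D * u))" by simp
    show ?thesis by (subst integrable_completion[OF borel_measurable_integrable[OF i]]) (rule i)
  qed
  have i2: "integrable lebesgue (\<lambda>u. indicator {0<..1} u * u powr (\<beta> - 1))"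
  proof -
    have "(\<lambda>u. u powr (\<beta> - 1)) absolutely_integrable_on {0<..1}"
      by (rule nonnegative_absolutely_integrable_1[OF integrable_on_powr_from_0']) (use \<beta> in auto)
    then show ?thesis by (simp add: set_integrable_def)
  qed
  have i3: "integrable lebesgue (indicator {0<..1::real} :: real \<Rightarrow> real)" by simp
  let ?G = "\<lambda>u. \<nu> C * (L * D) * (indicator {0<..1} (D * u) * g (D * u))
     + (\<nu> C * C * (indicator {0<..1} u * u powr (\<beta> - 1)) + (\<nu> C)\<^sup>2 * D * indicator {0<..1} u)"
  have iG: "integrable lebesgue ?G"
    by (intro Bochner_Integration.integrable_add integrable_mult_right i1 i2 i3)
  have bound: "b u \<le> ?G u" if u: "u \<in> {0<..1}" for u
  proof -
    have pos: "0 \<le> C * u powr \<beta>" using C by simp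
    have "u powr \<beta> \<le> 1" using u \<beta> by (intro powr_le1) auto
    then have le: "\<nu> (C * u powr \<beta>) \<le> \<nu> C" using C by (intro \<nu>_mono pos) (simp add: mult_left_le)
    have g0: "0 \<le> g (D * u)" using D u \<mu>(3) by (simp add: g_def)
    show ?thesis
    proof (cases "D * u \<le> 1")
      case True
      have ind: "indicator {0<..1} (D * u) = (1::real)" using True D u by simp
      have "\<nu> (C * u powr \<beta>) / u = L * D * g (D * u) + C * u powr (\<beta> - 1)"
        using u D DC[of u] by (simp add: \<nu> g_def powr_diff field_simps)
      moreover have "b u \<le> \<nu> C * (\<nu> (C * u powr \<beta>) / u)"
        unfolding b_def using u mult_right_mono[OF le \<nu>0[OF pos]] by (simp add: power2_eq_square divide_right_mono)
      ultimately have "b u \<le> \<nu> C * (L * D) * g (D * u) + \<nu> C * C * u powr (\<beta> - 1)"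
        by (simp add: algebra_simps)
      moreover have "0 \<le> (\<nu> C)\<^sup>2 * D" using D by simp
      ultimately show ?thesis using u ind by simp
    next
      case False
      have "b u \<le> (\<nu> C)\<^sup>2 / u"
        unfolding b_def using le \<nu>0[OF pos] u by (intro divide_right_mono power_mono) auto
      also have "1 / u \<le> D" using False u by (simp add: field_simps)
      then have "(\<nu> C)\<^sup>2 / u \<le> (\<nu> C)\<^sup>2 * D" using mult_left_mono[of "1 / u" D "(\<nu> C)\<^sup>2"] by simp
      also have "\<dots> \<le> ?G u"
      proof -
        have "0 \<le> \<nu> C * (L * D) * (indicator {0<..1} (D * u) * g (D * u))" "0 \<le> \<nu> C * C * u powr (\<beta> - 1)"
          using \<nu>0[of C] C L D g0 by auto
        then show ?thesis using u by simp
      qed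
      finally show ?thesis .
    qed
  qed
  have "integrable lebesgue (\<lambda>u. indicator {0<..1} u *\<^sub>R b u)"
  proof (rule Bochner_Integration.integrable_bound[OF iG])
    have "(\<lambda>u. indicator {0<..1} u *\<^sub>R b u) \<in> borel_measurable borel"
      by (rule borel_measurable_continuous_on_indicator[OF _ b_cont]) simp
    then show "(\<lambda>u. indicator {0<..1} u *\<^sub>R b u) \<in> borel_measurable lebesgue"
      by (simp add: measurable_completion)
    show "AE u in lebesgue. norm (indicator {0<..1} u *\<^sub>R b u) \<le> norm (?G u)"
    proof (rule AE_I2)
      fix u
      show "norm (indicator {0<..1} u *\<^sub>R b u) \<le> norm (?G u)"
      proof (cases "u \<in> {0<..1}")
        case True
        have "0 \<le> b u" using True by (simp add: b_def)
        then show ?thesis using bound[OF True] True by simp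
      qed simp
    qed
  qed
  then have bi: "b integrable_on {0<..1}"
    using set_lebesgue_integral_eq_integral(1)[of "{0<..1}" b] by (simp add: set_integrable_def)
  have b_int: "b integrable_on {0..1}"
  proof (rule integrable_spike_set[OF bi])
    show "negligible {x \<in> {0<..1} - {0..1}. b x \<noteq> 0}" by (rule negligible_subset[of "{0}"]) auto
    show "negligible {x \<in> {0..1} - {0<..1}. b x \<noteq> 0}" by (rule negligible_subset[of "{0}"]) auto
  qed
  show ?thesis
  proof (intro exI[of _ "\<lambda>u. integral {0..u} b"] conjI allI impI)
    show "continuous_on {0..1} (\<lambda>u. integral {0..u} b)" by (rule indefinite_integral_continuous_1[OF b_int])
    fix u :: real assume u: "0 < u" "u < 1"
    have cb: "continuous (at u within {0..1}) b"
    proof -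
      have "continuous (at u) b"
        using continuous_on_interior[OF b_cont, of u] u by simp
      then show ?thesis by (rule continuous_at_imp_continuous_within)
    qed
    have "((\<lambda>u. integral {0..u} b) has_vector_derivative b u) (at u within {0..1})"
      using integral_has_vector_derivative_continuous_at[OF b_int, of u "{}"] cb u by simp
    then show "((\<lambda>u. integral {0..u} b) has_real_derivative (\<nu> (C * u powr \<beta>))\<^sup>2 / u) (at u)"
      using u by (simp add: has_real_derivative_iff_has_vector_derivative at_within_Icc_at b_def)
  qed simp
qed

lemma synth_composition_L2:
  assumes c: "(\<lambda>k. freq k * c k) \<in> ell2" and f: "continuous_on UNIV f"
  shows "(\<lambda>x. f (synth c x)) \<in> L2"
  by (rule continuous_L2, rule continuous_on_compose2[OF f synth_cont[OF c]]) auto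

lemma synth_H2_cont:
  assumes X1: "ell2_cont S (\<lambda>t k. freq k * c t k)" and T: "T \<subseteq> S" and X2: "ell2_cont T (\<lambda>t k. (freq k)\<^sup>2 * c t k)"
  shows "continuous_into (H2 \<inter> H10) H2_norm T (\<lambda>t. synth (c t))"
  unfolding continuous_into_def
proof (intro conjI ballI)
  have X1': "ell2_cont T (\<lambda>t k. freq k * c t k)" by (rule ell2_cont_subset[OF X1 T])
  have m1: "(\<lambda>k. freq k * c t k) \<in> ell2" and m2: "(\<lambda>k. (freq k)\<^sup>2 * c t k) \<in> ell2" if "t \<in> T" for t
    using X1' X2 that by (auto simp: ell2_cont_def)
  fix t assume t: "t \<in> T"
  show "synth (c t) \<in> H2 \<inter> H10" using synth_H2(1)[OF m1[OF t] m2[OF t]] synth_H10[OF m1[OF t]] by simp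
  let ?d = "\<lambda>s k. c s k - c t k"
  have d1: "(\<lambda>k. freq k * ?d s k) \<in> ell2" if "s \<in> T" for s
    using ell2_diff(1)[OF m1[OF that] m1[OF t]] by (simp add: right_diff_distrib)
  have d2: "(\<lambda>k. (freq k)\<^sup>2 * ?d s k) \<in> ell2" if "s \<in> T" for s
    using ell2_diff(1)[OF m2[OF that] m2[OF t]] by (simp add: right_diff_distrib)
  have l1: "((\<lambda>s. ell2_norm (\<lambda>k. freq k * ?d s k)) \<longlongrightarrow> 0) (at t within T)"
    using X1' t by (simp add: ell2_cont_def right_diff_distrib)
  have l2: "((\<lambda>s. ell2_norm (\<lambda>k. (freq k)\<^sup>2 * ?d s k)) \<longlongrightarrow> 0) (at t within T)"
    using X2 t by (simp add: ell2_cont_def right_diff_distrib)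
  have l0: "((\<lambda>s. ell2_norm (?d s)) \<longlongrightarrow> 0) (at t within T)"
  proof (rule Lim_null_comparison[OF _ l1], rule eventually_mono[OF eventually_in_within])
    fix s assume s: "s \<in> T"
    have "\<bar>?d s k\<bar> \<le> \<bar>freq k * ?d s k\<bar>" for k
      using mult_right_mono[OF freq_ge_1[of k], of "\<bar>?d s k\<bar>"] freq_pos[of k] by (simp add: abs_mult)
    then show "norm (ell2_norm (?d s)) \<le> ell2_norm (\<lambda>k. freq k * ?d s k)"
      using ell2_mono(2)[OF d1[OF s]] ell2_norm_nonneg[OF ell2_of_freq_weighted[OF d1[OF s]]] by simp
  qed
  have "((\<lambda>s. sqrt ((ell2_norm (?d s))\<^sup>2 + (ell2_norm (\<lambda>k. freq k * ?d s k))\<^sup>2 + (ell2_norm (\<lambda>k. (freq k)\<^sup>2 * ?d s k))\<^sup>2))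
      \<longlongrightarrow> sqrt (0\<^sup>2 + 0\<^sup>2 + 0\<^sup>2)) (at t within T)"
    by (intro tendsto_real_sqrt tendsto_add tendsto_power l0 l1 l2)
  then have lim: "((\<lambda>s. sqrt ((ell2_norm (?d s))\<^sup>2 + (ell2_norm (\<lambda>k. freq k * ?d s k))\<^sup>2 + (ell2_norm (\<lambda>k. (freq k)\<^sup>2 * ?d s k))\<^sup>2))
      \<longlongrightarrow> 0) (at t within T)" by simp
  show "((\<lambda>s. H2_norm (\<lambda>x. synth (c s) x - synth (c t) x)) \<longlongrightarrow> 0) (at t within T)"
  proof (rule Lim_transform_eventually[OF lim], rule eventually_mono[OF eventually_in_within])
    fix s assume s: "s \<in> T"
    have "(\<lambda>x. synth (c s) x - synth (c t) x) = synth (?d s)"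
      by (rule ext, rule synth_diff[OF m1[OF s] m1[OF t]])
    then show "sqrt ((ell2_norm (?d s))\<^sup>2 + (ell2_norm (\<lambda>k. freq k * ?d s k))\<^sup>2 + (ell2_norm (\<lambda>k. (freq k)\<^sup>2 * ?d s k))\<^sup>2)
        = H2_norm (\<lambda>x. synth (c s) x - synth (c t) x)"
      using H2_norm_synth[OF d1[OF s] d2[OF s]] by simp
  qed
qed

lemma synth_H10_cont:
  assumes X1: "ell2_cont S (\<lambda>t k. freq k * c t k)"
  shows "continuous_into H10 H10_norm S (\<lambda>t. synth (c t))"
  unfolding continuous_into_def
proof (intro conjI ballI)
  have m1: "(\<lambda>k. freq k * c t k) \<in> ell2" if "t \<in> S" for t
    using X1 that by (auto simp: ell2_cont_def)
  fix t assume t: "t \<in> S"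
  show "synth (c t) \<in> H10" by (rule synth_H10[OF m1[OF t]])
  have lim: "((\<lambda>s. ell2_norm (\<lambda>k. freq k * (c s k - c t k))) \<longlongrightarrow> 0) (at t within S)"
    using X1 t by (simp add: ell2_cont_def right_diff_distrib)
  show "((\<lambda>s. H10_norm (\<lambda>x. synth (c s) x - synth (c t) x)) \<longlongrightarrow> 0) (at t within S)"
  proof (rule Lim_transform_eventually[OF lim], rule eventually_mono[OF eventually_in_within])
    fix s assume s: "s \<in> S"
    show "ell2_norm (\<lambda>k. freq k * (c s k - c t k)) = H10_norm (\<lambda>x. synth (c s) x - synth (c t) x)"
      using synth_coeff_H10_norm_diff[OF synth_H10[OF m1[OF s]] synth_H10[OF m1[OF t]]]
      by (simp add: synth_coeff[OF m1[OF s]] synth_coeff[OF m1[OF t]])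
  qed
qed

theorem theorem1p5:
  fixes lam \<gamma> \<rho> m M C0 C1 \<beta> :: real
    and l :: "(real \<Rightarrow> real) \<Rightarrow> real"
    and a f \<mu> :: "real \<Rightarrow> real"
    and \<phi> :: "real \<Rightarrow> real \<Rightarrow> real"
  assumes "lam > 0" and "\<gamma> > 0" and "\<rho> > 0"
    and "continuous_functional_H10 l" and "\<forall>u\<in>H10. l u \<ge> 0"
    and "continuous_on UNIV a" and "range a \<subseteq> {m..M}" and "{m..M} \<subseteq> {0<..}"
    and "continuous_into H10 H10_norm {-\<rho>..0} \<phi>"
    and "continuous_on UNIV f"
    and "\<forall>\<nu>\<in>{m / lam, M / lam}. \<forall>u. u * f u \<le> - \<nu> * C0 * u\<^sup>2 + C1 * \<bar>u\<bar>"
    and "continuous_on {0..} \<mu>" and "mono_on {0..} \<mu>" and "\<mu> ` {0..} \<subseteq> {0..}" and "\<mu> 0 = 0"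
    and "0 < \<beta>" and "\<beta> < 1 / 2"
    and "set_integrable lborel {0<..1} (\<lambda>s. inverse s * \<mu> (s powr \<beta>))"
    and "\<forall>s s'. \<bar>f s - f s'\<bar> \<le> \<mu> \<bar>s - s'\<bar>"
    and "\<forall>u\<in>H10. \<forall>v\<in>H10. \<bar>a (l u) - a (l v)\<bar> \<le> \<mu> (H10_norm (\<lambda>x. u x - v x))"
    and "\<forall>t\<in>{-\<rho>..0}. \<forall>t'\<in>{-\<rho>..0}. L2_norm (\<lambda>x. \<phi> t x - \<phi> t' x) \<le> \<mu> (\<bar>t - t'\<bar> powr \<beta>)"
  shows "\<exists>w. strong_solution lam \<gamma> \<rho> a l f \<phi> w \<and>
             continuous_into (H2 \<inter> H10) H2_norm {0<..} w \<and>
             (\<phi> 0 \<in> H2 \<longrightarrow> continuous_into (H2 \<inter> H10) H2_norm {0..} w)"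
proof -
  have lam: "0 < lam" and \<rho>: "0 < \<rho>" and f_cont: "continuous_on UNIV f" and \<beta>: "0 < \<beta>" "\<beta> < 1 / 2"
    and \<mu>_cont: "continuous_on {0..} \<mu>" and \<mu>_mono: "mono_on {0..} \<mu>" and \<mu>_0: "\<mu> 0 = 0"
    and dini: "set_integrable lborel {0<..1} (\<lambda>s. inverse s * \<mu> (s powr \<beta>))"
    using assms by auto
  have \<mu>_nonneg: "0 \<le> \<mu> x" if "0 \<le> x" for x using assms(14) that by auto
  have a_range: "m \<le> a x \<and> a x \<le> M" for x using assms(7) by (auto simp: image_subset_iff)
  have mM: "m \<le> M" using a_range[of 0] by linarith
  have m: "0 < m" using assms(8) mM by auto
  have f_mod: "\<bar>f s - f s'\<bar> \<le> \<mu> \<bar>s - s'\<bar>" for s s' using assms(19) by blast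
  have al_mod: "\<bar>a (l u) - a (l v)\<bar> \<le> \<mu> (H10_norm (\<lambda>x. u x - v x))" if "u \<in> H10" "v \<in> H10" for u v
    using assms(20) that by blast
  have \<phi>_mod: "L2_norm (\<lambda>x. \<phi> s x - \<phi> t x) \<le> \<mu> (\<bar>s - t\<bar> powr \<beta>)" if "s \<in> {-\<rho>..0}" "t \<in> {-\<rho>..0}" for s t
    using assms(21) that by blast
  have \<phi>_H10: "\<phi> t \<in> H10" if "t \<in> {-\<rho>..0}" for t using assms(9) that by (auto simp: continuous_into_def)

  define al where "al c = a (l (synth c))" for c
  define F where "F c k = lam * sine_coeff (\<lambda>x. f (synth c x)) k" for c k
  define q where "q t = sine_coeff (\<phi> t)" for t
  \<comment> \<open>dominates the modulus of \<open>a \<circ> l\<close>, that of \<open>lam * f\<close>, and the identity\<close>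
  define \<nu> where "\<nu> x = (1 + lam) * \<mu> x + x" for x
  define Kf where "Kf = max 1 embedding_const"
  define A where "A = \<bar>f 0\<bar> + \<mu> 1"
  define Cg where "Cg = 2 * lam\<^sup>2 * A\<^sup>2"
  interpret diagonal_flow freq m M
    by unfold_locales (use freq_pos freq_mono freq_at_top m mM in auto)
  have X1D: "(\<lambda>k. freq k * c k) \<in> ell2" if "c \<in> X1" for c using that by (simp add: X1_def)
  have fL2: "(\<lambda>x. f (synth c x)) \<in> L2" if "c \<in> X1" for c
    by (rule synth_composition_L2[OF X1D[OF that] f_cont])
  have \<mu>_le_\<nu>: "\<mu> x \<le> \<nu> x" "lam * \<mu> x \<le> \<nu> x" "x \<le> \<nu> x" if "0 \<le> x" for x
    using \<mu>_nonneg[OF that] lam that mult_nonneg_nonneg[of lam "\<mu> x"] by (auto simp: \<nu>_def distrib_right)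
  have \<nu>_mono: "mono_on {0..} \<nu>"
    using lam mono_onD[OF \<mu>_mono] by (auto simp: mono_on_def \<nu>_def intro!: add_mono mult_left_mono)
  have synth_X1_diff: "\<bar>synth c x - synth d x\<bar> \<le> Kf * X1_norm (\<lambda>k. c k - d k)" if "c \<in> X1" "d \<in> X1" for c d x
  proof -
    have cd: "(\<lambda>k. c k - d k) \<in> X1" by (rule X1_diff[OF that])
    have "\<bar>synth c x - synth d x\<bar> \<le> embedding_const * X1_norm (\<lambda>k. c k - d k)"
      unfolding synth_diff[OF X1D[OF that(1)] X1D[OF that(2)]] X1_norm_def by (rule synth_abs_le[OF X1D[OF cd]])
    also have "\<dots> \<le> Kf * X1_norm (\<lambda>k. c k - d k)"
      using X1_norm_nonneg[OF cd] by (intro mult_right_mono) (auto simp: Kf_def)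
    finally show ?thesis .
  qed
  have F_partial: "(\<Sum>k<N. (lam * sine_coeff u k)\<^sup>2) \<le> (lam * L2_norm u)\<^sup>2" if "u \<in> L2" for u N
  proof -
    have "(\<Sum>k<N. (sine_coeff u k)\<^sup>2) \<le> (L2_norm u)\<^sup>2"
      using sum_le_ell2_norm_sq[OF sine_coeff_ell2[OF that], of "{..<N}"] sine_parseval[OF that] by simp
    then show ?thesis
      by (simp add: power_mult_distrib sum_distrib_left[symmetric] mult_left_mono)
  qed

  interpret nonlocal_delay freq m M al F \<gamma> \<rho> \<beta> Kf Cg \<nu> q
  proof unfold_locales
    show "m \<le> al c \<and> al c \<le> M" for c using a_range by (simp add: al_def)
    show "\<bar>al c - al d\<bar> \<le> \<nu> (X1_norm (\<lambda>k. c k - d k))" if cd: "c \<in> X1" "d \<in> X1" for c d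
    proof -
      have H: "synth c \<in> H10" "synth d \<in> H10" using cd by (auto intro: synth_H10 X1D)
      have "H10_norm (\<lambda>x. synth c x - synth d x) = X1_norm (\<lambda>k. c k - d k)"
        using synth_coeff_H10_norm_diff[OF H] cd by (simp add: synth_coeff X1D X1_norm_def)
      then have "\<bar>al c - al d\<bar> \<le> \<mu> (X1_norm (\<lambda>k. c k - d k))"
        using al_mod[OF H] by (simp add: al_def)
      also have "\<dots> \<le> \<nu> (X1_norm (\<lambda>k. c k - d k))"
        by (rule \<mu>_le_\<nu>(1)[OF X1_norm_nonneg[OF X1_diff[OF cd]]])
      finally show ?thesis .
    qed
    show "(\<Sum>k<N. (F c k - F d k)\<^sup>2) \<le> (\<nu> (Kf * X1_norm (\<lambda>k. c k - d k)))\<^sup>2" if cd: "c \<in> X1" "d \<in> X1" for c d N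
    proof -
      let ?u = "\<lambda>x. f (synth c x) - f (synth d x)" and ?y = "Kf * X1_norm (\<lambda>k. c k - d k)"
      have y: "0 \<le> ?y" using X1_norm_nonneg[OF X1_diff[OF cd]] by (simp add: Kf_def)
      have uL: "?u \<in> L2" by (rule L2_diff[OF fL2[OF cd(1)] fL2[OF cd(2)]])
      have "L2_norm ?u \<le> \<mu> ?y"
      proof (rule bounded_L2(2)[OF L2_measurable[OF uL] _ \<mu>_nonneg[OF y]])
        fix x
        have "\<bar>?u x\<bar> \<le> \<mu> \<bar>synth c x - synth d x\<bar>" by (rule f_mod)
        also have "\<dots> \<le> \<mu> ?y" using synth_X1_diff[OF cd] y by (intro mono_onD[OF \<mu>_mono]) auto
        finally show "\<bar>?u x\<bar> \<le> \<mu> ?y" .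
      qed
      then have "lam * L2_norm ?u \<le> lam * \<mu> ?y" using lam by simp
      also have "\<dots> \<le> \<nu> ?y" by (rule \<mu>_le_\<nu>(2)[OF y])
      finally have "(lam * L2_norm ?u)\<^sup>2 \<le> (\<nu> ?y)\<^sup>2" using lam L2_norm_nonneg by (intro power_mono) auto
      moreover have "F c k - F d k = lam * sine_coeff ?u k" for k
        using sine_coeff_diff[OF fL2[OF cd(1)] fL2[OF cd(2)]] by (simp add: F_def right_diff_distrib)
      ultimately show ?thesis using F_partial[OF uL, of N] by simp
    qed
    show "(\<Sum>k<N. (F c k)\<^sup>2) \<le> Cg * (1 + (ell2_norm c)\<^sup>2)" if c: "c \<in> X1" for c N
    proof -
      have A: "0 \<le> A" using \<mu>_nonneg[of 1] by (simp add: A_def)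
      have sL: "synth c \<in> L2" by (rule synth_L2[OF X1D[OF c]])
      have pt: "(f (synth c x))\<^sup>2 \<le> 2 * A\<^sup>2 * (1 + (synth c x)\<^sup>2)" for x
      proof -
        have "\<bar>f (synth c x)\<bar> \<le> A * (1 + \<bar>synth c x\<bar>)"
        proof -
          have "A * (1 + \<bar>synth c x\<bar>) = \<bar>f 0\<bar> + (\<bar>synth c x\<bar> + 1) * \<mu> 1 + \<bar>f 0\<bar> * \<bar>synth c x\<bar>"
            by (simp add: A_def algebra_simps)
          moreover have "0 \<le> \<bar>f 0\<bar> * \<bar>synth c x\<bar>" by simp
          ultimately show ?thesis using modulus_linear_growth[OF f_mod \<mu>_mono, of "synth c x"] by linarith
        qed
        then have "\<bar>f (synth c x)\<bar>\<^sup>2 \<le> (A * (1 + \<bar>synth c x\<bar>))\<^sup>2" by (rule power_mono) simp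
        also have "\<dots> \<le> A\<^sup>2 * (2 * 1\<^sup>2 + 2 * \<bar>synth c x\<bar>\<^sup>2)"
          unfolding power_mult_distrib by (intro mult_left_mono power2_add_le) simp
        finally show ?thesis by (simp add: algebra_simps)
      qed
      have "(L2_norm (\<lambda>x. f (synth c x)))\<^sup>2 \<le> (LINT x|leb01. 2 * A\<^sup>2 * (1 + (synth c x)\<^sup>2))"
        unfolding L2_norm_sq
        by (rule integral_mono) (use pt L2_square_integrable[OF fL2[OF c]] L2_square_integrable[OF sL] in auto)
      also have "\<dots> = 2 * A\<^sup>2 * (1 + (L2_norm (synth c))\<^sup>2)"
        using L2_square_integrable[OF sL] measure_leb01 by (simp add: L2_norm_sq)
      also have "L2_norm (synth c) = ell2_norm c" by (rule synth_norm[OF X1D[OF c]])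
      finally have "lam\<^sup>2 * (L2_norm (\<lambda>x. f (synth c x)))\<^sup>2 \<le> lam\<^sup>2 * (2 * A\<^sup>2 * (1 + (ell2_norm c)\<^sup>2))"
        by (rule mult_left_mono) simp
      then show ?thesis
        using F_partial[OF fL2[OF c], of N] by (simp add: F_def Cg_def power_mult_distrib mult_ac)
    qed
    show "1 \<le> Kf" by (simp add: Kf_def)
    show "0 \<le> Cg" by (simp add: Cg_def)
    show "X1_cont {-\<rho>..0} q"
      unfolding ell2_cont_def
    proof (intro ballI conjI)
      fix t assume t: "t \<in> {-\<rho>..0}"
      show "(\<lambda>k. freq k * q t k) \<in> ell2" unfolding q_def by (rule H10_coeff(1)[OF \<phi>_H10[OF t]])
      have lim: "((\<lambda>s. H10_norm (\<lambda>x. \<phi> s x - \<phi> t x)) \<longlongrightarrow> 0) (at t within {-\<rho>..0})"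
        using assms(9) t unfolding continuous_into_def by blast
      show "((\<lambda>s. ell2_norm (\<lambda>k. freq k * q s k - freq k * q t k)) \<longlongrightarrow> 0) (at t within {-\<rho>..0})"
      proof (rule Lim_transform_eventually[OF lim], rule eventually_mono[OF eventually_in_within])
        fix s assume s: "s \<in> {-\<rho>..0}"
        show "H10_norm (\<lambda>x. \<phi> s x - \<phi> t x) = ell2_norm (\<lambda>k. freq k * q s k - freq k * q t k)"
          unfolding q_def synth_coeff_H10_norm_diff[OF \<phi>_H10[OF s] \<phi>_H10[OF t]] by (simp add: right_diff_distrib)
      qed
    qed
    show "ell2_norm (\<lambda>k. q s k - q t k) \<le> \<nu> (\<bar>s - t\<bar> powr \<beta>)" if st: "s \<in> {-\<rho>..0}" "t \<in> {-\<rho>..0}" for s t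
    proof -
      have L: "\<phi> s \<in> L2" "\<phi> t \<in> L2" by (intro H10_L2 \<phi>_H10 st)+
      have "sine_coeff (\<lambda>x. \<phi> s x - \<phi> t x) = (\<lambda>k. q s k - q t k)"
        using sine_coeff_diff[OF L] by (auto simp: q_def)
      then have "ell2_norm (\<lambda>k. q s k - q t k) = L2_norm (\<lambda>x. \<phi> s x - \<phi> t x)"
        using sine_parseval[OF L2_diff[OF L]] by simp
      also have "\<dots> \<le> \<mu> (\<bar>s - t\<bar> powr \<beta>)" by (rule \<phi>_mod[OF st])
      also have "\<dots> \<le> \<nu> (\<bar>s - t\<bar> powr \<beta>)" by (rule \<mu>_le_\<nu>(1)) simp
      finally show ?thesis .
    qed
    show "continuous_on {0..} \<nu>" unfolding \<nu>_def by (intro continuous_intros \<mu>_cont)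
    show "\<nu> 0 = 0" by (simp add: \<nu>_def \<mu>_0)
    show "\<exists>J. continuous_on {0..1} J \<and> J 0 = 0 \<and>
       (\<forall>u. 0 < u \<longrightarrow> u < 1 \<longrightarrow> (J has_real_derivative (\<nu> (C * u powr \<beta>))\<^sup>2 / u) (at u))" if "0 < C" for C
      by (rule dini_modulus_antiderivative[OF \<mu>_cont \<mu>_mono \<mu>_nonneg \<beta>(1) dini _ \<nu>_def that]) (use lam in auto)
  qed (use \<rho> \<beta> \<nu>_mono \<mu>_le_\<nu> in auto)

  obtain c dc where c: "X1_cont {-\<rho>..} c" "\<And>t. t \<in> {-\<rho>..0} \<Longrightarrow> c t = q t"
    "ell2_cont {0<..} (\<lambda>t k. (freq k)\<^sup>2 * c t k)"
    "(\<lambda>k. (freq k)\<^sup>2 * q 0 k) \<in> ell2 \<Longrightarrow> ell2_cont {0..} (\<lambda>t k. (freq k)\<^sup>2 * c t k)"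
    and dc: "ell2_cont {0<..} dc"
    "\<And>t. 0 < t \<Longrightarrow> ((\<lambda>h. ell2_norm (\<lambda>k. (c (t + h) k - c t k) / h - dc t k)) \<longlongrightarrow> 0) (at 0)"
    "\<And>t k. dc t k = - (freq k)\<^sup>2 * al (c t) * c t k + F (c t) k + \<gamma> * c (t - \<rho>) k"
  proof (rule nonlocal_strong_solution)
    fix c dc
    assume "X1_cont {-\<rho>..} c" "\<And>t. t \<in> {-\<rho>..0} \<Longrightarrow> c t = q t"
    "ell2_cont {0<..} (\<lambda>t k. (freq k)\<^sup>2 * c t k)"
    "(\<lambda>k. (freq k)\<^sup>2 * q 0 k) \<in> ell2 \<Longrightarrow> ell2_cont {0..} (\<lambda>t k. (freq k)\<^sup>2 * c t k)"
    "ell2_cont {0<..} dc"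
    "\<And>t. 0 < t \<Longrightarrow> ((\<lambda>h. ell2_norm (\<lambda>k. (c (t + h) k - c t k) / h - dc t k)) \<longlongrightarrow> 0) (at 0)"
    "\<And>t k. dc t k = - (freq k)\<^sup>2 * al (c t) * c t k + F (c t) k + \<gamma> * c (t - \<rho>) k"
    then show thesis by (rule that)
  qed
  have m1: "c t \<in> X1" "(\<lambda>k. freq k * c t k) \<in> ell2" if "-\<rho> \<le> t" for t
    using c(1) that by (auto simp: ell2_cont_def X1_def)
  have m2: "(\<lambda>k. (freq k)\<^sup>2 * c t k) \<in> ell2" if "0 < t" for t
    using c(3) that by (auto simp: ell2_cont_def)
  define w where "w t = synth (c t)" for t
  \<comment> \<open>the time derivative is defined by the equation; that it is one is then checked on coefficients\<close>
  define w' where "w' t x = a (l (w t)) * weak_deriv (weak_deriv (w t)) x + (lam * f (w t x) + \<gamma> * w (t - \<rho>) x)" for t x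
  have wL: "w t \<in> L2" if "-\<rho> \<le> t" for t unfolding w_def by (rule synth_L2[OF m1(2)[OF that]])
  have w': "w' t \<in> L2" "sine_coeff (w' t) = dc t" if t: "0 < t" for t
  proof -
    have t': "-\<rho> \<le> t" "-\<rho> \<le> t - \<rho>" using t \<rho> by auto
    have L1: "(\<lambda>x. a (l (w t)) * weak_deriv (weak_deriv (w t)) x) \<in> L2"
      unfolding w_def by (intro L2_scale synth_H2(2) m1(2) m2 t t')
    have L2a: "(\<lambda>x. lam * f (w t x)) \<in> L2" unfolding w_def by (intro L2_scale fL2 m1 t')
    have L2b: "(\<lambda>x. \<gamma> * w (t - \<rho>) x) \<in> L2" by (intro L2_scale wL t')
    show "w' t \<in> L2" unfolding w'_def[abs_def] by (intro L2_add L1 L2a L2b)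
    show "sine_coeff (w' t) = dc t"
    proof
      fix k
      have "sine_coeff (w' t) k = a (l (w t)) * sine_coeff (weak_deriv (weak_deriv (w t))) k
          + (lam * sine_coeff (\<lambda>x. f (w t x)) k + \<gamma> * sine_coeff (w (t - \<rho>)) k)"
        unfolding w'_def[abs_def] sine_coeff_add[OF L1 L2_add[OF L2a L2b]] sine_coeff_add[OF L2a L2b] sine_coeff_scale ..
      also have "\<dots> = dc t k"
        unfolding w_def synth_H2(3)[OF m1(2)[OF t'(1)] m2[OF t]] synth_coeff[OF m1(2)[OF t'(2)]] dc(3)
        by (simp add: al_def F_def mult_ac)
      finally show "sine_coeff (w' t) k = dc t k" .
    qed
  qed
  have ss: "strong_solution lam \<gamma> \<rho> a l f \<phi> w"
    unfolding strong_solution_def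
  proof (intro conjI allI impI ballI exI[of _ w'])
    show "continuous_into H10 H10_norm {-\<rho>..} w"
      unfolding w_def[abs_def] by (rule synth_H10_cont[OF c(1)])
    show "AE x in leb01. w t x = \<phi> t x" if "t \<in> {-\<rho>..0}" for t
      using H10_coeff(2)[OF \<phi>_H10[OF that]] unfolding w_def c(2)[OF that] q_def by (auto elim: eventually_mono)
    show "w t \<in> H2 \<inter> H10" if "0 < t" for t
      unfolding w_def using synth_H2(1)[OF m1(2) m2[OF that]] synth_H10[OF m1(2)] that \<rho> by auto
    show "continuous_into L2 L2_norm {0<..} w'"
      unfolding continuous_into_def
    proof (intro conjI ballI)
      fix t :: real assume t: "t \<in> {0<..}"
      then show "w' t \<in> L2" by (intro w') auto
      have lim: "((\<lambda>s. ell2_norm (\<lambda>k. dc s k - dc t k)) \<longlongrightarrow> 0) (at t within {0<..})"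
        using dc(1) t by (auto simp: ell2_cont_def)
      show "((\<lambda>s. L2_norm (\<lambda>x. w' s x - w' t x)) \<longlongrightarrow> 0) (at t within {0<..})"
      proof (rule Lim_transform_eventually[OF lim], rule eventually_mono[OF eventually_in_within])
        fix s :: real assume s: "s \<in> {0<..}"
        have L: "w' s \<in> L2" "w' t \<in> L2" using s t by (auto intro: w')
        have "sine_coeff (\<lambda>x. w' s x - w' t x) = (\<lambda>k. dc s k - dc t k)"
          using sine_coeff_diff[OF L] w'(2)[of s] w'(2)[of t] s t by auto
        then show "ell2_norm (\<lambda>k. dc s k - dc t k) = L2_norm (\<lambda>x. w' s x - w' t x)"
          using sine_parseval[OF L2_diff[OF L]] by simp
      qed
    qed
    show "has_L2_derivative w (w' t) t" if t: "0 < t" for t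
      unfolding has_L2_derivative_def
    proof (rule Lim_transform_eventually[OF dc(2)[OF t]])
      have "eventually (\<lambda>h. 0 < t + h) (at 0)"
        using order_tendstoD(1)[OF tendsto_add[OF tendsto_const[of t] tendsto_ident_at[of 0 UNIV]], of 0] t by simp
      then show "eventually (\<lambda>h. ell2_norm (\<lambda>k. (c (t + h) k - c t k) / h - dc t k)
          = L2_norm (\<lambda>x. (w (t + h) x - w t x) / h - w' t x)) (at 0)"
      proof eventually_elim
        case (elim h)
        have t': "-\<rho> \<le> t + h" "-\<rho> \<le> t" using elim t \<rho> by auto
        have Ld: "(\<lambda>x. w (t + h) x - w t x) \<in> L2" by (intro L2_diff wL t')
        have Lq: "(\<lambda>x. (1 / h) * (w (t + h) x - w t x)) \<in> L2" by (rule L2_scale[OF Ld])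
        have "sine_coeff (\<lambda>x. (1 / h) * (w (t + h) x - w t x) - w' t x) k = (c (t + h) k - c t k) / h - dc t k" for k
          unfolding sine_coeff_diff[OF Lq w'(1)[OF t]] sine_coeff_scale sine_coeff_diff[OF wL[OF t'(1)] wL[OF t'(2)]] w'(2)[OF t]
          unfolding w_def synth_coeff[OF m1(2)[OF t'(1)]] synth_coeff[OF m1(2)[OF t'(2)]] by simp
        then have "sine_coeff (\<lambda>x. (1 / h) * (w (t + h) x - w t x) - w' t x) = (\<lambda>k. (c (t + h) k - c t k) / h - dc t k)" by auto
        with sine_parseval[OF L2_diff[OF Lq w'(1)[OF t]]] show ?case by simp
      qed
    qed
    show "AE x in leb01. w' t x - a (l (w t)) * weak_deriv (weak_deriv (w t)) x = lam * f (w t x) + \<gamma> * w (t - \<rho>) x" for t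
      by (simp add: w'_def)
  qed
  moreover have "continuous_into (H2 \<inter> H10) H2_norm {0<..} w"
    unfolding w_def[abs_def] by (rule synth_H2_cont[OF c(1) _ c(3)]) (use \<rho> in auto)
  moreover have "continuous_into (H2 \<inter> H10) H2_norm {0..} w" if "\<phi> 0 \<in> H2"
  proof -
    have "(\<lambda>k. (freq k)\<^sup>2 * q 0 k) \<in> ell2"
      unfolding q_def by (rule H2_coeff[OF \<phi>_H10 that]) (use \<rho> in auto)
    then show ?thesis
      unfolding w_def[abs_def] by (intro synth_H2_cont[OF c(1) _ c(4)]) (use \<rho> in auto)
  qed
  ultimately show ?thesis by blast
qed

end
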